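(* In the LQ setting of the context, let $\tilde\rho_\alpha>\rho_\alpha$ be the number satisfying $\{(c^2\gamma+b^2e^{-2\tilde\rho_\alpha\delta})(2\tilde\rho_\alpha)^{-\alpha}+|b|(1+e^{-\tilde\rho_\alpha\delta})\}\tilde\rho_\alpha^{-\alpha}=\frac12$, and fix $\lambda>2\tilde\rho_\alpha$. Then there exists a unique optimal control $\hat u$ of the problem of minimizing $J_\lambda$ over $\mathcal{U}_{-\lambda/2}$. Furthermore, $\hat u\in\mathcal{U}_{-\mu}$ for every $\mu\in(\tilde\rho_\alpha,\lambda/2]$, and $$\hat u(t)=-\frac bc\hat X(t-\delta)+\frac{(c^2\gamma+b^2e^{-\lambda\delta})\lambda^{-\alpha}-b}{c}\Bigl(\int_0^\infty r_\lambda(t,s)ds-1\Bigr)x_0+\frac\sigma c\int_0^t\Bigl\{\int_0^\infty r_\lambda(t-\theta,s)g_\lambda(s)ds-g_\lambda(t-\theta)\Bigr\}dW(\theta),\quad t\ge0,$$ where $\hat X:=X^{\hat u}\in L^{2,-\mu}_{\mathbb{F}}(0,\infty;\mathbb{R})$ is the optimal state, and $r_\lambda$ is the Fredholm resolvent of type $L^{2,-\mu}$ of the Fredholm kernel $k_\lambda$ (of type $L^{2,-\mu}$) on $[0,\infty)$.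
   Context: $(\Omega,\mathcal{F},\mathbb{P})$ is a complete probability space with a one-dimensional Brownian motion $W$ and augmented natural filtration $\mathbb{F}$. Fix $x_0,b,\sigma\in\mathbb{R}$, $c\in\mathbb{R}\setminus\{0\}$, $\gamma>0$, $\alpha\in(\frac12,1]$, $\delta\ge0$, $\lambda>0$. For $\beta\in\mathbb{R}$, $L^{2,\beta}_{\mathbb{F}}(0,\infty;\mathbb{R})$ is the set of real jointly measurable adapted processes $f$ with $\mathbb{E}\int_0^\infty e^{2\beta t}|f(t)|^2dt<\infty$, and $\mathcal{U}_{-\mu}:=L^{2,-\mu}_{\mathbb{F}}(0,\infty;\mathbb{R})$. $\rho_\alpha:=0$ if $b=0$; if $b\ne0$, $\rho_\alpha>0$ satisfies $|b|(1+e^{-\rho_\alpha\delta})\rho_\alpha^{-\alpha}=1$. For $\mu>\rho_\alpha$ and $u\in\mathcal{U}_{-\mu}$, $X^u$ is the unique solution in $L^{2,-\mu}_{\mathbb{F}}(0,\infty;\mathbb{R})$ of $X^u(t)=x_0+\frac{1}{\Gamma(\alpha)}\int_0^t(t-s)^{\alpha-1}\{bX^u(s-\delta)+cu(s)\}ds+\frac{\sigma}{\Gamma(\alpha)}\int_0^t(t-s)^{\alpha-1}dW(s)$, $t\ge0$, $X^u=x_0$ on $[-\delta,0]$ (mild form of the Caputo fractional SDDE ${}^CD^\alpha X^u=bX^u(t-\delta)+cu(t)+\sigma\dot W$). Cost: $J_\lambda(u)=\frac12\mathbb{E}\int_0^\infty e^{-\lambda t}\{|X^u(t)|^2+\frac1\gamma|u(t)|^2\}dt$;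 an optimal control over $\mathcal{U}_{-\mu}$ is $\hat u\in\mathcal{U}_{-\mu}$ with $J_\lambda(\hat u)=\inf_{u\in\mathcal{U}_{-\mu}}J_\lambda(u)$. $g_\lambda(\tau):=\frac{c^2\gamma+b^2e^{-\lambda\delta}}{\Gamma(\alpha)^2}\int_0^\infty e^{-\lambda\theta}\theta^{\alpha-1}(\theta+\tau)^{\alpha-1}d\theta-\frac{b}{\Gamma(\alpha)}(\tau-\delta)_+^{\alpha-1}$ with $x_+^{\alpha-1}:=x^{\alpha-1}\mathbf{1}_{(0,\infty)}(x)$; $k_\lambda(t,s):=g_\lambda(t-s)$ for $0\le s\le t$ and $e^{-\lambda(s-t)}g_\lambda(s-t)$ for $0\le t\le s$. A measurable $k:[0,\infty)^2\to\mathbb{R}$ is a Fredholm kernel of type $L^2$ on $[0,\infty)$ if $\sup\int_0^\infty\int_0^\infty|g(t)k(t,s)f(s)|dsdt<\infty$ over $\|g\|_{L^2},\|f\|_{L^2}\le1$, and of type $L^{2,\eta}$ if $e^{\eta(t-s)}k(t,s)$ is of type $L^2$. A Fredholm resolvent of type $L^{2,\eta}$ of $k$ is a Fredholm kernel $r$ of type $L^{2,\eta}$ with $r(t,s)+\int_0^\infty k(t,\theta)r(\theta,s)d\theta=r(t,s)+\int_0^\infty r(t,\theta)k(\theta,s)d\theta=k(t,s)$ for a.e. $t,s\ge0$. *)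

theory Defs
  imports "HOL-Probability.Probability"
begin

definition brownian_motion :: "'a measure \<Rightarrow> (real \<Rightarrow> 'a \<Rightarrow> real) \<Rightarrow> bool" where
  "brownian_motion M W \<longleftrightarrow>
     prob_space M \<and>
     (\<forall>t. W t \<in> borel_measurable M) \<and>
     (AE \<omega> in M. W 0 \<omega> = 0) \<and>
     (AE \<omega> in M. continuous_on {0..} (\<lambda>t. W t \<omega>)) \<and>
     (\<forall>s t. 0 \<le> s \<and> s < t \<longrightarrow>
        distributed M lborel (\<lambda>\<omega>. W t \<omega> - W s \<omega>)
          (\<lambda>x. ennreal (normal_density 0 (sqrt (t - s)) x))) \<and>
     (\<forall>(n::nat) (ts::nat \<Rightarrow> real). (\<forall>i\<le>n. 0 \<le> ts i) \<and> (\<forall>i<n. ts i \<le> ts (Suc i)) \<longrightarrow>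
        prob_space.indep_vars M (\<lambda>_. borel) (\<lambda>i \<omega>. W (ts (Suc i)) \<omega> - W (ts i) \<omega>) {..<n})"

definition nat_filtration :: "'a measure \<Rightarrow> (real \<Rightarrow> 'a \<Rightarrow> real) \<Rightarrow> real \<Rightarrow> 'a set set" where
  "nat_filtration M W t =
     {A \<in> sets M. \<exists>B \<in> sigma_sets (space M)
          (\<Union>s\<in>{0..t}. {W s -` U \<inter> space M | U. U \<in> sets borel}).
        B \<in> sets M \<and> (A - B) \<union> (B - A) \<in> null_sets M}"

definition adapted_jm :: "'a measure \<Rightarrow> (real \<Rightarrow> 'a \<Rightarrow> real) \<Rightarrow> (real \<Rightarrow> 'a \<Rightarrow> real) \<Rightarrow> bool" where
  "adapted_jm M W f \<longleftrightarrow>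
     (\<lambda>(t, \<omega>). f t \<omega>) \<in> borel_measurable (restrict_space lborel {0..} \<Otimes>\<^sub>M M) \<and>
     (\<forall>t\<ge>0. \<forall>U \<in> sets borel. f t -` U \<inter> space M \<in> nat_filtration M W t)"

definition L2F :: "'a measure \<Rightarrow> (real \<Rightarrow> 'a \<Rightarrow> real) \<Rightarrow> real \<Rightarrow> (real \<Rightarrow> 'a \<Rightarrow> real) \<Rightarrow> bool" where
  "L2F M W \<beta> f \<longleftrightarrow> adapted_jm M W f \<and>
     (\<integral>\<^sup>+\<omega>. (\<integral>\<^sup>+t\<in>{0..}. ennreal (exp (2 * \<beta> * t) * (f t \<omega>)\<^sup>2) \<partial>lborel) \<partial>M) < \<infinity>"

definition step_fun :: "nat \<Rightarrow> (nat \<Rightarrow> real) \<Rightarrow> (nat \<Rightarrow> real) \<Rightarrow> real \<Rightarrow> real" where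
  "step_fun n p a s = (\<Sum>i<n. a i * indicator {p i<..p (Suc i)} s)"

definition step_integral :: "(real \<Rightarrow> 'a \<Rightarrow> real) \<Rightarrow> nat \<Rightarrow> (nat \<Rightarrow> real) \<Rightarrow> (nat \<Rightarrow> real) \<Rightarrow> 'a \<Rightarrow> real" where
  "step_integral W n p a \<omega> = (\<Sum>i<n. a i * (W (p (Suc i)) \<omega> - W (p i) \<omega>))"

definition partition_of :: "real \<Rightarrow> nat \<Rightarrow> (nat \<Rightarrow> real) \<Rightarrow> bool" where
  "partition_of T n p \<longleftrightarrow> (\<forall>i\<le>n. 0 \<le> p i \<and> p i \<le> T) \<and> (\<forall>i<n. p i \<le> p (Suc i))"

definition wiener_integral ::
  "'a measure \<Rightarrow> (real \<Rightarrow> 'a \<Rightarrow> real) \<Rightarrow> real \<Rightarrow> (real \<Rightarrow> real) \<Rightarrow> ('a \<Rightarrow> real) \<Rightarrow> bool" where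
  "wiener_integral M W T f Y \<longleftrightarrow>
     Y \<in> borel_measurable M \<and>
     set_borel_measurable lborel {0..T} f \<and>
     (\<integral>\<^sup>+s\<in>{0..T}. ennreal ((f s)\<^sup>2) \<partial>lborel) < \<infinity> \<and>
     (\<forall>(n::nat \<Rightarrow> nat) (p::nat \<Rightarrow> nat \<Rightarrow> real) (a::nat \<Rightarrow> nat \<Rightarrow> real).
        (\<forall>k. partition_of T (n k) (p k)) \<and>
        ((\<lambda>k. \<integral>\<^sup>+s\<in>{0..T}. ennreal ((f s - step_fun (n k) (p k) (a k) s)\<^sup>2) \<partial>lborel)
            \<longlonglongrightarrow> 0)
        \<longrightarrow> ((\<lambda>k. \<integral>\<^sup>+\<omega>. ennreal ((step_integral W (n k) (p k) (a k) \<omega> - Y \<omega>)\<^sup>2) \<partial>M)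
            \<longlonglongrightarrow> 0))"

definition delayed :: "real \<Rightarrow> real \<Rightarrow> (real \<Rightarrow> 'a \<Rightarrow> real) \<Rightarrow> real \<Rightarrow> 'a \<Rightarrow> real" where
  "delayed x0 \<delta> X s \<omega> = (if s - \<delta> \<le> 0 then x0 else X (s - \<delta>) \<omega>)"

definition is_state ::
  "'a measure \<Rightarrow> (real \<Rightarrow> 'a \<Rightarrow> real) \<Rightarrow> real \<Rightarrow> real \<Rightarrow> real \<Rightarrow> real \<Rightarrow> real \<Rightarrow> real \<Rightarrow> real
     \<Rightarrow> (real \<Rightarrow> 'a \<Rightarrow> real) \<Rightarrow> (real \<Rightarrow> 'a \<Rightarrow> real) \<Rightarrow> bool" where
  "is_state M W x0 b c \<sigma> \<alpha> \<delta> \<mu> u X \<longleftrightarrow>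
     L2F M W (-\<mu>) X \<and>
     (\<forall>t\<ge>0. \<exists>Y. wiener_integral M W t (\<lambda>s. (t - s) powr (\<alpha> - 1)) Y \<and>
        (AE \<omega> in M. X t \<omega> = x0
            + 1 / Gamma \<alpha> * (\<integral>s\<in>{0..t}. (t - s) powr (\<alpha> - 1)
                   * (b * delayed x0 \<delta> X s \<omega> + c * u s \<omega>) \<partial>lborel)
            + \<sigma> / Gamma \<alpha> * Y \<omega>))"

definition cost :: "'a measure \<Rightarrow> real \<Rightarrow> real \<Rightarrow> (real \<Rightarrow> 'a \<Rightarrow> real) \<Rightarrow> (real \<Rightarrow> 'a \<Rightarrow> real) \<Rightarrow> ennreal" where
  "cost M lam \<gamma> u X = ennreal (1/2) *
     (\<integral>\<^sup>+\<omega>. (\<integral>\<^sup>+t\<in>{0..}. ennreal (exp (-lam * t) * ((X t \<omega>)\<^sup>2 + (u t \<omega>)\<^sup>2 / \<gamma>)) \<partial>lborel) \<partial>M)"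

definition optimal_control ::
  "'a measure \<Rightarrow> (real \<Rightarrow> 'a \<Rightarrow> real) \<Rightarrow> real \<Rightarrow> real \<Rightarrow> real \<Rightarrow> real \<Rightarrow> real \<Rightarrow> real \<Rightarrow> real \<Rightarrow> real
     \<Rightarrow> real \<Rightarrow> (real \<Rightarrow> 'a \<Rightarrow> real) \<Rightarrow> bool" where
  "optimal_control M W x0 b c \<sigma> \<alpha> \<delta> \<gamma> lam \<mu> u \<longleftrightarrow>
     L2F M W (-\<mu>) u \<and>
     (\<exists>X. is_state M W x0 b c \<sigma> \<alpha> \<delta> \<mu> u X \<and>
        (\<forall>v V. L2F M W (-\<mu>) v \<and> is_state M W x0 b c \<sigma> \<alpha> \<delta> \<mu> v V \<longrightarrow>
           cost M lam \<gamma> u X \<le> cost M lam \<gamma> v V))"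

definition fredholm_L2 :: "(real \<Rightarrow> real \<Rightarrow> real) \<Rightarrow> bool" where
  "fredholm_L2 k \<longleftrightarrow>
     (\<lambda>(t, s). k t s) \<in> borel_measurable (lborel \<Otimes>\<^sub>M lborel) \<and>
     (\<exists>C::real. \<forall>f g. f \<in> borel_measurable lborel \<and> g \<in> borel_measurable lborel \<and>
        (\<integral>\<^sup>+s\<in>{0..}. ennreal ((f s)\<^sup>2) \<partial>lborel) \<le> 1 \<and>
        (\<integral>\<^sup>+t\<in>{0..}. ennreal ((g t)\<^sup>2) \<partial>lborel) \<le> 1 \<longrightarrow>
        (\<integral>\<^sup>+t\<in>{0..}. (\<integral>\<^sup>+s\<in>{0..}. ennreal \<bar>g t * k t s * f s\<bar> \<partial>lborel) \<partial>lborel) \<le> ennreal C)"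

definition fredholm_kernel :: "real \<Rightarrow> (real \<Rightarrow> real \<Rightarrow> real) \<Rightarrow> bool" where
  "fredholm_kernel \<eta> k \<longleftrightarrow> fredholm_L2 (\<lambda>t s. exp (\<eta> * (t - s)) * k t s)"

definition fredholm_resolvent :: "real \<Rightarrow> (real \<Rightarrow> real \<Rightarrow> real) \<Rightarrow> (real \<Rightarrow> real \<Rightarrow> real) \<Rightarrow> bool" where
  "fredholm_resolvent \<eta> k r \<longleftrightarrow> fredholm_kernel \<eta> r \<and>
     (AE z in lborel \<Otimes>\<^sub>M lborel. 0 \<le> fst z \<and> 0 \<le> snd z \<longrightarrow>
        r (fst z) (snd z) + (\<integral>\<theta>\<in>{0..}. k (fst z) \<theta> * r \<theta> (snd z) \<partial>lborel) = k (fst z) (snd z) \<and>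
        r (fst z) (snd z) + (\<integral>\<theta>\<in>{0..}. r (fst z) \<theta> * k \<theta> (snd z) \<partial>lborel) = k (fst z) (snd z))"

definition pos_powr :: "real \<Rightarrow> real \<Rightarrow> real" where
  "pos_powr x a = (if 0 < x then x powr a else 0)"

definition g_lam :: "real \<Rightarrow> real \<Rightarrow> real \<Rightarrow> real \<Rightarrow> real \<Rightarrow> real \<Rightarrow> real \<Rightarrow> real" where
  "g_lam b c \<gamma> \<alpha> \<delta> lam \<tau> =
     (c\<^sup>2 * \<gamma> + b\<^sup>2 * exp (-lam * \<delta>)) / (Gamma \<alpha>)\<^sup>2
       * (\<integral>\<theta>\<in>{0<..}. exp (-lam * \<theta>) * \<theta> powr (\<alpha> - 1) * (\<theta> + \<tau>) powr (\<alpha> - 1) \<partial>lborel)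
     - b / Gamma \<alpha> * pos_powr (\<tau> - \<delta>) (\<alpha> - 1)"

definition k_lam :: "real \<Rightarrow> real \<Rightarrow> real \<Rightarrow> real \<Rightarrow> real \<Rightarrow> real \<Rightarrow> real \<Rightarrow> real \<Rightarrow> real" where
  "k_lam b c \<gamma> \<alpha> \<delta> lam t s =
     (if t < 0 \<or> s < 0 then 0
      else if s \<le> t then g_lam b c \<gamma> \<alpha> \<delta> lam (t - s)
      else exp (-lam * (s - t)) * g_lam b c \<gamma> \<alpha> \<delta> lam (s - t))"

end

(*
  Write K for the fractional integral with kernel f0(x) = x^(alpha-1) / Gamma(alpha), S for the shift by
  delta, and K*, S* for the adjoints in L^2(e^(-lam t) dt).  For an admissible control u put
  phi = b X(. - delta) + c u, so that X = x0 + K phi + sigma I(f0), where I(q)(t) is the integral of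
  q(t - s) dW(s) over [0,t].  The cost is convex, hence u is optimal as soon as its first variation vanishes on
  adapted directions.  Since S*S acts as e^(-lam delta) on functions supported in [0,oo), that
  condition reads E[A x0 + phi + k phi + sigma (kappa K* - b S) I(f0) | F_t] = 0 with
  k = kappa K*K - b SK - b K*S*, and this k has the kernel k_lam.  The condition decouples into one equation
  (1 + k) phi = - A x0 for the mean and one equation (1 + k) h = - g for the kernel h of the
  Gaussian part sigma I(h); both are solved by the resolvent r, which is a Neumann series because the
  choice of rho-tilde makes the Schur norm of k in the weight e^(-mu t) smaller than one.
  Thus X and u are explicit, and no Volterra equation has to be solved.
*)
theory Submission
  imports Defs
begin

text \<open>Why the decoupling closes: the adjoint of K looks only forward in time, and its kernel
  on [\<theta>, oo) is the translate of its kernel on [0, oo). Testing I(q)(t) with the past of s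
  removes the noise after s. For each noise time \<theta> < s what remains is the same half-line
  equation as for the mean, read at s - \<theta> with other data. So one resolvent serves both, and
  r occurs with first argument t - \<theta>.

  A test variable \<xi> from the past of s is represented by a function m such that E[\<xi> I] is
  the integral of f m whenever I is the Wiener integral of f. Riesz's theorem supplies m, and
  identities between random integrals become Fubini arguments for m.

  \<open>wiener_integral\<close> speaks about all approximating step sequences, so it pins its value
  down only if one exists. Concrete step functions for the singular integrand are therefore built;
  this is what lets the noises of two competing states cancel.

  The 1/2 in the equation for \<open>\<rho>t\<close> fits the Schur bound because (2
  \<rho>t)^(-\<alpha>) is at least half of \<rho>t^(-\<alpha>).\<close>

abbreviation nn_lborel :: "(real \<Rightarrow> ennreal) \<Rightarrow> ennreal" (binder "NL " 10) where
  "nn_lborel f \<equiv> integral\<^sup>N lborel f"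

lemmas bochner_cong = Bochner_Integration.integral_cong

abbreviation kw :: "real \<Rightarrow> (real \<Rightarrow> real \<Rightarrow> real) \<Rightarrow> real \<Rightarrow> real \<Rightarrow> real" where
  "kw \<mu> k t s \<equiv> exp (- \<mu> * (t - s)) * \<bar>k t s\<bar>"


subsection \<open>Square-integrable functions\<close>

definition L2 :: "'a measure \<Rightarrow> ('a \<Rightarrow> real) \<Rightarrow> bool" where
  "L2 M f \<longleftrightarrow> f \<in> borel_measurable M \<and> integrable M (\<lambda>x. (f x)\<^sup>2)"

lemma L2_measurable: "L2 M f \<Longrightarrow> f \<in> borel_measurable M"
  and L2_integrable_sq: "L2 M f \<Longrightarrow> integrable M (\<lambda>x. (f x)\<^sup>2)"
  by (auto simp: L2_def)

lemma L2_iff_nn: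
  "L2 M f \<longleftrightarrow> f \<in> borel_measurable M \<and> (\<integral>\<^sup>+x. ennreal ((f x)\<^sup>2) \<partial>M) < \<infinity>"
proof (cases "f \<in> borel_measurable M")
  case True
  have "integrable M (\<lambda>x. (f x)\<^sup>2) \<longleftrightarrow> (\<integral>\<^sup>+x. ennreal ((f x)\<^sup>2) \<partial>M) < \<infinity>"
    using True by (subst integrable_iff_bounded) auto
  then show ?thesis using True by (auto simp: L2_def)
qed (auto simp: L2_def)

lemma L2_nn_eq:
  "L2 M f \<Longrightarrow> (\<integral>\<^sup>+x. ennreal ((f x)\<^sup>2) \<partial>M) = ennreal (\<integral>x. (f x)\<^sup>2 \<partial>M)"
  by (rule nn_integral_eq_integral) (auto simp: L2_def)

lemma L2_mult:
  assumes "L2 M f" "L2 M g"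
  shows "integrable M (\<lambda>x. f x * g x)"
proof (rule Bochner_Integration.integrable_bound[of M "\<lambda>x. (f x)\<^sup>2 + (g x)\<^sup>2"])
  show "integrable M (\<lambda>x. (f x)\<^sup>2 + (g x)\<^sup>2)"
    using assms by (auto simp: L2_def)
  show "(\<lambda>x. f x * g x) \<in> borel_measurable M"
    using assms by (auto simp: L2_def)
  have "\<bar>a * b\<bar> \<le> \<bar>a\<^sup>2 + b\<^sup>2\<bar>" for a b :: real
  proof -
    have "2 * (\<bar>a\<bar> * \<bar>b\<bar>) \<le> a\<^sup>2 + b\<^sup>2"
      using sum_squares_bound[of "\<bar>a\<bar>" "\<bar>b\<bar>"] by simp
    moreover have "0 \<le> \<bar>a\<bar> * \<bar>b\<bar>" by simp
    ultimately show ?thesis by (simp only: abs_mult)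
  qed
  then show "AE x in M. norm (f x * g x) \<le> norm ((f x)\<^sup>2 + (g x)\<^sup>2)"
    by (auto intro!: AE_I2)
qed

lemma L2_add: "L2 M f \<Longrightarrow> L2 M g \<Longrightarrow> L2 M (\<lambda>x. f x + g x)"
  using L2_mult[of M f g] by (auto simp: L2_def power2_sum mult.assoc)

lemma L2_cmult: "L2 M f \<Longrightarrow> L2 M (\<lambda>x. c * f x)"
  by (auto simp: L2_def power_mult_distrib)

lemma L2_diff: "L2 M f \<Longrightarrow> L2 M g \<Longrightarrow> L2 M (\<lambda>x. f x - g x)"
  using L2_add[of M f "\<lambda>x. (-1) * g x"] L2_cmult[of M g "-1"] by auto

lemma L2_zero: "L2 M (\<lambda>x. 0)"
  by (auto simp: L2_def)

lemma L2_abs: "L2 M f \<Longrightarrow> L2 M (\<lambda>x. \<bar>f x\<bar>)"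
  by (auto simp: L2_def)

lemma L2_bound:
  assumes "L2 M g" "f \<in> borel_measurable M" "AE x in M. \<bar>f x\<bar> \<le> \<bar>g x\<bar>"
  shows "L2 M f"
  unfolding L2_def
proof
  show "integrable M (\<lambda>x. (f x)\<^sup>2)"
    using assms by (intro Bochner_Integration.integrable_bound[OF L2_integrable_sq[OF assms(1)]])
       (auto simp: abs_le_square_iff)
qed (fact assms)

lemma L2_cong_AE:
  assumes "L2 M g" "f \<in> borel_measurable M" "AE x in M. f x = g x"
  shows "L2 M f"
  using assms by (intro L2_bound[OF assms(1)]) auto

text \<open>The quadratic in t given by the integral of (f - t g)^2 is nonnegative; its value at the
  vertex is the claim. The vertex exists only if g is not null, hence the case distinction.\<close>

lemma L2_CS:
  assumes f: "L2 M f" and g: "L2 M g"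
  shows "(\<integral>x. f x * g x \<partial>M)\<^sup>2 \<le> (\<integral>x. (f x)\<^sup>2 \<partial>M) * (\<integral>x. (g x)\<^sup>2 \<partial>M)"
proof -
  let ?a = "\<integral>x. (f x)\<^sup>2 \<partial>M" and ?b = "\<integral>x. f x * g x \<partial>M" and ?c = "\<integral>x. (g x)\<^sup>2 \<partial>M"
  have q: "0 \<le> ?a - 2 * t * ?b + t\<^sup>2 * ?c" for t
  proof -
    have "0 \<le> (\<integral>x. (f x - t * g x)\<^sup>2 \<partial>M)" by simp
    also have "(\<lambda>x. (f x - t * g x)\<^sup>2) = (\<lambda>x. (f x)\<^sup>2 - 2 * t * (f x * g x) + t\<^sup>2 * (g x)\<^sup>2)"
      by (auto simp: power2_eq_square algebra_simps)
    also have "(\<integral>x. (f x)\<^sup>2 - 2 * t * (f x * g x) + t\<^sup>2 * (g x)\<^sup>2 \<partial>M) = ?a - 2 * t * ?b + t\<^sup>2 * ?c"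
      using f g L2_mult[OF f g] by (simp add: L2_def)
    finally show ?thesis .
  qed
  have c0: "0 \<le> ?c" by simp
  show ?thesis
  proof (cases "?c = 0")
    case True
    have "?b = 0"
    proof (rule ccontr)
      assume "?b \<noteq> 0"
      \<comment> \<open>For ?c = 0 the quadratic is affine in t, and at this point it takes the
        value -1.\<close>
      then show False using q[of "(?a + 1) / (2 * ?b)"] True by (simp add: field_simps)
    qed
    then show ?thesis using True by simp
  next
    case False
    then have "0 \<le> ?a - ?b\<^sup>2 / ?c"
      using q[of "?b / ?c"] by (simp add: field_simps power2_eq_square)
    then show ?thesis using False c0 by (simp add: field_simps)
  qed
qed

lemma L2_sq_sum_le:
  assumes "L2 M f" "L2 M g"
  shows "(\<integral>x. (f x + g x)\<^sup>2 \<partial>M) \<le> 2 * (\<integral>x. (f x)\<^sup>2 \<partial>M) + 2 * (\<integral>x. (g x)\<^sup>2 \<partial>M)"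
proof -
  have "(\<integral>x. (f x + g x)\<^sup>2 \<partial>M) \<le> (\<integral>x. 2 * (f x)\<^sup>2 + 2 * (g x)\<^sup>2 \<partial>M)"
  proof (rule integral_mono)
    fix x show "(f x + g x)\<^sup>2 \<le> 2 * (f x)\<^sup>2 + 2 * (g x)\<^sup>2"
      using sum_squares_bound[of "f x" "g x"] by (simp add: power2_sum)
  qed (use assms L2_integrable_sq[OF L2_add[OF assms]] in \<open>auto simp: L2_def\<close>)
  then show ?thesis using assms by (simp add: L2_def)
qed

lemma L2_sq_zero_AE:
  assumes "L2 M f" "(\<integral>x. (f x)\<^sup>2 \<partial>M) = 0"
  shows "AE x in M. f x = 0"
  using assms integral_nonneg_eq_0_iff_AE[of M "\<lambda>x. (f x)\<^sup>2"] by (auto simp: L2_def)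

text \<open>Summability of $2^n (f_{n+1} - f_n)^2$ yields almost sure convergence without Minkowski, and Fatou the rate.\<close>

lemma L2_limit:
  fixes f :: "nat \<Rightarrow> 'a \<Rightarrow> real"
  assumes L: "\<And>n. L2 M (f n)"
    and C: "\<And>n m. n \<le> m \<Longrightarrow> (\<integral>x. (f m x - f n x)\<^sup>2 \<partial>M) \<le> K * (1/4) ^ n"
  shows "AE x in M. convergent (\<lambda>n. f n x)"
    and "g \<in> borel_measurable M \<Longrightarrow> AE x in M. (\<lambda>n. f n x) \<longlonglongrightarrow> g x \<Longrightarrow>
          L2 M g \<and> (\<forall>n. (\<integral>x. (f n x - g x)\<^sup>2 \<partial>M) \<le> K * (1/4) ^ n)"
proof -
  note [measurable] = L2_measurable[OF L]
  have K0: "0 \<le> K" using C[of 0 0] by simp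
  have D: "L2 M (\<lambda>x. f m x - f n x)" for m n by (intro L2_diff L)
  have nnC: "(\<integral>\<^sup>+x. ennreal ((f m x - f n x)\<^sup>2) \<partial>M) \<le> ennreal (K * (1/4) ^ n)" if "n \<le> m" for n m
    using L2_nn_eq[OF D[of m n]] C[OF that] by (simp add: ennreal_leI)
  have "(\<integral>\<^sup>+x. (\<Sum>n. ennreal (2 ^ n * (f (Suc n) x - f n x)\<^sup>2)) \<partial>M)
      = (\<Sum>n. \<integral>\<^sup>+x. ennreal (2 ^ n * (f (Suc n) x - f n x)\<^sup>2) \<partial>M)"
    by (rule nn_integral_suminf) auto
  also have "\<dots> \<le> (\<Sum>n. ennreal (K * (1/2) ^ n))"
  proof (rule suminf_le)
    fix n
    have "(\<integral>\<^sup>+x. ennreal (2 ^ n * (f (Suc n) x - f n x)\<^sup>2) \<partial>M)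
       = ennreal (2 ^ n) * (\<integral>\<^sup>+x. ennreal ((f (Suc n) x - f n x)\<^sup>2) \<partial>M)"
      by (subst nn_integral_cmult[symmetric]) (auto simp: ennreal_mult)
    also have "\<dots> \<le> ennreal (2 ^ n) * ennreal (K * (1/4) ^ n)"
      by (intro mult_left_mono nnC) auto
    also have "\<dots> = ennreal (K * (1/2) ^ n)"
      using K0 by (subst ennreal_mult[symmetric]) (auto simp: power_mult_distrib[symmetric] mult.left_commute)
    finally show "(\<integral>\<^sup>+x. ennreal (2 ^ n * (f (Suc n) x - f n x)\<^sup>2) \<partial>M) \<le> ennreal (K * (1/2) ^ n)" .
  qed auto
  also have "\<dots> = ennreal (\<Sum>n. K * (1/2) ^ n)"
    using K0 by (intro suminf_ennreal2) (auto intro!: summable_mult summable_geometric)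
  also have "\<dots> < \<infinity>" by simp
  finally have "(\<integral>\<^sup>+x. (\<Sum>n. ennreal (2 ^ n * (f (Suc n) x - f n x)\<^sup>2)) \<partial>M) \<noteq> \<infinity>" by simp
  then have "AE x in M. (\<Sum>n. ennreal (2 ^ n * (f (Suc n) x - f n x)\<^sup>2)) \<noteq> \<infinity>"
    by (intro nn_integral_PInf_AE) auto
  then show "AE x in M. convergent (\<lambda>n. f n x)"
  proof eventually_elim
    case (elim x)
    let ?d = "\<lambda>n. f (Suc n) x - f n x"
    from elim have s1: "summable (\<lambda>n. 2 ^ n * (?d n)\<^sup>2)"
      by (intro summable_suminf_not_top) auto
    have s2: "summable (\<lambda>n. (1/2::real) ^ n)" by (intro summable_geometric) auto
    have "summable (\<lambda>n. ?d n)"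
    proof (rule summable_comparison_test[OF _ summable_add[OF s1 s2]], intro exI allI impI)
      fix n :: nat
      \<comment> \<open>The inequality 2xy \<le> x^2 + y^2 with x = 2^(n/2) |d| and y = 2^(-n/2):
        the increment is dominated by two summable sequences.\<close>
      have "2 * (\<bar>?d n\<bar> * 1) \<le> 2 ^ n * (?d n)\<^sup>2 + (1/2) ^ n"
        using sum_squares_bound[of "sqrt (2 ^ n) * \<bar>?d n\<bar>" "sqrt ((1/2) ^ n)"]
        by (simp add: power_mult_distrib real_sqrt_mult[symmetric] power_one_over mult.assoc) (simp add: real_sqrt_divide real_sqrt_mult field_simps)
      then show "norm (?d n) \<le> 2 ^ n * (?d n)\<^sup>2 + (1/2) ^ n"
        using abs_ge_zero[of "?d n"] unfolding real_norm_def
        by (rule_tac order_trans[OF _ \<open>2 * _ \<le> _\<close>]) simp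
    qed
    then have "convergent (\<lambda>n. \<Sum>i<n. ?d i)"
      by (simp add: summable_iff_convergent)
    then have "convergent (\<lambda>n. f n x - f 0 x)"
      using sum_lessThan_telescope[of "\<lambda>n. f n x"] by simp
    then have "convergent (\<lambda>n. (f n x - f 0 x) + f 0 x)"
      by (intro convergent_add convergent_const)
    then show ?case by simp
  qed
  assume g[measurable]: "g \<in> borel_measurable M" and lim: "AE x in M. (\<lambda>n. f n x) \<longlonglongrightarrow> g x"
  have fat: "(\<integral>\<^sup>+x. ennreal ((f n x - g x)\<^sup>2) \<partial>M) \<le> ennreal (K * (1/4) ^ n)" for n
  proof -
    have "(\<integral>\<^sup>+x. ennreal ((f n x - g x)\<^sup>2) \<partial>M)
       = (\<integral>\<^sup>+x. liminf (\<lambda>m. ennreal ((f m x - f n x)\<^sup>2)) \<partial>M)"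
    proof (rule nn_integral_cong_AE)
      show "AE x in M. ennreal ((f n x - g x)\<^sup>2) = liminf (\<lambda>m. ennreal ((f m x - f n x)\<^sup>2))"
        using lim
      proof eventually_elim
        case (elim x)
        have lm: "(\<lambda>m. ennreal ((f m x - f n x)\<^sup>2)) \<longlonglongrightarrow> ennreal ((g x - f n x)\<^sup>2)"
          by (intro tendsto_ennrealI tendsto_intros elim)
        then show ?case
          using lim_imp_Liminf[OF trivial_limit_sequentially lm] by (simp only: power2_commute)
      qed
    qed
    also have "\<dots> \<le> liminf (\<lambda>m. \<integral>\<^sup>+x. ennreal ((f m x - f n x)\<^sup>2) \<partial>M)"
      by (intro nn_integral_liminf) auto
    also have "\<dots> \<le> liminf (\<lambda>m::nat. ennreal (K * (1/4) ^ n))"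
      by (intro Liminf_mono) (auto simp: eventually_sequentially intro!: exI[of _ n] nnC)
    also have "\<dots> = ennreal (K * (1/4) ^ n)"
      by (simp add: Liminf_const)
    finally show ?thesis .
  qed
  have "(\<integral>\<^sup>+x. ennreal ((f 0 x - g x)\<^sup>2) \<partial>M) < \<infinity>" using fat[of 0] by (simp add: le_less_trans)
  then have d0: "L2 M (\<lambda>x. f 0 x - g x)" by (auto simp: L2_iff_nn)
  have Lg: "L2 M g" using L2_diff[OF L[of 0] d0] by simp
  moreover have "(\<integral>x. (f n x - g x)\<^sup>2 \<partial>M) \<le> K * (1/4) ^ n" for n
    using fat[of n] L2_nn_eq[OF L2_diff[OF L[of n] Lg]] K0 by (simp add: ennreal_le_iff)
  ultimately show "L2 M g \<and> (\<forall>n. (\<integral>x. (f n x - g x)\<^sup>2 \<partial>M) \<le> K * (1/4) ^ n)" by auto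
qed

text \<open>The limit is the concrete function \<open>lim\<close>, not just some element of L2. A
  pointwise limit is measurable for every sigma-algebra for which the approximants are; adaptedness
  and joint measurability of the stochastic integrals rest on this.\<close>

lemma L2_complete:
  fixes f :: "nat \<Rightarrow> 'a \<Rightarrow> real"
  assumes L: "\<And>n. L2 M (f n)"
    and C: "\<And>n m. n \<le> m \<Longrightarrow> (\<integral>x. (f m x - f n x)\<^sup>2 \<partial>M) \<le> K * (1/4) ^ n"
  defines "g \<equiv> \<lambda>x. lim (\<lambda>n. f n x)"
  shows "L2 M g" "\<And>n. (\<integral>x. (f n x - g x)\<^sup>2 \<partial>M) \<le> K * (1/4) ^ n"
    "AE x in M. (\<lambda>n. f n x) \<longlonglongrightarrow> g x"
proof -
  note [measurable] = L2_measurable[OF L]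
  have [measurable]: "g \<in> borel_measurable M" unfolding g_def by measurable
  show c: "AE x in M. (\<lambda>n. f n x) \<longlonglongrightarrow> g x"
    using L2_limit(1)[OF L C] by (rule AE_mp) (auto simp: g_def convergent_LIMSEQ_iff)
  show "L2 M g" "\<And>n. (\<integral>x. (f n x - g x)\<^sup>2 \<partial>M) \<le> K * (1/4) ^ n"
    using L2_limit(2)[OF L C _ c] by auto
qed

lemma L2_tendsto_sq:
  assumes L: "\<And>n. L2 M (f n)" "L2 M g"
    and C: "(\<lambda>n. \<integral>x. (f n x - g x)\<^sup>2 \<partial>M) \<longlonglongrightarrow> 0" and h: "L2 M h"
  shows "(\<lambda>n. \<integral>x. f n x * h x \<partial>M) \<longlonglongrightarrow> (\<integral>x. g x * h x \<partial>M)"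
    and "(\<lambda>n. \<integral>x. (f n x)\<^sup>2 \<partial>M) \<longlonglongrightarrow> (\<integral>x. (g x)\<^sup>2 \<partial>M)"
proof -
  have D: "L2 M (\<lambda>x. f n x - g x)" for n by (intro L2_diff L)
  have p: "(\<lambda>n. \<integral>x. (f n x - g x) * h x \<partial>M) \<longlonglongrightarrow> 0" if h: "L2 M h" for h
  proof (rule Lim_null_comparison)
    show "\<forall>\<^sub>F n in sequentially. norm (\<integral>x. (f n x - g x) * h x \<partial>M)
        \<le> sqrt ((\<integral>x. (f n x - g x)\<^sup>2 \<partial>M) * (\<integral>x. (h x)\<^sup>2 \<partial>M))"
      using L2_CS[OF D h] by (intro always_eventually allI) (auto intro!: real_le_rsqrt)
    show "(\<lambda>n. sqrt ((\<integral>x. (f n x - g x)\<^sup>2 \<partial>M) * (\<integral>x. (h x)\<^sup>2 \<partial>M))) \<longlonglongrightarrow> 0"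
      using tendsto_real_sqrt[OF tendsto_mult[OF C tendsto_const[of "\<integral>x. (h x)\<^sup>2 \<partial>M"]]] by simp
  qed
  have e: "(\<integral>x. (f n x - g x) * h x \<partial>M) = (\<integral>x. f n x * h x \<partial>M) - (\<integral>x. g x * h x \<partial>M)"
    if "L2 M h" for n h
    using L2_mult[OF L(1)[of n] that] L2_mult[OF L(2) that]
    by (simp add: left_diff_distrib)
  show "(\<lambda>n. \<integral>x. f n x * h x \<partial>M) \<longlonglongrightarrow> (\<integral>x. g x * h x \<partial>M)"
    using p[OF h] by (simp only: e[OF h] LIM_zero_iff)
  have "(\<integral>x. (f n x)\<^sup>2 \<partial>M) = (\<integral>x. (f n x - g x)\<^sup>2 \<partial>M) + 2 * (\<integral>x. (f n x - g x) * g x \<partial>M)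
      + (\<integral>x. (g x)\<^sup>2 \<partial>M)" for n
  proof -
    have "(\<lambda>x. (f n x)\<^sup>2) = (\<lambda>x. (f n x - g x)\<^sup>2 + 2 * ((f n x - g x) * g x) + (g x)\<^sup>2)"
      by (auto simp: power2_eq_square algebra_simps)
    then show ?thesis
      using L2_integrable_sq[OF D[of n]] L2_integrable_sq[OF L(2)] L2_mult[OF D[of n] L(2)]
      by simp
  qed
  moreover have "(\<lambda>n. (\<integral>x. (f n x - g x)\<^sup>2 \<partial>M) + 2 * (\<integral>x. (f n x - g x) * g x \<partial>M)
      + (\<integral>x. (g x)\<^sup>2 \<partial>M)) \<longlonglongrightarrow> 0 + 2 * 0 + (\<integral>x. (g x)\<^sup>2 \<partial>M)"
    by (intro tendsto_intros C p L)
  ultimately show "(\<lambda>n. \<integral>x. (f n x)\<^sup>2 \<partial>M) \<longlonglongrightarrow> (\<integral>x. (g x)\<^sup>2 \<partial>M)" by simp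
qed

text \<open>Direct method: the representing function minimises the functional \<open>\<Phi>\<close>,
  which is bounded below by -C. Comparison with midpoints shows that a minimising sequence is Cauchy
  at the rate \<open>L2_complete\<close> asks for, and stationarity of the minimiser is the
  representation.\<close>

lemma L2_riesz:
  fixes l :: "('a \<Rightarrow> real) \<Rightarrow> real"
  assumes C: "0 \<le> C" and add: "\<And>f g c. L2 M f \<Longrightarrow> L2 M g \<Longrightarrow> l (\<lambda>x. f x + c * g x) = l f + c * l g"
    and bd: "\<And>f. L2 M f \<Longrightarrow> (l f)\<^sup>2 \<le> C * (\<integral>x. (f x)\<^sup>2 \<partial>M)"
  shows "\<exists>m. L2 M m \<and> (\<forall>f. L2 M f \<longrightarrow> l f = (\<integral>x. f x * m x \<partial>M))"
proof -
  define \<Phi> where "\<Phi> f = (\<integral>x. (f x)\<^sup>2 \<partial>M) - 2 * l f" for f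
  have expand: "\<Phi> (\<lambda>x. f x + t * g x) = \<Phi> f + 2 * t * ((\<integral>x. f x * g x \<partial>M) - l g) + t\<^sup>2 * (\<integral>x. (g x)\<^sup>2 \<partial>M)"
    if f: "L2 M f" and g: "L2 M g" for f g t
  proof -
    have "(\<lambda>x. (f x + t * g x)\<^sup>2) = (\<lambda>x. (f x)\<^sup>2 + 2 * t * (f x * g x) + t\<^sup>2 * (g x)\<^sup>2)"
      by (auto simp: power2_eq_square algebra_simps)
    then have "(\<integral>x. (f x + t * g x)\<^sup>2 \<partial>M) = (\<integral>x. (f x)\<^sup>2 \<partial>M) + 2 * t * (\<integral>x. f x * g x \<partial>M) + t\<^sup>2 * (\<integral>x. (g x)\<^sup>2 \<partial>M)"
      using f g L2_mult[OF f g] by (simp add: L2_def)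
    then show ?thesis unfolding \<Phi>_def using add[OF f g, of t] by (simp add: algebra_simps)
  qed
  have lb: "- C \<le> \<Phi> f" if f: "L2 M f" for f
  proof -
    let ?a = "\<integral>x. (f x)\<^sup>2 \<partial>M"
    have a: "?a \<ge> 0" by simp
    have "(2 * l f)\<^sup>2 \<le> 4 * (C * ?a)" using bd[OF f] by (simp add: power_mult_distrib)
    also have "\<dots> \<le> (C + ?a)\<^sup>2" using sum_squares_bound[of C ?a] by (simp add: power2_sum)
    finally have "\<bar>2 * l f\<bar> \<le> \<bar>C + ?a\<bar>" by (simp add: abs_le_square_iff)
    then show ?thesis unfolding \<Phi>_def using a C by linarith
  qed
  define d where "d = Inf (\<Phi> ` {f. L2 M f})"
  have ne: "\<Phi> ` {f. L2 M f} \<noteq> {}" using L2_zero[of M] by auto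
  have bb: "bdd_below (\<Phi> ` {f. L2 M f})" using lb by (auto intro!: bdd_belowI2)
  have dle: "d \<le> \<Phi> f" if "L2 M f" for f
    unfolding d_def using that by (intro cInf_lower bb) auto
  have "\<exists>f. L2 M f \<and> \<Phi> f < d + (1/4) ^ n" for n :: nat
    using cInf_lessD[OF ne, of "d + (1/4) ^ n"] unfolding d_def by auto
  then obtain f :: "nat \<Rightarrow> 'a \<Rightarrow> real" where f: "\<And>n. L2 M (f n)" "\<And>n. \<Phi> (f n) < d + (1/4) ^ n"
    by metis
  have cau: "(\<integral>x. (f m x - f n x)\<^sup>2 \<partial>M) \<le> 4 * (1/4) ^ n" if "n \<le> m" for n m
  proof -
    have D: "L2 M (\<lambda>x. f m x - f n x)" by (intro L2_diff f)
    \<comment> \<open>The infimum is compared with the midpoint of \<open>f n\<close> and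
      \<open>f m\<close>.\<close>
    have "d \<le> \<Phi> (\<lambda>x. f n x + 1/2 * (f m x - f n x))"
      by (intro dle L2_add f L2_cmult D)
    also have "\<dots> = \<Phi> (f n) + ((\<integral>x. f n x * (f m x - f n x) \<partial>M) - l (\<lambda>x. f m x - f n x)) + 1/4 * (\<integral>x. (f m x - f n x)\<^sup>2 \<partial>M)"
      by (subst expand[OF f(1) D]) (simp add: power2_eq_square)
    finally have 1: "d \<le> \<Phi> (f n) + ((\<integral>x. f n x * (f m x - f n x) \<partial>M) - l (\<lambda>x. f m x - f n x)) + 1/4 * (\<integral>x. (f m x - f n x)\<^sup>2 \<partial>M)" .
    have "\<Phi> (f m) = \<Phi> (\<lambda>x. f n x + 1 * (f m x - f n x))" by simp
    also have "\<dots> = \<Phi> (f n) + 2 * ((\<integral>x. f n x * (f m x - f n x) \<partial>M) - l (\<lambda>x. f m x - f n x)) + (\<integral>x. (f m x - f n x)\<^sup>2 \<partial>M)"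
      by (subst expand[OF f(1) D]) simp
    finally have 2: "\<Phi> (f m) = \<dots>" .
    have "(1/4::real) ^ m \<le> (1/4) ^ n" using that by (intro power_decreasing) auto
    \<comment> \<open>Parallelogram identity in disguise: the midpoint value p + b + i/4 equals (p +
      q)/2 - i/4, and both p and q are less than d + e.\<close>
    moreover have "i \<le> 4 * e" if "d \<le> p + b + 1/4 * i" "q = p + 2 * b + i" "p < d + e" "q < d + e'" "e' \<le> e"
      for p q b i e e' :: real using that by linarith
    ultimately show ?thesis using 1 2 f(2)[of n] f(2)[of m] by blast
  qed
  define m where "m = (\<lambda>x. lim (\<lambda>n. f n x))"
  note m = L2_complete[OF f(1) cau, folded m_def]
  have lim0: "(\<lambda>n. \<integral>x. (f n x - m x)\<^sup>2 \<partial>M) \<longlonglongrightarrow> 0"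
  proof (rule Lim_null_comparison)
    show "\<forall>\<^sub>F n in sequentially. norm (\<integral>x. (f n x - m x)\<^sup>2 \<partial>M) \<le> 4 * (1/4) ^ n"
      using m(2) unfolding m_def by (intro always_eventually) auto
    show "(\<lambda>n. 4 * (1/4::real) ^ n) \<longlonglongrightarrow> 0"
      by (intro tendsto_mult_right_zero LIMSEQ_power_zero) auto
  qed
  have "(\<lambda>n. l (\<lambda>x. f n x - m x)) \<longlonglongrightarrow> 0"
  proof (rule Lim_null_comparison)
    show "\<forall>\<^sub>F n in sequentially. norm (l (\<lambda>x. f n x - m x)) \<le> sqrt (C * (\<integral>x. (f n x - m x)\<^sup>2 \<partial>M))"
      using bd[OF L2_diff[OF f(1) m(1)]] by (intro always_eventually allI) (auto intro!: real_le_rsqrt)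
    show "(\<lambda>n. sqrt (C * (\<integral>x. (f n x - m x)\<^sup>2 \<partial>M))) \<longlonglongrightarrow> 0"
      using tendsto_real_sqrt[OF tendsto_mult[OF tendsto_const[of C] lim0]] by simp
  qed
  moreover have "l (\<lambda>x. f n x - m x) = l (f n) - l m" for n
    using add[OF f(1)[of n] m(1), of "-1"] by simp
  ultimately have "(\<lambda>n. l (f n)) \<longlonglongrightarrow> l m" by (simp add: LIM_zero_iff)
  with L2_tendsto_sq(2)[OF f(1) m(1) lim0 L2_zero]
  have "(\<lambda>n. \<Phi> (f n)) \<longlonglongrightarrow> \<Phi> m" unfolding \<Phi>_def by (intro tendsto_intros)
  moreover have "(\<lambda>n. d + (1/4::real) ^ n) \<longlonglongrightarrow> d + 0"
    by (intro tendsto_intros LIMSEQ_power_zero) auto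
  ultimately have \<Phi>m: "\<Phi> m \<le> d"
    using f(2) by (intro LIMSEQ_le[of "\<lambda>n. \<Phi> (f n)" _ "\<lambda>n. d + (1/4) ^ n"]) (auto intro: less_imp_le)
  show ?thesis
  proof (intro exI[of _ m] conjI allI impI m(1))
    fix q assume q: "L2 M q"
    define a where "a = (\<integral>x. m x * q x \<partial>M) - l q"
    define c where "c = (\<integral>x. (q x)\<^sup>2 \<partial>M)"
    have c0: "0 \<le> c" unfolding c_def by simp
    \<comment> \<open>The optimal step would be -a / c; the denominator c + 1 is never zero and
      still gives the negative value -a^2 (c + 2) / (c + 1)^2 unless a = 0.\<close>
    define t where "t = - a / (c + 1)"
    have "d \<le> \<Phi> (\<lambda>x. m x + t * q x)" by (intro dle L2_add L2_cmult m q)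
    then have "0 \<le> 2 * t * a + t\<^sup>2 * c"
      using expand[OF m(1) q, of t] \<Phi>m unfolding a_def c_def by linarith
    also have "2 * t * a + t\<^sup>2 * c = - (a\<^sup>2 * (c + 2) / (c + 1)\<^sup>2)"
      using c0 unfolding t_def by (simp add: power2_eq_square divide_simps) (simp add: algebra_simps)
    finally have "a\<^sup>2 * (c + 2) / (c + 1)\<^sup>2 \<le> 0" by simp
    then have "a\<^sup>2 * (c + 2) \<le> 0" using c0 by (simp add: divide_le_0_iff)
    then have "a = 0" using c0 by (simp add: mult_le_0_iff)
    then show "l q = (\<integral>x. q x * m x \<partial>M)" unfolding a_def by (simp add: mult.commute)
  qed
qed

subsection \<open>Kernels satisfying the Schur test in a weighted space\<close>

lemma (in pair_sigma_finite) fubini_abs: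
  fixes f :: "'a \<Rightarrow> 'b \<Rightarrow> real"
  assumes m: "case_prod f \<in> borel_measurable (M1 \<Otimes>\<^sub>M M2)"
    and fin: "(\<integral>\<^sup>+x. \<integral>\<^sup>+y. ennreal \<bar>f x y\<bar> \<partial>M2 \<partial>M1) < \<infinity>"
  shows "integrable (M1 \<Otimes>\<^sub>M M2) (case_prod f)"
    and "(\<integral>y. (\<integral>x. f x y \<partial>M1) \<partial>M2) = (\<integral>x. (\<integral>y. f x y \<partial>M2) \<partial>M1)"
proof -
  show i: "integrable (M1 \<Otimes>\<^sub>M M2) (case_prod f)"
  proof (rule integrableI_bounded[OF m])
    have "(\<integral>\<^sup>+z. ennreal (norm (case_prod f z)) \<partial>(M1 \<Otimes>\<^sub>M M2)) = (\<integral>\<^sup>+x. \<integral>\<^sup>+y. ennreal \<bar>f x y\<bar> \<partial>M2 \<partial>M1)"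
      using m by (subst M2.nn_integral_fst[symmetric]) auto
    then show "(\<integral>\<^sup>+z. ennreal (norm (case_prod f z)) \<partial>(M1 \<Otimes>\<^sub>M M2)) < \<infinity>" using fin by simp
  qed
  show "(\<integral>y. (\<integral>x. f x y \<partial>M1) \<partial>M2) = (\<integral>x. (\<integral>y. f x y \<partial>M2) \<partial>M1)"
    by (rule Fubini_integral[OF i])
qed

lemma lborel_pair_AE:
  assumes [measurable]: "{z \<in> space (lborel \<Otimes>\<^sub>M lborel). P (fst z) (snd z)} \<in> sets (lborel \<Otimes>\<^sub>M (lborel :: real measure))"
    and "\<And>t :: real. AE s in lborel. P t s"
  shows "AE z in lborel \<Otimes>\<^sub>M lborel. P (fst z) (snd z)"
  using lborel_pair.AE_pair_iff[of P] assms by auto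

lemma ennreal_abs_integral_le: "ennreal \<bar>\<integral>x. f x \<partial>M\<bar> \<le> (\<integral>\<^sup>+x. ennreal \<bar>f x\<bar> \<partial>M)"
  for f :: "'a \<Rightarrow> real"
proof (cases "integrable M f")
  case True
  then show ?thesis using integral_norm_bound_ennreal[of M f] by simp
qed (simp add: not_integrable_integral_eq)

text \<open>Kernels and functions on the half-line are extended by zero to negative arguments, so that all integrals run over the whole line.\<close>

definition schur :: "real \<Rightarrow> real \<Rightarrow> (real \<Rightarrow> real \<Rightarrow> real) \<Rightarrow> bool" where
  "schur \<mu> C k \<longleftrightarrow> 0 \<le> C \<and> case_prod k \<in> borel_measurable (borel \<Otimes>\<^sub>M borel) \<and>
     (\<forall>t s. t < 0 \<or> s < 0 \<longrightarrow> k t s = 0) \<and>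
     (\<forall>t. (NL s. ennreal (kw \<mu> k t s)) \<le> ennreal C) \<and>
     (\<forall>s. (NL t. ennreal (kw \<mu> k t s)) \<le> ennreal C)"

lemma kernel_measurable:
  assumes "case_prod k \<in> borel_measurable (borel \<Otimes>\<^sub>M borel)"
    "f \<in> borel_measurable N" "g \<in> borel_measurable N"
  shows "(\<lambda>x. k (f x) (g x :: real)) \<in> borel_measurable N"
  using measurable_compose[OF measurable_Pair[OF assms(2,3)] assms(1)] by simp

lemma schurD:
  assumes "schur \<mu> C k"
  shows "0 \<le> C" "case_prod k \<in> borel_measurable (borel \<Otimes>\<^sub>M borel)"
    "\<And>t s. t < 0 \<Longrightarrow> k t s = 0" "\<And>t s. s < 0 \<Longrightarrow> k t s = 0"
    "\<And>t. (NL s. ennreal (kw \<mu> k t s)) \<le> ennreal C"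
    "\<And>s. (NL t. ennreal (kw \<mu> k t s)) \<le> ennreal C"
  using assms unfolding schur_def by auto

lemmas schur_measurable = kernel_measurable[OF schurD(2)]

text \<open>Swapping the arguments inverts the weight, so rows and columns change roles. A row
  estimate proved for all weights thereby gives the column estimate for free.\<close>

lemma schur_transpose: "schur \<mu> C k \<Longrightarrow> schur (- \<mu>) C (\<lambda>t s. k s t)"
  unfolding schur_def
proof (elim conjE, intro conjI)
  assume m: "case_prod k \<in> borel_measurable (borel \<Otimes>\<^sub>M borel)"
  show "(\<lambda>(t, s). k s t) \<in> borel_measurable (borel \<Otimes>\<^sub>M borel)"
    unfolding case_prod_beta by (intro kernel_measurable[OF m]) auto
qed (simp_all add: algebra_simps)

lemma schur_scale: "schur \<mu> C k \<Longrightarrow> schur \<mu> (\<bar>a\<bar> * C) (\<lambda>t s. a * k t s)"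
proof -
  assume k: "schur \<mu> C k"
  note [measurable] = schur_measurable[OF k]
  note C = schurD(1)[OF k]
  have *: "ennreal (exp (- \<mu> * (t - s)) * \<bar>a * k t s\<bar>) = ennreal \<bar>a\<bar> * ennreal (kw \<mu> k t s)" for t s
    by (subst ennreal_mult[symmetric]) (auto simp: abs_mult mult_ac)
  show ?thesis
    unfolding schur_def *
    using C schurD(3-6)[OF k]
    by (auto simp: nn_integral_cmult ennreal_mult intro!: mult_left_mono)
qed

lemma schur_add:
  assumes k: "schur \<mu> C k" and l: "schur \<mu> D l"
  shows "schur \<mu> (C + D) (\<lambda>t s. k t s + l t s)"
proof -
  note [measurable] = schur_measurable[OF k] schur_measurable[OF l]
  note C = schurD(1)[OF k] schurD(1)[OF l]
  have *: "ennreal (exp (- \<mu> * (t - s)) * \<bar>k t s + l t s\<bar>)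
     \<le> ennreal (kw \<mu> k t s) + ennreal (kw \<mu> l t s)" for t s
    by (subst ennreal_plus[symmetric])
       (auto intro!: ennreal_leI simp: distrib_left[symmetric])
  have "(NL s. ennreal (exp (- \<mu> * (t - s)) * \<bar>k t s + l t s\<bar>)) \<le> ennreal (C + D)" for t
  proof -
    have "(NL s. ennreal (exp (- \<mu> * (t - s)) * \<bar>k t s + l t s\<bar>)) \<le> (NL s. ennreal (kw \<mu> k t s) + ennreal (kw \<mu> l t s))"
      by (intro nn_integral_mono *)
    also have "\<dots> = (NL s. ennreal (kw \<mu> k t s)) + (NL s. ennreal (kw \<mu> l t s))"
      by (intro nn_integral_add) measurable
    also have "\<dots> \<le> ennreal C + ennreal D"
      by (intro add_mono schurD(5)[OF k] schurD(5)[OF l])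
    also have "\<dots> = ennreal (C + D)" using C by simp
    finally show ?thesis .
  qed
  moreover have "(NL t. ennreal (exp (- \<mu> * (t - s)) * \<bar>k t s + l t s\<bar>)) \<le> ennreal (C + D)" for s
  proof -
    have "(NL t. ennreal (exp (- \<mu> * (t - s)) * \<bar>k t s + l t s\<bar>)) \<le> (NL t. ennreal (kw \<mu> k t s) + ennreal (kw \<mu> l t s))"
      by (intro nn_integral_mono *)
    also have "\<dots> = (NL t. ennreal (kw \<mu> k t s)) + (NL t. ennreal (kw \<mu> l t s))"
      by (intro nn_integral_add) measurable
    also have "\<dots> \<le> ennreal C + ennreal D"
      by (intro add_mono schurD(6)[OF k] schurD(6)[OF l])
    also have "\<dots> = ennreal (C + D)" using C by simp
    finally show ?thesis .
  qed
  ultimately show ?thesis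
    using C schurD(3,4)[OF k] schurD(3,4)[OF l] unfolding schur_def by (auto simp del: ennreal_plus)
qed

section \<open>Composition of kernels and their action on functions\<close>

definition kcomp :: "(real \<Rightarrow> real \<Rightarrow> real) \<Rightarrow> (real \<Rightarrow> real \<Rightarrow> real) \<Rightarrow> real \<Rightarrow> real \<Rightarrow> real" where
  "kcomp k l t s = (LBINT \<theta>. k t \<theta> * l \<theta> s)"

definition kop :: "(real \<Rightarrow> real \<Rightarrow> real) \<Rightarrow> (real \<Rightarrow> real) \<Rightarrow> real \<Rightarrow> real" where
  "kop k f t = (LBINT s. k t s * f s)"

text \<open>The weight is multiplicative along t, \<theta>, s, so it can be shared between the two
  kernels: weighting a composition is composing the weighted kernels.\<close>

lemma schur_weight_le:
  "ennreal (exp (- \<mu> * (t - s)) * \<bar>kcomp k l t s\<bar>)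
   \<le> (NL \<theta>. ennreal (kw \<mu> k t \<theta>) * ennreal (kw \<mu> l \<theta> s))"
proof -
  have "exp (- \<mu> * (t - s)) * \<bar>kcomp k l t s\<bar> = \<bar>LBINT \<theta>. exp (- \<mu> * (t - s)) * (k t \<theta> * l \<theta> s)\<bar>"
    unfolding kcomp_def by (simp add: abs_mult)
  also have "ennreal \<dots> \<le> (NL \<theta>. ennreal \<bar>exp (- \<mu> * (t - s)) * (k t \<theta> * l \<theta> s)\<bar>)"
    by (rule ennreal_abs_integral_le)
  also have "\<dots> = (NL \<theta>. ennreal (kw \<mu> k t \<theta>) * ennreal (kw \<mu> l \<theta> s))"
  proof (rule nn_integral_cong)
    fix \<theta>
    have "exp (- \<mu> * (t - s)) = exp (- \<mu> * (t - \<theta>)) * exp (- \<mu> * (\<theta> - s))"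
      by (simp add: exp_add[symmetric] algebra_simps)
    then show "ennreal \<bar>exp (- \<mu> * (t - s)) * (k t \<theta> * l \<theta> s)\<bar>
      = ennreal (kw \<mu> k t \<theta>) * ennreal (kw \<mu> l \<theta> s)"
      by (subst ennreal_mult[symmetric]) (auto simp: abs_mult mult_ac)
  qed
  finally show ?thesis .
qed

lemma schur_comp_nn:
  assumes k: "schur \<mu> C k" and l: "schur \<mu> D l"
  shows "(NL s. NL \<theta>. ennreal (kw \<mu> k t \<theta>) * ennreal (kw \<mu> l \<theta> s)) \<le> ennreal (C * D)"
proof -
  note [measurable] = schur_measurable[OF k] schur_measurable[OF l]
  have "(NL s. NL \<theta>. ennreal (kw \<mu> k t \<theta>) * ennreal (kw \<mu> l \<theta> s))
     = (NL \<theta>. NL s. ennreal (kw \<mu> k t \<theta>) * ennreal (kw \<mu> l \<theta> s))"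
    by (rule lborel_pair.Fubini') measurable
  also have "\<dots> = (NL \<theta>. ennreal (kw \<mu> k t \<theta>) * (NL s. ennreal (kw \<mu> l \<theta> s)))"
    by (intro nn_integral_cong nn_integral_cmult) measurable
  also have "\<dots> \<le> (NL \<theta>. ennreal (kw \<mu> k t \<theta>) * ennreal D)"
    by (intro nn_integral_mono mult_left_mono schurD(5)[OF l]) auto
  also have "\<dots> = (NL \<theta>. ennreal (kw \<mu> k t \<theta>)) * ennreal D"
    by (intro nn_integral_multc) measurable
  also have "\<dots> \<le> ennreal C * ennreal D"
    by (intro mult_right_mono schurD(5)[OF k]) auto
  also have "\<dots> = ennreal (C * D)" using schurD(1)[OF k] schurD(1)[OF l] by (simp add: ennreal_mult)
  finally show ?thesis .
qed

lemma kcomp_transpose: "kcomp (\<lambda>t s. l s t) (\<lambda>t s. k s t) t s = kcomp k l s t"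
  unfolding kcomp_def by (simp add: mult.commute)

lemma schur_kcomp:
  assumes k: "schur \<mu> C k" and l: "schur \<mu> D l"
  shows "schur \<mu> (C * D) (kcomp k l)"
proof -
  note [measurable] = schur_measurable[OF k] schur_measurable[OF l]
  have 1: "(NL s. ennreal (exp (- \<mu> * (t - s)) * \<bar>kcomp k l t s\<bar>)) \<le> ennreal (C * D)"
    if k: "schur \<mu> C k" and l: "schur \<mu> D l" for t \<mu> k l C D
    by (rule order_trans[OF _ schur_comp_nn[OF k l, of t]]) (intro nn_integral_mono schur_weight_le)
  have 2: "(NL t. ennreal (exp (- \<mu> * (t - s)) * \<bar>kcomp k l t s\<bar>)) \<le> ennreal (C * D)" for s
    using 1[OF schur_transpose[OF l] schur_transpose[OF k], of s]
    by (simp only: kcomp_transpose[of l k]) (simp add: algebra_simps)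
  have "case_prod (kcomp k l) \<in> borel_measurable (borel \<Otimes>\<^sub>M borel)"
    unfolding kcomp_def case_prod_beta by measurable
  then show ?thesis
    using 1[OF k l] 2 schurD(1,3,4)[OF k] schurD(1,3,4)[OF l]
    unfolding schur_def by (auto simp: kcomp_def)
qed

text \<open>The Schur test. The weighted kernel w is written as a product of two square roots;
  Cauchy-Schwarz leaves the row integral of w, at most C, times the integral of w F^2, and after
  exchanging the integrals the column bound gives the second factor C.\<close>

lemma schur_nn:
  fixes F :: "real \<Rightarrow> ennreal"
  assumes k: "schur \<mu> C k" and [measurable]: "F \<in> borel_measurable borel"
  shows "(NL t. (NL s. ennreal (kw \<mu> k t s) * F s)\<^sup>2)
    \<le> ennreal (C\<^sup>2) * (NL s. (F s)\<^sup>2)"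
proof -
  note [measurable] = schur_measurable[OF k]
  define w where "w t s = kw \<mu> k t s" for t s
  have w0: "0 \<le> w t s" for t s unfolding w_def by simp
  have [measurable]: "case_prod w \<in> borel_measurable (borel \<Otimes>\<^sub>M borel)"
    unfolding w_def case_prod_beta by measurable
  note [measurable] = kernel_measurable[OF this]
  have "(NL s. ennreal (w t s) * F s)\<^sup>2 \<le> ennreal C * (NL s. ennreal (w t s) * (F s)\<^sup>2)" for t
  proof -
    have "(NL s. ennreal (w t s) * F s) = (NL s. ennreal (sqrt (w t s)) * (ennreal (sqrt (w t s)) * F s))"
      by (intro nn_integral_cong) (simp add: mult.assoc[symmetric] ennreal_mult[symmetric] w0)
    moreover have "(NL s. ennreal (sqrt (w t s)) * (ennreal (sqrt (w t s)) * F s))\<^sup>2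
      \<le> (NL s. (ennreal (sqrt (w t s)))\<^sup>2) * (NL s. (ennreal (sqrt (w t s)) * F s)\<^sup>2)"
      by (rule Cauchy_Schwarz_nn_integral) measurable
    ultimately have "(NL s. ennreal (w t s) * F s)\<^sup>2
      \<le> (NL s. (ennreal (sqrt (w t s)))\<^sup>2) * (NL s. (ennreal (sqrt (w t s)) * F s)\<^sup>2)"
      by metis
    also have "\<dots> = (NL s. ennreal (w t s)) * (NL s. ennreal (w t s) * (F s)\<^sup>2)"
      by (simp add: power_mult_distrib ennreal_power w0)
    also have "\<dots> \<le> ennreal C * (NL s. ennreal (w t s) * (F s)\<^sup>2)"
      unfolding w_def by (intro mult_right_mono schurD(5)[OF k]) auto
    finally show ?thesis .
  qed
  then have "(NL t. (NL s. ennreal (w t s) * F s)\<^sup>2)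
     \<le> (NL t. ennreal C * (NL s. ennreal (w t s) * (F s)\<^sup>2))"
    by (intro nn_integral_mono)
  also have "\<dots> = ennreal C * (NL t. (NL s. ennreal (w t s) * (F s)\<^sup>2))"
    by (intro nn_integral_cmult) measurable
  also have "(NL t. (NL s. ennreal (w t s) * (F s)\<^sup>2))
     = (NL s. (NL t. ennreal (w t s) * (F s)\<^sup>2))"
    by (rule lborel_pair.Fubini'[symmetric]) measurable
  also have "\<dots> = (NL s. (NL t. ennreal (w t s)) * (F s)\<^sup>2)"
    by (intro nn_integral_cong nn_integral_multc) measurable
  also have "\<dots> \<le> (NL s. ennreal C * (F s)\<^sup>2)"
    unfolding w_def by (intro nn_integral_mono mult_right_mono schurD(6)[OF k]) auto
  also have "\<dots> = ennreal C * (NL s. (F s)\<^sup>2)"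
    by (intro nn_integral_cmult) measurable
  finally show ?thesis
    using schurD(1)[OF k] unfolding w_def by (simp add: power2_eq_square ennreal_mult mult.assoc mult_left_mono)
qed

definition Lw :: "real \<Rightarrow> (real \<Rightarrow> real) \<Rightarrow> bool" where
  "Lw \<mu> f \<longleftrightarrow> f \<in> borel_measurable borel \<and> (\<forall>t<0. f t = 0) \<and>
     (NL t. ennreal ((exp (- \<mu> * t) * f t)\<^sup>2)) < \<infinity>"

lemma LwD:
  assumes "Lw \<mu> f"
  shows "f \<in> borel_measurable borel" "\<And>t. t < 0 \<Longrightarrow> f t = 0"
    "(NL t. ennreal ((exp (- \<mu> * t) * f t)\<^sup>2)) < \<infinity>"
  using assms unfolding Lw_def by auto

lemma Lw_iff_L2: "Lw \<mu> f \<longleftrightarrow> f \<in> borel_measurable borel \<and> (\<forall>t<0. f t = 0) \<and> L2 lborel (\<lambda>t. exp (- \<mu> * t) * f t)"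
  unfolding Lw_def L2_iff_nn by auto

lemma Lw_L2: "Lw \<mu> f \<Longrightarrow> L2 lborel (\<lambda>t. exp (- \<mu> * t) * f t)"
  by (simp add: Lw_iff_L2)

lemma Lw_add: "Lw \<mu> f \<Longrightarrow> Lw \<mu> g \<Longrightarrow> Lw \<mu> (\<lambda>t. f t + g t)"
  using L2_add[OF Lw_L2 Lw_L2, of \<mu> f \<mu> g] by (auto simp: Lw_iff_L2 distrib_left)

lemma Lw_cmult: "Lw \<mu> f \<Longrightarrow> Lw \<mu> (\<lambda>t. c * f t)"
  using L2_cmult[OF Lw_L2, of \<mu> f c] by (auto simp: Lw_iff_L2 mult_ac)

lemma Lw_diff: "Lw \<mu> f \<Longrightarrow> Lw \<mu> g \<Longrightarrow> Lw \<mu> (\<lambda>t. f t - g t)"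
  using Lw_add[OF _ Lw_cmult[of \<mu> g "-1"], of f] by simp

lemma kop_nn:
  assumes k: "schur \<mu> C k" and f: "Lw \<mu> f"
  shows "(NL t. (NL s. ennreal (exp (- \<mu> * t) * \<bar>k t s * f s\<bar>))\<^sup>2)
    \<le> ennreal (C\<^sup>2) * (NL t. ennreal ((exp (- \<mu> * t) * f t)\<^sup>2))"
proof -
  note [measurable] = LwD(1)[OF f]
  have *: "ennreal (kw \<mu> k t s) * ennreal (exp (- \<mu> * s) * \<bar>f s\<bar>)
     = ennreal (exp (- \<mu> * t) * \<bar>k t s * f s\<bar>)" for t s
  proof -
    have "exp (- \<mu> * t) = exp (- \<mu> * (t - s)) * exp (- \<mu> * s)"
      by (simp add: exp_add[symmetric] algebra_simps)
    then show ?thesis by (simp add: ennreal_mult[symmetric] abs_mult mult_ac)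
  qed
  show ?thesis
    using schur_nn[OF k, of "\<lambda>s. ennreal (exp (- \<mu> * s) * \<bar>f s\<bar>)"]
    unfolding * by (simp add: ennreal_power power_mult_distrib)
qed

lemma kop_AE_integrable:
  assumes k: "schur \<mu> C k" and f: "Lw \<mu> f"
  shows "AE t in lborel. integrable lborel (\<lambda>s. k t s * f s)"
proof -
  note [measurable] = LwD(1)[OF f] schur_measurable[OF k]
  have "(NL t. (NL s. ennreal (exp (- \<mu> * t) * \<bar>k t s * f s\<bar>))\<^sup>2) < \<infinity>"
    using LwD(3)[OF f] by (intro le_less_trans[OF kop_nn[OF k f]]) (simp add: ennreal_mult_less_top)
  then have "(NL t. (NL s. ennreal (exp (- \<mu> * t) * \<bar>k t s * f s\<bar>))\<^sup>2) \<noteq> \<infinity>" by simp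
  then have "AE t in lborel. (NL s. ennreal (exp (- \<mu> * t) * \<bar>k t s * f s\<bar>))\<^sup>2 \<noteq> \<infinity>"
    by (intro nn_integral_PInf_AE) auto
  then show ?thesis
  proof eventually_elim
    case (elim t)
    have "(NL s. ennreal (exp (- \<mu> * t) * \<bar>k t s * f s\<bar>))
      = ennreal (exp (- \<mu> * t)) * (NL s. ennreal \<bar>k t s * f s\<bar>)"
      by (subst nn_integral_cmult[symmetric]) (auto simp: ennreal_mult)
    with elim have "ennreal (exp (- \<mu> * t)) * (NL s. ennreal \<bar>k t s * f s\<bar>) \<noteq> \<infinity>"
      by (auto simp: power2_eq_square ennreal_mult_eq_top_iff)
    then have "(NL s. ennreal \<bar>k t s * f s\<bar>) < \<infinity>"
      by (auto simp: ennreal_mult_eq_top_iff less_top)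
    then show ?case by (intro integrableI_bounded) auto
  qed
qed

lemma kop_measurable:
  assumes k: "schur \<mu> C k" and [measurable]: "f \<in> borel_measurable borel"
  shows "kop k f \<in> borel_measurable borel"
proof -
  note [measurable] = schur_measurable[OF k]
  show ?thesis unfolding kop_def by measurable
qed

lemma Lw_kop:
  assumes k: "schur \<mu> C k" and f: "Lw \<mu> f"
  shows "Lw \<mu> (kop k f)"
  unfolding Lw_def
proof (intro conjI allI impI)
  show "kop k f \<in> borel_measurable borel" by (rule kop_measurable[OF k LwD(1)[OF f]])
  show "kop k f t = 0" if "t < 0" for t using schurD(3)[OF k that] by (simp add: kop_def)
  have "(NL t. ennreal ((exp (- \<mu> * t) * kop k f t)\<^sup>2))
     \<le> (NL t. (NL s. ennreal (exp (- \<mu> * t) * \<bar>k t s * f s\<bar>))\<^sup>2)"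
  proof (rule nn_integral_mono)
    fix t
    have "ennreal ((exp (- \<mu> * t) * kop k f t)\<^sup>2) = (ennreal \<bar>LBINT s. exp (- \<mu> * t) * (k t s * f s)\<bar>)\<^sup>2"
      by (simp add: kop_def ennreal_power)
    also have "\<dots> \<le> (NL s. ennreal \<bar>exp (- \<mu> * t) * (k t s * f s)\<bar>)\<^sup>2"
      by (intro power_mono ennreal_abs_integral_le) auto
    finally show "ennreal ((exp (- \<mu> * t) * kop k f t)\<^sup>2) \<le> (NL s. ennreal (exp (- \<mu> * t) * \<bar>k t s * f s\<bar>))\<^sup>2"
      by (simp add: abs_mult)
  qed
  also have "\<dots> < \<infinity>"
    using LwD(3)[OF f] by (intro le_less_trans[OF kop_nn[OF k f]]) (simp add: ennreal_mult_less_top)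
  finally show "(NL t. ennreal ((exp (- \<mu> * t) * kop k f t)\<^sup>2)) < \<infinity>" .
qed

text \<open>Fubini at a fixed t needs absolute integrability of the triple product.
  \<open>F1\<close> is the weighted integral of |l f|; two applications of the Schur test show that
  k applied to it is square integrable, hence finite for almost every t, and only there does the
  identity hold.\<close>

lemma kop_kcomp:
  assumes k: "schur \<mu> C k" and l: "schur \<mu> D l" and f: "Lw \<mu> f"
  shows "AE t in lborel. kop (kcomp k l) f t = kop k (kop l f) t"
proof -
  note [measurable] = LwD(1)[OF f] schur_measurable[OF k] schur_measurable[OF l]
  define F1 where "F1 \<eta> = (NL s. ennreal (exp (- \<mu> * \<eta>) * \<bar>l \<eta> s * f s\<bar>))" for \<eta>
  have [measurable]: "F1 \<in> borel_measurable borel" unfolding F1_def by measurable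
  have "(NL t. (NL s. ennreal (kw \<mu> k t s) * F1 s)\<^sup>2) < \<infinity>"
    using LwD(3)[OF f] le_less_trans[OF kop_nn[OF l f]]
    by (intro le_less_trans[OF schur_nn[OF k]]) (auto simp: ennreal_mult_less_top F1_def)
  then have "(NL t. (NL s. ennreal (kw \<mu> k t s) * F1 s)\<^sup>2) \<noteq> \<infinity>" by simp
  then have "AE t in lborel. (NL s. ennreal (kw \<mu> k t s) * F1 s)\<^sup>2 \<noteq> \<infinity>"
    by (intro nn_integral_PInf_AE) auto
  then show ?thesis
  proof eventually_elim
    case (elim t)
    have "(NL \<eta>. ennreal (kw \<mu> k t \<eta>) * F1 \<eta>)
      = (NL \<eta>. NL s. ennreal (exp (- \<mu> * t)) * ennreal \<bar>k t \<eta> * l \<eta> s * f s\<bar>)"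
    proof (rule nn_integral_cong)
      fix \<eta>
      have "ennreal (kw \<mu> k t \<eta>) * F1 \<eta> =
         (NL s. ennreal (kw \<mu> k t \<eta>) * ennreal (exp (- \<mu> * \<eta>) * \<bar>l \<eta> s * f s\<bar>))"
        unfolding F1_def by (intro nn_integral_cmult[symmetric]) measurable
      also have "\<dots> = (NL s. ennreal (exp (- \<mu> * t)) * ennreal \<bar>k t \<eta> * l \<eta> s * f s\<bar>)"
      proof (rule nn_integral_cong)
        fix s
        have "exp (- \<mu> * t) = exp (- \<mu> * (t - \<eta>)) * exp (- \<mu> * \<eta>)"
          by (simp add: exp_add[symmetric] algebra_simps)
        then show "ennreal (kw \<mu> k t \<eta>) * ennreal (exp (- \<mu> * \<eta>) * \<bar>l \<eta> s * f s\<bar>)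
          = ennreal (exp (- \<mu> * t)) * ennreal \<bar>k t \<eta> * l \<eta> s * f s\<bar>"
          by (simp add: ennreal_mult[symmetric] abs_mult mult_ac)
      qed
      finally show "ennreal (kw \<mu> k t \<eta>) * F1 \<eta> =
        (NL s. ennreal (exp (- \<mu> * t)) * ennreal \<bar>k t \<eta> * l \<eta> s * f s\<bar>)" .
    qed
    also have "\<dots> = ennreal (exp (- \<mu> * t)) * (NL \<eta>. NL s. ennreal \<bar>k t \<eta> * l \<eta> s * f s\<bar>)"
      by (simp add: nn_integral_cmult)
    finally have "ennreal (exp (- \<mu> * t)) * (NL \<eta>. NL s. ennreal \<bar>k t \<eta> * l \<eta> s * f s\<bar>) \<noteq> \<infinity>"
      using elim by (auto simp: power2_eq_square ennreal_mult_eq_top_iff)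
    then have fin: "(NL \<eta>. NL s. ennreal \<bar>k t \<eta> * l \<eta> s * f s\<bar>) < \<infinity>"
      by (auto simp: ennreal_mult_eq_top_iff less_top)
    have "(LBINT s. (LBINT \<eta>. k t \<eta> * l \<eta> s * f s)) = (LBINT \<eta>. (LBINT s. k t \<eta> * l \<eta> s * f s))"
      by (rule lborel_pair.fubini_abs(2)[OF _ fin]) measurable
    moreover have "(LBINT \<eta>. k t \<eta> * l \<eta> s * f s) = (LBINT \<eta>. k t \<eta> * l \<eta> s) * f s" for s
      by (rule integral_mult_left_zero)
    moreover have "(LBINT s. k t \<eta> * l \<eta> s * f s) = k t \<eta> * (LBINT s. l \<eta> s * f s)" for \<eta>
      by (simp only: mult.assoc integral_mult_right_zero)
    ultimately show ?case
      unfolding kop_def kcomp_def by simp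
  qed
qed

text \<open>Valid for every t because the row bounds hold for every t: the integral over s of the
  triple composition of absolute values is finite, so Fubini applies for almost every s.\<close>

lemma kcomp_assoc:
  assumes k: "schur \<mu> C k" and l: "schur \<mu> D l" and m: "schur \<mu> E m"
  shows "AE s in lborel. kcomp (kcomp k l) m t s = kcomp k (kcomp l m) t s"
proof -
  note [measurable] = schur_measurable[OF k] schur_measurable[OF l] schur_measurable[OF m]
  define a where "a \<eta> = (NL s. NL \<theta>. ennreal (kw \<mu> l \<eta> \<theta>) * ennreal (kw \<mu> m \<theta> s))" for \<eta>
  have a: "a \<eta> \<le> ennreal (D * E)" for \<eta> unfolding a_def by (rule schur_comp_nn[OF l m])
  have [measurable]: "a \<in> borel_measurable borel" unfolding a_def by measurable
  define b where "b s = (NL \<eta>. ennreal (kw \<mu> k t \<eta>) * (NL \<theta>. ennreal (kw \<mu> l \<eta> \<theta>) * ennreal (kw \<mu> m \<theta> s)))" for s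
  have [measurable]: "b \<in> borel_measurable borel" unfolding b_def by measurable
  have "(NL s. b s) = (NL \<eta>. NL s. ennreal (kw \<mu> k t \<eta>) * (NL \<theta>. ennreal (kw \<mu> l \<eta> \<theta>) * ennreal (kw \<mu> m \<theta> s)))"
    unfolding b_def by (rule lborel_pair.Fubini') measurable
  also have "\<dots> = (NL \<eta>. ennreal (kw \<mu> k t \<eta>) * a \<eta>)"
    unfolding a_def by (intro nn_integral_cong nn_integral_cmult) measurable
  also have "\<dots> \<le> (NL \<eta>. ennreal (kw \<mu> k t \<eta>) * ennreal (D * E))"
    by (intro nn_integral_mono mult_left_mono a) auto
  also have "\<dots> = (NL \<eta>. ennreal (kw \<mu> k t \<eta>)) * ennreal (D * E)"
    by (intro nn_integral_multc) measurable
  also have "\<dots> \<le> ennreal C * ennreal (D * E)"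
    by (intro mult_right_mono schurD(5)[OF k]) auto
  also have "\<dots> < \<infinity>" by (simp add: ennreal_mult_less_top)
  finally have "(NL s. b s) \<noteq> \<infinity>" by simp
  then have "AE s in lborel. b s \<noteq> \<infinity>" by (intro nn_integral_PInf_AE) auto
  then show ?thesis
  proof eventually_elim
    case (elim s)
    have "b s = (NL \<eta>. NL \<theta>. ennreal (exp (- \<mu> * (t - s))) * ennreal \<bar>k t \<eta> * l \<eta> \<theta> * m \<theta> s\<bar>)"
      unfolding b_def
    proof (rule nn_integral_cong)
      fix \<eta>
      have "ennreal (kw \<mu> k t \<eta>) * (NL \<theta>. ennreal (kw \<mu> l \<eta> \<theta>) * ennreal (kw \<mu> m \<theta> s))
        = (NL \<theta>. ennreal (kw \<mu> k t \<eta>) * (ennreal (kw \<mu> l \<eta> \<theta>) * ennreal (kw \<mu> m \<theta> s)))"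
        by (intro nn_integral_cmult[symmetric]) measurable
      also have "\<dots> = (NL \<theta>. ennreal (exp (- \<mu> * (t - s))) * ennreal \<bar>k t \<eta> * l \<eta> \<theta> * m \<theta> s\<bar>)"
      proof (rule nn_integral_cong)
        fix \<theta>
        have "exp (- \<mu> * (t - s)) = exp (- \<mu> * (t - \<eta>)) * (exp (- \<mu> * (\<eta> - \<theta>)) * exp (- \<mu> * (\<theta> - s)))"
          by (simp add: exp_add[symmetric] algebra_simps)
        then show "ennreal (kw \<mu> k t \<eta>) * (ennreal (kw \<mu> l \<eta> \<theta>) * ennreal (kw \<mu> m \<theta> s))
          = ennreal (exp (- \<mu> * (t - s))) * ennreal \<bar>k t \<eta> * l \<eta> \<theta> * m \<theta> s\<bar>"
          by (simp add: ennreal_mult[symmetric] abs_mult mult_ac)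
      qed
      finally show "ennreal (kw \<mu> k t \<eta>) * (NL \<theta>. ennreal (kw \<mu> l \<eta> \<theta>) * ennreal (kw \<mu> m \<theta> s))
        = (NL \<theta>. ennreal (exp (- \<mu> * (t - s))) * ennreal \<bar>k t \<eta> * l \<eta> \<theta> * m \<theta> s\<bar>)" .
    qed
    also have "\<dots> = ennreal (exp (- \<mu> * (t - s))) * (NL \<eta>. NL \<theta>. ennreal \<bar>k t \<eta> * l \<eta> \<theta> * m \<theta> s\<bar>)"
      by (simp add: nn_integral_cmult)
    finally have fin: "(NL \<eta>. NL \<theta>. ennreal \<bar>k t \<eta> * l \<eta> \<theta> * m \<theta> s\<bar>) < \<infinity>"
      using elim by (auto simp: ennreal_mult_eq_top_iff less_top)
    have "(LBINT \<theta>. (LBINT \<eta>. k t \<eta> * l \<eta> \<theta> * m \<theta> s)) = (LBINT \<eta>. (LBINT \<theta>. k t \<eta> * l \<eta> \<theta> * m \<theta> s))"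
      by (rule lborel_pair.fubini_abs(2)[OF _ fin]) measurable
    moreover have "(LBINT \<eta>. k t \<eta> * l \<eta> \<theta> * m \<theta> s) = (LBINT \<eta>. k t \<eta> * l \<eta> \<theta>) * m \<theta> s" for \<theta>
      by (rule integral_mult_left_zero)
    moreover have "(LBINT \<theta>. k t \<eta> * l \<eta> \<theta> * m \<theta> s) = k t \<eta> * (LBINT \<theta>. l \<eta> \<theta> * m \<theta> s)" for \<eta>
      by (simp only: mult.assoc integral_mult_right_zero)
    ultimately show ?case
      unfolding kcomp_def by simp
  qed
qed

section \<open>Series of kernels\<close>

lemma ennreal_summable_AE:
  fixes f :: "nat \<Rightarrow> 'a \<Rightarrow> real"
  assumes [measurable]: "\<And>n. f n \<in> borel_measurable M" and f0: "\<And>n x. 0 \<le> f n x"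
    and le: "\<And>n. (\<integral>\<^sup>+x. ennreal (f n x) \<partial>M) \<le> ennreal (D n)" and D: "summable D" "\<And>n. 0 \<le> D n"
  shows "AE x in M. summable (\<lambda>n. f n x)" "(\<integral>\<^sup>+x. (\<Sum>n. ennreal (f n x)) \<partial>M) \<le> ennreal (suminf D)"
proof -
  have "(\<integral>\<^sup>+x. (\<Sum>n. ennreal (f n x)) \<partial>M) = (\<Sum>n. \<integral>\<^sup>+x. ennreal (f n x) \<partial>M)"
    by (rule nn_integral_suminf) measurable
  also have "\<dots> \<le> (\<Sum>n. ennreal (D n))" by (intro suminf_le le) auto
  also have "\<dots> = ennreal (suminf D)" using D by (intro suminf_ennreal2) auto
  finally show le: "(\<integral>\<^sup>+x. (\<Sum>n. ennreal (f n x)) \<partial>M) \<le> ennreal (suminf D)" .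
  then have "(\<integral>\<^sup>+x. (\<Sum>n. ennreal (f n x)) \<partial>M) \<noteq> \<infinity>" by (auto simp: top_unique)
  then have "AE x in M. (\<Sum>n. ennreal (f n x)) \<noteq> \<infinity>"
    by (intro nn_integral_PInf_AE) auto
  then show "AE x in M. summable (\<lambda>n. f n x)"
    by eventually_elim (auto intro: summable_suminf_not_top f0)
qed

lemma schur_summable_AE:
  assumes l: "\<And>n. schur \<mu> (D n) (l n)" and D: "summable D"
  shows "AE s in lborel. summable (\<lambda>n. \<bar>l n t s\<bar>)"
    and "(NL s. ennreal (exp (- \<mu> * (t - s)) * \<bar>\<Sum>n. l n t s\<bar>)) \<le> ennreal (suminf D)"
proof -
  have [measurable]: "\<And>n f g N. f \<in> borel_measurable N \<Longrightarrow> g \<in> borel_measurable N \<Longrightarrow> (\<lambda>x. l n (f x) (g x)) \<in> borel_measurable N"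
    by (rule schur_measurable[OF l])
  have le: "\<And>n. (NL s. ennreal (exp (- \<mu> * (t - s)) * \<bar>l n t s\<bar>)) \<le> ennreal (D n)"
    by (rule schurD(5)[OF l])
  have a: "AE s in lborel. summable (\<lambda>n. exp (- \<mu> * (t - s)) * \<bar>l n t s\<bar>)"
    by (rule ennreal_summable_AE[OF _ _ le D schurD(1)[OF l]]) auto
  then show s: "AE s in lborel. summable (\<lambda>n. \<bar>l n t s\<bar>)"
    by eventually_elim (subst (asm) summable_cmult_iff, auto)
  have "(NL s. ennreal (exp (- \<mu> * (t - s)) * \<bar>\<Sum>n. l n t s\<bar>))
    \<le> (NL s. (\<Sum>n. ennreal (exp (- \<mu> * (t - s)) * \<bar>l n t s\<bar>)))"
  proof (rule nn_integral_mono_AE)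
    show "AE s in lborel. ennreal (exp (- \<mu> * (t - s)) * \<bar>\<Sum>n. l n t s\<bar>) \<le> (\<Sum>n. ennreal (exp (- \<mu> * (t - s)) * \<bar>l n t s\<bar>))"
      using s a
    proof eventually_elim
      case (elim s)
      have "ennreal (exp (- \<mu> * (t - s)) * \<bar>\<Sum>n. l n t s\<bar>) \<le> ennreal (exp (- \<mu> * (t - s)) * (\<Sum>n. \<bar>l n t s\<bar>))"
        by (intro ennreal_leI mult_left_mono summable_rabs elim) auto
      also have "\<dots> = ennreal (\<Sum>n. exp (- \<mu> * (t - s)) * \<bar>l n t s\<bar>)"
        by (subst suminf_mult[OF elim(1)]) simp
      also have "\<dots> = (\<Sum>n. ennreal (exp (- \<mu> * (t - s)) * \<bar>l n t s\<bar>))"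
        by (intro suminf_ennreal2[symmetric] elim) auto
      finally show ?case .
    qed
  qed
  also have "\<dots> \<le> ennreal (suminf D)"
    by (rule ennreal_summable_AE[OF _ _ le D schurD(1)[OF l]]) auto
  finally show "(NL s. ennreal (exp (- \<mu> * (t - s)) * \<bar>\<Sum>n. l n t s\<bar>)) \<le> ennreal (suminf D)" .
qed

lemma schur_suminf:
  assumes l: "\<And>n. schur \<mu> (D n) (l n)" and D: "summable D"
  shows "schur \<mu> (suminf D) (\<lambda>t s. \<Sum>n. l n t s)"
proof -
  have [measurable]: "\<And>n f g N. f \<in> borel_measurable N \<Longrightarrow> g \<in> borel_measurable N \<Longrightarrow> (\<lambda>x. l n (f x) (g x)) \<in> borel_measurable N"
    by (rule schur_measurable[OF l])
  have 1: "(NL t. ennreal (exp (- \<mu> * (t - s)) * \<bar>\<Sum>n. l n t s\<bar>)) \<le> ennreal (suminf D)" for s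
    using schur_summable_AE(2)[OF schur_transpose[OF l] D, of s] by (simp add: algebra_simps)
  have 2: "(\<lambda>(t, s). \<Sum>n. l n t s) \<in> borel_measurable (borel \<Otimes>\<^sub>M borel)"
    unfolding case_prod_beta by measurable
  show ?thesis
    unfolding schur_def
    using suminf_nonneg[OF D schurD(1)[OF l]] 2 schur_summable_AE(2)[OF l D] 1 schurD(3,4)[OF l]
    by auto
qed

text \<open>With t fixed, the compositions of the absolute values have total mass at most the sum of
  C * D n over s. Hence for almost every s the series of absolute integrals converges, and sum and
  integral may be exchanged.\<close>

lemma kcomp_suminf:
  assumes k: "schur \<mu> C k" and l: "\<And>n. schur \<mu> (D n) (l n)" and D: "summable D"
  shows "AE s in lborel. summable (\<lambda>n. kcomp k (l n) t s) \<and>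
     kcomp k (\<lambda>t s. \<Sum>n. l n t s) t s = (\<Sum>n. kcomp k (l n) t s)"
proof -
  have [measurable]: "\<And>n f g N. f \<in> borel_measurable N \<Longrightarrow> g \<in> borel_measurable N \<Longrightarrow> (\<lambda>x. l n (f x) (g x)) \<in> borel_measurable N"
    by (rule schur_measurable[OF l])
  note [measurable] = schur_measurable[OF k]
  define B where "B n s = (NL \<theta>. ennreal (kw \<mu> k t \<theta>) * ennreal (exp (- \<mu> * (\<theta> - s)) * \<bar>l n \<theta> s\<bar>))" for n s
  have [measurable]: "B n \<in> borel_measurable borel" for n unfolding B_def by measurable
  have "(NL s. (\<Sum>n. B n s)) = (\<Sum>n. NL s. B n s)"
    by (rule nn_integral_suminf) measurable
  also have "\<dots> \<le> (\<Sum>n. ennreal (C * D n))"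
    unfolding B_def by (intro suminf_le schur_comp_nn[OF k l]) auto
  also have "\<dots> = ennreal (\<Sum>n. C * D n)"
    using schurD(1)[OF k] schurD(1)[OF l] D by (intro suminf_ennreal2 summable_mult) auto
  finally have "(NL s. (\<Sum>n. B n s)) \<noteq> \<infinity>" by (auto simp: top_unique)
  then have "AE s in lborel. (\<Sum>n. B n s) \<noteq> \<infinity>"
    by (intro nn_integral_PInf_AE) auto
  then show ?thesis
  proof eventually_elim
    case (elim s)
    have B: "B n s = ennreal (exp (- \<mu> * (t - s))) * (NL \<theta>. ennreal \<bar>k t \<theta> * l n \<theta> s\<bar>)" for n
    proof -
      have "B n s = (NL \<theta>. ennreal (exp (- \<mu> * (t - s))) * ennreal \<bar>k t \<theta> * l n \<theta> s\<bar>)"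
        unfolding B_def
      proof (rule nn_integral_cong)
        fix \<theta>
        have "exp (- \<mu> * (t - s)) = exp (- \<mu> * (t - \<theta>)) * exp (- \<mu> * (\<theta> - s))"
          by (simp add: exp_add[symmetric] algebra_simps)
        then show "ennreal (kw \<mu> k t \<theta>) * ennreal (exp (- \<mu> * (\<theta> - s)) * \<bar>l n \<theta> s\<bar>)
          = ennreal (exp (- \<mu> * (t - s))) * ennreal \<bar>k t \<theta> * l n \<theta> s\<bar>"
          by (simp add: ennreal_mult[symmetric] abs_mult mult_ac)
      qed
      then show ?thesis by (simp add: nn_integral_cmult)
    qed
    have nt: "B n s \<noteq> \<infinity>" for n
    proof
      assume "B n s = \<infinity>"
      then have "(\<infinity>::ennreal) \<le> (\<Sum>n. B n s)" using sum_le_suminf[of "\<lambda>n. B n s" "{n}"] by auto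
      with elim show False by (simp add: top_unique)
    qed
    have int: "integrable lborel (\<lambda>\<theta>. k t \<theta> * l n \<theta> s)" for n
      using nt[of n] unfolding B by (intro integrableI_bounded) (auto simp: ennreal_mult_eq_top_iff less_top)
    have B2: "B n s = ennreal (exp (- \<mu> * (t - s)) * (LBINT \<theta>. norm (k t \<theta> * l n \<theta> s)))" for n
      unfolding B using nn_integral_eq_integral[OF integrable_norm[OF int[of n]]]
      by (simp add: ennreal_mult)
    have "summable (\<lambda>n. exp (- \<mu> * (t - s)) * (LBINT \<theta>. norm (k t \<theta> * l n \<theta> s)))"
      using elim unfolding B2 by (intro summable_suminf_not_top) auto
    then have sn: "summable (\<lambda>n. LBINT \<theta>. norm (k t \<theta> * l n \<theta> s))"
      by (subst (asm) summable_cmult_iff) auto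
    have "AE \<theta> in lborel. summable (\<lambda>n. \<bar>l n \<theta> s\<bar>)"
      using schur_summable_AE(1)[OF schur_transpose[OF l] D] .
    then have ae: "AE \<theta> in lborel. summable (\<lambda>n. norm (k t \<theta> * l n \<theta> s)) \<and> (\<Sum>n. k t \<theta> * l n \<theta> s) = k t \<theta> * (\<Sum>n. l n \<theta> s)"
      by eventually_elim (auto simp: abs_mult intro!: summable_mult suminf_mult intro: summable_rabs_cancel)
    then have ae1: "AE \<theta> in lborel. summable (\<lambda>n. norm (k t \<theta> * l n \<theta> s))" by eventually_elim auto
    note S = summable_integral[OF int ae1 sn] integral_suminf[OF int ae1 sn]
    have "kcomp k (\<lambda>t s. \<Sum>n. l n t s) t s = (LBINT \<theta>. (\<Sum>n. k t \<theta> * l n \<theta> s))"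
      unfolding kcomp_def using ae by (intro integral_cong_AE) auto
    with S show ?case unfolding kcomp_def by simp
  qed
qed

subsection \<open>Neumann series\<close>

text \<open>Indices are shifted: \<open>kpow k n\<close> is the (n+1)-fold composition, since the
  identity operator has no kernel.\<close>

primrec kpow :: "(real \<Rightarrow> real \<Rightarrow> real) \<Rightarrow> nat \<Rightarrow> real \<Rightarrow> real \<Rightarrow> real" where
  "kpow k 0 = k"
| "kpow k (Suc n) = kcomp k (kpow k n)"

text \<open>The kernel of k (1 + k)^(-1), so that 1 - r inverts 1 + k. The series does not mention
  the weight: the same function serves every \<mu> for which the Schur constant is below 1.\<close>

definition kres :: "(real \<Rightarrow> real \<Rightarrow> real) \<Rightarrow> real \<Rightarrow> real \<Rightarrow> real" where
  "kres k t s = (\<Sum>n. (-1) ^ n * kpow k n t s)"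

lemma schur_kpow: "schur \<mu> C k \<Longrightarrow> schur \<mu> (C ^ Suc n) (kpow k n)"
proof (induction n)
  case (Suc n)
  then show ?case using schur_kcomp[of \<mu> C k "C ^ Suc n" "kpow k n"] by (simp only: kpow.simps power_Suc)
qed simp

lemma schur_kpow_sgn: "schur \<mu> C k \<Longrightarrow> schur \<mu> (C ^ Suc n) (\<lambda>t s. (-1) ^ n * kpow k n t s)"
  using schur_scale[OF schur_kpow, of \<mu> C k "(-1) ^ n" n] by (simp add: power_abs)

lemma schur_kres:
  assumes k: "schur \<mu> C k" and C: "C < 1"
  shows "schur \<mu> (\<Sum>n. C ^ Suc n) (kres k)"
proof -
  have D: "summable (\<lambda>n. C ^ Suc n)"
    using C schurD(1)[OF k] by (intro summable_ignore_initial_segment[where k=1, simplified] summable_geometric) auto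
  show ?thesis using schur_suminf[OF schur_kpow_sgn[OF k] D] unfolding kres_def .
qed

text \<open>The hypothesis is almost everywhere in the second variable, while composing integrates
  over the first variable of l. The two quantifiers are exchanged by Fubini for null sets, which
  needs jointly measurable kernels.\<close>

lemma kcomp_cong_AE:
  assumes "\<And>t. AE s in lborel. l t s = l' t s"
    and [measurable]: "case_prod k \<in> borel_measurable (borel \<Otimes>\<^sub>M borel)" "case_prod l \<in> borel_measurable (borel \<Otimes>\<^sub>M borel)" "case_prod l' \<in> borel_measurable (borel \<Otimes>\<^sub>M borel)"
  shows "AE s in lborel. kcomp k l t s = kcomp k l' t s"
proof -
  note [measurable] = kernel_measurable[OF assms(2)] kernel_measurable[OF assms(3)] kernel_measurable[OF assms(4)]
  have "AE s in lborel. AE t in lborel. l t s = l' t s"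
    by (subst lborel_pair.AE_commute[symmetric]) (measurable, use assms(1) in auto)
  then show ?thesis
  proof eventually_elim
    case (elim s)
    then show ?case unfolding kcomp_def
      by (intro integral_cong_AE) (measurable, auto elim: eventually_mono)
  qed
qed

text \<open>Powers are built by composing on the left. That composing on the right gives the same
  follows from associativity, which holds only almost everywhere; hence the form of the
  conclusion.\<close>

lemma kpow_commute:
  assumes k: "schur \<mu> C k"
  shows "AE s in lborel. kcomp (kpow k n) k t s = kpow k (Suc n) t s"
proof (induction n arbitrary: t)
  case (Suc n)
  note m = schurD(2)[OF k] schurD(2)[OF schur_kpow[OF k]] schurD(2)[OF schur_kcomp[OF schur_kpow[OF k] k]]
  have "AE s in lborel. kcomp k (kcomp (kpow k n) k) t s = kcomp k (kpow k (Suc n)) t s"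
    by (intro kcomp_cong_AE Suc m)
  moreover have "AE s in lborel. kcomp (kcomp k (kpow k n)) k t s = kcomp k (kcomp (kpow k n) k) t s"
    by (rule kcomp_assoc[OF k schur_kpow[OF k] k])
  ultimately show ?case by eventually_elim simp
qed simp

text \<open>The second equation is stated on the product and not row by row: commuting k past its
  powers is known for every t and almost every s, whereas summing the series against k comes by
  transposition, for every s and almost every t. The two meet only up to a null set of
  pairs.\<close>

lemma kres_equation:
  assumes k: "schur \<mu> C k" and C: "C < 1"
  shows "AE s in lborel. kres k t s + kcomp k (kres k) t s = k t s"
    and "AE z in lborel \<Otimes>\<^sub>M lborel. kres k (fst z) (snd z) + kcomp (kres k) k (fst z) (snd z) = k (fst z) (snd z)"
proof -
  have D: "summable (\<lambda>n. C ^ Suc n)"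
    using C schurD(1)[OF k] by (intro summable_ignore_initial_segment[where k=1, simplified] summable_geometric) auto
  \<comment> \<open>The term with n = 0 is split off; the tail is, up to sign, the series of
    compositions with k.\<close>
  have head: "kres k t s - (\<Sum>n. - ((-1) ^ n * kpow k (Suc n) t s)) = k t s" if "summable (\<lambda>n. \<bar>(-1) ^ n * kpow k n t s\<bar>)" for t s
    using suminf_split_head[OF summable_rabs_cancel[OF that]] unfolding kres_def by simp
  have neg: "(\<Sum>n. - a n) = - (\<Sum>n. a n)" if "summable a" for a :: "nat \<Rightarrow> real"
    using suminf_minus[OF that] by simp
  have sum: "AE s in lborel. summable (\<lambda>n. \<bar>(-1) ^ n * kpow k n t s\<bar>)" for t
    by (rule schur_summable_AE(1)[OF schur_kpow_sgn[OF k] D])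
  have c: "kcomp k (\<lambda>t s. a * l t s) t s = a * kcomp k l t s" for a l k t s
    unfolding kcomp_def by (simp add: mult.left_commute[of _ a] )
  have c': "kcomp (\<lambda>t s. a * l t s) k t s = a * kcomp l k t s" for a l k t s
    unfolding kcomp_def by (simp add: mult.assoc)
  show "AE s in lborel. kres k t s + kcomp k (kres k) t s = k t s"
    using sum[of t] kcomp_suminf[OF k schur_kpow_sgn[OF k] D, of t]
  proof eventually_elim
    case (elim s)
    then show ?case using head[of t s] neg by (auto simp: c kres_def[abs_def])
  qed
  have L: "AE t in lborel. summable (\<lambda>n. kcomp (\<lambda>t s. (-1) ^ n * kpow k n t s) k t s) \<and>
     kcomp (\<lambda>t s. \<Sum>n. (-1) ^ n * kpow k n t s) k t s = (\<Sum>n. kcomp (\<lambda>t s. (-1) ^ n * kpow k n t s) k t s)" for s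
    using kcomp_suminf[OF schur_transpose[OF k] schur_transpose[OF schur_kpow_sgn[OF k]] D, of s]
    unfolding kcomp_def by (simp only: mult.commute)
  have 1: "AE s in lborel. AE t in lborel. \<forall>n. kcomp (kpow k n) k t s = kpow k (Suc n) t s"
    unfolding AE_all_countable
  proof
    fix n
    have [measurable]: "(\<lambda>z. kcomp (kpow k n) k (fst z) (snd z)) \<in> borel_measurable (lborel \<Otimes>\<^sub>M lborel)"
      by (rule schur_measurable[OF schur_kcomp[OF schur_kpow[OF k] k]]) auto
    have [measurable]: "(\<lambda>z. kpow k (Suc n) (fst z) (snd z)) \<in> borel_measurable (lborel \<Otimes>\<^sub>M lborel)"
      by (rule schur_measurable[OF schur_kpow[OF k]]) auto
    have "{z \<in> space (lborel \<Otimes>\<^sub>M lborel). kcomp (kpow k n) k (fst z) (snd z) = kpow k (Suc n) (fst z) (snd z)}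
      \<in> sets (lborel \<Otimes>\<^sub>M lborel)"
      by (rule borel_measurable_eq) fact+
    then show "AE s in lborel. AE t in lborel. kcomp (kpow k n) k t s = kpow k (Suc n) t s"
      using kpow_commute[OF k, of n] by (subst lborel_pair.AE_commute[symmetric]) auto
  qed
  have 2: "AE t in lborel. summable (\<lambda>n. \<bar>(-1) ^ n * kpow k n t s\<bar>)" for s
    by (rule schur_summable_AE(1)[OF schur_transpose[OF schur_kpow_sgn[OF k]] D])
  have "AE s in lborel. AE t in lborel. kres k t s + kcomp (kres k) k t s = k t s"
    using 1
  proof eventually_elim
    case (elim s)
    then show ?case using L[of s] 2[of s]
    proof eventually_elim
      case (elim t)
      then have "(\<Sum>n. kcomp (\<lambda>t s. (-1) ^ n * kpow k n t s) k t s) = - (\<Sum>n. - ((-1) ^ n * kpow k (Suc n) t s))"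
        using neg[of "\<lambda>n. (-1) ^ n * kpow k (Suc n) t s"] by (simp add: c' del: kpow.simps)
      then show ?case using head[of t s] elim by (simp add: kres_def[abs_def] del: kpow.simps)
    qed
  qed
  moreover have S: "{z \<in> space (lborel \<Otimes>\<^sub>M lborel). kres k (fst z) (snd z) + kcomp (kres k) k (fst z) (snd z) = k (fst z) (snd z)}
      \<in> sets (lborel \<Otimes>\<^sub>M lborel)"
    by (intro borel_measurable_eq borel_measurable_add schur_measurable[OF schur_kres[OF k C]]
        schur_measurable[OF schur_kcomp[OF schur_kres[OF k C] k]] schur_measurable[OF k]) auto
  ultimately have "AE t in lborel. AE s in lborel. kres k t s + kcomp (kres k) k t s = k t s"
    by (subst lborel_pair.AE_commute) auto
  then show "AE z in lborel \<Otimes>\<^sub>M lborel. kres k (fst z) (snd z) + kcomp (kres k) k (fst z) (snd z) = k (fst z) (snd z)"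
    using lborel_pair.AE_pair_iff[OF S] by simp
qed

subsection \<open>Brownian motion and its filtration\<close>

locale bmotion = prob_space M for M :: "'a measure" +
  fixes W :: "real \<Rightarrow> 'a \<Rightarrow> real"
  assumes bm: "brownian_motion M W"
begin

lemma W_measurable[measurable]: "W t \<in> borel_measurable M"
  using bm unfolding brownian_motion_def by auto

lemma W_zero: "AE \<omega> in M. W 0 \<omega> = 0"
  using bm unfolding brownian_motion_def by auto

lemma W_increment:
  assumes "0 \<le> a" "a \<le> b"
  shows "L2 M (\<lambda>\<omega>. W b \<omega> - W a \<omega>)" "(\<integral>\<omega>. W b \<omega> - W a \<omega> \<partial>M) = 0"
    "(\<integral>\<omega>. (W b \<omega> - W a \<omega>)\<^sup>2 \<partial>M) = b - a"
proof -
  have "L2 M (\<lambda>\<omega>. W b \<omega> - W a \<omega>) \<and> (\<integral>\<omega>. W b \<omega> - W a \<omega> \<partial>M) = 0 \<and> (\<integral>\<omega>. (W b \<omega> - W a \<omega>)\<^sup>2 \<partial>M) = b - a"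
  proof (cases "a = b")
    case True then show ?thesis by (simp add: L2_zero)
  next
    case False
    then have s: "0 < sqrt (b - a)" using assms by auto
    have d: "distributed M lborel (\<lambda>\<omega>. W b \<omega> - W a \<omega>) (\<lambda>x. ennreal (normal_density 0 (sqrt (b - a)) x))"
      using bm False assms unfolding brownian_motion_def by auto
    have "integrable lborel (\<lambda>x. normal_density 0 (sqrt (b - a)) x * (x - 0)\<^sup>2)"
      by (rule integrable_normal_moment[OF s])
    then have i: "integrable M (\<lambda>\<omega>. (W b \<omega> - W a \<omega>)\<^sup>2)"
      using distributed_integrable[OF d, of "\<lambda>x. x\<^sup>2"] by simp
    have e: "(\<integral>\<omega>. W b \<omega> - W a \<omega> \<partial>M) = 0"
      using normal_distributed_expectation[OF s d] by simp
    have "(\<integral>\<omega>. (W b \<omega> - W a \<omega>)\<^sup>2 \<partial>M) = b - a"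
      using normal_distributed_variance[OF s d] unfolding e using assms by simp
    then show ?thesis using i e by (auto simp: L2_def)
  qed
  then show "L2 M (\<lambda>\<omega>. W b \<omega> - W a \<omega>)" "(\<integral>\<omega>. W b \<omega> - W a \<omega> \<partial>M) = 0"
    "(\<integral>\<omega>. (W b \<omega> - W a \<omega>)\<^sup>2 \<partial>M) = b - a" by auto
qed

lemma L2_integrable: "L2 M f \<Longrightarrow> integrable M f"
  using L2_mult[of M f "\<lambda>_. 1"] by (simp add: L2_def)

text \<open>Brownian motion is given through independent increments along finite grids, so the
  cylinder event has to be expressed by increments. It then depends on a block of increments before
  a, independent of the centred W b - W a.\<close>

lemma cylinder_orthogonal:
  assumes J: "finite J" "J \<subseteq> {0..t}" and U: "\<And>j. j \<in> J \<Longrightarrow> U j \<in> sets borel"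
    and ab: "0 \<le> t" "t \<le> a" "a \<le> b"
  shows "(\<integral>\<omega>. indicator {\<omega> \<in> space M. \<forall>j\<in>J. W j \<omega> \<in> U j} \<omega> * (W b \<omega> - W a \<omega>) \<partial>M) = 0"
proof -
  define L where "L = sorted_list_of_set (insert 0 J)"
  define n where "n = length L"
  have setL: "set L = insert 0 J" and sL: "sorted L" unfolding L_def using J by (simp_all only: finite_insert set_sorted_list_of_set sorted_sorted_list_of_set)
  have n0: "n > 0" unfolding n_def using setL by (cases L) auto
  have Lt: "0 \<le> L ! i \<and> L ! i \<le> t" if "i < n" for i
    using nth_mem[of i L] that J ab unfolding setL n_def by auto
  have L0: "L ! 0 = 0"
  proof -
    obtain i where i: "i < n" "L ! i = 0" using setL unfolding n_def by (metis in_set_conv_nth insertI1)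
    have "L ! 0 \<le> L ! i" using sL i unfolding n_def by (intro sorted_nth_mono) auto
    with i Lt[OF n0] show ?thesis by auto
  qed
  \<comment> \<open>The grid consists of the n sorted points of J with 0, then a at position n, then
    b. Increment number n is thus W b - W a and belongs to the second block.\<close>
  define ts where "ts i = (if i < n then L ! i else if i = n then a else b)" for i
  have ts_mono: "ts i \<le> ts (Suc i)" if lt: "i < Suc n" for i
  proof -
    consider "Suc i < n" | "Suc i = n" | "i = n" using lt by linarith
    then show ?thesis
    proof cases
      case 1 then show ?thesis unfolding ts_def using sL by (auto simp: n_def intro!: sorted_nth_mono)
    next
      case 2 then show ?thesis unfolding ts_def using Lt[of i] ab by auto
    next
      case 3 then show ?thesis unfolding ts_def using ab by auto
    qed
  qed
  have ts0: "0 \<le> ts i" for i unfolding ts_def using Lt ab by auto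
  define X where "X i \<omega> = W (ts (Suc i)) \<omega> - W (ts i) \<omega>" for i \<omega>
  have ind: "indep_vars (\<lambda>_. borel) X {..<Suc n}"
    using bm ts_mono ts0 unfolding brownian_motion_def X_def by blast
  have iv: "indep_var (PiM {..<n} (\<lambda>_. borel)) (\<lambda>\<omega>. restrict (\<lambda>i. X i \<omega>) {..<n})
      (PiM {n} (\<lambda>_. borel)) (\<lambda>\<omega>. restrict (\<lambda>i. X i \<omega>) {n})"
    by (rule indep_var_restrict[OF ind]) auto
  \<comment> \<open>The cylinder condition in terms of increments: the sum of the first m of them is
    the value of W at grid point m, but only where W 0 = 0, so the events agree almost
    surely.\<close>
  define C where "C = {x \<in> space (PiM {..<n} (\<lambda>_. borel :: real measure)). \<forall>m\<in>{m. m < n \<and> L ! m \<in> J}. (\<Sum>i<m. x i) \<in> U (L ! m)}"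
  have C: "C \<in> sets (PiM {..<n} (\<lambda>_. borel))"
    unfolding C_def
  proof (intro sets.sets_Collect_finite_All)
    fix m assume "m \<in> {m. m < n \<and> L ! m \<in> J}"
    then have m: "m < n" "L ! m \<in> J" by auto
    have "(\<lambda>x. \<Sum>i<m. x i) \<in> borel_measurable (PiM {..<n} (\<lambda>_. borel :: real measure))"
      using m by (intro borel_measurable_sum measurable_component_singleton) auto
    from measurable_sets_Collect[OF this, of "\<lambda>y. y \<in> U (L ! m)"] U[OF m(2)]
    show "{x \<in> space (PiM {..<n} (\<lambda>_. borel :: real measure)). (\<Sum>i<m. x i) \<in> U (L ! m)} \<in> sets (PiM {..<n} (\<lambda>_. borel))"
      by simp
  qed simp
  have "indep_var borel (indicator C \<circ> (\<lambda>\<omega>. restrict (\<lambda>i. X i \<omega>) {..<n})) borel ((\<lambda>x. x n) \<circ> (\<lambda>\<omega>. restrict (\<lambda>i. X i \<omega>) {n}))"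
    by (rule indep_var_compose[OF iv]) (use C in \<open>auto intro!: measurable_component_singleton\<close>)
  then have iv2: "indep_var borel (\<lambda>\<omega>. indicator C (restrict (\<lambda>i. X i \<omega>) {..<n}) :: real) borel (\<lambda>\<omega>. W b \<omega> - W a \<omega>)"
    by (simp add: comp_def X_def ts_def)
  have Ci: "integrable M (\<lambda>\<omega>. indicator C (restrict (\<lambda>i. X i \<omega>) {..<n}) :: real)"
    using indep_var_rv1[OF iv2] by (intro integrable_const_bound[where B=1]) (auto simp: indicator_def)
  have "(\<integral>\<omega>. indicator {\<omega> \<in> space M. \<forall>j\<in>J. W j \<omega> \<in> U j} \<omega> * (W b \<omega> - W a \<omega>) \<partial>M)
    = (\<integral>\<omega>. indicator C (restrict (\<lambda>i. X i \<omega>) {..<n}) * (W b \<omega> - W a \<omega>) \<partial>M)"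
  proof (intro integral_cong_AE)
    have "{\<omega> \<in> space M. \<forall>j\<in>J. W j \<omega> \<in> U j} \<in> sets M"
      using J U by (intro sets.sets_Collect_finite_All) (auto intro!: measurable_sets_Collect[OF W_measurable])
    then show "(\<lambda>\<omega>. indicator {\<omega> \<in> space M. \<forall>j\<in>J. W j \<omega> \<in> U j} \<omega> * (W b \<omega> - W a \<omega>)) \<in> borel_measurable M"
      by (intro borel_measurable_times borel_measurable_indicator) auto
    show "(\<lambda>\<omega>. indicator C (restrict (\<lambda>i. X i \<omega>) {..<n}) * (W b \<omega> - W a \<omega>)) \<in> borel_measurable M"
      using indep_var_rv1[OF iv2] by (intro borel_measurable_times) auto
    show "AE \<omega> in M. indicator {\<omega> \<in> space M. \<forall>j\<in>J. W j \<omega> \<in> U j} \<omega> * (W b \<omega> - W a \<omega>)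
      = indicator C (restrict (\<lambda>i. X i \<omega>) {..<n}) * (W b \<omega> - W a \<omega>)"
      using W_zero AE_space
    proof eventually_elim
      case (elim \<omega>)
      have s: "(\<Sum>i<m. restrict (\<lambda>i. X i \<omega>) {..<n} i) = W (L ! m) \<omega>" if "m < n" for m
      proof -
        have "(\<Sum>i<m. restrict (\<lambda>i. X i \<omega>) {..<n} i) = (\<Sum>i<m. W (ts (Suc i)) \<omega> - W (ts i) \<omega>)"
          using that by (intro sum.cong) (auto simp: X_def)
        also have "\<dots> = W (ts m) \<omega> - W (ts 0) \<omega>" by (rule sum_lessThan_telescope)
        finally show ?thesis using that n0 L0 elim by (simp add: ts_def)
      qed
      have "(\<forall>j\<in>J. W j \<omega> \<in> U j) \<longleftrightarrow> (\<forall>m\<in>{m. m < n \<and> L ! m \<in> J}. W (L ! m) \<omega> \<in> U (L ! m))"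
      proof
        assume r: "\<forall>m\<in>{m. m < n \<and> L ! m \<in> J}. W (L ! m) \<omega> \<in> U (L ! m)"
        show "\<forall>j\<in>J. W j \<omega> \<in> U j"
        proof
          fix j assume "j \<in> J"
          then obtain m where "m < n" "L ! m = j" using setL unfolding n_def by (metis in_set_conv_nth insertI2)
          then show "W j \<omega> \<in> U j" using r \<open>j \<in> J\<close> by auto
        qed
      qed auto
      also have "\<dots> \<longleftrightarrow> restrict (\<lambda>i. X i \<omega>) {..<n} \<in> C"
        unfolding C_def using s by (auto simp: space_PiM)
      finally show ?case using elim by (auto simp: indicator_def)
    qed
  qed
  also have "\<dots> = (\<integral>\<omega>. indicator C (restrict (\<lambda>i. X i \<omega>) {..<n}) \<partial>M) * (\<integral>\<omega>. W b \<omega> - W a \<omega> \<partial>M)"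
    using ab by (intro indep_var_lebesgue_integral[OF iv2 Ci]) (auto intro!: L2_integrable W_increment)
  also have "\<dots> = 0" using W_increment(2)[of a b] ab by simp
  finally show ?thesis .
qed

section \<open>The augmented filtration\<close>

definition gen :: "real \<Rightarrow> 'a set set" where
  "gen t = (\<Union>s\<in>{0..t}. {W s -` U \<inter> space M | U. U \<in> sets borel})"

lemma gen_sets: "sigma_sets (space M) (gen t) \<subseteq> sets M"
  by (rule sets.sigma_sets_subset) (auto simp: gen_def)

text \<open>Dynkin's argument. The generators in \<open>gen t\<close> involve one time each and are
  not stable under intersection; the finite cylinders \<open>P\<close> contain them and are.\<close>

lemma sigma_gen_orthogonal:
  assumes B: "B \<in> sigma_sets (space M) (gen t)" and ab: "0 \<le> t" "t \<le> a" "a \<le> b"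
  shows "(\<integral>\<omega>. indicator B \<omega> * (W b \<omega> - W a \<omega>) \<partial>M) = 0"
proof -
  define P where "P = {A. \<exists>J U. finite J \<and> J \<subseteq> {0..t} \<and> (\<forall>j. U j \<in> sets borel) \<and> A = {\<omega> \<in> space M. \<forall>j\<in>J. W j \<omega> \<in> U j}}"
  have PM: "P \<subseteq> sets M"
    unfolding P_def by (auto intro!: sets.sets_Collect_finite_All measurable_sets_Collect[OF W_measurable])
  have PPow: "P \<subseteq> Pow (space M)" using PM sets.sets_into_space by auto
  have "Int_stable P"
  proof (rule Int_stableI)
    fix A B assume "A \<in> P" "B \<in> P"
    then obtain J U K V where *: "finite J" "J \<subseteq> {0..t}" "\<forall>j. U j \<in> sets borel" "A = {\<omega> \<in> space M. \<forall>j\<in>J. W j \<omega> \<in> U j}"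
      "finite K" "K \<subseteq> {0..t}" "\<forall>j. V j \<in> sets borel" "B = {\<omega> \<in> space M. \<forall>j\<in>K. W j \<omega> \<in> V j}"
      unfolding P_def by auto
    have "A \<inter> B = {\<omega> \<in> space M. \<forall>j\<in>J \<union> K. W j \<omega> \<in> (if j \<in> J then U j else UNIV) \<inter> (if j \<in> K then V j else UNIV)}"
      unfolding * by auto
    then show "A \<inter> B \<in> P" unfolding P_def using *
      by (intro CollectI exI[of _ "J \<union> K"] exI[of _ "\<lambda>j. (if j \<in> J then U j else UNIV) \<inter> (if j \<in> K then V j else UNIV)"]) auto
  qed
  have "gen t \<subseteq> P"
  proof
    fix A assume "A \<in> gen t"
    then obtain s U where "s \<in> {0..t}" "U \<in> sets borel" "A = W s -` U \<inter> space M" unfolding gen_def by auto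
    then show "A \<in> P" unfolding P_def by (intro CollectI exI[of _ "{s}"] exI[of _ "\<lambda>_. U"]) auto
  qed
  then have BP: "B \<in> sigma_sets (space M) P" using B sigma_sets_mono'[of "gen t" P] by auto
  note i = L2_integrable[OF W_increment(1)[of a b]]
  have sM: "A \<in> sets M" if "A \<in> sigma_sets (space M) P" for A
    using that sets.sigma_sets_subset[OF PM] by auto
  have ii: "integrable M (\<lambda>\<omega>. indicator A \<omega> * (W b \<omega> - W a \<omega>))" if "A \<in> sets M" for A
    using integrable_real_mult_indicator[OF that i] ab by (simp add: mult.commute)
  show ?thesis
    using \<open>Int_stable P\<close> PPow BP
  proof (induction rule: sigma_sets_induct_disjoint)
    case (basic A)
    then obtain J U where "finite J" "J \<subseteq> {0..t}" "\<forall>j. U j \<in> sets borel" "A = {\<omega> \<in> space M. \<forall>j\<in>J. W j \<omega> \<in> U j}"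
      unfolding P_def by auto
    then show ?case using cylinder_orthogonal[of J t U a b] ab by simp
  next
    case empty show ?case by simp
  next
    case (compl A)
    have "(\<integral>\<omega>. indicator (space M - A) \<omega> * (W b \<omega> - W a \<omega>) \<partial>M)
      = (\<integral>\<omega>. (W b \<omega> - W a \<omega>) - indicator A \<omega> * (W b \<omega> - W a \<omega>) \<partial>M)"
      by (intro bochner_cong) (auto simp: indicator_def)
    also have "\<dots> = 0" using compl i ii[OF sM[OF compl(1)]] ab W_increment(2)[of a b]
      by (subst Bochner_Integration.integral_diff) auto
    finally show ?case .
  next
    case (union A)
    have AM: "A i \<in> sets M" for i using union(2) sM by auto
    have "set_integrable M (\<Union>i. A i) (\<lambda>\<omega>. W b \<omega> - W a \<omega>)"
      unfolding set_integrable_def using ii[of "\<Union>i. A i"] AM by auto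
    from lebesgue_integral_countable_add[OF AM _ this] union(1)
    have "(\<integral>\<omega>. indicator (\<Union>i. A i) \<omega> * (W b \<omega> - W a \<omega>) \<partial>M) = (\<Sum>i. \<integral>\<omega>. indicator (A i) \<omega> * (W b \<omega> - W a \<omega>) \<partial>M)"
      unfolding set_lebesgue_integral_def disjoint_family_on_def by simp
    then show ?case using union by simp
  qed
qed


lemma nat_filtration_alt:
  "nat_filtration M W t = {A \<in> sets M. \<exists>B \<in> sigma_sets (space M) (gen t). B \<in> sets M \<and> (A - B) \<union> (B - A) \<in> null_sets M}"
  unfolding nat_filtration_def gen_def ..

definition Ft :: "real \<Rightarrow> 'a measure" where
  "Ft t = sigma (space M) (nat_filtration M W t)"

lemma nat_filtration_sigma_algebra: "sigma_algebra (space M) (nat_filtration M W t)"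
proof -
  interpret G: sigma_algebra "space M" "sigma_sets (space M) (gen t)"
    by (rule sigma_algebra_sigma_sets) (auto simp: gen_def)
  show ?thesis
    unfolding sigma_algebra_iff2
  proof (intro conjI ballI allI impI)
    show "nat_filtration M W t \<subseteq> Pow (space M)"
      unfolding nat_filtration_alt using sets.sets_into_space by auto
    show "{} \<in> nat_filtration M W t" unfolding nat_filtration_alt by (auto intro!: bexI[of _ "{}"])
  next
    fix A assume "A \<in> nat_filtration M W t"
    then obtain B where *: "A \<in> sets M" "B \<in> sigma_sets (space M) (gen t)" "B \<in> sets M" "(A - B) \<union> (B - A) \<in> null_sets M"
      unfolding nat_filtration_alt by auto
    have "((space M - A) - (space M - B)) \<union> ((space M - B) - (space M - A)) = (A - B) \<union> (B - A)"
      using sets.sets_into_space *(1,3) by blast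
    then show "space M - A \<in> nat_filtration M W t"
      unfolding nat_filtration_alt using * by (auto intro!: bexI[of _ "space M - B"])
  next
    fix A :: "nat \<Rightarrow> 'a set" assume "range A \<subseteq> nat_filtration M W t"
    then have "\<forall>i. \<exists>B. A i \<in> sets M \<and> B \<in> sigma_sets (space M) (gen t) \<and> B \<in> sets M \<and> (A i - B) \<union> (B - A i) \<in> null_sets M"
      unfolding nat_filtration_alt by blast
    then obtain B where B: "\<And>i. A i \<in> sets M" "\<And>i. B i \<in> sigma_sets (space M) (gen t)" "\<And>i. B i \<in> sets M" "\<And>i. (A i - B i) \<union> (B i - A i) \<in> null_sets M"
      by metis
    have "((\<Union>i. A i) - (\<Union>i. B i)) \<union> ((\<Union>i. B i) - (\<Union>i. A i)) \<in> null_sets M"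
    proof (rule null_sets_subset)
      show "(\<Union>i. (A i - B i) \<union> (B i - A i)) \<in> null_sets M" by (intro null_sets_UN B)
      show "((\<Union>i. A i) - (\<Union>i. B i)) \<union> ((\<Union>i. B i) - (\<Union>i. A i)) \<in> sets M" using B by auto
    qed auto
    then show "(\<Union>i. A i) \<in> nat_filtration M W t"
      unfolding nat_filtration_alt using B by (auto intro!: bexI[of _ "\<Union>i. B i"])
  qed
qed

lemma space_Ft[simp]: "space (Ft t) = space M" and sets_Ft: "sets (Ft t) = nat_filtration M W t"
proof -
  interpret sigma_algebra "space M" "nat_filtration M W t" by (rule nat_filtration_sigma_algebra)
  show "space (Ft t) = space M" "sets (Ft t) = nat_filtration M W t"
    unfolding Ft_def using space_closed by (auto simp: sigma_sets_eq)
qed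

lemma Ft_subset: "sets (Ft t) \<subseteq> sets M"
  unfolding sets_Ft nat_filtration_alt by auto

lemma Ft_subalgebra: "subalgebra M (Ft t)"
  unfolding subalgebra_def using Ft_subset by auto

lemma gen_mono: "s \<le> t \<Longrightarrow> gen s \<subseteq> gen t"
  unfolding gen_def by fastforce

lemma Ft_mono: "s \<le> t \<Longrightarrow> sets (Ft s) \<subseteq> sets (Ft t)"
  unfolding sets_Ft nat_filtration_alt using sigma_sets_mono'[OF gen_mono[of s t], of "space M"] by blast

lemma Ft_measurable_mono:
  assumes "f \<in> borel_measurable (Ft s)" "s \<le> t" shows "f \<in> borel_measurable (Ft t)"
  using assms Ft_mono[OF assms(2)] unfolding measurable_def by auto

lemma null_sets_Ft: "N \<in> null_sets M \<Longrightarrow> N \<in> sets (Ft t)"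
  unfolding sets_Ft nat_filtration_alt by (auto intro!: bexI[of _ "{}"] sigma_sets.Empty)

lemma gen_Ft: "B \<in> gen t \<Longrightarrow> B \<in> sets (Ft t)"
  unfolding sets_Ft nat_filtration_alt using gen_sets[of t] by (auto intro!: bexI[of _ B])

lemma W_adapted: "0 \<le> s \<Longrightarrow> s \<le> t \<Longrightarrow> W s \<in> borel_measurable (Ft t)"
proof (rule measurableI)
  fix A :: "real set" assume "0 \<le> s" "s \<le> t" "A \<in> sets borel"
  then have "W s -` A \<inter> space M \<in> gen t" unfolding gen_def by fastforce
  then show "W s -` A \<inter> space (Ft t) \<in> sets (Ft t)" using gen_Ft by simp
qed simp

lemma adapted_iff:
  "(\<forall>U\<in>sets borel. f -` U \<inter> space M \<in> nat_filtration M W t) \<longleftrightarrow> f \<in> borel_measurable (Ft t)"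
  for f :: "'a \<Rightarrow> real"
  unfolding measurable_def by (auto simp: sets_Ft)

text \<open>A set of the augmented sigma-algebra differs from one generated by W by a null set, so
  the increment integrates to zero over it as well. Its conditional expectation is therefore zero,
  which extends orthogonality from indicators to all square-integrable \<xi>.\<close>

lemma Ft_orthogonal:
  assumes xi: "\<xi> \<in> borel_measurable (Ft t)" "L2 M \<xi>" and ab: "0 \<le> t" "t \<le> a" "a \<le> b"
  shows "(\<integral>\<omega>. \<xi> \<omega> * (W b \<omega> - W a \<omega>) \<partial>M) = 0"
proof -
  interpret F: finite_measure_subalgebra M "Ft t"
    by unfold_locales (rule Ft_subalgebra)
  note D = W_increment(1)[of a b]
  have D: "L2 M (\<lambda>\<omega>. W b \<omega> - W a \<omega>)" using D ab by auto
  have "AE \<omega> in M. real_cond_exp M (Ft t) (\<lambda>\<omega>. W b \<omega> - W a \<omega>) \<omega> = 0"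
  proof (rule F.real_cond_exp_charact)
    fix A assume "A \<in> sets (Ft t)"
    then obtain B where *: "A \<in> sets M" "B \<in> sigma_sets (space M) (gen t)" "B \<in> sets M" "(A - B) \<union> (B - A) \<in> null_sets M"
      unfolding sets_Ft nat_filtration_alt by auto
    have "(\<integral>\<omega>\<in>A. (W b \<omega> - W a \<omega>) \<partial>M) = (\<integral>\<omega>. indicator B \<omega> * (W b \<omega> - W a \<omega>) \<partial>M)"
      unfolding set_lebesgue_integral_def
    proof (rule integral_cong_AE)
      show "AE \<omega> in M. indicator A \<omega> *\<^sub>R (W b \<omega> - W a \<omega>) = indicator B \<omega> * (W b \<omega> - W a \<omega>)"
        using AE_not_in[OF *(4)] by eventually_elim (auto simp: indicator_def)
    qed (use * in auto)
    also have "\<dots> = 0" by (rule sigma_gen_orthogonal[OF *(2) ab])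
    finally show "(\<integral>\<omega>\<in>A. (W b \<omega> - W a \<omega>) \<partial>M) = (\<integral>\<omega>\<in>A. 0 \<partial>M)" by simp
  qed (use L2_integrable[OF D] in auto)
  then have "(\<integral>\<omega>. \<xi> \<omega> * real_cond_exp M (Ft t) (\<lambda>\<omega>. W b \<omega> - W a \<omega>) \<omega> \<partial>M) = (\<integral>\<omega>. 0 \<partial>M)"
    using L2_measurable[OF xi(2)] by (intro integral_cong_AE) (auto elim: eventually_mono)
  moreover have "(\<integral>\<omega>. \<xi> \<omega> * real_cond_exp M (Ft t) (\<lambda>\<omega>. W b \<omega> - W a \<omega>) \<omega> \<partial>M) = (\<integral>\<omega>. \<xi> \<omega> * (W b \<omega> - W a \<omega>) \<partial>M)"
    by (rule F.real_cond_exp_intg(2)) (use L2_mult[OF xi(2) D] xi in auto)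
  ultimately show ?thesis by simp
qed

text \<open>Outside a null set the paths are continuous and start at zero; on it they are replaced by zero, which makes the process jointly measurable and keeps it adapted to the augmented filtration.\<close>

definition bad_set :: "'a set" where
  "bad_set = (SOME N. N \<in> null_sets M \<and> (\<forall>\<omega>\<in>space M - N. W 0 \<omega> = 0 \<and> continuous_on {0..} (\<lambda>t. W t \<omega>)))"

lemma bad_set: "bad_set \<in> null_sets M" "\<And>\<omega>. \<omega> \<in> space M \<Longrightarrow> \<omega> \<notin> bad_set \<Longrightarrow> W 0 \<omega> = 0 \<and> continuous_on {0..} (\<lambda>t. W t \<omega>)"
proof -
  have "AE \<omega> in M. W 0 \<omega> = 0 \<and> continuous_on {0..} (\<lambda>t. W t \<omega>)"
    using bm unfolding brownian_motion_def by auto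
  then obtain N where "{\<omega> \<in> space M. \<not> (W 0 \<omega> = 0 \<and> continuous_on {0..} (\<lambda>t. W t \<omega>))} \<subseteq> N" "N \<in> null_sets M"
    unfolding eventually_ae_filter by auto
  then have "\<exists>N. N \<in> null_sets M \<and> (\<forall>\<omega>\<in>space M - N. W 0 \<omega> = 0 \<and> continuous_on {0..} (\<lambda>t. W t \<omega>))"
    by (intro exI[of _ N]) blast
  then have "bad_set \<in> null_sets M \<and> (\<forall>\<omega>\<in>space M - bad_set. W 0 \<omega> = 0 \<and> continuous_on {0..} (\<lambda>t. W t \<omega>))"
    unfolding bad_set_def by (rule someI_ex)
  then show "bad_set \<in> null_sets M" "\<And>\<omega>. \<omega> \<in> space M \<Longrightarrow> \<omega> \<notin> bad_set \<Longrightarrow> W 0 \<omega> = 0 \<and> continuous_on {0..} (\<lambda>t. W t \<omega>)"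
    by blast+
qed

text \<open>Time is clamped at 0, so that \<open>Wc d\<close> vanishes for d \<le> 0 just as the
  indicator of \<open>{0<..d}\<close> does. Lists encoding step functions may thus contain arbitrary
  real endpoints.\<close>

definition Wc :: "real \<Rightarrow> 'a \<Rightarrow> real" where
  "Wc t \<omega> = (if \<omega> \<in> bad_set then 0 else W (max 0 t) \<omega>)"

lemma bad_set_sets[measurable]: "bad_set \<in> sets M" using bad_set(1) by auto

lemma Wc_measurable[measurable]: "Wc t \<in> borel_measurable M"
  unfolding Wc_def[abs_def] by measurable

lemma Wc_AE: "0 \<le> t \<Longrightarrow> AE \<omega> in M. Wc t \<omega> = W t \<omega>"
  using AE_not_in[OF bad_set(1)] by eventually_elim (auto simp: Wc_def)

lemma Wc_neg: "t \<le> 0 \<Longrightarrow> \<omega> \<in> space M \<Longrightarrow> Wc t \<omega> = 0"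
  using bad_set(2)[of \<omega>] by (auto simp: Wc_def max_def)

lemma Wc_adapted: "0 \<le> t \<Longrightarrow> s \<le> t \<Longrightarrow> Wc s \<in> borel_measurable (Ft t)"
proof -
  assume "0 \<le> t" "s \<le> t"
  then have [measurable]: "W (max 0 s) \<in> borel_measurable (Ft t)" by (intro W_adapted) auto
  have [measurable]: "bad_set \<in> sets (Ft t)" by (rule null_sets_Ft[OF bad_set(1)])
  show ?thesis unfolding Wc_def[abs_def] by measurable
qed

lemma Wc_cont: "\<omega> \<in> space M \<Longrightarrow> continuous_on UNIV (\<lambda>t. Wc t \<omega>)"
proof (cases "\<omega> \<in> bad_set")
  case False
  assume "\<omega> \<in> space M"
  then have "continuous_on {0..} (\<lambda>t. W t \<omega>)" using bad_set(2) False by auto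
  then have "continuous_on UNIV (\<lambda>t. W (max 0 t) \<omega>)"
    by (rule continuous_on_compose2) (auto intro!: continuous_intros)
  then show ?thesis using False by (simp add: Wc_def)
qed (simp add: Wc_def)

text \<open>Rounding the time down to multiples of 1/(n+1) leaves countably many random variables,
  so the rounded process is jointly measurable; by path continuity it converges to \<open>Wc\<close>
  at every point.\<close>

lemma Wc_joint: "case_prod Wc \<in> borel_measurable (borel \<Otimes>\<^sub>M M)"
proof (rule borel_measurable_LIMSEQ_metric)
  fix n :: nat
  have "(\<lambda>z. (\<lambda>i z. Wc (of_int i / real (Suc n)) (snd z)) \<lfloor>real (Suc n) * fst z\<rfloor> z) \<in> borel_measurable (borel \<Otimes>\<^sub>M M)"
    by (rule measurable_compose_countable) measurable
  then show "(\<lambda>z. Wc (of_int \<lfloor>real (Suc n) * fst z\<rfloor> / real (Suc n)) (snd z)) \<in> borel_measurable (borel \<Otimes>\<^sub>M M)" by simp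
next
  fix z :: "real \<times> 'a" assume z: "z \<in> space (borel \<Otimes>\<^sub>M M)"
  obtain t \<omega> where tz: "z = (t, \<omega>)" by (cases z)
  with z have w: "\<omega> \<in> space M" by (auto simp: space_pair_measure)
  have "(\<lambda>n. of_int \<lfloor>real (Suc n) * t\<rfloor> / real (Suc n)) \<longlonglongrightarrow> t"
  proof (rule LIMSEQ_I)
    fix r :: real assume "0 < r"
    obtain N where N: "inverse (real (Suc N)) < r" using reals_Archimedean[OF \<open>0 < r\<close>] by auto
    show "\<exists>no. \<forall>n\<ge>no. norm (of_int \<lfloor>real (Suc n) * t\<rfloor> / real (Suc n) - t) < r"
    proof (intro exI allI impI)
      fix n assume "N \<le> n"
      have "\<bar>of_int \<lfloor>real (Suc n) * t\<rfloor> - real (Suc n) * t\<bar> \<le> 1" by linarith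
      then have "\<bar>of_int \<lfloor>real (Suc n) * t\<rfloor> - real (Suc n) * t\<bar> / real (Suc n) \<le> 1 / real (Suc n)"
        by (intro divide_right_mono) auto
      moreover have "of_int \<lfloor>real (Suc n) * t\<rfloor> / real (Suc n) - t = (of_int \<lfloor>real (Suc n) * t\<rfloor> - real (Suc n) * t) / real (Suc n)"
        by (simp add: diff_divide_distrib del: of_nat_Suc)
      moreover have "1 / real (Suc n) \<le> inverse (real (Suc N))" using \<open>N \<le> n\<close> by (simp add: divide_simps)
      ultimately show "norm (of_int \<lfloor>real (Suc n) * t\<rfloor> / real (Suc n) - t) < r"
        using N by (simp add: abs_divide del: of_nat_Suc)
    qed
  qed
  then show "(\<lambda>n. Wc (of_int \<lfloor>real (Suc n) * fst z\<rfloor> / real (Suc n)) (snd z)) \<longlonglongrightarrow> case_prod Wc z"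
    using continuous_on_tendsto_compose[OF Wc_cont[OF w]] unfolding tz by (simp del: of_nat_Suc)
qed

lemma Wc_L2: "L2 M (Wc t)"
proof (rule L2_cong_AE)
  show "L2 M (\<lambda>\<omega>. W (max 0 t) \<omega> - W 0 \<omega>)" by (rule W_increment) auto
  show "AE \<omega> in M. Wc t \<omega> = W (max 0 t) \<omega> - W 0 \<omega>"
    using AE_not_in[OF bad_set(1)] W_zero by eventually_elim (auto simp: Wc_def)
qed measurable

text \<open>The value is the length of the intersection of (0, s] and (0, t], for all real s and t.
  This agreement with the inner product of indicators is the whole content of the isometry.\<close>

lemma Wc_cov: "(\<integral>\<omega>. Wc s \<omega> * Wc t \<omega> \<partial>M) = max 0 (min s t)"
proof -
  have *: "(\<integral>\<omega>. Wc s \<omega> * Wc t \<omega> \<partial>M) = s" if st: "0 \<le> s" "s \<le> t" for s t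
  proof -
    have "(\<integral>\<omega>. Wc s \<omega> * Wc t \<omega> \<partial>M) = (\<integral>\<omega>. (W s \<omega> - W 0 \<omega>)\<^sup>2 + Wc s \<omega> * (W t \<omega> - W s \<omega>) \<partial>M)"
    proof (rule integral_cong_AE)
      show "AE \<omega> in M. Wc s \<omega> * Wc t \<omega> = (W s \<omega> - W 0 \<omega>)\<^sup>2 + Wc s \<omega> * (W t \<omega> - W s \<omega>)"
        using AE_not_in[OF bad_set(1)] W_zero
        by eventually_elim (use st in \<open>auto simp: Wc_def power2_eq_square algebra_simps max_def\<close>)
    qed measurable
    also have "\<dots> = s"
      using st W_increment[of 0 s] L2_mult[OF Wc_L2 W_increment(1)[of s t], of s] Ft_orthogonal[OF Wc_adapted Wc_L2, of s s s t]
      by (subst Bochner_Integration.integral_add) (auto simp: L2_def)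
    finally show ?thesis .
  qed
  consider "s < 0 \<or> t < 0" | "0 \<le> s" "s \<le> t" | "0 \<le> t" "t \<le> s" by linarith
  then show ?thesis
  proof cases
    case 1
    then have "(\<integral>\<omega>. Wc s \<omega> * Wc t \<omega> \<partial>M) = (\<integral>\<omega>. 0 \<partial>M)"
      by (intro bochner_cong) (auto simp: Wc_neg)
    then show ?thesis using 1 by auto
  next
    case 2 then show ?thesis using * by auto
  next
    case 3 then show ?thesis using *[of t s] by (auto simp: mult.commute)
  qed
qed

end

subsection \<open>The Wiener integral\<close>

text \<open>A list of pairs $(a, d)$ encodes the step function with jumps $a$ on $(0, d]$; the isometry for such functions only needs the covariance $\min(s, t)$.\<close>

definition sf :: "(real \<times> real) list \<Rightarrow> real \<Rightarrow> real" where
  "sf l s = (\<Sum>(a, d)\<leftarrow>l. a * indicator {0<..d} s)"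

definition smul :: "real \<Rightarrow> (real \<times> real) list \<Rightarrow> (real \<times> real) list" where
  "smul c l = map (\<lambda>(a, d). (c * a, d)) l"

lemma sf_simps[simp]: "sf [] s = 0" "sf ((a, d) # l) s = a * indicator {0<..d} s + sf l s"
  "sf (l @ l') s = sf l s + sf l' s"
  by (auto simp: sf_def)

lemma sf_smul[simp]: "sf (smul c l) s = c * sf l s"
  by (induction l) (auto simp: smul_def algebra_simps)

lemma sf_measurable[measurable]: "sf l \<in> borel_measurable borel"
  unfolding sf_def[abs_def] by (induction l) auto

lemma L2_indicator_Ioc: "L2 lborel (indicator {0<..d} :: real \<Rightarrow> real)"
proof -
  have "(\<lambda>x. (indicator {0<..d} x :: real)\<^sup>2) = indicator {0<..d}"
    by (auto simp: indicator_def)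
  moreover have "integrable lborel (indicator {0<..d} :: real \<Rightarrow> real)"
    by (cases "0 \<le> d") (auto intro!: integrable_real_indicator)
  ultimately show ?thesis unfolding L2_def by (auto intro!: borel_measurable_indicator)
qed

lemma sf_L2: "L2 lborel (sf l)"
proof (induction l)
  case (Cons x l)
  obtain a d where "x = (a, d)" by (cases x)
  then show ?case using L2_add[OF L2_cmult[OF L2_indicator_Ioc[of d], of a] Cons] by simp
qed (simp add: L2_zero)

section \<open>Density of step functions\<close>

definition apx :: "(real \<Rightarrow> real) \<Rightarrow> bool" where
  "apx f \<longleftrightarrow> L2 lborel f \<and> (\<forall>\<epsilon>>0. \<exists>l. (LBINT s. (f s - sf l s)\<^sup>2) < \<epsilon>)"

lemma apx_closed:
  assumes f: "L2 lborel f" and ex: "\<And>\<epsilon>. \<epsilon> > 0 \<Longrightarrow> \<exists>g. apx g \<and> (LBINT s. (f s - g s)\<^sup>2) < \<epsilon>"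
  shows "apx f"
  unfolding apx_def
proof (intro conjI allI impI f)
  fix \<epsilon> :: real assume "\<epsilon> > 0"
  then obtain g where g: "apx g" "(LBINT s. (f s - g s)\<^sup>2) < \<epsilon> / 4" using ex[of "\<epsilon> / 4"] by auto
  then obtain l where l: "(LBINT s. (g s - sf l s)\<^sup>2) < \<epsilon> / 4" using \<open>\<epsilon> > 0\<close> unfolding apx_def by (metis divide_pos_pos zero_less_numeral)
  have "(LBINT s. ((f s - g s) + (g s - sf l s))\<^sup>2) \<le> 2 * (LBINT s. (f s - g s)\<^sup>2) + 2 * (LBINT s. (g s - sf l s)\<^sup>2)"
    using g f unfolding apx_def by (intro L2_sq_sum_le L2_diff sf_L2) auto
  with g l show "\<exists>l. (LBINT s. (f s - sf l s)\<^sup>2) < \<epsilon>" by (intro exI[of _ l]) simp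
qed

lemma apx_sf: "apx (sf l)"
  unfolding apx_def using sf_L2 by (auto intro!: exI[of _ l])

lemma apx_lincomb:
  assumes f: "apx f" and g: "apx g"
  shows "apx (\<lambda>s. f s + c * g s)"
  unfolding apx_def
proof (intro conjI allI impI)
  show "L2 lborel (\<lambda>s. f s + c * g s)" using f g unfolding apx_def by (intro L2_add L2_cmult) auto
  fix \<epsilon> :: real assume e: "\<epsilon> > 0"
  define \<eta> where "\<eta> = \<epsilon> / (4 * (1 + c\<^sup>2))"
  have c1: "0 < 1 + c\<^sup>2" by (simp add: add_pos_nonneg)
  have eta: "\<eta> > 0" "\<eta> * (1 + c\<^sup>2) = \<epsilon> / 4" unfolding \<eta>_def using e c1 by (auto simp: field_simps)
  obtain l where l: "(LBINT s. (f s - sf l s)\<^sup>2) < \<eta>" using f eta unfolding apx_def by auto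
  obtain k where k: "(LBINT s. (g s - sf k s)\<^sup>2) < \<eta>" using g eta unfolding apx_def by auto
  have "(LBINT s. ((f s - sf l s) + c * (g s - sf k s))\<^sup>2) \<le> 2 * (LBINT s. (f s - sf l s)\<^sup>2) + 2 * (LBINT s. (c * (g s - sf k s))\<^sup>2)"
    using f g unfolding apx_def by (intro L2_sq_sum_le L2_diff L2_cmult sf_L2) auto
  also have "\<dots> = 2 * (LBINT s. (f s - sf l s)\<^sup>2) + 2 * (c\<^sup>2 * (LBINT s. (g s - sf k s)\<^sup>2))"
    by (simp add: power_mult_distrib)
  also have "\<dots> \<le> 2 * \<eta> + 2 * (c\<^sup>2 * \<eta>)"
    using l k by (intro add_mono mult_left_mono) auto
  also have "\<dots> < \<epsilon>" using eta e by (simp add: algebra_simps)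
  finally show "\<exists>l. (LBINT s. (f s + c * g s - sf l s)\<^sup>2) < \<epsilon>"
    by (intro exI[of _ "l @ smul c k"]) (simp add: algebra_simps)
qed

lemma apx_sum: "finite I \<Longrightarrow> (\<And>i. i \<in> I \<Longrightarrow> apx (f i)) \<Longrightarrow> apx (\<lambda>s. \<Sum>i\<in>I. c i * f i s)"
proof (induction I rule: finite_induct)
  case empty then show ?case using apx_sf[of "[]"] by (simp add: sf_def[abs_def])
next
  case (insert i I)
  then show ?case using apx_lincomb[of "\<lambda>s. \<Sum>i\<in>I. c i * f i s" "f i" "c i"] by (simp add: add.commute)
qed

lemma apx_dominated:
  assumes g: "\<And>n. apx (g n)" and [measurable]: "f \<in> borel_measurable borel" and h: "L2 lborel h"
    and lim: "\<And>x. (\<lambda>n. g n x) \<longlonglongrightarrow> f x" and bd: "\<And>n x. \<bar>g n x\<bar> \<le> h x"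
  shows "apx f"
proof (rule apx_closed)
  have gm[measurable]: "g n \<in> borel_measurable borel" for n using g[of n] by (auto simp: apx_def L2_def)
  have fh: "\<bar>f x\<bar> \<le> h x" for x
    by (rule LIMSEQ_le_const2[OF tendsto_rabs[OF lim]]) (use bd in auto)
  show f: "L2 lborel f"
    by (rule L2_bound[OF h]) (use fh in \<open>auto intro!: AE_I2 order_trans[OF fh]\<close>)
  have "(\<lambda>n. LBINT s. (f s - g n s)\<^sup>2) \<longlonglongrightarrow> (LBINT (s::real). 0)"
  proof (rule integral_dominated_convergence[where w = "\<lambda>s. 4 * (h s)\<^sup>2"])
    show "integrable lborel (\<lambda>s. 4 * (h s)\<^sup>2)" using h by (simp add: L2_def)
    show "AE s in lborel. (\<lambda>n. (f s - g n s)\<^sup>2) \<longlonglongrightarrow> 0"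
    proof (rule AE_I2)
      fix s
      have "(\<lambda>n. (f s - g n s)\<^sup>2) \<longlonglongrightarrow> (f s - f s)\<^sup>2" by (intro tendsto_intros lim)
      then show "(\<lambda>n. (f s - g n s)\<^sup>2) \<longlonglongrightarrow> 0" by simp
    qed
    show "AE s in lborel. norm ((f s - g n s)\<^sup>2) \<le> 4 * (h s)\<^sup>2" for n
    proof (rule AE_I2)
      fix s
      have "\<bar>f s - g n s\<bar> \<le> 2 * h s" using fh[of s] bd[of n s] by linarith
      then have "\<bar>f s - g n s\<bar>\<^sup>2 \<le> (2 * h s)\<^sup>2" by (intro power_mono) auto
      then show "norm ((f s - g n s)\<^sup>2) \<le> 4 * (h s)\<^sup>2" by (simp add: power_mult_distrib)
    qed
  qed measurable
  then have lim0: "(\<lambda>n. LBINT s. (f s - g n s)\<^sup>2) \<longlonglongrightarrow> 0" by simp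
  fix \<epsilon> :: real assume "\<epsilon> > 0"
  with lim0 obtain n where "(LBINT s. (f s - g n s)\<^sup>2) < \<epsilon>"
    using order_tendstoD(2)[OF lim0 \<open>\<epsilon> > 0\<close>] by (auto simp: eventually_sequentially)
  then show "\<exists>g. apx g \<and> (LBINT s. (f s - g s)\<^sup>2) < \<epsilon>" using g by blast
qed

text \<open>Dynkin's argument started from half-lines, whose intersections with (0, T] are
  themselves step functions. The window (0, T] keeps complements square integrable and provides the
  dominating function for countable unions.\<close>

lemma apx_indicator:
  assumes A: "A \<in> sets borel"
  shows "apx (indicator (A \<inter> {0<..T}) :: real \<Rightarrow> real)"
proof -
  have AA: "A \<in> sigma_sets UNIV (range (\<lambda>a. {..a :: real}))"
    using A by (subst (asm) borel_eq_atMost) simp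
  have st: "Int_stable (range (\<lambda>a. {..a :: real}))"
  proof (rule Int_stableI)
    fix A B assume "A \<in> range (\<lambda>a. {..a :: real})" "B \<in> range (\<lambda>a. {..a :: real})"
    then obtain a b where "A = {..a}" "B = {..b}" by auto
    then have "A \<inter> B = {..min a b}" by auto
    then show "A \<inter> B \<in> range (\<lambda>a. {..a :: real})" by blast
  qed
  have cl: "range (\<lambda>a. {..a :: real}) \<subseteq> Pow UNIV" by auto
  have bm: "B \<in> sets borel" if "B \<in> sigma_sets UNIV (range (\<lambda>a. {..a :: real}))" for B
    using that by (subst borel_eq_atMost) simp
  show ?thesis
    using st cl AA
  proof (induction rule: sigma_sets_induct_disjoint[where G="range (\<lambda>a. {..a :: real})" and \<Omega> = UNIV and A = A])
    case (basic A)
    then obtain d where "A = {..d}" by auto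
    then have "indicator (A \<inter> {0<..T}) = sf [(1, min d T)]"
      by (auto simp: fun_eq_iff indicator_def)
    then show ?case by (simp only: apx_sf)
  next
    case empty then show ?case using apx_sf[of "[]"] by (simp add: sf_def[abs_def] indicator_def[abs_def])
  next
    case (compl A)
    have "indicator ((UNIV - A) \<inter> {0<..T}) = (\<lambda>s. sf [(1, T)] s + (-1) * indicator (A \<inter> {0<..T}) s :: real)"
      by (auto simp: fun_eq_iff indicator_def)
    then show ?case using apx_lincomb[OF apx_sf[of "[(1, T)]"] compl(2), of "-1"] by simp
  next
    case (union A)
    have Am: "A i \<in> sets borel" for i using union(2) bm by auto
    show ?case
    proof (rule apx_dominated[where g = "\<lambda>n. indicator ((\<Union>i<n. A i) \<inter> {0<..T})" and h = "indicator {0<..T}"])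
      fix n
      have "(indicator ((\<Union>i<n. A i) \<inter> {0<..T}) :: real \<Rightarrow> real) = (\<lambda>s. \<Sum>i<n. 1 * indicator (A i \<inter> {0<..T}) s)"
      proof
        fix s
        have "disjoint_family_on (\<lambda>i. A i \<inter> {0<..T}) {..<n}"
          using union(1) unfolding disjoint_family_on_def by blast
        then have "indicator (\<Union>i<n. A i \<inter> {0<..T}) s = (\<Sum>i<n. indicator (A i \<inter> {0<..T}) s :: real)"
          by (intro indicator_UN_disjoint) auto
        moreover have "(\<Union>i<n. A i \<inter> {0<..T}) = (\<Union>i<n. A i) \<inter> {0<..T}" by auto
        ultimately show "(indicator ((\<Union>i<n. A i) \<inter> {0<..T}) s :: real) = (\<Sum>i<n. 1 * indicator (A i \<inter> {0<..T}) s)" by simp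
      qed
      then show "apx (indicator ((\<Union>i<n. A i) \<inter> {0<..T}) :: real \<Rightarrow> real)"
        using union(3) by (simp only:) (intro apx_sum, auto)
    next
      fix x
      have "(\<lambda>n. indicator (\<Union>i<n. A i) x * indicator {0<..T} x :: real) \<longlonglongrightarrow> indicator (\<Union>i. A i) x * indicator {0<..T} x"
        by (intro tendsto_mult LIMSEQ_indicator_UN tendsto_const)
      then show "(\<lambda>n. indicator ((\<Union>i<n. A i) \<inter> {0<..T}) x :: real) \<longlonglongrightarrow> indicator ((\<Union>i. A i) \<inter> {0<..T}) x"
        by (simp add: indicator_inter_arith)
    qed (use Am in \<open>auto simp: indicator_def L2_indicator_Ioc intro!: borel_measurable_indicator\<close>)
  qed
qed

text \<open>Simple functions converging to f are cut to (0, n]. Their level sets then have the form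
  treated before, and 2|f| dominates the sequence.\<close>

lemma apx_L2:
  assumes f: "L2 lborel f" and f0: "\<And>s. s \<le> 0 \<Longrightarrow> f s = 0"
  shows "apx f"
proof -
  have [measurable]: "f \<in> borel_measurable borel" using L2_measurable[OF f] by simp
  obtain S where S: "\<And>i. simple_function lborel (S i)" "\<And>x. (\<lambda>i. S i x) \<longlonglongrightarrow> f x" "\<And>i x. norm (S i x) \<le> 2 * norm (f x)"
    using borel_measurable_implies_sequence_metric[OF L2_measurable[OF f], of 0] by (auto simp: dist_norm)
  show ?thesis
  proof (rule apx_dominated[where g = "\<lambda>n x. S n x * indicator {0<..real n} x" and h = "\<lambda>x. 2 * \<bar>f x\<bar>"])
    fix n
    have "S n x * indicator {0<..real n} x = (\<Sum>y\<in>range (S n). y * indicator (S n -` {y} \<inter> {0<..real n}) x)" for x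
    proof -
      have fin: "finite (range (S n))" using S(1)[of n] by (auto dest: simple_functionD)
      have "(\<Sum>y\<in>range (S n). y * indicator (S n -` {y} \<inter> {0<..real n}) x) = (\<Sum>y\<in>range (S n). if y = S n x then y * indicator {0<..real n} x else 0)"
        by (intro sum.cong) (auto simp: indicator_def)
      then show ?thesis using fin by (simp add: sum.delta)
    qed
    moreover have "S n -` {y} \<in> sets borel" for y using simple_functionD(2)[OF S(1)[of n], of "{y}"] by simp
    moreover have "finite (range (S n))" using S(1)[of n] by (auto dest: simple_functionD)
    ultimately show "apx (\<lambda>x. S n x * indicator {0<..real n} x)"
      by (simp only:) (intro apx_sum apx_indicator)
  next
    fix x
    show "(\<lambda>n. S n x * indicator {0<..real n} x) \<longlonglongrightarrow> f x"
    proof (cases "x \<le> 0")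
      case True then show ?thesis using f0[of x] by (simp add: indicator_def)
    next
      case False
      obtain N :: nat where N: "x \<le> real N" using real_arch_simple by blast
      have "\<forall>\<^sub>F n in sequentially. S n x = S n x * indicator {0<..real n} x"
        unfolding eventually_sequentially using N False
        by (intro exI[of _ N]) (auto simp: indicator_def)
      then show ?thesis using S(2)[of x] by (rule Lim_transform_eventually[rotated])
    qed
  next
    fix n x show "\<bar>S n x * indicator {0<..real n} x\<bar> \<le> 2 * \<bar>f x\<bar>"
      using S(3)[of n x] by (auto simp: indicator_def)
  next
    show "L2 lborel (\<lambda>x. 2 * \<bar>f x\<bar>)" by (intro L2_cmult L2_abs f)
  qed measurable
qed

lemma apx_seq_ex:
  assumes "apx f"
  shows "\<exists>l. (LBINT s. (sf l s - f s)\<^sup>2) \<le> (1/4) ^ n"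
proof -
  have "(0::real) < (1/4) ^ n" by simp
  then obtain l where "(LBINT s. (f s - sf l s)\<^sup>2) < (1/4) ^ n"
    using assms unfolding apx_def by blast
  then show ?thesis by (intro exI[of _ l]) (simp only: power2_commute[of "sf _ _"] less_imp_le)
qed

section \<open>Wiener integrals through the isometry\<close>

context bmotion begin

definition si :: "(real \<times> real) list \<Rightarrow> 'a \<Rightarrow> real" where
  "si l \<omega> = (\<Sum>(a, d)\<leftarrow>l. a * Wc d \<omega>)"

lemma si_simps[simp]: "si [] \<omega> = 0" "si ((a, d) # l) \<omega> = a * Wc d \<omega> + si l \<omega>"
  "si (l @ l') \<omega> = si l \<omega> + si l' \<omega>"
  by (auto simp: si_def)

lemma si_smul[simp]: "si (smul c l) \<omega> = c * si l \<omega>"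
  by (induction l) (auto simp: smul_def algebra_simps)

lemma si_L2: "L2 M (si l)"
proof (induction l)
  case Nil then show ?case by (simp add: si_def[abs_def] L2_zero)
next
  case (Cons x l)
  obtain a d where "x = (a, d)" by (cases x)
  then show ?case using L2_add[OF L2_cmult[OF Wc_L2[of d], of a] Cons] by simp
qed

lemma si_measurable[measurable]: "si l \<in> borel_measurable M"
  by (rule L2_measurable[OF si_L2])

lemma indicator_Ioc_prod: "(LBINT s. indicator {0<..d} s * indicator {0<..e} s) = max 0 (min d (e::real))"
proof -
  have "(\<lambda>s. indicator {0<..d} s * indicator {0<..e} s :: real) = indicator {0<..min d e}"
    by (auto simp: indicator_def)
  then show ?thesis by (cases "0 \<le> min d e") auto
qed

lemma si_isometry: "(\<integral>\<omega>. si l \<omega> * si l' \<omega> \<partial>M) = (LBINT s. sf l s * sf l' s)"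
proof (induction l)
  case (Cons x l)
  obtain a d where x: "x = (a, d)" by (cases x)
  have 1: "(\<integral>\<omega>. Wc d \<omega> * si l' \<omega> \<partial>M) = (LBINT s. indicator {0<..d} s * sf l' s)"
  proof (induction l')
    case (Cons y l')
    obtain b e where y: "y = (b, e)" by (cases y)
    have "(\<integral>\<omega>. Wc d \<omega> * si (y # l') \<omega> \<partial>M) = (\<integral>\<omega>. b * (Wc d \<omega> * Wc e \<omega>) + Wc d \<omega> * si l' \<omega> \<partial>M)"
      by (simp add: y algebra_simps)
    also have "\<dots> = b * max 0 (min d e) + (LBINT s. indicator {0<..d} s * sf l' s)"
      using L2_mult[OF Wc_L2 Wc_L2, of d e] L2_mult[OF Wc_L2 si_L2, of d l'] Cons by (simp add: Wc_cov)
    also have "\<dots> = (LBINT s. b * (indicator {0<..d} s * indicator {0<..e} s) + indicator {0<..d} s * sf l' s)"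
      using L2_mult[OF L2_indicator_Ioc L2_indicator_Ioc, of d e] L2_mult[OF L2_indicator_Ioc sf_L2, of d l']
      by (simp add: indicator_Ioc_prod)
    finally show ?case by (simp add: y algebra_simps)
  qed simp
  have "(\<integral>\<omega>. si (x # l) \<omega> * si l' \<omega> \<partial>M) = (\<integral>\<omega>. a * (Wc d \<omega> * si l' \<omega>) + si l \<omega> * si l' \<omega> \<partial>M)"
    by (simp add: x algebra_simps)
  also have "\<dots> = a * (LBINT s. indicator {0<..d} s * sf l' s) + (LBINT s. sf l s * sf l' s)"
    using L2_mult[OF Wc_L2 si_L2, of d l'] L2_mult[OF si_L2 si_L2, of l l'] Cons 1 by simp
  also have "\<dots> = (LBINT s. a * (indicator {0<..d} s * sf l' s) + sf l s * sf l' s)"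
    using L2_mult[OF L2_indicator_Ioc sf_L2, of d l'] L2_mult[OF sf_L2 sf_L2, of l l'] by simp
  finally show ?case by (simp add: x algebra_simps)
qed simp

lemma si_sq: "(\<integral>\<omega>. (si l \<omega>)\<^sup>2 \<partial>M) = (LBINT s. (sf l s)\<^sup>2)"
  using si_isometry[of l l] by (simp add: power2_eq_square)

lemma si_diff_sq: "(\<integral>\<omega>. (si l \<omega> - si l' \<omega>)\<^sup>2 \<partial>M) = (LBINT s. (sf l s - sf l' s)\<^sup>2)"
  using si_sq[of "l @ smul (-1) l'"] by simp

text \<open>Wiener integral over (0, oo). One approximating sequence is enough: by the isometry the
  limit does not depend on it. The quantification over all sequences in
  \<open>wiener_integral\<close> is recovered in \<open>is_wi_wiener_integral\<close>.\<close>

definition is_wi :: "(real \<Rightarrow> real) \<Rightarrow> ('a \<Rightarrow> real) \<Rightarrow> bool" where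
  "is_wi f Y \<longleftrightarrow> L2 lborel f \<and> L2 M Y \<and>
     (\<exists>l. (\<lambda>n. LBINT s. (sf (l n) s - f s)\<^sup>2) \<longlonglongrightarrow> 0 \<and> (\<lambda>n. \<integral>\<omega>. (si (l n) \<omega> - Y \<omega>)\<^sup>2 \<partial>M) \<longlonglongrightarrow> 0)"

lemma is_wi_L2: "is_wi f Y \<Longrightarrow> L2 lborel f" "is_wi f Y \<Longrightarrow> L2 M Y"
  by (auto simp: is_wi_def)

lemma is_wi_si: "is_wi (sf l) (si l)"
  unfolding is_wi_def using sf_L2 si_L2 by (auto intro!: exI[of _ "\<lambda>_. l"])

lemma L2_lincomb_lim:
  assumes "\<And>n. L2 N (f n)" "L2 N f'" "\<And>n. L2 N (g n)" "L2 N g'"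
    and "(\<lambda>n. \<integral>s. (f n s - f' s)\<^sup>2 \<partial>N) \<longlonglongrightarrow> 0" "(\<lambda>n. \<integral>s. (g n s - g' s)\<^sup>2 \<partial>N) \<longlonglongrightarrow> (0::real)"
  shows "(\<lambda>n. \<integral>s. ((f n s + c * g n s) - (f' s + c * g' s))\<^sup>2 \<partial>N) \<longlonglongrightarrow> 0"
proof (rule Lim_null_comparison)
  show "\<forall>\<^sub>F n in sequentially. norm (\<integral>s. ((f n s + c * g n s) - (f' s + c * g' s))\<^sup>2 \<partial>N)
     \<le> 2 * (\<integral>s. (f n s - f' s)\<^sup>2 \<partial>N) + 2 * (c\<^sup>2 * (\<integral>s. (g n s - g' s)\<^sup>2 \<partial>N))"
  proof (intro always_eventually allI)
    fix n
    have "(\<integral>s. ((f n s + c * g n s) - (f' s + c * g' s))\<^sup>2 \<partial>N) = (\<integral>s. ((f n s - f' s) + c * (g n s - g' s))\<^sup>2 \<partial>N)"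
      by (simp add: algebra_simps)
    also have "\<dots> \<le> 2 * (\<integral>s. (f n s - f' s)\<^sup>2 \<partial>N) + 2 * (\<integral>s. (c * (g n s - g' s))\<^sup>2 \<partial>N)"
      using assms by (intro L2_sq_sum_le L2_diff L2_cmult) auto
    finally show "norm (\<integral>s. ((f n s + c * g n s) - (f' s + c * g' s))\<^sup>2 \<partial>N)
       \<le> 2 * (\<integral>s. (f n s - f' s)\<^sup>2 \<partial>N) + 2 * (c\<^sup>2 * (\<integral>s. (g n s - g' s)\<^sup>2 \<partial>N))"
      by (simp add: power_mult_distrib)
  qed
  have "(\<lambda>n. 2 * (\<integral>s. (f n s - f' s)\<^sup>2 \<partial>N) + 2 * (c\<^sup>2 * (\<integral>s. (g n s - g' s)\<^sup>2 \<partial>N))) \<longlonglongrightarrow> 2 * 0 + 2 * (c\<^sup>2 * 0)"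
    by (intro tendsto_intros assms)
  then show "(\<lambda>n. 2 * (\<integral>s. (f n s - f' s)\<^sup>2 \<partial>N) + 2 * (c\<^sup>2 * (\<integral>s. (g n s - g' s)\<^sup>2 \<partial>N))) \<longlonglongrightarrow> 0" by simp
qed

lemma is_wi_lincomb:
  assumes "is_wi f Y" "is_wi g Z"
  shows "is_wi (\<lambda>s. f s + c * g s) (\<lambda>\<omega>. Y \<omega> + c * Z \<omega>)"
proof -
  obtain l where l: "(\<lambda>n. LBINT s. (sf (l n) s - f s)\<^sup>2) \<longlonglongrightarrow> 0" "(\<lambda>n. \<integral>\<omega>. (si (l n) \<omega> - Y \<omega>)\<^sup>2 \<partial>M) \<longlonglongrightarrow> 0"
    using assms unfolding is_wi_def by auto
  obtain k where k: "(\<lambda>n. LBINT s. (sf (k n) s - g s)\<^sup>2) \<longlonglongrightarrow> 0" "(\<lambda>n. \<integral>\<omega>. (si (k n) \<omega> - Z \<omega>)\<^sup>2 \<partial>M) \<longlonglongrightarrow> 0"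
    using assms unfolding is_wi_def by auto
  note i = is_wi_L2[OF assms(1)] is_wi_L2[OF assms(2)]
  show ?thesis
    unfolding is_wi_def
  proof (intro conjI exI[of _ "\<lambda>n. l n @ smul c (k n)"])
    show "(\<lambda>n. LBINT s. (sf (l n @ smul c (k n)) s - (f s + c * g s))\<^sup>2) \<longlonglongrightarrow> 0"
      using L2_lincomb_lim[OF sf_L2 i(1) sf_L2 i(3) l(1) k(1), of c] by simp
    show "(\<lambda>n. \<integral>\<omega>. (si (l n @ smul c (k n)) \<omega> - (Y \<omega> + c * Z \<omega>))\<^sup>2 \<partial>M) \<longlonglongrightarrow> 0"
      using L2_lincomb_lim[OF si_L2 i(2) si_L2 i(4) l(2) k(2), of c] by simp
  qed (auto intro!: L2_add L2_cmult i)
qed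

lemma is_wi_sq:
  assumes "is_wi f Y"
  shows "(\<integral>\<omega>. (Y \<omega>)\<^sup>2 \<partial>M) = (LBINT s. (f s)\<^sup>2)"
proof -
  obtain l where l: "(\<lambda>n. LBINT s. (sf (l n) s - f s)\<^sup>2) \<longlonglongrightarrow> 0" "(\<lambda>n. \<integral>\<omega>. (si (l n) \<omega> - Y \<omega>)\<^sup>2 \<partial>M) \<longlonglongrightarrow> 0"
    using assms unfolding is_wi_def by auto
  note i = is_wi_L2[OF assms(1)]
  have "(\<lambda>n. \<integral>\<omega>. (si (l n) \<omega>)\<^sup>2 \<partial>M) \<longlonglongrightarrow> (\<integral>\<omega>. (Y \<omega>)\<^sup>2 \<partial>M)"
    by (rule L2_tendsto_sq(2)[OF si_L2 i(2) l(2) L2_zero])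
  moreover have "(\<lambda>n. \<integral>\<omega>. (si (l n) \<omega>)\<^sup>2 \<partial>M) \<longlonglongrightarrow> (LBINT s. (f s)\<^sup>2)"
    unfolding si_sq by (rule L2_tendsto_sq(2)[OF sf_L2 i(1) l(1) L2_zero])
  ultimately show ?thesis by (rule LIMSEQ_unique)
qed

lemma is_wi_diff_sq:
  assumes "is_wi f Y" "is_wi g Z"
  shows "(\<integral>\<omega>. (Y \<omega> - Z \<omega>)\<^sup>2 \<partial>M) = (LBINT s. (f s - g s)\<^sup>2)"
  using is_wi_sq[OF is_wi_lincomb[OF assms, of "-1"]] by simp

lemma is_wi_unique:
  assumes "is_wi f Y" "is_wi g Z" "AE s in lborel. f s = g s"
  shows "AE \<omega> in M. Y \<omega> = Z \<omega>"
proof -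
  note [measurable] = L2_measurable[OF is_wi_L2(1)[OF assms(1)], simplified] L2_measurable[OF is_wi_L2(1)[OF assms(2)], simplified]
  have "(\<integral>\<omega>. (Y \<omega> - Z \<omega>)\<^sup>2 \<partial>M) = (LBINT (s::real). 0)"
    unfolding is_wi_diff_sq[OF assms(1,2)] using assms(3)
    by (intro integral_cong_AE) (auto elim: eventually_mono)
  then have "AE \<omega> in M. Y \<omega> - Z \<omega> = 0"
    using is_wi_L2[OF assms(1)] is_wi_L2[OF assms(2)] by (intro L2_sq_zero_AE L2_diff) auto
  then show ?thesis by eventually_elim simp
qed

text \<open>Produces the integral as the pointwise limit of a prescribed sequence. The rate (1/4)^n
  makes this limit exist almost surely, and measurability in whatever variables the sequence has is
  inherited.\<close>

lemma is_wi_limit: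
  assumes f: "L2 lborel f" and l: "\<And>n. (LBINT s. (sf (l n) s - f s)\<^sup>2) \<le> (1/4) ^ n"
    and Y: "Y \<in> borel_measurable M" "\<And>\<omega>. Y \<omega> = lim (\<lambda>n. si (l n) \<omega>)"
  shows "is_wi f Y"
proof -
  \<comment> \<open>Two errors of size at most (1/4)^n, each doubled by (x + y)^2 \<le> 2 x^2 + 2
    y^2, make up the factor 4.\<close>
  have c: "(\<integral>\<omega>. (si (l m) \<omega> - si (l n) \<omega>)\<^sup>2 \<partial>M) \<le> 4 * (1/4) ^ n" if "n \<le> m" for n m
  proof -
    have "(\<integral>\<omega>. (si (l m) \<omega> - si (l n) \<omega>)\<^sup>2 \<partial>M) = (LBINT s. ((sf (l m) s - f s) + (-1) * (sf (l n) s - f s))\<^sup>2)"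
      unfolding si_diff_sq by simp
    also have "\<dots> \<le> 2 * (LBINT s. (sf (l m) s - f s)\<^sup>2) + 2 * (LBINT s. ((-1) * (sf (l n) s - f s))\<^sup>2)"
      by (intro L2_sq_sum_le L2_cmult L2_diff sf_L2 f)
    also have "\<dots> \<le> 2 * (1/4) ^ m + 2 * (1/4) ^ n" using l[of m] l[of n] by (simp add: power2_commute)
    also have "\<dots> \<le> 4 * (1/4) ^ n" using power_decreasing[OF that, of "1/4::real"] by simp
    finally show ?thesis .
  qed
  note C = L2_complete[OF si_L2 c]
  have Y2: "Y = (\<lambda>\<omega>. lim (\<lambda>n. si (l n) \<omega>))" using Y by auto
  have p: "(\<lambda>n. C * (1/4::real) ^ n) \<longlonglongrightarrow> 0" for C
    by (intro tendsto_mult_right_zero LIMSEQ_power_zero) auto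
  have "(\<lambda>n. \<integral>\<omega>. (si (l n) \<omega> - Y \<omega>)\<^sup>2 \<partial>M) \<longlonglongrightarrow> 0"
    by (rule Lim_null_comparison[OF _ p[of 4]]) (use C(2) in \<open>auto simp: Y2 intro!: always_eventually\<close>)
  moreover have "(\<lambda>n. LBINT s. (sf (l n) s - f s)\<^sup>2) \<longlonglongrightarrow> 0"
    by (rule Lim_null_comparison[OF _ p[of 1]]) (use l in \<open>auto intro!: always_eventually\<close>)
  ultimately show ?thesis unfolding is_wi_def using f C(1) by (auto simp: Y2)
qed

lemma apx_seq:
  assumes "apx f"
  obtains l where "\<And>n. (LBINT s. (sf (l n) s - f s)\<^sup>2) \<le> (1/4) ^ n"
  using apx_seq_ex[OF assms] by metis

lemma is_wi_exists:
  assumes "L2 lborel f" "\<And>s. s \<le> 0 \<Longrightarrow> f s = 0"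
  shows "\<exists>Y. is_wi f Y"
proof -
  obtain l where l: "\<And>n. (LBINT s. (sf (l n) s - f s)\<^sup>2) \<le> (1/4) ^ n"
    using apx_seq[OF apx_L2[OF assms]] by blast
  have "(\<lambda>\<omega>. lim (\<lambda>n. si (l n) \<omega>)) \<in> borel_measurable M" by measurable
  then show ?thesis using is_wi_limit[OF assms(1) l] by blast
qed

text \<open>Multiplication by the indicator of (t, oo) at the level of lists: a jump on (0, d]
  becomes one on (0, max t d] minus one on (0, t]. Its integral thus consists of increments of
  \<open>Wc\<close> after t.\<close>

definition trunc :: "real \<Rightarrow> (real \<times> real) list \<Rightarrow> (real \<times> real) list" where
  "trunc t l = concat (map (\<lambda>(a, d). [(a, max t d), (- a, t)]) l)"

lemma sf_trunc: "0 \<le> t \<Longrightarrow> sf (trunc t l) s = indicator {t<..} s * sf l s"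
  by (induction l) (auto simp: trunc_def indicator_def split: if_splits)

lemma si_trunc_orthogonal:
  assumes t: "0 \<le> t" and xi: "\<xi> \<in> borel_measurable (Ft t)" "L2 M \<xi>"
  shows "(\<integral>\<omega>. \<xi> \<omega> * si (trunc t l) \<omega> \<partial>M) = 0"
proof (induction l)
  case (Cons x l)
  obtain a d where x: "x = (a, d)" by (cases x)
  have D: "L2 M (\<lambda>\<omega>. Wc (max t d) \<omega> - Wc t \<omega>)" by (intro L2_diff Wc_L2)
  have "(\<integral>\<omega>. \<xi> \<omega> * si (trunc t (x # l)) \<omega> \<partial>M) = (\<integral>\<omega>. a * (\<xi> \<omega> * (Wc (max t d) \<omega> - Wc t \<omega>)) + \<xi> \<omega> * si (trunc t l) \<omega> \<partial>M)"
    by (simp add: x trunc_def algebra_simps)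
  also have "\<dots> = a * (\<integral>\<omega>. \<xi> \<omega> * (Wc (max t d) \<omega> - Wc t \<omega>) \<partial>M)"
    using L2_mult[OF xi(2) D] L2_mult[OF xi(2) si_L2[of "trunc t l"]] Cons by simp
  also have "(\<integral>\<omega>. \<xi> \<omega> * (Wc (max t d) \<omega> - Wc t \<omega>) \<partial>M) = (\<integral>\<omega>. \<xi> \<omega> * (W (max t d) \<omega> - W t \<omega>) \<partial>M)"
  proof (rule integral_cong_AE)
    show "AE \<omega> in M. \<xi> \<omega> * (Wc (max t d) \<omega> - Wc t \<omega>) = \<xi> \<omega> * (W (max t d) \<omega> - W t \<omega>)"
      using Wc_AE[OF t] Wc_AE[OF max.coboundedI1[OF t, of d]] by eventually_elim simp
  qed (use L2_measurable[OF xi(2)] in measurable)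
  also have "\<dots> = 0" by (rule Ft_orthogonal[OF xi]) (use t in auto)
  finally show ?case by simp
qed (simp add: trunc_def)

text \<open>Since f vanishes up to t, truncating the approximating step functions at t does not
  increase the error, and every truncated integral is orthogonal to the past of t.\<close>

lemma is_wi_orthogonal:
  assumes w: "is_wi f Y" and t: "0 \<le> t" and xi: "\<xi> \<in> borel_measurable (Ft t)" "L2 M \<xi>"
    and f0: "\<And>s. s \<le> t \<Longrightarrow> f s = 0"
  shows "(\<integral>\<omega>. \<xi> \<omega> * Y \<omega> \<partial>M) = 0"
proof -
  note i = is_wi_L2[OF w]
  obtain l where l: "(\<lambda>n. LBINT s. (sf (l n) s - f s)\<^sup>2) \<longlonglongrightarrow> 0"
    using w unfolding is_wi_def by auto
  have le: "(LBINT s. (sf (trunc t (l n)) s - f s)\<^sup>2) \<le> (LBINT s. (sf (l n) s - f s)\<^sup>2)" for n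
  proof (rule integral_mono)
    fix s show "(sf (trunc t (l n)) s - f s)\<^sup>2 \<le> (sf (l n) s - f s)\<^sup>2"
      using f0[of s] by (auto simp: sf_trunc[OF t] indicator_def)
  qed (auto intro!: L2_integrable_sq L2_diff sf_L2 i)
  have lim: "(\<lambda>n. LBINT s. (sf (trunc t (l n)) s - f s)\<^sup>2) \<longlonglongrightarrow> 0"
    by (rule Lim_null_comparison[OF _ l]) (use le in \<open>auto intro!: always_eventually\<close>)
  then have "(\<lambda>n. \<integral>\<omega>. (si (trunc t (l n)) \<omega> - Y \<omega>)\<^sup>2 \<partial>M) \<longlonglongrightarrow> 0"
    by (simp only: is_wi_diff_sq[OF is_wi_si w])
  from L2_tendsto_sq(1)[OF si_L2 i(2) this xi(2)]
  have "(\<lambda>n. \<integral>\<omega>. si (trunc t (l n)) \<omega> * \<xi> \<omega> \<partial>M) \<longlonglongrightarrow> (\<integral>\<omega>. Y \<omega> * \<xi> \<omega> \<partial>M)" .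
  moreover have "(\<integral>\<omega>. si (trunc t (l n)) \<omega> * \<xi> \<omega> \<partial>M) = 0" for n
    using si_trunc_orthogonal[OF t xi, of "l n"] by (simp add: mult.commute)
  ultimately show ?thesis by (simp add: LIMSEQ_const_iff mult.commute)
qed

text \<open>Replaces the martingale representation theorem: it turns statements about $E[\xi \, I(f)]$ into deterministic Fubini arguments.\<close>

lemma riesz_density:
  assumes xi: "L2 M \<xi>"
  obtains m where "L2 lborel m" "\<And>f Y. is_wi f Y \<Longrightarrow> (\<integral>\<omega>. \<xi> \<omega> * Y \<omega> \<partial>M) = (LBINT s. f s * m s)"
proof -
  \<comment> \<open>\<open>is_wi_exists\<close> requires the integrand to vanish on (-oo, 0]. With
    the cut, the functional is defined on all of L2, as the Riesz theorem asks.\<close>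
  define cut where "cut f s = f s * indicator {0<..} s" for f :: "real \<Rightarrow> real" and s
  have cutL2: "L2 lborel (cut f)" if "L2 lborel f" for f
    using that L2_measurable[OF that] unfolding cut_def
    by (intro L2_bound[OF that]) (auto simp: indicator_def intro!: borel_measurable_times)
  define I where "I f = (SOME Y. is_wi (cut f) Y)" for f
  have I: "is_wi (cut f) (I f)" if "L2 lborel f" for f
    unfolding I_def by (rule someI_ex[OF is_wi_exists]) (auto simp: cutL2[OF that], simp add: cut_def)
  define L where "L f = (\<integral>\<omega>. \<xi> \<omega> * I f \<omega> \<partial>M)" for f
  note IL = is_wi_L2(2)[OF I]
  have add: "L (\<lambda>x. f x + c * g x) = L f + c * L g" if f: "L2 lborel f" and g: "L2 lborel g" for f g c
  proof -
    have fg: "L2 lborel (\<lambda>x. f x + c * g x)" by (intro L2_add L2_cmult f g)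
    have "AE \<omega> in M. I (\<lambda>x. f x + c * g x) \<omega> = I f \<omega> + c * I g \<omega>"
      by (rule is_wi_unique[OF I[OF fg] is_wi_lincomb[OF I[OF f] I[OF g]]]) (simp add: cut_def algebra_simps)
    then have "L (\<lambda>x. f x + c * g x) = (\<integral>\<omega>. \<xi> \<omega> * I f \<omega> + c * (\<xi> \<omega> * I g \<omega>) \<partial>M)"
      unfolding L_def using L2_measurable[OF xi] L2_measurable[OF IL[OF f]] L2_measurable[OF IL[OF g]] L2_measurable[OF IL[OF fg]]
      by (intro integral_cong_AE) (auto simp: algebra_simps elim: eventually_mono)
    then show ?thesis unfolding L_def using L2_mult[OF xi IL[OF f]] L2_mult[OF xi IL[OF g]] by simp
  qed
  have bd: "(L f)\<^sup>2 \<le> (\<integral>\<omega>. (\<xi> \<omega>)\<^sup>2 \<partial>M) * (LBINT s. (f s)\<^sup>2)" if f: "L2 lborel f" for f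
  proof -
    have "(L f)\<^sup>2 \<le> (\<integral>\<omega>. (\<xi> \<omega>)\<^sup>2 \<partial>M) * (\<integral>\<omega>. (I f \<omega>)\<^sup>2 \<partial>M)"
      unfolding L_def by (rule L2_CS[OF xi IL[OF f]])
    also have "(\<integral>\<omega>. (I f \<omega>)\<^sup>2 \<partial>M) = (LBINT s. (cut f s)\<^sup>2)" by (rule is_wi_sq[OF I[OF f]])
    also have "\<dots> \<le> (LBINT s. (f s)\<^sup>2)"
      by (rule integral_mono[OF L2_integrable_sq[OF cutL2[OF f]] L2_integrable_sq[OF f]]) (auto simp: cut_def indicator_def)
    finally show ?thesis by (simp add: mult_left_mono)
  qed
  have C0: "0 \<le> (\<integral>\<omega>. (\<xi> \<omega>)\<^sup>2 \<partial>M)" by simp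
  obtain m where m: "L2 lborel m" "\<And>f. L2 lborel f \<Longrightarrow> L f = (LBINT x. f x * m x)"
    using L2_riesz[OF C0 add bd] by blast
  show ?thesis
  proof (rule that[OF m(1)])
    fix f Y assume w: "is_wi f Y"
    note f = is_wi_L2(1)[OF w]
    obtain l where l: "(\<lambda>n. LBINT s. (sf (l n) s - f s)\<^sup>2) \<longlonglongrightarrow> 0" "(\<lambda>n. \<integral>\<omega>. (si (l n) \<omega> - Y \<omega>)\<^sup>2 \<partial>M) \<longlonglongrightarrow> 0"
      using w unfolding is_wi_def by auto
    \<comment> \<open>Step functions vanish on (-oo, 0], so cutting f only decreases the
      approximation error: an integral of f is also an integral of \<open>cut f\<close>, and the
      representation applies to it.\<close>
    have sc: "sf k s = 0" if "s \<le> 0" for k s using that by (induction k) auto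
    have le: "(LBINT s. (sf (l n) s - cut f s)\<^sup>2) \<le> (LBINT s. (sf (l n) s - f s)\<^sup>2)" for n
      by (rule integral_mono[OF L2_integrable_sq[OF L2_diff[OF sf_L2 cutL2[OF f]]] L2_integrable_sq[OF L2_diff[OF sf_L2 f]]])
         (use sc in \<open>auto simp: cut_def indicator_def\<close>)
    have "(\<lambda>n. LBINT s. (sf (l n) s - cut f s)\<^sup>2) \<longlonglongrightarrow> 0"
      by (rule Lim_null_comparison[OF _ l(1)]) (use le in \<open>auto intro!: always_eventually\<close>)
    then have "is_wi (cut f) Y" unfolding is_wi_def using cutL2[OF f] is_wi_L2(2)[OF w] l(2) by auto
    then have "AE \<omega> in M. Y \<omega> = I f \<omega>" by (rule is_wi_unique[OF _ I[OF f]]) simp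
    then have "(\<integral>\<omega>. \<xi> \<omega> * Y \<omega> \<partial>M) = L f"
      unfolding L_def using L2_measurable[OF xi] L2_measurable[OF IL[OF f]] L2_measurable[OF is_wi_L2(2)[OF w]]
      by (intro integral_cong_AE) (auto elim: eventually_mono)
    then show "(\<integral>\<omega>. \<xi> \<omega> * Y \<omega> \<partial>M) = (LBINT s. f s * m s)" using m(2)[OF f] by simp
  qed
qed

end

subsection \<open>Stochastic convolutions\<close>

definition locL2 :: "(real \<Rightarrow> real) \<Rightarrow> bool" where
  "locL2 q \<longleftrightarrow> q \<in> borel_measurable borel \<and> (\<forall>T. L2 lborel (\<lambda>s. q s * indicator {0<..T} s))"

lemma locL2_lincomb: "locL2 p \<Longrightarrow> locL2 q \<Longrightarrow> locL2 (\<lambda>s. p s + a * q s)"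
  using L2_add[OF _ L2_cmult, of lborel "\<lambda>s. p s * indicator {0<..T} s" "\<lambda>s. q s * indicator {0<..T} s" a for T]
  by (auto simp: locL2_def algebra_simps)

text \<open>The list of the time-reversed function $s \mapsto q(t - s)$ on $(0, t]$.\<close>

definition rv :: "real \<Rightarrow> (real \<times> real) list \<Rightarrow> (real \<times> real) list" where
  "rv t l = concat (map (\<lambda>(a, d). [(a, t), (- a, t - max 0 d)]) l)"

text \<open>Only almost everywhere: reflecting (0, d] gives [t - d, t), while the list encodes (t -
  d, t]. For d > t the second entry has a negative endpoint and contributes nothing.\<close>

lemma sf_rv: "0 \<le> t \<Longrightarrow> AE s in lborel. sf (rv t l) s = indicator {0<..t} s * sf l (t - s)"
proof (induction l)
  case (Cons x l)
  obtain a d where x: "x = (a, d)" by (cases x)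
  have "AE s in lborel. s \<noteq> t" "AE s in lborel. s \<noteq> t - max 0 d" by (rule AE_lborel_singleton)+
  with Cons show ?case
    by (auto simp: x rv_def indicator_def max_def elim!: eventually_elim2 AE_mp)
qed (simp add: rv_def)

text \<open>The approximating sequence is chosen for q alone, on growing windows (0, n], before any
  time t is fixed.\<close>

definition qseq :: "(real \<Rightarrow> real) \<Rightarrow> nat \<Rightarrow> (real \<times> real) list" where
  "qseq q n = (SOME l. (LBINT s. (sf l s - q s * indicator {0<..real n} s)\<^sup>2) \<le> (1/4) ^ n)"

lemma qseq:
  assumes "locL2 q"
  shows "(LBINT s. (sf (qseq q n) s - q s * indicator {0<..real n} s)\<^sup>2) \<le> (1/4) ^ n"
proof -
  have "apx (\<lambda>s. q s * indicator {0<..real n} s)"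
    using assms by (intro apx_L2) (auto simp: locL2_def)
  from apx_seq_ex[OF this, of n] show ?thesis unfolding qseq_def by (rule someI_ex)
qed

lemma L2_reflect:
  assumes f: "L2 lborel f" shows "L2 lborel (\<lambda>s. f (t - s :: real))"
    and "(LBINT s. (f (t - s))\<^sup>2) = (LBINT s. (f s)\<^sup>2)"
proof -
  have [measurable]: "f \<in> borel_measurable borel" using L2_measurable[OF f] by simp
  show "L2 lborel (\<lambda>s. f (t - s :: real))"
    using lborel_integrable_real_affine[OF L2_integrable_sq[OF f], of "-1" t] by (auto simp: L2_def)
  show "(LBINT s. (f (t - s))\<^sup>2) = (LBINT s. (f s)\<^sup>2)"
    by (subst lborel_integral_real_affine[where c="-1" and t=t, of "\<lambda>s. (f s)\<^sup>2"]) auto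
qed

lemma locL2_conv:
  assumes q: "locL2 q"
  shows "L2 lborel (\<lambda>s. indicator {0<..t} s * q (t - s))"
    and "(LBINT s. (indicator {0<..t} s * q (t - s))\<^sup>2) = (LBINT s. (q s * indicator {0<..t} s)\<^sup>2)"
proof -
  have [measurable]: "q \<in> borel_measurable borel" using q by (simp add: locL2_def)
  have L: "L2 lborel (\<lambda>s. q s * indicator {0<..t} s)" using q by (simp add: locL2_def)
  have "AE s in lborel. s \<noteq> t" "AE s in lborel. s \<noteq> 0" by (rule AE_lborel_singleton)+
  then have ae: "AE s in lborel. indicator {0<..t} s * q (t - s) = q (t - s) * indicator {0<..t} (t - s)"
    by eventually_elim (auto simp: indicator_def)
  show "L2 lborel (\<lambda>s. indicator {0<..t} s * q (t - s))"
    by (rule L2_cong_AE[OF L2_reflect(1)[OF L, of t] _ ae]) measurable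
  have "(LBINT s. (indicator {0<..t} s * q (t - s))\<^sup>2) = (LBINT s. (q (t - s) * indicator {0<..t} (t - s))\<^sup>2)"
  proof (intro integral_cong_AE)
    show "AE s in lborel. (indicator {0<..t} s * q (t - s))\<^sup>2 = (q (t - s) * indicator {0<..t} (t - s))\<^sup>2"
      using ae by eventually_elim (simp only:)
  qed measurable
  then show "(LBINT s. (indicator {0<..t} s * q (t - s))\<^sup>2) = (LBINT s. (q s * indicator {0<..t} s)\<^sup>2)"
    using L2_reflect(2)[OF L, of t] by simp
qed

lemma lim_offset: "lim (\<lambda>n. x (n + N)) = lim (x :: nat \<Rightarrow> real)"
proof -
  have "(\<lambda>n. x (n + N)) \<longlonglongrightarrow> L \<longleftrightarrow> x \<longlonglongrightarrow> L" for L
    using LIMSEQ_offset[of x N L] LIMSEQ_ignore_initial_segment[of x L N] by blast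
  then show ?thesis unfolding lim_def by simp
qed

lemma sq_diff_le: "(v - u)\<^sup>2 \<le> 2 * u\<^sup>2 + 2 * v\<^sup>2" for u v :: real
  using zero_le_power2[of "u + v"] by (simp add: power2_eq_square algebra_simps)

context bmotion begin

text \<open>The stochastic convolution of q with W at time t. Because the sequence does not depend
  on t and each approximant is a finite combination of \<open>Wc\<close> at t and at earlier times,
  the limit is jointly measurable and adapted as it stands, without passing to a
  modification.\<close>

definition Iq :: "(real \<Rightarrow> real) \<Rightarrow> real \<Rightarrow> 'a \<Rightarrow> real" where
  "Iq q t \<omega> = lim (\<lambda>n. si (rv t (qseq q n)) \<omega>)"

lemma Iq_measurable[measurable]: "Iq q t \<in> borel_measurable M"
  unfolding Iq_def[abs_def] by measurable

lemma Iq_wi: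
  assumes q: "locL2 q" and t: "0 \<le> t"
  shows "is_wi (\<lambda>s. indicator {0<..t} s * q (t - s)) (Iq q t)"
proof -
  have [measurable]: "q \<in> borel_measurable borel" using q by (simp add: locL2_def)
  obtain N :: nat where N: "t \<le> real N" using real_arch_simple by blast
  show ?thesis
  \<comment> \<open>Dropping the first N terms does not change the limit and makes the window (0, n
    + N] contain (0, t].\<close>
  proof (rule is_wi_limit[where l = "\<lambda>n. rv t (qseq q (n + N))"])
    show "L2 lborel (\<lambda>s. indicator {0<..t} s * q (t - s))" by (rule locL2_conv[OF q])
  next
    fix n
    let ?k = "n + N"
    let ?e = "\<lambda>s. sf (qseq q ?k) s - q s * indicator {0<..real ?k} s"
    have L: "L2 lborel (\<lambda>s. ?e (t - s))"
      using q by (intro L2_reflect(1)[of ?e] L2_diff sf_L2) (auto simp: locL2_def)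
    have "(LBINT s. (sf (rv t (qseq q ?k)) s - indicator {0<..t} s * q (t - s))\<^sup>2)
      \<le> (LBINT s. (?e (t - s))\<^sup>2)"
    proof (rule integral_mono_AE)
      show "integrable lborel (\<lambda>s. (?e (t - s))\<^sup>2)" by (rule L2_integrable_sq[OF L])
      show "integrable lborel (\<lambda>s. (sf (rv t (qseq q ?k)) s - indicator {0<..t} s * q (t - s))\<^sup>2)"
        by (intro L2_integrable_sq L2_diff sf_L2 locL2_conv q)
      have "AE s in lborel. s \<noteq> t" by (rule AE_lborel_singleton)
      with sf_rv[OF t, of "qseq q ?k"]
      show "AE s in lborel. (sf (rv t (qseq q ?k)) s - indicator {0<..t} s * q (t - s))\<^sup>2 \<le> (?e (t - s))\<^sup>2"
        by eventually_elim (use N in \<open>auto simp: indicator_def\<close>)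
    qed
    also have "\<dots> = (LBINT s. (?e s)\<^sup>2)"
      using q by (intro L2_reflect(2)[of ?e] L2_diff sf_L2) (auto simp: locL2_def)
    also have "\<dots> \<le> (1/4) ^ ?k" by (rule qseq[OF q])
    also have "\<dots> \<le> (1/4) ^ n" by (intro power_decreasing) auto
    finally show "(LBINT s. (sf (rv t (qseq q ?k)) s - indicator {0<..t} s * q (t - s))\<^sup>2) \<le> (1/4) ^ n" .
  next
    fix \<omega> show "Iq q t \<omega> = lim (\<lambda>n. si (rv t (qseq q (n + N))) \<omega>)"
      unfolding Iq_def by (rule lim_offset[symmetric])
  qed measurable
qed

lemma Iq_L2: "locL2 q \<Longrightarrow> 0 \<le> t \<Longrightarrow> L2 M (Iq q t)"
  by (rule is_wi_L2(2)[OF Iq_wi])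

lemma Iq_sq:
  "locL2 q \<Longrightarrow> 0 \<le> t \<Longrightarrow> (\<integral>\<omega>. (Iq q t \<omega>)\<^sup>2 \<partial>M) = (LBINT s. (q s * indicator {0<..t} s)\<^sup>2)"
  using is_wi_sq[OF Iq_wi] locL2_conv(2) by metis

lemma si_rv_joint: "(\<lambda>z. si (rv (fst z) l) (snd z)) \<in> borel_measurable (borel \<Otimes>\<^sub>M M)"
proof (induction l)
  case (Cons x l)
  obtain a d where x: "x = (a, d)" by (cases x)
  have m: "(\<lambda>z. Wc (fst z - c) (snd z)) \<in> borel_measurable (borel \<Otimes>\<^sub>M M)" for c
    using measurable_compose[OF measurable_Pair[of "\<lambda>z. fst z - c" "borel \<Otimes>\<^sub>M M" borel snd M] Wc_joint] by simp
  have "(\<lambda>z. si (rv (fst z) (x # l)) (snd z)) = (\<lambda>z. a * Wc (fst z - 0) (snd z) + (- a) * Wc (fst z - max 0 d) (snd z) + si (rv (fst z) l) (snd z))"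
    by (simp add: x rv_def fun_eq_iff)
  then show ?case using m[of 0] m[of "max 0 d"] Cons by simp
qed (simp add: rv_def)

lemma Iq_joint: "case_prod (Iq q) \<in> borel_measurable (borel \<Otimes>\<^sub>M M)"
  unfolding Iq_def[abs_def] case_prod_beta
  by (intro borel_measurable_lim_metric si_rv_joint)

lemma Iq_adapted: assumes "0 \<le> t" shows "Iq q t \<in> borel_measurable (Ft t)"
proof -
  have "si (rv t l) \<in> borel_measurable (Ft t)" for l
  proof (induction l)
    case Nil then show ?case by (simp add: rv_def si_def[abs_def])
  next
    case (Cons x l)
    obtain a d where x: "x = (a, d)" by (cases x)
    have "si (rv t (x # l)) = (\<lambda>\<omega>. a * Wc t \<omega> + (- a) * Wc (t - max 0 d) \<omega> + si (rv t l) \<omega>)"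
      by (simp add: x rv_def fun_eq_iff)
    then show ?case using Wc_adapted[OF assms, of t] Wc_adapted[OF assms, of "t - max 0 d"] Cons by simp
  qed
  then show ?thesis unfolding Iq_def[abs_def] by (intro borel_measurable_lim_metric)
qed

section \<open>Agreement with the Wiener integral of the state equation\<close>

definition plist :: "nat \<Rightarrow> (nat \<Rightarrow> real) \<Rightarrow> (nat \<Rightarrow> real) \<Rightarrow> (real \<times> real) list" where
  "plist n p a = concat (map (\<lambda>i. [(a i, p (Suc i)), (- a i, p i)]) [0..<n])"

lemma sf_plist: "partition_of T n p \<Longrightarrow> sf (plist n p a) s = step_fun n p a s"
proof (induction n)
  case (Suc n)
  then have p: "partition_of T n p" "0 \<le> p n" "p n \<le> p (Suc n)" by (auto simp: partition_of_def)
  then have "sf (plist (Suc n) p a) s = step_fun n p a s + a n * (indicator {0<..p (Suc n)} s - indicator {0<..p n} s)"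
    using Suc(1) by (simp add: plist_def algebra_simps)
  also have "indicator {0<..p (Suc n)} s - indicator {0<..p n} s = (indicator {p n<..p (Suc n)} s :: real)"
    using p by (auto simp: indicator_def)
  finally show ?case by (simp add: step_fun_def)
qed (simp add: plist_def step_fun_def)

lemma si_plist:
  assumes "partition_of T n p"
  shows "AE \<omega> in M. si (plist n p a) \<omega> = step_integral W n p a \<omega>"
  using AE_not_in[OF bad_set(1)]
proof eventually_elim
  case (elim \<omega>)
  show ?case using assms
  proof (induction n)
    case (Suc n)
    then have p: "partition_of T n p" "0 \<le> p n" "0 \<le> p (Suc n)" by (auto simp: partition_of_def)
    have "si (plist (Suc n) p a) \<omega> = step_integral W n p a \<omega> + a n * (Wc (p (Suc n)) \<omega> - Wc (p n) \<omega>)"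
      using Suc(1)[OF p(1)] by (simp add: plist_def algebra_simps)
    then show ?case using p elim by (simp add: step_integral_def Wc_def max_def)
  qed (simp add: plist_def step_integral_def)
qed

text \<open>For each single step function, the error of its integral equals its own L2 error, by the
  isometry. Convergence along an arbitrary approximating sequence is then the same statement on both
  sides.\<close>

lemma is_wi_wiener_integral:
  assumes w: "is_wi f Y" and T: "0 \<le> T" and ae: "AE s in lborel. f s = indicator {0..T} s * g s"
    and [measurable]: "g \<in> borel_measurable borel"
  shows "wiener_integral M W T g Y"
proof -
  note f = is_wi_L2(1)[OF w] and Y = is_wi_L2(2)[OF w]
  have [measurable]: "f \<in> borel_measurable borel" "Y \<in> borel_measurable M"
    using L2_measurable[OF f] L2_measurable[OF Y] by auto
  have key: "(\<integral>\<^sup>+\<omega>. ennreal ((step_integral W n p a \<omega> - Y \<omega>)\<^sup>2) \<partial>M)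
     = (\<integral>\<^sup>+s\<in>{0..T}. ennreal ((g s - step_fun n p a s)\<^sup>2) \<partial>lborel)" if p: "partition_of T n p" for n p a
  proof -
    have z: "sf (plist n p a) s = 0" if "s \<notin> {0..T}" for s
    proof -
      have "step_fun n p a s = (\<Sum>i<n. 0)"
        unfolding step_fun_def
      proof (intro sum.cong refl)
        fix i assume i: "i \<in> {..<n}"
        then have "0 \<le> p i" "p (Suc i) \<le> T" using p unfolding partition_of_def by auto
        then show "a i * indicator {p i<..p (Suc i)} s = 0" using that by (auto simp: indicator_def)
      qed
      then show ?thesis using sf_plist[OF p] by simp
    qed
    have "(\<integral>\<^sup>+\<omega>. ennreal ((step_integral W n p a \<omega> - Y \<omega>)\<^sup>2) \<partial>M) = (\<integral>\<^sup>+\<omega>. ennreal ((si (plist n p a) \<omega> - Y \<omega>)\<^sup>2) \<partial>M)"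
      using si_plist[OF p, of a] by (intro nn_integral_cong_AE) (auto elim: eventually_mono)
    also have "\<dots> = ennreal (\<integral>\<omega>. (si (plist n p a) \<omega> - Y \<omega>)\<^sup>2 \<partial>M)"
      by (rule L2_nn_eq[OF L2_diff[OF si_L2 Y]])
    also have "\<dots> = ennreal (LBINT s. (sf (plist n p a) s - f s)\<^sup>2)"
      by (simp only: is_wi_diff_sq[OF is_wi_si w])
    also have "\<dots> = (NL s. ennreal ((sf (plist n p a) s - f s)\<^sup>2))"
      by (rule L2_nn_eq[OF L2_diff[OF sf_L2 f], symmetric])
    also have "\<dots> = (\<integral>\<^sup>+s\<in>{0..T}. ennreal ((g s - step_fun n p a s)\<^sup>2) \<partial>lborel)"
      using ae
    proof (intro nn_integral_cong_AE, eventually_elim)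
      case (elim s)
      then show ?case using z[of s] sf_plist[OF p, of a s] by (cases "s \<in> {0..T}") (auto simp: power2_commute)
    qed
    finally show ?thesis .
  qed
  have "(\<integral>\<^sup>+s\<in>{0..T}. ennreal ((g s)\<^sup>2) \<partial>lborel) = (NL s. ennreal ((f s)\<^sup>2))"
    using ae by (intro nn_integral_cong_AE) (auto simp: indicator_def elim: eventually_mono)
  also have "\<dots> < \<infinity>" using f by (simp add: L2_iff_nn)
  finally show ?thesis
    unfolding wiener_integral_def set_borel_measurable_def using key by auto
qed

text \<open>Two integrals are compared along a common sequence. \<open>wiener_integral\<close> only
  says what happens if a step sequence approximates g, so the existence of one is a hypothesis
  here.\<close>

lemma wiener_integral_unique:
  assumes w: "wiener_integral M W T g Y" "wiener_integral M W T g Z"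
    and p: "\<And>k. partition_of T (n k) (p k)"
    and lim: "(\<lambda>k. \<integral>\<^sup>+s\<in>{0..T}. ennreal ((g s - step_fun (n k) (p k) (a k) s)\<^sup>2) \<partial>lborel) \<longlonglongrightarrow> 0"
  shows "AE \<omega> in M. Y \<omega> = Z \<omega>"
proof -
  have [measurable]: "Y \<in> borel_measurable M" "Z \<in> borel_measurable M" using w by (auto simp: wiener_integral_def)
  define S where "S k = step_integral W (n k) (p k) (a k)" for k
  have [measurable]: "S k \<in> borel_measurable M" for k
    unfolding S_def step_integral_def[abs_def] by measurable
  have y: "(\<lambda>k. \<integral>\<^sup>+\<omega>. ennreal ((S k \<omega> - Y \<omega>)\<^sup>2) \<partial>M) \<longlonglongrightarrow> 0"
    using w(1) p lim unfolding wiener_integral_def S_def by blast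
  have z: "(\<lambda>k. \<integral>\<^sup>+\<omega>. ennreal ((S k \<omega> - Z \<omega>)\<^sup>2) \<partial>M) \<longlonglongrightarrow> 0"
    using w(2) p lim unfolding wiener_integral_def S_def by blast
  have le: "(\<integral>\<^sup>+\<omega>. ennreal ((Y \<omega> - Z \<omega>)\<^sup>2) \<partial>M)
     \<le> 2 * (\<integral>\<^sup>+\<omega>. ennreal ((S k \<omega> - Y \<omega>)\<^sup>2) \<partial>M) + 2 * (\<integral>\<^sup>+\<omega>. ennreal ((S k \<omega> - Z \<omega>)\<^sup>2) \<partial>M)" for k
  proof -
    have "(\<integral>\<^sup>+\<omega>. ennreal ((Y \<omega> - Z \<omega>)\<^sup>2) \<partial>M) \<le> (\<integral>\<^sup>+\<omega>. 2 * ennreal ((S k \<omega> - Y \<omega>)\<^sup>2) + 2 * ennreal ((S k \<omega> - Z \<omega>)\<^sup>2) \<partial>M)"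
    proof (intro nn_integral_mono)
      fix \<omega>
      let ?u = "S k \<omega> - Y \<omega>" and ?v = "S k \<omega> - Z \<omega>"
      have "(Y \<omega> - Z \<omega>)\<^sup>2 = (?v - ?u)\<^sup>2" by simp
      also have "\<dots> \<le> 2 * ?u\<^sup>2 + 2 * ?v\<^sup>2" by (rule sq_diff_le)
      finally have "ennreal ((Y \<omega> - Z \<omega>)\<^sup>2) \<le> ennreal (2 * ?u\<^sup>2 + 2 * ?v\<^sup>2)" by (rule ennreal_leI)
      then show "ennreal ((Y \<omega> - Z \<omega>)\<^sup>2) \<le> 2 * ennreal (?u\<^sup>2) + 2 * ennreal (?v\<^sup>2)"
        by (simp add: ennreal_mult)
    qed
    also have "\<dots> = 2 * (\<integral>\<^sup>+\<omega>. ennreal ((S k \<omega> - Y \<omega>)\<^sup>2) \<partial>M) + 2 * (\<integral>\<^sup>+\<omega>. ennreal ((S k \<omega> - Z \<omega>)\<^sup>2) \<partial>M)"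
      by (simp add: nn_integral_add nn_integral_cmult)
    finally show ?thesis .
  qed
  have "(\<lambda>k. 2 * (\<integral>\<^sup>+\<omega>. ennreal ((S k \<omega> - Y \<omega>)\<^sup>2) \<partial>M) + 2 * (\<integral>\<^sup>+\<omega>. ennreal ((S k \<omega> - Z \<omega>)\<^sup>2) \<partial>M)) \<longlonglongrightarrow> 2 * 0 + 2 * 0"
    by (intro tendsto_add ennreal_tendsto_cmult y z) auto
  then have "(\<integral>\<^sup>+\<omega>. ennreal ((Y \<omega> - Z \<omega>)\<^sup>2) \<partial>M) \<le> 2 * 0 + 2 * 0"
    by (rule LIMSEQ_le_const) (use le in auto)
  then have "(\<integral>\<^sup>+\<omega>. ennreal ((Y \<omega> - Z \<omega>)\<^sup>2) \<partial>M) = 0" by simp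
  then have "AE \<omega> in M. ennreal ((Y \<omega> - Z \<omega>)\<^sup>2) = 0" by (subst (asm) nn_integral_0_iff_AE) auto
  then show ?thesis by eventually_elim simp
qed

end

context bmotion begin

lemma Iq_compose:
  assumes "f \<in> borel_measurable N" "g \<in> measurable N M"
  shows "(\<lambda>x. Iq q (f x) (g x)) \<in> borel_measurable N"
  using measurable_compose[OF measurable_Pair[OF assms] Iq_joint] by simp

text \<open>The integrand is split at s, and the part after s is orthogonal to the past of s. In
  effect this is the rule that conditioning I(q)(t) on the past of s stops the integral at
  s.\<close>

lemma Iq_riesz:
  assumes q: "locL2 q" and st: "0 \<le> s" "s \<le> t" and xi: "\<xi> \<in> borel_measurable (Ft s)" "L2 M \<xi>"
    and m: "\<And>f Y. is_wi f Y \<Longrightarrow> (\<integral>\<omega>. \<xi> \<omega> * Y \<omega> \<partial>M) = (LBINT s. f s * m s)"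
  shows "(\<integral>\<omega>. \<xi> \<omega> * Iq q t \<omega> \<partial>M) = (LBINT \<theta>. indicator {0<..s} \<theta> * q (t - \<theta>) * m \<theta>)"
proof -
  have [measurable]: "q \<in> borel_measurable borel" using q by (simp add: locL2_def)
  have t: "0 \<le> t" using st by auto
  note L = locL2_conv(1)[OF q, of t]
  define f1 where "f1 \<theta> = indicator {0<..s} \<theta> * q (t - \<theta>)" for \<theta>
  define f2 where "f2 \<theta> = indicator {s<..t} \<theta> * q (t - \<theta>)" for \<theta>
  have L1: "L2 lborel f1" unfolding f1_def
    by (rule L2_bound[OF L]) (use st in \<open>auto simp: indicator_def\<close>)
  have L2: "L2 lborel f2" unfolding f2_def
    by (rule L2_bound[OF L]) (use st in \<open>auto simp: indicator_def\<close>)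
  obtain Y1 where Y1: "is_wi f1 Y1" using is_wi_exists[OF L1] by (auto simp: f1_def)
  obtain Y2 where Y2: "is_wi f2 Y2" using is_wi_exists[OF L2] st by (auto simp: f2_def)
  note [measurable] = L2_measurable[OF is_wi_L2(2)[OF Y1]] L2_measurable[OF is_wi_L2(2)[OF Y2]] L2_measurable[OF xi(2)]
  have "AE \<omega> in M. Iq q t \<omega> = Y1 \<omega> + 1 * Y2 \<omega>"
    by (rule is_wi_unique[OF Iq_wi[OF q t] is_wi_lincomb[OF Y1 Y2]])
       (use st in \<open>auto simp: f1_def f2_def indicator_def\<close>)
  then have "(\<integral>\<omega>. \<xi> \<omega> * Iq q t \<omega> \<partial>M) = (\<integral>\<omega>. \<xi> \<omega> * Y1 \<omega> + \<xi> \<omega> * Y2 \<omega> \<partial>M)"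
    by (intro integral_cong_AE) (auto simp: algebra_simps elim: eventually_mono)
  also have "\<dots> = (\<integral>\<omega>. \<xi> \<omega> * Y1 \<omega> \<partial>M) + (\<integral>\<omega>. \<xi> \<omega> * Y2 \<omega> \<partial>M)"
    by (intro Bochner_Integration.integral_add L2_mult xi is_wi_L2(2)[OF Y1] is_wi_L2(2)[OF Y2])
  also have "(\<integral>\<omega>. \<xi> \<omega> * Y2 \<omega> \<partial>M) = 0"
    by (rule is_wi_orthogonal[OF Y2 st(1) xi]) (auto simp: f2_def)
  finally show ?thesis using m[OF Y1] by (simp add: f1_def)
qed

lemma abs_le_one_plus_sq: "\<bar>x\<bar> \<le> 1 + x\<^sup>2" for x :: real
proof -
  have "2 * (\<bar>x\<bar> * 1) \<le> 1 + x\<^sup>2" using sum_squares_bound[of "\<bar>x\<bar>" 1] by simp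
  moreover have "\<bar>x\<bar> \<ge> 0" by simp
  ultimately show ?thesis by linarith
qed

lemma Iq_abs_bound:
  assumes h: "locL2 h" and s: "0 \<le> s" "s \<le> t"
  shows "(\<integral>\<^sup>+\<omega>. ennreal \<bar>Iq h s \<omega>\<bar> \<partial>M) \<le> ennreal (1 + (LBINT s. (h s * indicator {0<..t} s)\<^sup>2))"
proof -
  have [measurable]: "h \<in> borel_measurable borel" using h by (simp add: locL2_def)
  have "(\<integral>\<^sup>+\<omega>. ennreal \<bar>Iq h s \<omega>\<bar> \<partial>M) \<le> (\<integral>\<^sup>+\<omega>. ennreal (1 + (Iq h s \<omega>)\<^sup>2) \<partial>M)"
    by (intro nn_integral_mono ennreal_leI abs_le_one_plus_sq)
  also have "\<dots> = ennreal (\<integral>\<omega>. 1 + (Iq h s \<omega>)\<^sup>2 \<partial>M)"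
    using L2_integrable_sq[OF Iq_L2[OF h s(1)]] by (intro nn_integral_eq_integral) auto
  also have "(\<integral>\<omega>. 1 + (Iq h s \<omega>)\<^sup>2 \<partial>M) = 1 + (LBINT r. (h r * indicator {0<..s} r)\<^sup>2)"
    using L2_integrable_sq[OF Iq_L2[OF h s(1)]] Iq_sq[OF h s(1)] by (simp add: prob_space)
  also have "(LBINT r. (h r * indicator {0<..s} r)\<^sup>2) \<le> (LBINT r. (h r * indicator {0<..t} r)\<^sup>2)"
    using h s by (intro integral_mono L2_integrable_sq) (auto simp: locL2_def indicator_def simp del: of_bool_def)
  finally show ?thesis by (simp add: ennreal_leI)
qed

text \<open>Both sides are tested against the sign of their difference.\<close>

lemma stochastic_fubini:
  assumes h: "locL2 h" and h0: "\<And>s. s < 0 \<Longrightarrow> h s = 0" and f[measurable]: "f \<in> borel_measurable borel"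
    and f0: "\<And>s. s \<le> 0 \<Longrightarrow> f s = 0" and fi: "integrable lborel (\<lambda>s. f s * indicator {0<..t} s)"
    and K: "locL2 K" "\<And>\<tau>. 0 \<le> \<tau> \<Longrightarrow> K \<tau> = (LBINT s. f (\<tau> - s) * h s)" and t: "0 \<le> t"
  shows "AE \<omega> in M. integrable lborel (\<lambda>s. indicator {0..t} s * (f (t - s) * Iq h s \<omega>))"
    and "AE \<omega> in M. Iq K t \<omega> = (LBINT s. indicator {0..t} s * (f (t - s) * Iq h s \<omega>))"
proof -
  have [measurable]: "h \<in> borel_measurable borel" "K \<in> borel_measurable borel" using h K by (auto simp: locL2_def)
  note [measurable] = Iq_compose
  interpret P: pair_sigma_finite lborel M ..
  interpret Q: pair_sigma_finite M lborel ..
  define H where "H = (LBINT s. (h s * indicator {0<..t} s)\<^sup>2)"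
  have H0: "0 \<le> H" unfolding H_def by simp
  have nf: "(NL s. ennreal (indicator {0..t} s * \<bar>f (t - s)\<bar>)) < \<infinity>"
  proof -
    have "(NL s. ennreal (indicator {0..t} s * \<bar>f (t - s)\<bar>)) = (NL s. ennreal \<bar>f (t + (-1) * s) * indicator {0<..t} (t + (-1) * s)\<bar>)"
      using f0 by (intro nn_integral_cong) (auto simp: indicator_def)
    also have "\<dots> = (NL s. ennreal \<bar>f s * indicator {0<..t} s\<bar>)"
      by (subst nn_integral_real_affine[where c="-1" and t=t, of "\<lambda>s. ennreal \<bar>f s * indicator {0<..t} s\<bar>"]) auto
    also have "\<dots> < \<infinity>" using fi by (simp add: integrable_iff_bounded)
    finally show ?thesis .
  qed
  have fin: "(NL s. \<integral>\<^sup>+\<omega>. ennreal \<bar>x \<omega> * (indicator {0..t} s * (f (t - s) * Iq h s \<omega>))\<bar> \<partial>M) < \<infinity>"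
    if [measurable]: "x \<in> borel_measurable M" and x: "\<And>\<omega>. \<bar>x \<omega>\<bar> \<le> 1" for x
  proof -
    have "(NL s. \<integral>\<^sup>+\<omega>. ennreal \<bar>x \<omega> * (indicator {0..t} s * (f (t - s) * Iq h s \<omega>))\<bar> \<partial>M)
      \<le> (NL s. ennreal (indicator {0..t} s * \<bar>f (t - s)\<bar>) * ennreal (1 + H))"
    proof (intro nn_integral_mono)
      fix s
      have "(\<integral>\<^sup>+\<omega>. ennreal \<bar>x \<omega> * (indicator {0..t} s * (f (t - s) * Iq h s \<omega>))\<bar> \<partial>M)
        \<le> (\<integral>\<^sup>+\<omega>. ennreal (indicator {0..t} s * \<bar>f (t - s)\<bar>) * ennreal \<bar>Iq h s \<omega>\<bar> \<partial>M)"
      proof (intro nn_integral_mono)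
        fix \<omega>
        have "\<bar>x \<omega>\<bar> * (indicator {0..t} s * \<bar>f (t - s)\<bar> * \<bar>Iq h s \<omega>\<bar>) \<le> 1 * (indicator {0..t} s * \<bar>f (t - s)\<bar> * \<bar>Iq h s \<omega>\<bar>)"
          by (intro mult_right_mono x) auto
        then show "ennreal \<bar>x \<omega> * (indicator {0..t} s * (f (t - s) * Iq h s \<omega>))\<bar> \<le> ennreal (indicator {0..t} s * \<bar>f (t - s)\<bar>) * ennreal \<bar>Iq h s \<omega>\<bar>"
          by (subst ennreal_mult[symmetric]) (auto simp: abs_mult mult.assoc intro!: ennreal_leI)
      qed
      also have "\<dots> = ennreal (indicator {0..t} s * \<bar>f (t - s)\<bar>) * (\<integral>\<^sup>+\<omega>. ennreal \<bar>Iq h s \<omega>\<bar> \<partial>M)"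
        by (rule nn_integral_cmult) measurable
      also have "\<dots> \<le> ennreal (indicator {0..t} s * \<bar>f (t - s)\<bar>) * ennreal (1 + H)"
      proof (cases "s \<in> {0..t}")
        case True then show ?thesis unfolding H_def by (intro mult_left_mono Iq_abs_bound h) auto
      qed simp
      finally show "(\<integral>\<^sup>+\<omega>. ennreal \<bar>x \<omega> * (indicator {0..t} s * (f (t - s) * Iq h s \<omega>))\<bar> \<partial>M) \<le> ennreal (indicator {0..t} s * \<bar>f (t - s)\<bar>) * ennreal (1 + H)" .
    qed
    also have "\<dots> = (NL s. ennreal (indicator {0..t} s * \<bar>f (t - s)\<bar>)) * ennreal (1 + H)"
      by (rule nn_integral_multc) measurable
    also have "\<dots> < \<infinity>" using nf by (simp add: ennreal_mult_less_top)
    finally show ?thesis .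
  qed
  have mF: "(\<lambda>(s, \<omega>). x \<omega> * (indicator {0..t} s * (f (t - s) * Iq h s \<omega>))) \<in> borel_measurable (lborel \<Otimes>\<^sub>M M)"
    if [measurable]: "x \<in> borel_measurable M" for x unfolding case_prod_beta by measurable
  have i1: "integrable (lborel \<Otimes>\<^sub>M M) (\<lambda>(s, \<omega>). 1 * (indicator {0..t} s * (f (t - s) * Iq h s \<omega>)))"
    by (rule P.fubini_abs(1)[OF mF fin]) auto
  have i2: "integrable (M \<Otimes>\<^sub>M lborel) (\<lambda>(\<omega>, s). indicator {0..t} s * (f (t - s) * Iq h s \<omega>))"
    using P.integrable_product_swap[OF i1] by simp
  show "AE \<omega> in M. integrable lborel (\<lambda>s. indicator {0..t} s * (f (t - s) * Iq h s \<omega>))"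
    using Q.AE_integrable_fst'[OF i2] by simp
  define Z where "Z \<omega> = (LBINT s. indicator {0..t} s * (f (t - s) * Iq h s \<omega>))" for \<omega>
  have Zi: "integrable M Z" unfolding Z_def using Q.integrable_fst'[OF i2] by simp
  then have [measurable]: "Z \<in> borel_measurable M" by simp
  define D where "D \<omega> = Iq K t \<omega> - Z \<omega>" for \<omega>
  have Di: "integrable M D" unfolding D_def using L2_integrable[OF Iq_L2[OF K(1) t]] Zi by auto
  have [measurable]: "D \<in> borel_measurable M" unfolding D_def by measurable
  define \<xi> where "\<xi> \<omega> = sgn (D \<omega>)" for \<omega>
  have [measurable]: "\<xi> \<in> borel_measurable M" unfolding \<xi>_def by measurable
  have x1: "\<bar>\<xi> \<omega>\<bar> \<le> 1" for \<omega> unfolding \<xi>_def by (auto simp: sgn_if)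
  have xL: "L2 M \<xi>"
    by (rule L2_bound[of M "\<lambda>_. 1"]) (use x1 in \<open>auto simp: L2_def\<close>)
  obtain m where m: "L2 lborel m" "\<And>f Y. is_wi f Y \<Longrightarrow> (\<integral>\<omega>. \<xi> \<omega> * Y \<omega> \<partial>M) = (LBINT s. f s * m s)"
    using riesz_density[OF xL] by metis
  have [measurable]: "m \<in> borel_measurable borel" using L2_measurable[OF m(1)] by simp
  have e1: "(\<integral>\<omega>. \<xi> \<omega> * Iq h s \<omega> \<partial>M) = (LBINT \<theta>. indicator {0<..s} \<theta> * h (s - \<theta>) * m \<theta>)" if "0 \<le> s" for s
    using m(2)[OF Iq_wi[OF h that]] .
  \<comment> \<open>The inner integral is bounded uniformly for s in [0, t] by the squared norms of
    h on (0, t] and of m; the outer one then uses integrability of f on (0, t].\<close>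
  have finG: "(NL s. NL \<theta>. ennreal \<bar>indicator {0..t} s * f (t - s) * (indicator {0<..s} \<theta> * h (s - \<theta>) * m \<theta>)\<bar>) < \<infinity>"
  proof -
    let ?B = "H + (LBINT s. (m s)\<^sup>2)"
    have "(NL s. NL \<theta>. ennreal \<bar>indicator {0..t} s * f (t - s) * (indicator {0<..s} \<theta> * h (s - \<theta>) * m \<theta>)\<bar>)
      \<le> (NL s. ennreal (indicator {0..t} s * \<bar>f (t - s)\<bar>) * ennreal ?B)"
    proof (intro nn_integral_mono)
      fix s
      have "(NL \<theta>. ennreal \<bar>indicator {0..t} s * f (t - s) * (indicator {0<..s} \<theta> * h (s - \<theta>) * m \<theta>)\<bar>)
        = (NL \<theta>. ennreal (indicator {0..t} s * \<bar>f (t - s)\<bar>) * ennreal \<bar>indicator {0<..s} \<theta> * h (s - \<theta>) * m \<theta>\<bar>)"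
        by (intro nn_integral_cong) (subst ennreal_mult[symmetric], auto simp: abs_mult)
      also have "\<dots> = ennreal (indicator {0..t} s * \<bar>f (t - s)\<bar>) * (NL \<theta>. ennreal \<bar>indicator {0<..s} \<theta> * h (s - \<theta>) * m \<theta>\<bar>)"
        by (rule nn_integral_cmult) measurable
      also have "\<dots> \<le> ennreal (indicator {0..t} s * \<bar>f (t - s)\<bar>) * ennreal ?B"
      proof (cases "s \<in> {0..t}")
        case True
        have "(NL \<theta>. ennreal \<bar>indicator {0<..s} \<theta> * h (s - \<theta>) * m \<theta>\<bar>)
          \<le> (NL \<theta>. ennreal ((indicator {0<..s} \<theta> * h (s - \<theta>))\<^sup>2 + (m \<theta>)\<^sup>2))"
        proof (intro nn_integral_mono ennreal_leI)
          fix \<theta>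
          let ?a = "indicator {0<..s} \<theta> * h (s - \<theta>)"
          have "2 * (\<bar>?a\<bar> * \<bar>m \<theta>\<bar>) \<le> ?a\<^sup>2 + (m \<theta>)\<^sup>2" using sum_squares_bound[of "\<bar>?a\<bar>" "\<bar>m \<theta>\<bar>"] by simp
          moreover have "0 \<le> \<bar>?a\<bar> * \<bar>m \<theta>\<bar>" by simp
          ultimately show "\<bar>?a * m \<theta>\<bar> \<le> ?a\<^sup>2 + (m \<theta>)\<^sup>2" unfolding abs_mult[of ?a] by linarith
        qed
        also have "\<dots> = ennreal (LBINT \<theta>. (indicator {0<..s} \<theta> * h (s - \<theta>))\<^sup>2 + (m \<theta>)\<^sup>2)"
          by (intro nn_integral_eq_integral Bochner_Integration.integrable_add L2_integrable_sq locL2_conv h m) auto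
        also have "(LBINT \<theta>. (indicator {0<..s} \<theta> * h (s - \<theta>))\<^sup>2 + (m \<theta>)\<^sup>2) = (LBINT \<theta>. (indicator {0<..s} \<theta> * h (s - \<theta>))\<^sup>2) + (LBINT s. (m s)\<^sup>2)"
          by (intro Bochner_Integration.integral_add L2_integrable_sq locL2_conv h m)
        also have "(LBINT \<theta>. (indicator {0<..s} \<theta> * h (s - \<theta>))\<^sup>2) \<le> H"
          unfolding locL2_conv(2)[OF h] H_def using h True
          by (intro integral_mono L2_integrable_sq) (auto simp: locL2_def indicator_def simp del: of_bool_def)
        finally show ?thesis by (intro mult_left_mono) (auto simp: ennreal_leI)
      qed simp
      finally show "(NL \<theta>. ennreal \<bar>indicator {0..t} s * f (t - s) * (indicator {0<..s} \<theta> * h (s - \<theta>) * m \<theta>)\<bar>)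
         \<le> ennreal (indicator {0..t} s * \<bar>f (t - s)\<bar>) * ennreal ?B" .
    qed
    also have "\<dots> = (NL s. ennreal (indicator {0..t} s * \<bar>f (t - s)\<bar>)) * ennreal ?B"
      by (rule nn_integral_multc) measurable
    also have "\<dots> < \<infinity>" using nf by (simp add: ennreal_mult_less_top)
    finally show ?thesis .
  qed
  have mG: "(\<lambda>(s, \<theta>). indicator {0..t} s * f (t - s) * (indicator {0<..s} \<theta> * h (s - \<theta>) * m \<theta>)) \<in> borel_measurable (lborel \<Otimes>\<^sub>M lborel)"
  proof -
    have "(\<lambda>z. indicator {0..t} (fst z) * f (t - fst z) * ((if 0 < snd z \<and> snd z \<le> fst z then 1 else 0) * h (fst z - snd z) * m (snd z))) \<in> borel_measurable (lborel \<Otimes>\<^sub>M lborel)"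
      by measurable
    moreover have "(\<lambda>(s, \<theta>). indicator {0..t} s * f (t - s) * (indicator {0<..s} \<theta> * h (s - \<theta>) * m \<theta>)) = (\<lambda>z. indicator {0..t} (fst z) * f (t - fst z) * ((if 0 < snd z \<and> snd z \<le> fst z then 1 else 0) * h (fst z - snd z) * m (snd z)))"
      by (auto simp: fun_eq_iff indicator_def)
    ultimately show ?thesis by simp
  qed
  have "(\<integral>\<omega>. \<xi> \<omega> * Z \<omega> \<partial>M) = (\<integral>\<omega>. (LBINT s. \<xi> \<omega> * (indicator {0..t} s * (f (t - s) * Iq h s \<omega>))) \<partial>M)"
    unfolding Z_def by simp
  also have "\<dots> = (LBINT s. (\<integral>\<omega>. \<xi> \<omega> * (indicator {0..t} s * (f (t - s) * Iq h s \<omega>)) \<partial>M))"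
    by (rule P.fubini_abs(2)[OF mF fin[OF _ x1]]) measurable
  also have "\<dots> = (LBINT s. (LBINT \<theta>. indicator {0..t} s * f (t - s) * (indicator {0<..s} \<theta> * h (s - \<theta>) * m \<theta>)))"
  proof (intro bochner_cong refl)
    fix s :: real
    have "(\<integral>\<omega>. \<xi> \<omega> * (indicator {0..t} s * (f (t - s) * Iq h s \<omega>)) \<partial>M) = (\<integral>\<omega>. indicator {0..t} s * f (t - s) * (\<xi> \<omega> * Iq h s \<omega>) \<partial>M)"
      by (intro bochner_cong) (auto simp: mult_ac)
    also have "\<dots> = indicator {0..t} s * f (t - s) * (\<integral>\<omega>. \<xi> \<omega> * Iq h s \<omega> \<partial>M)" by (rule integral_mult_right_zero)
    also have "\<dots> = indicator {0..t} s * f (t - s) * (LBINT \<theta>. indicator {0<..s} \<theta> * h (s - \<theta>) * m \<theta>)"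
      using e1[of s] by (cases "s \<in> {0..t}") auto
    also have "\<dots> = (LBINT \<theta>. indicator {0..t} s * f (t - s) * (indicator {0<..s} \<theta> * h (s - \<theta>) * m \<theta>))"
      by (rule integral_mult_right_zero[symmetric])
    finally show "(\<integral>\<omega>. \<xi> \<omega> * (indicator {0..t} s * (f (t - s) * Iq h s \<omega>)) \<partial>M) = (LBINT \<theta>. indicator {0..t} s * f (t - s) * (indicator {0<..s} \<theta> * h (s - \<theta>) * m \<theta>))" .
  qed
  also have "\<dots> = (LBINT \<theta>. (LBINT s. indicator {0..t} s * f (t - s) * (indicator {0<..s} \<theta> * h (s - \<theta>) * m \<theta>)))"
    by (rule lborel_pair.fubini_abs(2)[OF mG finG, symmetric])
  also have "\<dots> = (LBINT \<theta>. indicator {0<..t} \<theta> * K (t - \<theta>) * m \<theta>)"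
  proof (intro bochner_cong refl)
    fix \<theta> :: real
    show "(LBINT s. indicator {0..t} s * f (t - s) * (indicator {0<..s} \<theta> * h (s - \<theta>) * m \<theta>)) = indicator {0<..t} \<theta> * K (t - \<theta>) * m \<theta>"
    proof (cases "\<theta> \<in> {0<..t}")
      case True
      \<comment> \<open>Both indicators may go: h (s - \<theta>) vanishes for s < \<theta> and f (t
        - s) for s > t.\<close>
      have "(LBINT s. indicator {0..t} s * f (t - s) * (indicator {0<..s} \<theta> * h (s - \<theta>) * m \<theta>))
        = (LBINT s. f (t - s) * h (s - \<theta>) * m \<theta>)"
      proof (intro bochner_cong refl)
        fix s
        show "indicator {0..t} s * f (t - s) * (indicator {0<..s} \<theta> * h (s - \<theta>) * m \<theta>) = f (t - s) * h (s - \<theta>) * m \<theta>"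
          using True h0[of "s - \<theta>"] f0[of "t - s"] by (cases "s < \<theta>"; cases "s > t") auto
      qed
      also have "\<dots> = (LBINT s. f (t - s) * h (s - \<theta>)) * m \<theta>" by (rule integral_mult_left_zero)
      also have "(LBINT s. f (t - s) * h (s - \<theta>)) = (LBINT s. f ((t - \<theta>) - s) * h s)"
        by (subst lborel_integral_real_affine[where c=1 and t=\<theta>]) (auto simp: algebra_simps)
      also have "\<dots> = K (t - \<theta>)" using K(2)[of "t - \<theta>"] True by auto
      finally show ?thesis using True by simp
    next
      case False
      then have "(\<lambda>s. indicator {0..t} s * f (t - s) * (indicator {0<..s} \<theta> * h (s - \<theta>) * m \<theta>)) = (\<lambda>_. 0)"
        by (auto simp: fun_eq_iff indicator_def)
      then show ?thesis using False by simp
    qed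
  qed
  also have "\<dots> = (\<integral>\<omega>. \<xi> \<omega> * Iq K t \<omega> \<partial>M)" by (rule m(2)[OF Iq_wi[OF K(1) t], symmetric])
  finally have eq: "(\<integral>\<omega>. \<xi> \<omega> * Z \<omega> \<partial>M) = (\<integral>\<omega>. \<xi> \<omega> * Iq K t \<omega> \<partial>M)" .
  have xi_int: "integrable M (\<lambda>\<omega>. \<xi> \<omega> * X \<omega>)" if "integrable M X" for X
    using that x1 by (intro Bochner_Integration.integrable_bound[OF that]) (auto simp: abs_mult intro!: AE_I2 mult_left_le_one_le)
  have "(\<integral>\<omega>. \<bar>D \<omega>\<bar> \<partial>M) = (\<integral>\<omega>. \<xi> \<omega> * Iq K t \<omega> - \<xi> \<omega> * Z \<omega> \<partial>M)"
    by (intro bochner_cong) (auto simp: \<xi>_def D_def sgn_if)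
  also have "\<dots> = 0"
    using xi_int[OF Zi] xi_int[OF L2_integrable[OF Iq_L2[OF K(1) t]]] eq by simp
  finally have "AE \<omega> in M. \<bar>D \<omega>\<bar> = 0"
    using integral_nonneg_eq_0_iff_AE[of M "\<lambda>\<omega>. \<bar>D \<omega>\<bar>"] Di by simp
  then show "AE \<omega> in M. Iq K t \<omega> = (LBINT s. indicator {0..t} s * (f (t - s) * Iq h s \<omega>))"
    by eventually_elim (simp add: D_def Z_def)
qed

end

subsection \<open>The fractional kernels\<close>

definition trans_ker :: "(real \<Rightarrow> real) \<Rightarrow> real \<Rightarrow> real \<Rightarrow> real" where
  "trans_ker l t s = (if 0 \<le> t \<and> 0 \<le> s then l (t - s) else 0)"

lemma schur_trans_ker:
  assumes [measurable]: "l \<in> borel_measurable borel" and C: "0 \<le> C"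
    and le: "(NL x. ennreal (exp (- \<mu> * x) * \<bar>l x\<bar>)) \<le> ennreal C"
  shows "schur \<mu> C (trans_ker l)"
proof -
  have "(NL s. ennreal (exp (- \<mu> * (t - s)) * \<bar>trans_ker l t s\<bar>)) \<le> ennreal C" for t
  proof -
    have "(NL s. ennreal (exp (- \<mu> * (t - s)) * \<bar>trans_ker l t s\<bar>))
      \<le> (NL s. ennreal (exp (- \<mu> * (t - s)) * \<bar>l (t - s)\<bar>))"
      by (intro nn_integral_mono) (auto simp: trans_ker_def)
    also have "\<dots> = (NL x. ennreal (exp (- \<mu> * x) * \<bar>l x\<bar>))"
      by (subst nn_integral_real_affine[where c="-1" and t=t, of "\<lambda>x. ennreal (exp (- \<mu> * x) * \<bar>l x\<bar>)"]) auto
    finally show ?thesis using le by simp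
  qed
  moreover have "(NL t. ennreal (exp (- \<mu> * (t - s)) * \<bar>trans_ker l t s\<bar>)) \<le> ennreal C" for s
  proof -
    have "(NL t. ennreal (exp (- \<mu> * (t - s)) * \<bar>trans_ker l t s\<bar>))
      \<le> (NL t. ennreal (exp (- \<mu> * (- s + 1 * t)) * \<bar>l (- s + 1 * t)\<bar>))"
      by (intro nn_integral_mono) (auto simp: trans_ker_def)
    also have "\<dots> = (NL x. ennreal (exp (- \<mu> * x) * \<bar>l x\<bar>))"
      by (subst nn_integral_real_affine[where c="1" and t="-s", of "\<lambda>x. ennreal (exp (- \<mu> * x) * \<bar>l x\<bar>)"]) auto
    finally show ?thesis using le by simp
  qed
  moreover have "case_prod (trans_ker l) \<in> borel_measurable (borel \<Otimes>\<^sub>M borel)"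
    unfolding trans_ker_def case_prod_beta by measurable
  ultimately show ?thesis using C unfolding schur_def by (auto simp: trans_ker_def)
qed

section \<open>Laplace transforms and Schur norms of the fractional kernels\<close>

lemma nn_integral_powr_exp:
  assumes a: "a > 0" and p: "p > (0::real)"
  shows "(NL x. ennreal (if x > 0 then x powr (a - 1) * exp (- p * x) else 0)) = ennreal (Gamma a * p powr (- a))"
proof -
  let ?I = "NL x. ennreal (if x > 0 then x powr (a - 1) * exp (- p * x) else 0)"
  have "ennreal (Gamma a) = (NL t. ennreal (indicator {0..} t * t powr (a - 1) / exp t))"
    by (rule Gamma_conv_nn_integral_real[OF a])
  also have "\<dots> = ennreal p * (NL x. ennreal (indicator {0..} (p * x) * (p * x) powr (a - 1) / exp (p * x)))"
    using p by (subst nn_integral_real_affine[where c=p and t=0]) auto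
  also have "(NL x. ennreal (indicator {0..} (p * x) * (p * x) powr (a - 1) / exp (p * x)))
    = (NL x. ennreal (p powr (a - 1)) * ennreal (if x > 0 then x powr (a - 1) * exp (- p * x) else 0))"
    using p by (intro nn_integral_cong)
      (auto simp: indicator_def powr_mult ennreal_mult[symmetric] exp_minus field_simps zero_le_mult_iff)
  also have "\<dots> = ennreal (p powr (a - 1)) * ?I"
    by (rule nn_integral_cmult) measurable
  finally have G: "ennreal (Gamma a) = ennreal (p powr a) * ?I"
    using p by (simp add: mult.assoc[symmetric] ennreal_mult[symmetric] powr_diff)
  have "ennreal (p powr (- a)) * ennreal (Gamma a) = ennreal (p powr (- a)) * (ennreal (p powr a) * ?I)"
    unfolding G ..
  also have "\<dots> = ?I"
    using p by (simp add: mult.assoc[symmetric] ennreal_mult[symmetric] powr_add[symmetric])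
  finally show ?thesis using Gamma_real_pos[OF a] by (simp add: ennreal_mult mult.commute)
qed

locale lq =
  fixes b c \<gamma> \<alpha> \<delta> lam \<rho>t :: real
  assumes c: "c \<noteq> 0" and \<gamma>: "\<gamma> > 0" and \<alpha>: "1/2 < \<alpha>" "\<alpha> \<le> 1" and \<delta>: "\<delta> \<ge> 0"
    and \<rho>t0: "\<rho>t > 0"
    and \<rho>t: "((c\<^sup>2 * \<gamma> + b\<^sup>2 * exp (-2 * \<rho>t * \<delta>)) * (2 * \<rho>t) powr (-\<alpha>)
          + \<bar>b\<bar> * (1 + exp (-\<rho>t * \<delta>))) * \<rho>t powr (-\<alpha>) = 1/2"
    and lam: "lam > 2 * \<rho>t"
begin

text \<open>Multiply the running cost by c^2 \<gamma> and insert c u = phi - b S X. The term X^2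
  gets the factor c^2 \<gamma>, and b^2 (S X)^2 adds b^2 e^(-lam \<delta>) after the delay has been
  shifted into the discount.\<close>

definition "\<kappa> = c\<^sup>2 * \<gamma> + b\<^sup>2 * exp (-lam * \<delta>)"

definition f0 :: "real \<Rightarrow> real" where "f0 x = (if x > 0 then x powr (\<alpha> - 1) / Gamma \<alpha> else 0)"

abbreviation "gl \<equiv> g_lam b c \<gamma> \<alpha> \<delta> lam"
abbreviation "kl \<equiv> k_lam b c \<gamma> \<alpha> \<delta> lam"

lemma Gamma_pos: "Gamma \<alpha> > 0" using \<alpha> by (intro Gamma_real_pos) auto

lemma \<kappa>_pos: "\<kappa> > 0" unfolding \<kappa>_def using c \<gamma> by (intro add_pos_nonneg) auto

lemma f0_nonneg: "0 \<le> f0 x" unfolding f0_def using Gamma_pos by auto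

lemma f0_measurable[measurable]: "f0 \<in> borel_measurable borel"
  unfolding f0_def by measurable

lemma f0_laplace:
  assumes "p > 0"
  shows "(NL x. ennreal (exp (- p * x) * f0 x)) = ennreal (p powr (- \<alpha>))"
proof -
  have "(NL x. ennreal (exp (- p * x) * f0 x))
    = (NL x. ennreal (1 / Gamma \<alpha>) * ennreal (if x > 0 then x powr (\<alpha> - 1) * exp (- p * x) else 0))"
    using Gamma_pos by (intro nn_integral_cong) (auto simp: f0_def ennreal_mult[symmetric])
  also have "\<dots> = ennreal (1 / Gamma \<alpha>) * ennreal (Gamma \<alpha> * p powr (- \<alpha>))"
    using \<alpha> assms by (subst nn_integral_cmult) (auto simp: nn_integral_powr_exp)
  finally show ?thesis using Gamma_pos by (simp add: ennreal_mult[symmetric])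
qed

lemma f0_laplace_shift:
  assumes "p > 0"
  shows "(NL x. ennreal (exp (- p * x) * f0 (x - d))) = ennreal (exp (- p * d) * p powr (- \<alpha>))"
proof -
  have "(NL x. ennreal (exp (- p * x) * f0 (x - d)))
    = (NL x. ennreal (exp (- p * (d + x)) * f0 x))"
    by (subst nn_integral_real_affine[where c=1 and t=d]) auto
  also have "\<dots> = (NL x. ennreal (exp (- p * d)) * ennreal (exp (- p * x) * f0 x))"
  proof (intro nn_integral_cong)
    fix x
    have "exp (- p * (d + x)) = exp (- p * d) * exp (- p * x)"
      by (simp add: exp_add[symmetric] algebra_simps)
    then show "ennreal (exp (- p * (d + x)) * f0 x) = ennreal (exp (- p * d)) * ennreal (exp (- p * x) * f0 x)"
      by (simp only: ennreal_mult[symmetric] exp_ge_zero mult_nonneg_nonneg f0_nonneg mult.assoc)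
  qed
  also have "\<dots> = ennreal (exp (- p * d)) * ennreal (p powr (- \<alpha>))"
    using assms by (subst nn_integral_cmult) (auto simp: f0_laplace[simplified])
  finally show ?thesis by (simp add: ennreal_mult)
qed

text \<open>These are the kernels of $S_d K$ and of its adjoint with respect to $e^{-\lambda t} \, dt$.\<close>

definition "kA d = trans_ker (\<lambda>x. f0 (x - d))"
definition "kB d = trans_ker (\<lambda>x. exp (lam * x) * f0 (- x - d))"

lemma schur_kA: "\<mu> > 0 \<Longrightarrow> schur \<mu> (exp (- \<mu> * d) * \<mu> powr (- \<alpha>)) (kA d)"
  unfolding kA_def by (rule schur_trans_ker) (auto simp: f0_nonneg f0_laplace_shift[simplified])

lemma schur_kB:
  assumes "\<mu> < lam"
  shows "schur \<mu> (exp (- (lam - \<mu>) * d) * (lam - \<mu>) powr (- \<alpha>)) (kB d)"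
  unfolding kB_def
proof (rule schur_trans_ker)
  have "(NL x. ennreal (exp (- \<mu> * x) * \<bar>exp (lam * x) * f0 (- x - d)\<bar>))
    = (NL x. ennreal (exp (- (lam - \<mu>) * x) * f0 (x - d)))"
    by (subst nn_integral_real_affine[where c="-1" and t=0])
       (auto simp: f0_nonneg abs_mult mult.assoc[symmetric] exp_add[symmetric] algebra_simps intro!: nn_integral_cong)
  then show "(NL x. ennreal (exp (- \<mu> * x) * \<bar>exp (lam * x) * f0 (- x - d)\<bar>))
    \<le> ennreal (exp (- (lam - \<mu>) * d) * (lam - \<mu>) powr (- \<alpha>))"
    using f0_laplace_shift[of "lam - \<mu>" d] assms by simp
qed auto

text \<open>The discounted autocorrelation of f0. It is the adjoint of K applied to f0
  (\<open>kB_f0\<close>) and also the kernel of that adjoint composed with K (\<open>kB_kA\<close>).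
  Because of this coincidence the function \<open>gl\<close> both builds the kernel
  \<open>kl\<close> and is the right-hand side of the equation for the Gaussian kernel.\<close>

definition g_conv :: "real \<Rightarrow> real" where "g_conv \<tau> = (LBINT \<theta>. exp (- lam * \<theta>) * f0 \<theta> * f0 (\<theta> + \<tau>))"

lemma gl_g_conv:
  assumes "0 \<le> \<tau>"
  shows "gl \<tau> = \<kappa> * g_conv \<tau> - b * f0 (\<tau> - \<delta>)"
proof -
  have "(\<integral>\<theta>\<in>{0<..}. exp (-lam * \<theta>) * \<theta> powr (\<alpha> - 1) * (\<theta> + \<tau>) powr (\<alpha> - 1) \<partial>lborel)
    = (LBINT \<theta>. (Gamma \<alpha>)\<^sup>2 * (exp (- lam * \<theta>) * f0 \<theta> * f0 (\<theta> + \<tau>)))"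
    unfolding set_lebesgue_integral_def using assms Gamma_pos
    by (intro bochner_cong) (auto simp: f0_def indicator_def power2_eq_square)
  also have "\<dots> = (Gamma \<alpha>)\<^sup>2 * g_conv \<tau>" by (simp add: g_conv_def)
  finally show ?thesis
    using Gamma_pos unfolding g_lam_def \<kappa>_def by (simp add: f0_def pos_powr_def)
qed

lemma kB_f0:
  assumes "0 \<le> \<tau>"
  shows "kop (kB 0) f0 \<tau> = g_conv \<tau>"
proof -
  have "kop (kB 0) f0 \<tau> = (LBINT \<theta>. kB 0 \<tau> (\<tau> + 1 * \<theta>) * f0 (\<tau> + 1 * \<theta>))"
    unfolding kop_def by (subst lborel_integral_real_affine[where c=1 and t=\<tau>]) auto
  also have "\<dots> = g_conv \<tau>"
    unfolding g_conv_def using assms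
    by (intro bochner_cong) (auto simp: kB_def trans_ker_def f0_def add.commute)
  finally show ?thesis .
qed

text \<open>The first factor lives after t, the second after s, so the integration variable is
  measured from the later of the two times. If that is s, the discount between t and s splits
  off.\<close>

lemma kB_kA:
  assumes "0 \<le> t" "0 \<le> s"
  shows "kcomp (kB 0) (kA 0) t s = (if s \<le> t then g_conv (t - s) else exp (- lam * (s - t)) * g_conv (s - t))"
proof (cases "s \<le> t")
  case True
  have "kcomp (kB 0) (kA 0) t s = (LBINT \<theta>. kB 0 t (t + 1 * \<theta>) * kA 0 (t + 1 * \<theta>) s)"
    unfolding kcomp_def by (subst lborel_integral_real_affine[where c=1 and t=t]) auto
  also have "\<dots> = g_conv (t - s)"
    unfolding g_conv_def using assms True
    by (intro bochner_cong) (auto simp: kB_def kA_def trans_ker_def f0_def algebra_simps)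
  finally show ?thesis using True by simp
next
  case False
  have "kcomp (kB 0) (kA 0) t s = (LBINT \<theta>. kB 0 t (s + 1 * \<theta>) * kA 0 (s + 1 * \<theta>) s)"
    unfolding kcomp_def by (subst lborel_integral_real_affine[where c=1 and t=s]) auto
  also have "\<dots> = (LBINT \<theta>. exp (- lam * (s - t)) * (exp (- lam * \<theta>) * f0 \<theta> * f0 (\<theta> + (s - t))))"
  proof (intro bochner_cong refl)
    fix \<theta>
    have "exp (lam * (t - (s + \<theta>))) = exp (- lam * (s - t)) * exp (- lam * \<theta>)"
      by (simp add: exp_add[symmetric] algebra_simps)
    then show "kB 0 t (s + 1 * \<theta>) * kA 0 (s + 1 * \<theta>) s = exp (- lam * (s - t)) * (exp (- lam * \<theta>) * f0 \<theta> * f0 (\<theta> + (s - t)))"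
      using assms False by (auto simp: kB_def kA_def trans_ker_def f0_def[of \<theta>] algebra_simps)
  qed
  also have "\<dots> = exp (- lam * (s - t)) * g_conv (s - t)" by (simp add: g_conv_def)
  finally show ?thesis using False by simp
qed

text \<open>The two delay kernels never overlap: as \<delta> \<ge> 0, \<open>kA \<delta>\<close> can
  be nonzero only for s < t and \<open>kB \<delta>\<close> only for t < s. This matches the two
  branches of \<open>k_lam\<close>.\<close>

lemma kl_eq: "kl t s = \<kappa> * kcomp (kB 0) (kA 0) t s + ((- b) * kA \<delta> t s + (- b) * kB \<delta> t s)"
proof -
  consider "t < 0 \<or> s < 0" | "0 \<le> s" "s \<le> t" | "0 \<le> t" "t < s" by linarith
  then show ?thesis
  proof cases
    case 1
    then have "kl t s = 0" by (auto simp: k_lam_def)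
    moreover have "kcomp (kB 0) (kA 0) t s = 0" using 1 by (auto simp: kcomp_def kA_def kB_def trans_ker_def)
    ultimately show ?thesis using 1 by (auto simp: kA_def kB_def trans_ker_def)
  next
    case 2
    then have "kB \<delta> t s = 0" "kA \<delta> t s = f0 (t - s - \<delta>)" using \<delta> by (auto simp: kA_def kB_def trans_ker_def f0_def)
    with 2 show ?thesis using gl_g_conv[of "t - s"] kB_kA[of t s] by (simp add: k_lam_def)
  next
    case 3
    then have "kA \<delta> t s = 0" "kB \<delta> t s = exp (- lam * (s - t)) * f0 (s - t - \<delta>)" using \<delta>
      by (auto simp: kA_def kB_def trans_ker_def f0_def algebra_simps)
    moreover have "kl t s = exp (- lam * (s - t)) * (\<kappa> * g_conv (s - t) - b * f0 (s - t - \<delta>))"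
      using gl_g_conv[of "s - t"] 3 by (simp add: k_lam_def)
    ultimately show ?thesis using 3 kB_kA[of t s] by (simp only: if_False not_le) (simp add: right_diff_distrib)
  qed
qed

text \<open>Left unsimplified, with \<open>* 0\<close> and the absolute value of -b, in the shape in
  which the Schur rules combine the constants along \<open>kl_eq\<close>. The building blocks
  \<mu>^(-\<alpha>) and (lam - \<mu>)^(-\<alpha>) are the Laplace transforms bounding K and its
  adjoint in the weight e^(-\<mu> t).\<close>

definition "qc \<mu> = \<bar>\<kappa>\<bar> * ((exp (- (lam - \<mu>) * 0) * (lam - \<mu>) powr (- \<alpha>)) * (exp (- \<mu> * 0) * \<mu> powr (- \<alpha>)))
   + (\<bar>- b\<bar> * (exp (- \<mu> * \<delta>) * \<mu> powr (- \<alpha>)) + \<bar>- b\<bar> * (exp (- (lam - \<mu>) * \<delta>) * (lam - \<mu>) powr (- \<alpha>)))"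

lemma schur_kl:
  assumes "0 < \<mu>" "\<mu> < lam"
  shows "schur \<mu> (qc \<mu>) kl"
proof -
  have "schur \<mu> (qc \<mu>) (\<lambda>t s. \<kappa> * kcomp (kB 0) (kA 0) t s + ((- b) * kA \<delta> t s + (- b) * kB \<delta> t s))"
    unfolding qc_def
    by (intro schur_add schur_scale schur_kcomp schur_kA schur_kB assms)
  then show ?thesis by (simp only: kl_eq[symmetric])
qed

text \<open>As \<mu> \<le> lam / 2, both \<mu> and lam - \<mu> exceed \<open>\<rho>t\<close>, so
  their powers are below P; lam > 2 \<rho>t gives \<kappa> \<le> \<kappa>'. Replacing (2
  \<rho>t)^(-\<alpha>) by its lower bound P / 2 and doubling the equation for \<open>\<rho>t\<close>
  bounds the resulting sum by 1. Strictness comes from the first term, where \<kappa> > 0.\<close>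

lemma qc_less_1:
  assumes "\<rho>t < \<mu>" "\<mu> \<le> lam / 2"
  shows "qc \<mu> < 1"
proof -
  define P where "P = \<rho>t powr (- \<alpha>)"
  define \<kappa>' where "\<kappa>' = c\<^sup>2 * \<gamma> + b\<^sup>2 * exp (-2 * \<rho>t * \<delta>)"
  define E where "E = exp (- \<rho>t * \<delta>)"
  define p where "p = \<mu> powr (- \<alpha>)"
  define p' where "p' = (lam - \<mu>) powr (- \<alpha>)"
  have P: "0 < P" unfolding P_def using \<rho>t0 by simp
  have p: "p < P" "0 < p" unfolding p_def P_def using assms \<rho>t0 \<alpha> by (auto intro!: powr_less_mono2_neg)
  have p': "p' < P" "0 < p'" unfolding p'_def P_def using assms \<rho>t0 \<alpha> by (auto intro!: powr_less_mono2_neg)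
  have \<kappa>': "\<kappa> \<le> \<kappa>'" unfolding \<kappa>_def \<kappa>'_def using lam \<delta>
    by (intro add_left_mono mult_left_mono) (auto intro!: mult_right_mono)
  have "\<rho>t * \<delta> \<le> \<mu> * \<delta>" "\<rho>t * \<delta> \<le> (lam - \<mu>) * \<delta>"
    using assms \<delta> by (auto intro!: mult_right_mono)
  then have e1: "exp (- \<mu> * \<delta>) \<le> E" "exp (- (lam - \<mu>) * \<delta>) \<le> E"
    unfolding E_def by (auto simp: algebra_simps)
  have "(2 * \<rho>t) powr (- \<alpha>) = 2 powr (- \<alpha>) * P" unfolding P_def using \<rho>t0 by (simp add: powr_mult)
  \<comment> \<open>Here \<alpha> \<le> 1 enters, through 2^(-\<alpha>) \<ge> 2^(-1).\<close>
  moreover have "1/2 \<le> (2::real) powr (- \<alpha>)" using powr_mono[of "-1" "- \<alpha>" "2::real"] \<alpha> by (simp add: powr_minus field_simps)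
  ultimately have "P / 2 \<le> (2 * \<rho>t) powr (- \<alpha>)" using P by (simp add: mult_right_mono)
  then have "(\<kappa>' * (P / 2) + \<bar>b\<bar> * (1 + E)) * P \<le> (\<kappa>' * (2 * \<rho>t) powr (- \<alpha>) + \<bar>b\<bar> * (1 + E)) * P"
    using \<kappa>' \<kappa>_pos P by (intro mult_right_mono add_right_mono mult_left_mono) auto
  also have "\<dots> = 1/2" using \<rho>t unfolding P_def \<kappa>'_def E_def .
  finally have "(\<kappa>' * (P / 2) + \<bar>b\<bar> * (1 + E)) * P \<le> 1/2" .
  then have 1: "\<kappa>' * (P * P) + 2 * (\<bar>b\<bar> * (E * P)) + 2 * (\<bar>b\<bar> * P) \<le> 1" by (simp add: algebra_simps)
  have "\<kappa> * (p' * p) < \<kappa>' * (P * P)"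
    using p p' \<kappa>' \<kappa>_pos by (intro mult_le_less_imp_less mult_strict_mono) auto
  moreover have "\<bar>b\<bar> * (exp (- \<mu> * \<delta>) * p) \<le> \<bar>b\<bar> * (E * P)"
    using e1 p by (intro mult_left_mono mult_mono) (auto simp: E_def)
  moreover have "\<bar>b\<bar> * (exp (- (lam - \<mu>) * \<delta>) * p') \<le> \<bar>b\<bar> * (E * P)"
    using e1 p' by (intro mult_left_mono mult_mono) (auto simp: E_def)
  moreover have "0 \<le> \<bar>b\<bar> * P" using P by simp
  ultimately show ?thesis unfolding qc_def p_def[symmetric] p'_def[symmetric] using \<kappa>_pos 1 by simp
qed

section \<open>The resolvent of the kernel\<close>

definition "rl = kres kl"

lemma schur_rl:
  assumes "\<rho>t < \<mu>" "\<mu> \<le> lam / 2"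
  shows "schur \<mu> (\<Sum>n. qc \<mu> ^ Suc n) rl"
  unfolding rl_def using assms \<rho>t0 by (intro schur_kres schur_kl qc_less_1) auto


text \<open>Young's inequality |g f| \<le> f^2 / 2 + g^2 / 2 splits the bilinear form into a column
  integral against f^2 and a row integral against g^2, each at most C / 2.\<close>

lemma fredholm_kernel_schur:
  assumes "schur \<mu> C k"
  shows "fredholm_kernel (- \<mu>) k"
proof -
  note [measurable] = schur_measurable[OF assms]
  define w where "w t s = kw \<mu> k t s" for t s
  have [measurable]: "case_prod w \<in> borel_measurable (borel \<Otimes>\<^sub>M borel)"
    unfolding w_def case_prod_beta by measurable
  note [measurable] = kernel_measurable[OF this]
  have w0: "0 \<le> w t s" for t s unfolding w_def by simp
  have neg: "w t s = 0" if "t < 0 \<or> s < 0" for t s using schurD(3,4)[OF assms] that unfolding w_def by auto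
  note C = schurD(1)[OF assms]
  have bound: "(\<integral>\<^sup>+t\<in>{0..}. (\<integral>\<^sup>+s\<in>{0..}. ennreal \<bar>g t * (exp (- \<mu> * (t - s)) * k t s) * f s\<bar> \<partial>lborel) \<partial>lborel) \<le> ennreal C"
    if [measurable]: "f \<in> borel_measurable lborel" "g \<in> borel_measurable lborel"
      and f: "(\<integral>\<^sup>+s\<in>{0..}. ennreal ((f s)\<^sup>2) \<partial>lborel) \<le> 1" and g: "(\<integral>\<^sup>+t\<in>{0..}. ennreal ((g t)\<^sup>2) \<partial>lborel) \<le> 1" for f g
  proof -
    define F where "F s = ennreal ((f s)\<^sup>2 / 2) * indicator {0..} s" for s
    define G where "G t = ennreal ((g t)\<^sup>2 / 2) * indicator {0..} t" for t
    have [measurable]: "F \<in> borel_measurable borel" "G \<in> borel_measurable borel" unfolding F_def G_def by measurable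
    have half: "(NL s. ennreal ((h s)\<^sup>2 / 2) * indicator {0..} s) \<le> ennreal (1/2)"
      if [measurable]: "h \<in> borel_measurable lborel" and "(\<integral>\<^sup>+s\<in>{0..}. ennreal ((h s)\<^sup>2) \<partial>lborel) \<le> 1" for h :: "real \<Rightarrow> real"
    proof -
      have "(NL s. ennreal ((h s)\<^sup>2 / 2) * indicator {0..} s) = (NL s. ennreal (1/2) * (ennreal ((h s)\<^sup>2) * indicator {0..} s))"
        by (intro nn_integral_cong, unfold mult.assoc[symmetric], subst ennreal_mult[symmetric]) auto
      also have "\<dots> = ennreal (1/2) * (\<integral>\<^sup>+s\<in>{0..}. ennreal ((h s)\<^sup>2) \<partial>lborel)"
        by (rule nn_integral_cmult) measurable
      also have "\<dots> \<le> ennreal (1/2) * 1" by (intro mult_left_mono that) auto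
      finally show ?thesis by simp
    qed
    have "(\<integral>\<^sup>+t\<in>{0..}. (\<integral>\<^sup>+s\<in>{0..}. ennreal \<bar>g t * (exp (- \<mu> * (t - s)) * k t s) * f s\<bar> \<partial>lborel) \<partial>lborel)
      \<le> (NL t. (NL s. ennreal (w t s) * F s + ennreal (w t s) * G t))"
    proof (intro nn_integral_mono)
      fix t
      have "ennreal \<bar>g t * (exp (- \<mu> * (t - s)) * k t s) * f s\<bar> \<le> ennreal (w t s) * F s + ennreal (w t s) * G t"
        if "0 \<le> t" "0 \<le> s" for s
      proof -
        have "\<bar>g t\<bar> * \<bar>f s\<bar> \<le> (f s)\<^sup>2 / 2 + (g t)\<^sup>2 / 2"
          using sum_squares_bound[of "\<bar>f s\<bar>" "\<bar>g t\<bar>"] by (simp add: mult_ac)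
        then have "w t s * (\<bar>g t\<bar> * \<bar>f s\<bar>) \<le> w t s * ((f s)\<^sup>2 / 2 + (g t)\<^sup>2 / 2)"
          by (intro mult_left_mono w0)
        then have "\<bar>g t * (exp (- \<mu> * (t - s)) * k t s) * f s\<bar> \<le> w t s * ((f s)\<^sup>2 / 2) + w t s * ((g t)\<^sup>2 / 2)"
          by (simp add: w_def abs_mult mult_ac distrib_left)
        then have "ennreal \<bar>g t * (exp (- \<mu> * (t - s)) * k t s) * f s\<bar> \<le> ennreal (w t s * ((f s)\<^sup>2 / 2) + w t s * ((g t)\<^sup>2 / 2))"
          by (rule ennreal_leI)
        then show ?thesis using that w0 by (simp add: F_def G_def ennreal_mult[symmetric] ennreal_plus[symmetric] del: ennreal_plus)
      qed
      then show "(\<integral>\<^sup>+s\<in>{0..}. ennreal \<bar>g t * (exp (- \<mu> * (t - s)) * k t s) * f s\<bar> \<partial>lborel) * indicator {0..} t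
         \<le> (NL s. ennreal (w t s) * F s + ennreal (w t s) * G t)"
        by (cases "0 \<le> t") (auto intro!: nn_integral_mono simp: indicator_def)
    qed
    also have "\<dots> = (NL t. NL s. ennreal (w t s) * F s) + (NL t. NL s. ennreal (w t s) * G t)"
      by (subst nn_integral_add[symmetric]) (auto intro!: nn_integral_cong nn_integral_add)
    also have "(NL t. NL s. ennreal (w t s) * F s) = (NL s. NL t. ennreal (w t s) * F s)"
      by (rule lborel_pair.Fubini'[symmetric]) measurable
    also have "\<dots> = (NL s. (NL t. ennreal (w t s)) * F s)"
      by (intro nn_integral_cong nn_integral_multc) measurable
    also have "\<dots> \<le> (NL s. ennreal C * F s)"
      unfolding w_def by (intro nn_integral_mono mult_right_mono schurD(6)[OF assms]) auto
    also have "\<dots> = ennreal C * (NL s. F s)" by (intro nn_integral_cmult) measurable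
    also have "\<dots> \<le> ennreal C * ennreal (1/2)" unfolding F_def by (intro mult_left_mono half f) auto
    also have "(NL t. NL s. ennreal (w t s) * G t) = (NL t. (NL s. ennreal (w t s)) * G t)"
      by (intro nn_integral_cong nn_integral_multc) measurable
    also have "\<dots> \<le> (NL t. ennreal C * G t)"
      unfolding w_def by (intro nn_integral_mono mult_right_mono schurD(5)[OF assms]) auto
    also have "\<dots> = ennreal C * (NL t. G t)" by (intro nn_integral_cmult) measurable
    also have "\<dots> \<le> ennreal C * ennreal (1/2)" unfolding G_def by (intro mult_left_mono half g) auto
    also have "ennreal C * ennreal (1/2) + ennreal C * ennreal (1/2) = ennreal C"
    proof -
      have "ennreal C * ennreal (1/2) = ennreal (C/2)" using C by (subst ennreal_mult[symmetric]) auto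
      then show ?thesis using C by (simp only:) (subst ennreal_plus[symmetric], auto)
    qed
    finally show ?thesis by (simp add: add_mono)
  qed
  have "(\<lambda>(t, s). exp (- \<mu> * (t - s)) * k t s) \<in> borel_measurable (lborel \<Otimes>\<^sub>M lborel)"
    unfolding case_prod_beta by measurable
  then show ?thesis unfolding fredholm_kernel_def fredholm_L2_def using bound by blast
qed

lemma fredholm_resolvent_rl:
  assumes "\<rho>t < \<mu>" "\<mu> \<le> lam / 2"
  shows "fredholm_resolvent (- \<mu>) kl rl"
proof -
  have k: "schur \<mu> (qc \<mu>) kl" using assms \<rho>t0 by (intro schur_kl) auto
  note r = schur_rl[OF assms]
  have e1: "(\<integral>\<theta>\<in>{0..}. kl t \<theta> * rl \<theta> s \<partial>lborel) = kcomp kl rl t s" for t s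
    unfolding kcomp_def set_lebesgue_integral_def
    by (intro bochner_cong) (auto simp: indicator_def schurD(3)[OF r])
  have e2: "(\<integral>\<theta>\<in>{0..}. rl t \<theta> * kl \<theta> s \<partial>lborel) = kcomp rl kl t s" for t s
    unfolding kcomp_def set_lebesgue_integral_def
    by (intro bochner_cong) (auto simp: indicator_def schurD(3)[OF k])
  have S: "{z \<in> space (lborel \<Otimes>\<^sub>M lborel). rl (fst z) (snd z) + kcomp kl rl (fst z) (snd z) = kl (fst z) (snd z)}
      \<in> sets (lborel \<Otimes>\<^sub>M lborel)"
    by (intro borel_measurable_eq borel_measurable_add schur_measurable[OF r]
        schur_measurable[OF schur_kcomp[OF k r]] schur_measurable[OF k]) auto
  have "AE z in lborel \<Otimes>\<^sub>M lborel. rl (fst z) (snd z) + kcomp kl rl (fst z) (snd z) = kl (fst z) (snd z)"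
    unfolding rl_def by (rule lborel_pair_AE[OF S[unfolded rl_def] kres_equation(1)[OF k qc_less_1[OF assms]]])
  moreover have "AE z in lborel \<Otimes>\<^sub>M lborel. rl (fst z) (snd z) + kcomp rl kl (fst z) (snd z) = kl (fst z) (snd z)"
    unfolding rl_def by (rule kres_equation(2)[OF k qc_less_1[OF assms]])
  ultimately show ?thesis
    unfolding fredholm_resolvent_def e1 e2 using fredholm_kernel_schur[OF r] by (auto elim: AE_mp)
qed

text \<open>The squared kernel behaves like x^(2 \<alpha> - 2), so its discounted integral is a
  Gamma integral with exponent 2 \<alpha> - 1. This is where \<alpha> > 1/2 enters; it makes the
  noise term of the state square integrable.\<close>

lemma Lw_f0: assumes "\<mu> > 0" shows "Lw \<mu> f0"
proof -
  have "(NL t. ennreal ((exp (- \<mu> * t) * f0 t)\<^sup>2))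
    = (NL x. ennreal (1 / (Gamma \<alpha>)\<^sup>2) * ennreal (if x > 0 then x powr ((2 * \<alpha> - 1) - 1) * exp (- (2 * \<mu>) * x) else 0))"
  proof (intro nn_integral_cong)
    fix x
    have "(x powr (\<alpha> - 1))\<^sup>2 = x powr ((2 * \<alpha> - 1) - 1)" "(exp (- \<mu> * x))\<^sup>2 = exp (- (2 * \<mu>) * x)"
      by (auto simp: power2_eq_square powr_add[symmetric] exp_add[symmetric])
    then show "ennreal ((exp (- \<mu> * x) * f0 x)\<^sup>2)
      = ennreal (1 / (Gamma \<alpha>)\<^sup>2) * ennreal (if x > 0 then x powr ((2 * \<alpha> - 1) - 1) * exp (- (2 * \<mu>) * x) else 0)"
      by (simp add: f0_def ennreal_mult[symmetric] power_mult_distrib power_divide mult.commute)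
  qed
  also have "\<dots> = ennreal (1 / (Gamma \<alpha>)\<^sup>2) * ennreal (Gamma (2 * \<alpha> - 1) * (2 * \<mu>) powr (- (2 * \<alpha> - 1)))"
    using \<alpha> assms by (subst nn_integral_cmult) (auto simp: nn_integral_powr_exp[of "2 * \<alpha> - 1" "2 * \<mu>"])
  also have "\<dots> < \<infinity>" by (simp add: ennreal_mult_less_top)
  finally show ?thesis unfolding Lw_def by (auto simp: f0_def)
qed

definition one :: "real \<Rightarrow> real" where "one t = (if 0 \<le> t then 1 else 0)"

lemma Lw_one: assumes "\<mu> > 0" shows "Lw \<mu> one"
proof -
  have "(NL t. ennreal ((exp (- \<mu> * t) * one t)\<^sup>2))
    = (NL x. ennreal (if x > 0 then x powr (1 - 1) * exp (- (2 * \<mu>) * x) else 0))"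
  proof (intro nn_integral_cong_AE AE_I[where N="{0}"])
    show "{x \<in> space lborel. ennreal ((exp (- \<mu> * x) * one x)\<^sup>2) \<noteq> ennreal (if x > 0 then x powr (1 - 1) * exp (- (2 * \<mu>) * x) else 0)} \<subseteq> {0}"
      by (auto simp: one_def power2_eq_square exp_add[symmetric] algebra_simps)
  qed auto
  also have "\<dots> < \<infinity>" using assms by (subst nn_integral_powr_exp) auto
  finally show ?thesis unfolding Lw_def by (auto simp: one_def[abs_def])
qed

text \<open>On constants the adjoint of K acts as the Laplace transform of f0 at lam. This is the
  origin of lam^(-\<alpha>) in the formula for the control.\<close>

lemma kB_one: assumes "0 \<le> \<tau>" shows "kop (kB 0) one \<tau> = lam powr (- \<alpha>)"
proof -
  have "kop (kB 0) one \<tau> = (LBINT \<theta>. kB 0 \<tau> (\<tau> + 1 * \<theta>) * one (\<tau> + 1 * \<theta>))"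
    unfolding kop_def by (subst lborel_integral_real_affine[where c=1 and t=\<tau>]) auto
  also have "\<dots> = (LBINT \<theta>. exp (- lam * \<theta>) * f0 \<theta>)"
    using assms by (intro bochner_cong) (auto simp: kB_def trans_ker_def f0_def one_def)
  also have "\<dots> = lam powr (- \<alpha>)"
  proof -
    have lam_pos: "lam > 0" using lam \<rho>t0 by auto
    show ?thesis
      using f0_laplace[OF lam_pos] by (subst integral_eq_nn_integral) (auto simp: f0_nonneg)
  qed
  finally show ?thesis .
qed

lemma Lw_shift:
  assumes f: "Lw \<mu> f" and d: "0 \<le> d"
  shows "Lw \<mu> (\<lambda>t. f (t - d))"
proof -
  note [measurable] = LwD(1)[OF f]
  have "(NL t. ennreal ((exp (- \<mu> * t) * f (t - d))\<^sup>2))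
    = (NL t. ennreal ((exp (- \<mu> * d))\<^sup>2) * ennreal ((exp (- \<mu> * t) * f t)\<^sup>2))"
    (is "?l = ?r")
  proof -
    have "(exp (- \<mu> * (d + 1 * t)) * f (d + 1 * t - d))\<^sup>2 = (exp (- \<mu> * d))\<^sup>2 * (exp (- \<mu> * t) * f t)\<^sup>2" for t
    proof -
      have "exp (- \<mu> * (d + 1 * t)) = exp (- \<mu> * d) * exp (- \<mu> * t)"
        by (simp add: exp_add[symmetric] algebra_simps)
      then show ?thesis by (simp only: power_mult_distrib mult.assoc) simp
    qed
    moreover have "?l = (NL t. ennreal ((exp (- \<mu> * (d + 1 * t)) * f (d + 1 * t - d))\<^sup>2))"
      by (subst nn_integral_real_affine[where c=1 and t=d]) auto
    ultimately show ?thesis by (simp only: ennreal_mult zero_le_power2)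
  qed
  also have "\<dots> < \<infinity>" using LwD(3)[OF f] by (subst nn_integral_cmult) (auto simp: ennreal_mult_less_top)
  finally show ?thesis using LwD(2)[OF f] d unfolding Lw_def by auto
qed

lemma kA_shift:
  assumes "\<And>t. t < 0 \<Longrightarrow> f t = 0"
  shows "kop (kA \<delta>) f t = kop (kA 0) f (t - \<delta>)"
  unfolding kop_def using \<delta> assms
  by (intro bochner_cong) (auto simp: kA_def trans_ker_def f0_def algebra_simps)

lemma kop_linear:
  assumes k: "schur \<mu> C k" and f: "Lw \<mu> f" and g: "Lw \<mu> g"
  shows "AE t in lborel. kop k (\<lambda>s. f s + a * g s) t = kop k f t + a * kop k g t"
  using kop_AE_integrable[OF k f] kop_AE_integrable[OF k g]
proof eventually_elim
  case (elim t)
  have "kop k (\<lambda>s. f s + a * g s) t = (LBINT s. k t s * f s + a * (k t s * g s))"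
    unfolding kop_def by (intro bochner_cong) (auto simp: algebra_simps)
  then show ?case using elim unfolding kop_def by simp
qed

text \<open>\<^term>\<open>sol \<psi>\<close> solves $(1 + k) \phi = - \psi$, and \<^term>\<open>nrm e e'\<close> is $\kappa K^* e - b e'$, where $e'$ is the delayed version of $e$.\<close>

definition nrm :: "(real \<Rightarrow> real) \<Rightarrow> (real \<Rightarrow> real) \<Rightarrow> real \<Rightarrow> real" where
  "nrm e e' t = (if 0 \<le> t then \<kappa> * kop (kB 0) e t - b * e' t else 0)"

definition sol :: "(real \<Rightarrow> real) \<Rightarrow> real \<Rightarrow> real" where
  "sol \<psi> t = kop rl \<psi> t - \<psi> t"

lemma Lw_nrm:
  assumes e: "Lw \<mu> e" and e': "Lw \<mu> e'" and mu: "\<rho>t < \<mu>" "\<mu> \<le> lam / 2"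
  shows "Lw \<mu> (nrm e e')"
proof -
  have "\<mu> < lam" using mu \<rho>t0 by auto
  then have "Lw \<mu> (\<lambda>t. \<kappa> * kop (kB 0) e t - b * e' t)"
    by (intro Lw_diff Lw_cmult Lw_kop[OF schur_kB] e e')
  moreover from this have "nrm e e' = (\<lambda>t. \<kappa> * kop (kB 0) e t - b * e' t)"
    by (auto simp: nrm_def fun_eq_iff Lw_def)
  ultimately show ?thesis by simp
qed

lemma Lw_sol:
  assumes "Lw \<mu> \<psi>" and mu: "\<rho>t < \<mu>" "\<mu> \<le> lam / 2"
  shows "Lw \<mu> (sol \<psi>)"
  unfolding sol_def[abs_def] by (intro Lw_diff Lw_kop[OF schur_rl[OF mu]] assms)

text \<open>\<open>sol \<psi>\<close> is -(1 - r) \<psi>, and the resolvent equation r + k r = k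
  says that 1 - r is a right inverse of 1 + k.\<close>

lemma sol_equation:
  assumes p: "Lw \<mu> \<psi>" and mu: "\<rho>t < \<mu>" "\<mu> \<le> lam / 2"
  shows "AE t in lborel. sol \<psi> t + kop kl (sol \<psi>) t = - \<psi> t"
proof -
  have k: "schur \<mu> (qc \<mu>) kl" using mu \<rho>t0 by (intro schur_kl) auto
  note r = schur_rl[OF mu]
  note kr = schur_kcomp[OF k r]
  note [measurable] = schur_measurable[OF k] schur_measurable[OF r] schur_measurable[OF kr] LwD(1)[OF p]
  have "AE t in lborel. kop rl \<psi> t + kop (kcomp kl rl) \<psi> t = kop kl \<psi> t"
    using kop_AE_integrable[OF r p] kop_AE_integrable[OF kr p]
  proof eventually_elim
    case (elim t)
    have "kop rl \<psi> t + kop (kcomp kl rl) \<psi> t = (LBINT s. rl t s * \<psi> s + kcomp kl rl t s * \<psi> s)"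
      unfolding kop_def by (rule Bochner_Integration.integral_add[OF elim, symmetric])
    also have "\<dots> = kop kl \<psi> t"
      unfolding kop_def
    proof (intro integral_cong_AE)
      show "AE s in lborel. rl t s * \<psi> s + kcomp kl rl t s * \<psi> s = kl t s * \<psi> s"
        using kres_equation(1)[OF k qc_less_1[OF mu], of t, folded rl_def]
        by eventually_elim (simp only: distrib_right[symmetric])
    qed measurable
    finally show ?case .
  qed
  moreover have "AE t in lborel. kop kl (sol \<psi>) t = kop kl (kop rl \<psi>) t - kop kl \<psi> t"
    using kop_linear[OF k Lw_kop[OF r p] p, where a = "-1"] unfolding sol_def[abs_def] by simp
  ultimately show ?thesis using kop_kcomp[OF k r p]
    by eventually_elim (simp add: sol_def)
qed

text \<open>With p = e + K phi this is the optimality condition for a deterministic state with free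
  part e. Here e' stands for the delayed free part and is kept separate because the two uses differ:
  for the mean the history continues the constant x0, so e' = e on the half-line, whereas for the
  Gaussian kernel f0 is shifted and vanishes before \<delta>.\<close>

theorem det_identity:
  assumes e: "Lw \<mu> e" and e': "Lw \<mu> e'" and mu: "\<rho>t < \<mu>" "\<mu> \<le> lam / 2"
  defines "\<phi> \<equiv> sol (nrm e e')"
  defines "p \<equiv> \<lambda>t. e t + kop (kA 0) \<phi> t"
  shows "AE t in lborel. \<kappa> * kop (kB 0) p t - b * kop (kB \<delta>) \<phi> t + \<phi> t - b * (e' t + kop (kA 0) \<phi> (t - \<delta>)) = 0"
proof -
  have m: "0 < \<mu>" "\<mu> < lam" using mu \<rho>t0 by auto
  have k: "schur \<mu> (qc \<mu>) kl" using m by (intro schur_kl) auto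
  have ph: "Lw \<mu> \<phi>" unfolding \<phi>_def by (intro Lw_sol Lw_nrm e e' mu)
  note A0 = schur_kA[OF m(1), of 0] and Ad = schur_kA[OF m(1), of \<delta>] and B0 = schur_kB[OF m(2), of 0] and Bd = schur_kB[OF m(2), of \<delta>]
  note BA = schur_kcomp[OF B0 A0]
  have "AE t in lborel. kop kl \<phi> t = \<kappa> * kop (kcomp (kB 0) (kA 0)) \<phi> t - b * kop (kA \<delta>) \<phi> t - b * kop (kB \<delta>) \<phi> t"
    using kop_AE_integrable[OF BA ph] kop_AE_integrable[OF Ad ph] kop_AE_integrable[OF Bd ph]
  proof eventually_elim
    case (elim t)
    have "kop kl \<phi> t = (LBINT s. \<kappa> * (kcomp (kB 0) (kA 0) t s * \<phi> s) - b * (kA \<delta> t s * \<phi> s) - b * (kB \<delta> t s * \<phi> s))"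
      unfolding kop_def kl_eq by (intro bochner_cong) (auto simp: algebra_simps)
    then show ?case using elim unfolding kop_def by simp
  qed
  moreover have "AE t in lborel. kop (kB 0) p t = kop (kB 0) e t + 1 * kop (kB 0) (kop (kA 0) \<phi>) t"
    using kop_linear[OF B0 e Lw_kop[OF A0 ph], where a = 1] unfolding p_def by simp
  moreover note kop_kcomp[OF B0 A0 ph]
  moreover have "AE t in lborel. \<phi> t + kop kl \<phi> t = - nrm e e' t"
    unfolding \<phi>_def by (intro sol_equation[of \<mu>] Lw_nrm e e' mu)
  ultimately show ?thesis
  proof eventually_elim
    case (elim t)
    have n: "nrm e e' t = \<kappa> * kop (kB 0) e t - b * e' t"
      using LwD(2)[OF e', of t] by (auto simp: nrm_def kop_def kB_def trans_ker_def)
    show ?case using elim kA_shift[OF LwD(2)[OF ph], where t = t] unfolding n by (simp add: algebra_simps)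
  qed
qed

end

subsection \<open>Processes in weighted spaces\<close>

lemma Lw_locL2:
  assumes f: "Lw \<mu> f" and mu: "0 \<le> \<mu>"
  shows "locL2 f"
  unfolding locL2_def
proof (intro conjI allI)
  note [measurable] = LwD(1)[OF f]
  show "f \<in> borel_measurable borel" by measurable
  fix T
  show "L2 lborel (\<lambda>s. f s * indicator {0<..T} s)"
  proof (rule L2_bound[OF L2_cmult[OF Lw_L2[OF f], of "exp (\<mu> * T)"]])
    show "AE s in lborel. \<bar>f s * indicator {0<..T} s\<bar> \<le> \<bar>exp (\<mu> * T) * (exp (- \<mu> * s) * f s)\<bar>"
    proof (rule AE_I2)
      fix s
      have "\<bar>f s\<bar> \<le> exp (\<mu> * T) * exp (- \<mu> * s) * \<bar>f s\<bar>" if "s \<le> T"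
      proof -
        have "exp (\<mu> * T) * exp (- \<mu> * s) = exp (\<mu> * (T - s))" by (simp add: exp_add[symmetric] algebra_simps)
        moreover have "1 \<le> exp (\<mu> * (T - s))" using mu that by simp
        ultimately show ?thesis using mult_right_mono[of 1 "exp (\<mu> * T) * exp (- \<mu> * s)" "\<bar>f s\<bar>"] by simp
      qed
      then show "\<bar>f s * indicator {0<..T} s\<bar> \<le> \<bar>exp (\<mu> * T) * (exp (- \<mu> * s) * f s)\<bar>"
        by (auto simp: indicator_def abs_mult mult.assoc)
    qed
  qed measurable
qed

context bmotion begin

sublocale TM: pair_sigma_finite lborel M ..

sublocale MT: pair_sigma_finite M lborel ..

abbreviation "NN \<equiv> (lborel :: real measure) \<Otimes>\<^sub>M M"

text \<open>Turns a process into a function on time times \<Omega> that vanishes for negative times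
  and carries the weight. Membership in \<open>L2F\<close> becomes membership in L2 of the product
  measure, where products, sums and Fubini are available.\<close>

definition wt :: "real \<Rightarrow> (real \<Rightarrow> 'a \<Rightarrow> real) \<Rightarrow> real \<times> 'a \<Rightarrow> real" where
  "wt \<mu> f z = indicator {0..} (fst z) * exp (- \<mu> * fst z) * f (fst z) (snd z)"

lemma wt_pair: "wt \<mu> f (t, \<omega>) = indicator {0..} t * exp (- \<mu> * t) * f t \<omega>"
  by (simp add: wt_def)

lemma wt_lincomb: "wt \<mu> (\<lambda>t \<omega>. f t \<omega> + a * g t \<omega>) = (\<lambda>z. wt \<mu> f z + a * wt \<mu> g z)"
  by (auto simp: wt_def fun_eq_iff algebra_simps)

text \<open>The map t to max 0 t retracts the line measurably onto [0, oo); composing with it passes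
  from measurability on the restricted time axis to the whole line. In the other direction the
  positive weight is divided out.\<close>

lemma adapted_jm_iff:
  "adapted_jm M W f \<longleftrightarrow> wt \<mu> f \<in> borel_measurable NN \<and> (\<forall>t\<ge>0. f t \<in> borel_measurable (Ft t))"
proof -
  have "(\<lambda>(t, \<omega>). f t \<omega>) \<in> borel_measurable (restrict_space lborel {0..} \<Otimes>\<^sub>M M) \<longleftrightarrow> wt \<mu> f \<in> borel_measurable NN"
  proof
    assume m: "(\<lambda>(t, \<omega>). f t \<omega>) \<in> borel_measurable (restrict_space lborel {0..} \<Otimes>\<^sub>M M)"
    have "(\<lambda>z. (max 0 (fst z), snd z)) \<in> measurable NN (restrict_space lborel {0..} \<Otimes>\<^sub>M M)"
      by (intro measurable_Pair measurable_restrict_space2) auto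
    from measurable_compose[OF this m]
    have "(\<lambda>z. f (max 0 (fst z)) (snd z)) \<in> borel_measurable NN" by simp
    then have "(\<lambda>z. indicator {0..} (fst z) * exp (- \<mu> * fst z) * f (max 0 (fst z)) (snd z)) \<in> borel_measurable NN"
      by measurable
    also have "(\<lambda>z. indicator {0..} (fst z) * exp (- \<mu> * fst z) * f (max 0 (fst z)) (snd z)) = wt \<mu> f"
      by (auto simp: wt_def fun_eq_iff indicator_def max_def)
    finally show "wt \<mu> f \<in> borel_measurable NN" .
  next
    assume m: "wt \<mu> f \<in> borel_measurable NN"
    have fm: "fst \<in> measurable (restrict_space lborel {0..} \<Otimes>\<^sub>M M) (lborel :: real measure)"
      using measurable_compose[OF measurable_fst measurable_restrict_space1[OF measurable_ident_sets[OF refl]], of "lborel :: real measure" "{0..}" M] by simp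
    then have fb: "fst \<in> borel_measurable (restrict_space (lborel :: real measure) {0..} \<Otimes>\<^sub>M M)" by simp
    have "(\<lambda>z. (fst z, snd z)) \<in> measurable (restrict_space lborel {0..} \<Otimes>\<^sub>M M) NN"
      by (intro measurable_Pair measurable_snd fm)
    from measurable_compose[OF this m]
    have "(\<lambda>z. exp (\<mu> * fst z) * wt \<mu> f (fst z, snd z)) \<in> borel_measurable (restrict_space lborel {0..} \<Otimes>\<^sub>M M)"
      using fb by (intro borel_measurable_times measurable_compose[OF _ borel_measurable_exp]) auto
    then show "(\<lambda>(t, \<omega>). f t \<omega>) \<in> borel_measurable (restrict_space lborel {0..} \<Otimes>\<^sub>M M)"
      by (rule measurable_cong[THEN iffD1, rotated])
         (auto simp: wt_def space_pair_measure space_restrict_space exp_add[symmetric] mult.assoc[symmetric])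
  qed
  then show ?thesis unfolding adapted_jm_def adapted_iff by blast
qed

lemma nn_wt:
  assumes [measurable]: "wt \<mu> f \<in> borel_measurable NN"
  shows "(\<integral>\<^sup>+\<omega>. (\<integral>\<^sup>+t\<in>{0..}. ennreal (exp (2 * (- \<mu>) * t) * (f t \<omega>)\<^sup>2) \<partial>lborel) \<partial>M) = (\<integral>\<^sup>+z. ennreal ((wt \<mu> f z)\<^sup>2) \<partial>NN)"
proof -
  have "(\<integral>\<^sup>+z. ennreal ((wt \<mu> f z)\<^sup>2) \<partial>NN) = (\<integral>\<^sup>+\<omega>. (NL t. ennreal ((wt \<mu> f (t, \<omega>))\<^sup>2)) \<partial>M)"
    by (rule TM.nn_integral_snd[symmetric]) measurable
  also have "\<dots> = (\<integral>\<^sup>+\<omega>. (\<integral>\<^sup>+t\<in>{0..}. ennreal (exp (2 * (- \<mu>) * t) * (f t \<omega>)\<^sup>2) \<partial>lborel) \<partial>M)"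
    by (intro nn_integral_cong)
       (auto simp: wt_pair indicator_def power_mult_distrib exp_double[symmetric])
  finally show ?thesis by simp
qed

lemma L2F_iff:
  "L2F M W (- \<mu>) f \<longleftrightarrow> L2 NN (wt \<mu> f) \<and> (\<forall>t\<ge>0. f t \<in> borel_measurable (Ft t))"
  unfolding L2F_def L2_iff_nn adapted_jm_iff[of f \<mu>] using nn_wt[of \<mu> f] by auto

lemma cost_eq:
  assumes X: "L2 NN (wt (lam / 2) X)" and u: "L2 NN (wt (lam / 2) u)" and g: "0 < \<gamma>"
  shows "cost M lam \<gamma> u X = ennreal (1/2 * ((\<integral>z. (wt (lam / 2) X z)\<^sup>2 \<partial>NN) + (\<integral>z. (wt (lam / 2) u z)\<^sup>2 \<partial>NN) / \<gamma>))"
proof -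
  let ?F = "\<lambda>z. (wt (lam / 2) X z)\<^sup>2 + (wt (lam / 2) u z)\<^sup>2 / \<gamma>"
  note [measurable] = L2_measurable[OF X] L2_measurable[OF u]
  have i: "integrable NN ?F" using L2_integrable_sq[OF X] L2_integrable_sq[OF u] by auto
  have "(\<integral>\<^sup>+\<omega>. (\<integral>\<^sup>+t\<in>{0..}. ennreal (exp (-lam * t) * ((X t \<omega>)\<^sup>2 + (u t \<omega>)\<^sup>2 / \<gamma>)) \<partial>lborel) \<partial>M)
     = (\<integral>\<^sup>+\<omega>. (NL t. ennreal (?F (t, \<omega>))) \<partial>M)"
  proof (intro nn_integral_cong)
    fix t \<omega>
    have "(exp (- (lam / 2) * t))\<^sup>2 = exp (- lam * t)" by (simp add: exp_double[symmetric])
    then show "ennreal (exp (-lam * t) * ((X t \<omega>)\<^sup>2 + (u t \<omega>)\<^sup>2 / \<gamma>)) * indicator {0..} t = ennreal (?F (t, \<omega>))"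
      by (simp add: wt_pair indicator_def power_mult_distrib distrib_left)
  qed
  also have "\<dots> = (\<integral>\<^sup>+z. ennreal (?F z) \<partial>NN)"
    by (rule TM.nn_integral_snd) measurable
  also have "\<dots> = ennreal (\<integral>z. ?F z \<partial>NN)"
    using g by (intro nn_integral_eq_integral[OF i]) auto
  also have "(\<integral>z. ?F z \<partial>NN) = (\<integral>z. (wt (lam / 2) X z)\<^sup>2 \<partial>NN) + (\<integral>z. (wt (lam / 2) u z)\<^sup>2 \<partial>NN) / \<gamma>"
    using L2_integrable_sq[OF X] L2_integrable_sq[OF u] by simp
  finally have E: "(\<integral>\<^sup>+\<omega>. (\<integral>\<^sup>+t\<in>{0..}. ennreal (exp (-lam * t) * ((X t \<omega>)\<^sup>2 + (u t \<omega>)\<^sup>2 / \<gamma>)) \<partial>lborel) \<partial>M)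
    = ennreal ((\<integral>z. (wt (lam / 2) X z)\<^sup>2 \<partial>NN) + (\<integral>z. (wt (lam / 2) u z)\<^sup>2 \<partial>NN) / \<gamma>)" .
  show ?thesis unfolding cost_def E using g by (subst ennreal_mult[symmetric]) auto
qed

lemma L2F_lincomb:
  assumes "L2F M W (- \<mu>) f" "L2F M W (- \<mu>) g"
  shows "L2F M W (- \<mu>) (\<lambda>t \<omega>. f t \<omega> + a * g t \<omega>)"
  using assms unfolding L2F_iff wt_lincomb by (auto intro!: L2_add L2_cmult borel_measurable_add borel_measurable_times)

lemma L2F_det:
  assumes d: "Lw \<mu> d" shows "L2F M W (- \<mu>) (\<lambda>t \<omega>. d t)"
  unfolding L2F_iff L2_iff_nn
proof (intro conjI allI impI)
  note [measurable] = LwD(1)[OF d]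
  show m: "wt \<mu> (\<lambda>t \<omega>. d t) \<in> borel_measurable NN" unfolding wt_def[abs_def] by measurable
  have "(\<integral>\<^sup>+z. ennreal ((wt \<mu> (\<lambda>t \<omega>. d t) z)\<^sup>2) \<partial>NN) = (NL t. (\<integral>\<^sup>+\<omega>. ennreal ((wt \<mu> (\<lambda>t \<omega>. d t) (t, \<omega>))\<^sup>2) \<partial>M))"
    by (rule nn_integral_fst[symmetric]) (use m in measurable)
  also have "\<dots> = (NL t. ennreal ((exp (- \<mu> * t) * d t)\<^sup>2))"
    using LwD(2)[OF d] by (intro nn_integral_cong) (auto simp: wt_pair indicator_def emeasure_space_1 not_le)
  also have "\<dots> < \<infinity>" by (rule LwD(3)[OF d])
  finally show "(\<integral>\<^sup>+z. ennreal ((wt \<mu> (\<lambda>t \<omega>. d t) z)\<^sup>2) \<partial>NN) < \<infinity>" .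
qed auto

text \<open>By the isometry the second moment at t is the integral of q^2 over (0, t]. Exchanging
  the time integrals leaves the integral of e^(-2 \<mu> t) over [s, oo), that is e^(-2 \<mu> s) / (2
  \<mu>), times q(s)^2.\<close>

lemma L2F_Iq:
  assumes q: "Lw \<mu> q" and mu: "0 < \<mu>" shows "L2F M W (- \<mu>) (Iq q)"
  unfolding L2F_iff L2_iff_nn
proof (intro conjI allI impI)
  note [measurable] = LwD(1)[OF q] Iq_compose
  have lq: "locL2 q" by (rule Lw_locL2[OF q]) (use mu in auto)
  show m: "wt \<mu> (Iq q) \<in> borel_measurable NN" unfolding wt_def[abs_def] by measurable
  have "(\<integral>\<^sup>+z. ennreal ((wt \<mu> (Iq q) z)\<^sup>2) \<partial>NN) = (NL t. (\<integral>\<^sup>+\<omega>. ennreal ((wt \<mu> (Iq q) (t, \<omega>))\<^sup>2) \<partial>M))"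
    by (rule nn_integral_fst[symmetric]) (use m in measurable)
  also have "\<dots> = (NL t. (NL s. ennreal (indicator {s..} t * exp (- (2 * \<mu>) * t)) * ennreal (indicator {0<..} s * (q s)\<^sup>2)))"
  proof (intro nn_integral_cong)
    fix t :: real
    show "(\<integral>\<^sup>+\<omega>. ennreal ((wt \<mu> (Iq q) (t, \<omega>))\<^sup>2) \<partial>M) = (NL s. ennreal (indicator {s..} t * exp (- (2 * \<mu>) * t)) * ennreal (indicator {0<..} s * (q s)\<^sup>2))"
    proof (cases "0 \<le> t")
      case True
      have "(\<integral>\<^sup>+\<omega>. ennreal ((wt \<mu> (Iq q) (t, \<omega>))\<^sup>2) \<partial>M) = (\<integral>\<^sup>+\<omega>. ennreal (exp (- (2 * \<mu>) * t)) * ennreal ((Iq q t \<omega>)\<^sup>2) \<partial>M)"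
        using True by (intro nn_integral_cong) (simp add: wt_pair power_mult_distrib exp_double[symmetric] ennreal_mult mult.assoc)
      also have "\<dots> = ennreal (exp (- (2 * \<mu>) * t)) * (\<integral>\<^sup>+\<omega>. ennreal ((Iq q t \<omega>)\<^sup>2) \<partial>M)"
        by (rule nn_integral_cmult) measurable
      also have "(\<integral>\<^sup>+\<omega>. ennreal ((Iq q t \<omega>)\<^sup>2) \<partial>M) = (NL s. ennreal ((q s * indicator {0<..t} s)\<^sup>2))"
        using L2_nn_eq[OF Iq_L2[OF lq True]] L2_nn_eq[of lborel "\<lambda>s. q s * indicator {0<..t} s"] Iq_sq[OF lq True] lq
        by (simp add: locL2_def)
      also have "ennreal (exp (- (2 * \<mu>) * t)) * \<dots> = (NL s. ennreal (exp (- (2 * \<mu>) * t)) * ennreal ((q s * indicator {0<..t} s)\<^sup>2))"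
        by (rule nn_integral_cmult[symmetric]) measurable
      also have "\<dots> = (NL s. ennreal (indicator {s..} t * exp (- (2 * \<mu>) * t)) * ennreal (indicator {0<..} s * (q s)\<^sup>2))"
        by (intro nn_integral_cong) (auto simp: indicator_def)
      finally show ?thesis .
    next
      case False
      then have "(NL s. ennreal (indicator {s..} t * exp (- (2 * \<mu>) * t)) * ennreal (indicator {0<..} s * (q s)\<^sup>2)) = (NL (s::real). 0)"
        by (intro nn_integral_cong) (auto simp: indicator_def)
      then show ?thesis using False by (simp add: wt_pair)
    qed
  qed
  also have "\<dots> = (NL s. (NL t. ennreal (indicator {s..} t * exp (- (2 * \<mu>) * t)) * ennreal (indicator {0<..} s * (q s)\<^sup>2)))"
  proof (rule lborel_pair.Fubini'[symmetric])
    have "(\<lambda>z. ennreal ((if snd z \<le> fst z then 1 else 0) * exp (- (2 * \<mu>) * fst z)) * ennreal (indicator {0<..} (snd z) * (q (snd z))\<^sup>2)) \<in> borel_measurable (lborel \<Otimes>\<^sub>M lborel)"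
      by measurable
    also have "(\<lambda>z. ennreal ((if snd z \<le> fst z then 1 else 0) * exp (- (2 * \<mu>) * fst z)) * ennreal (indicator {0<..} (snd z) * (q (snd z))\<^sup>2))
      = (\<lambda>(t, s). ennreal (indicator {s..} t * exp (- (2 * \<mu>) * t)) * ennreal (indicator {0<..} s * (q s)\<^sup>2))"
      by (auto simp: fun_eq_iff indicator_def)
    finally show "(\<lambda>(t, s). ennreal (indicator {s..} t * exp (- (2 * \<mu>) * t)) * ennreal (indicator {0<..} s * (q s)\<^sup>2)) \<in> borel_measurable (lborel \<Otimes>\<^sub>M lborel)" .
  qed
  also have "\<dots> = (NL s. (NL t. ennreal (indicator {s..} t * exp (- (2 * \<mu>) * t))) * ennreal (indicator {0<..} s * (q s)\<^sup>2))"
    by (intro nn_integral_cong nn_integral_multc) measurable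
  also have "\<dots> \<le> (NL s. ennreal (1 / (2 * \<mu>)) * ennreal ((exp (- \<mu> * s) * q s)\<^sup>2))"
  proof (intro nn_integral_mono)
    fix s :: real
    have "(NL t. ennreal (indicator {s..} t * exp (- (2 * \<mu>) * t))) = (NL t. ennreal (exp (- (2 * \<mu>) * t)) * indicator {s..} t)"
      by (intro nn_integral_cong) (auto simp: indicator_def)
    also have "\<dots> = ennreal (0 - (- exp (- (2 * \<mu>) * s) / (2 * \<mu>)))"
    proof (rule nn_integral_FTC_atLeast)
      show "((\<lambda>t. - exp (- (2 * \<mu>) * t) / (2 * \<mu>)) \<longlongrightarrow> 0) at_top"
        using mu by (real_asymp)
      show "DERIV (\<lambda>t. - exp (- (2 * \<mu>) * t) / (2 * \<mu>)) x :> exp (- (2 * \<mu>) * x)" for x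
        using mu by (auto intro!: derivative_eq_intros)
    qed auto
    finally have "(NL t. ennreal (indicator {s..} t * exp (- (2 * \<mu>) * t))) = ennreal (exp (- (2 * \<mu>) * s) / (2 * \<mu>))" by simp
    then show "(NL t. ennreal (indicator {s..} t * exp (- (2 * \<mu>) * t))) * ennreal (indicator {0<..} s * (q s)\<^sup>2)
      \<le> ennreal (1 / (2 * \<mu>)) * ennreal ((exp (- \<mu> * s) * q s)\<^sup>2)"
      using mu by (simp add: ennreal_mult[symmetric] power_mult_distrib exp_double[symmetric] indicator_def mult.assoc)
  qed
  also have "\<dots> = ennreal (1 / (2 * \<mu>)) * (NL s. ennreal ((exp (- \<mu> * s) * q s)\<^sup>2))"
    by (rule nn_integral_cmult) measurable
  also have "\<dots> < \<infinity>" using LwD(3)[OF q] by (simp add: ennreal_mult_less_top)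
  finally show "(\<integral>\<^sup>+z. ennreal ((wt \<mu> (Iq q) z)\<^sup>2) \<partial>NN) < \<infinity>" .
qed (rule Iq_adapted)

lemma L2F_delayed:
  assumes X: "L2F M W (- \<mu>) X" and mu: "0 < \<mu>" and d: "0 \<le> \<delta>"
  shows "L2F M W (- \<mu>) (delayed x0 \<delta> X)"
  unfolding L2F_iff
proof (intro conjI allI impI)
  fix t :: real assume "0 \<le> t"
  show "delayed x0 \<delta> X t \<in> borel_measurable (Ft t)"
  proof (cases "t - \<delta> \<le> 0")
    case False
    then have "X (t - \<delta>) \<in> borel_measurable (Ft t)"
      using X d by (intro Ft_measurable_mono[of _ "t - \<delta>" t]) (auto simp: L2F_iff)
    then show ?thesis using False by (simp add: delayed_def[abs_def])
  qed (simp add: delayed_def[abs_def])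
next
  have L: "L2 NN (wt \<mu> X)" using X by (simp add: L2F_iff)
  note [measurable] = L2_measurable[OF L]
  have "(\<lambda>z. wt \<mu> X (fst z - \<delta>, snd z)) \<in> borel_measurable NN"
    by (rule measurable_compose[OF _ L2_measurable[OF L]]) measurable
  note [measurable] = this
  let ?S = "\<lambda>z. exp (- \<mu> * \<delta>) * (indicator {\<delta><..} (fst z) * wt \<mu> X (fst z - \<delta>, snd z))"
  \<comment> \<open>Constant history on [0, \<delta>], then the shifted process; moving the weight
    along with the shift costs the factor e^(-\<mu> \<delta>).\<close>
  have eq: "wt \<mu> (delayed x0 \<delta> X) = (\<lambda>z. x0 * (indicator {0..\<delta>} (fst z) * exp (- \<mu> * fst z)) + ?S z)"
  proof
    fix z :: "real \<times> 'a"
    have "exp (- \<mu> * fst z) = exp (- \<mu> * \<delta>) * exp (- \<mu> * (fst z - \<delta>))" by (simp add: exp_add[symmetric] algebra_simps)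
    then show "wt \<mu> (delayed x0 \<delta> X) z = x0 * (indicator {0..\<delta>} (fst z) * exp (- \<mu> * fst z)) + ?S z"
      using d by (auto simp: wt_def delayed_def indicator_def)
  qed
  have "L2 NN ?S"
  proof (rule L2_cmult)
    have "(\<integral>\<^sup>+z. ennreal ((indicator {\<delta><..} (fst z) * wt \<mu> X (fst z - \<delta>, snd z))\<^sup>2) \<partial>NN)
      \<le> (\<integral>\<^sup>+z. ennreal ((wt \<mu> X (fst z - \<delta>, snd z))\<^sup>2) \<partial>NN)"
      by (intro nn_integral_mono) (auto simp: indicator_def)
    also have "\<dots> = (\<integral>\<^sup>+\<omega>. (NL t. ennreal ((wt \<mu> X (- \<delta> + 1 * t, \<omega>))\<^sup>2)) \<partial>M)"
      by (subst TM.nn_integral_snd[symmetric]) (auto simp: algebra_simps)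
    also have "\<dots> = (\<integral>\<^sup>+\<omega>. (NL t. ennreal ((wt \<mu> X (t, \<omega>))\<^sup>2)) \<partial>M)"
    proof (rule nn_integral_cong)
      fix \<omega> assume w[measurable]: "\<omega> \<in> space M"
      have "(\<lambda>t. ennreal ((wt \<mu> X (t, \<omega>))\<^sup>2)) \<in> borel_measurable borel" by measurable
      from nn_integral_real_affine[OF this, of 1 "- \<delta>"]
      show "(NL t. ennreal ((wt \<mu> X (- \<delta> + 1 * t, \<omega>))\<^sup>2)) = (NL t. ennreal ((wt \<mu> X (t, \<omega>))\<^sup>2))" by simp
    qed
    also have "\<dots> = (\<integral>\<^sup>+z. ennreal ((wt \<mu> X z)\<^sup>2) \<partial>NN)" by (rule TM.nn_integral_snd) measurable
    also have "\<dots> < \<infinity>" using L by (simp add: L2_iff_nn)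
    finally show "L2 NN (\<lambda>z. indicator {\<delta><..} (fst z) * wt \<mu> X (fst z - \<delta>, snd z))"
      by (auto simp: L2_iff_nn)
  qed
  moreover have "L2 NN (\<lambda>z. indicator {0..\<delta>} (fst z) * exp (- \<mu> * fst z))"
  proof -
    have "L2 NN (wt \<mu> (\<lambda>t \<omega>. indicator {0..\<delta>} t))"
    proof -
      have "Lw \<mu> (indicator {0..\<delta>})"
        unfolding Lw_iff_L2
      proof (intro conjI)
        show "L2 lborel (\<lambda>t. exp (- \<mu> * t) * indicator {0..\<delta>} t)"
        proof (rule L2_bound)
          show "L2 lborel (indicator {0..\<delta>} :: real \<Rightarrow> real)"
          proof -
            have "(\<lambda>x. (indicator {0..\<delta>} x :: real)\<^sup>2) = indicator {0..\<delta>}" by (auto simp: indicator_def)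
            then show ?thesis unfolding L2_def using d by (auto intro!: integrable_real_indicator)
          qed
          show "AE t in lborel. \<bar>exp (- \<mu> * t) * indicator {0..\<delta>} t\<bar> \<le> \<bar>indicator {0..\<delta>} t\<bar>"
            using mu by (auto simp: indicator_def intro!: AE_I2)
        qed measurable
      qed (auto simp: indicator_def[abs_def])
      from L2F_det[OF this] show ?thesis by (simp add: L2F_iff)
    qed
    moreover have "wt \<mu> (\<lambda>t \<omega>. indicator {0..\<delta>} t) = (\<lambda>z. indicator {0..\<delta>} (fst z) * exp (- \<mu> * fst z))"
      by (auto simp: wt_def fun_eq_iff indicator_def)
    ultimately show ?thesis by simp
  qed
  ultimately show "L2 NN (wt \<mu> (delayed x0 \<delta> X))" unfolding eq by (rule L2_add[OF L2_cmult, rotated])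
qed

lemma L2F_cmult:
  assumes "L2F M W (- \<mu>) f" shows "L2F M W (- \<mu>) (\<lambda>t \<omega>. a * f t \<omega>)"
  using L2F_lincomb[OF assms assms, of "a - 1"] by (simp add: algebra_simps)

lemma Iq_lincomb:
  assumes p: "locL2 p" and q: "locL2 q" and t: "0 \<le> t"
  shows "AE \<omega> in M. Iq (\<lambda>s. p s + a * q s) t \<omega> = Iq p t \<omega> + a * Iq q t \<omega>"
  by (rule is_wi_unique[OF Iq_wi[OF locL2_lincomb[OF p q] t] is_wi_lincomb[OF Iq_wi[OF p t] Iq_wi[OF q t]]])
     (simp add: algebra_simps)

lemma is_wi_cmult: "is_wi f Y \<Longrightarrow> is_wi (\<lambda>s. a * f s) (\<lambda>\<omega>. a * Y \<omega>)"
  using is_wi_lincomb[of f Y f Y "a - 1"] by (simp add: algebra_simps)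

lemma L2F_AE_L2:
  assumes "L2F M W (- \<mu>) f"
  shows "AE \<omega> in M. L2 lborel (\<lambda>s. wt \<mu> f (s, \<omega>))"
proof -
  have L: "L2 NN (wt \<mu> f)" using assms by (simp add: L2F_iff)
  note [measurable] = L2_measurable[OF L]
  have "(\<lambda>(s, \<omega>). (wt \<mu> f (s, \<omega>))\<^sup>2) = (\<lambda>z. (wt \<mu> f z)\<^sup>2)" by auto
  then have "integrable NN (\<lambda>(s, \<omega>). (wt \<mu> f (s, \<omega>))\<^sup>2)" using L2_integrable_sq[OF L] by simp
  from MT.AE_integrable_fst'[OF TM.integrable_product_swap[OF this]]
  have "AE \<omega> in M. integrable lborel (\<lambda>s. (wt \<mu> f (s, \<omega>))\<^sup>2)" by simp
  then show ?thesis using AE_space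
  proof eventually_elim
    case (elim \<omega>)
    have [measurable]: "\<omega> \<in> space M" by fact
    have "(\<lambda>s. wt \<mu> f (s, \<omega>)) \<in> borel_measurable lborel" by measurable
    then show ?case using elim by (simp add: L2_def)
  qed
qed

text \<open>For a path that is square integrable with weight, both factors are square integrable on
  (0, t], so the convolution integral exists. This allows such integrals to be split for almost
  every path.\<close>

lemma L2_lborel_indicator_prod:
  assumes f: "L2 lborel (\<lambda>s. wt \<mu> F (s, \<omega>))" and g: "locL2 g" and g0: "\<And>s. s \<le> 0 \<Longrightarrow> g s = 0" and mu: "0 \<le> \<mu>" and t: "0 \<le> t"
  shows "integrable lborel (\<lambda>s. indicator {0..t} s * (g (t - s) * F s \<omega>))"
proof -
  have [measurable]: "g \<in> borel_measurable borel" using g by (simp add: locL2_def)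
  note [measurable] = L2_measurable[OF f]
  have "L2 lborel (\<lambda>s. exp (\<mu> * t) * (indicator {0..t} s * wt \<mu> F (s, \<omega>)))"
    by (intro L2_cmult L2_bound[OF f]) (auto simp: indicator_def)
  then have LF: "L2 lborel (\<lambda>s. indicator {0..t} s * F s \<omega>)"
  proof (rule L2_bound)
    have "(\<lambda>s. indicator {0..t} s * (exp (\<mu> * s) * wt \<mu> F (s, \<omega>))) \<in> borel_measurable lborel" by measurable
    also have "(\<lambda>s. indicator {0..t} s * (exp (\<mu> * s) * wt \<mu> F (s, \<omega>))) = (\<lambda>s. indicator {0..t} s * F s \<omega>)"
      by (auto simp: fun_eq_iff wt_pair indicator_def mult.assoc[symmetric] exp_add[symmetric])
    finally show "(\<lambda>s. indicator {0..t} s * F s \<omega>) \<in> borel_measurable lborel" .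
    show "AE s in lborel. \<bar>indicator {0..t} s * F s \<omega>\<bar> \<le> \<bar>exp (\<mu> * t) * (indicator {0..t} s * wt \<mu> F (s, \<omega>))\<bar>"
    proof (rule AE_I2)
      fix s
      have "\<bar>F s \<omega>\<bar> \<le> exp (\<mu> * t) * exp (- \<mu> * s) * \<bar>F s \<omega>\<bar>" if "s \<le> t"
      proof -
        have "exp (\<mu> * t) * exp (- \<mu> * s) = exp (\<mu> * (t - s))" by (simp add: exp_add[symmetric] algebra_simps)
        moreover have "1 \<le> exp (\<mu> * (t - s))" using mu that by simp
        ultimately show ?thesis using mult_right_mono[of 1 "exp (\<mu> * t) * exp (- \<mu> * s)" "\<bar>F s \<omega>\<bar>"] by simp
      qed
      then show "\<bar>indicator {0..t} s * F s \<omega>\<bar> \<le> \<bar>exp (\<mu> * t) * (indicator {0..t} s * wt \<mu> F (s, \<omega>))\<bar>"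
        by (auto simp: wt_pair indicator_def abs_mult mult.assoc)
    qed
  qed
  from L2_mult[OF locL2_conv(1)[OF g, of t] LF]
  have i: "integrable lborel (\<lambda>s. (indicator {0<..t} s * g (t - s)) * (indicator {0..t} s * F s \<omega>))" .
  have "AE s in lborel. s \<noteq> (0::real)" by (rule AE_lborel_singleton)
  then have "AE s in lborel. (indicator {0<..t} s * g (t - s)) * (indicator {0..t} s * F s \<omega>) = indicator {0..t} s * (g (t - s) * F s \<omega>)"
    by eventually_elim (auto simp: indicator_def)
  moreover have "(\<lambda>s. indicator {0..t} s * (g (t - s) * F s \<omega>)) \<in> borel_measurable lborel"
  proof -
    have "(\<lambda>s. g (t - s) * (indicator {0..t} s * F s \<omega>)) \<in> borel_measurable lborel"
      by (rule borel_measurable_times[OF _ L2_measurable[OF LF]]) measurable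
    then show ?thesis by (simp add: mult_ac)
  qed
  ultimately show ?thesis using i integrable_cong_AE[of "\<lambda>s. (indicator {0<..t} s * g (t - s)) * (indicator {0..t} s * F s \<omega>)" lborel "\<lambda>s. indicator {0..t} s * (g (t - s) * F s \<omega>)"]
    borel_measurable_integrable[OF i] by blast
qed

end

context lq begin

text \<open>The step sequence behind uniqueness of the noise term. Values at left endpoints of a
  uniform grid are used: for \<alpha> \<le> 1 the integrand increases in s, so the step values stay
  between 0 and the integrand. The error is dominated by the singular integrand itself, whose square
  is integrable, and it tends to zero off the endpoints.\<close>

lemma grid_steps:
  assumes t: "0 < t"
  defines "p \<equiv> \<lambda>k i. t * real i / real (Suc k)"
  defines "a \<equiv> \<lambda>k i. (t - p k i) powr (\<alpha> - 1)"
  shows "partition_of t (Suc k) (p k)"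
    and "(\<lambda>k. \<integral>\<^sup>+s\<in>{0..t}. ennreal (((t - s) powr (\<alpha> - 1) - step_fun (Suc k) (p k) (a k) s)\<^sup>2) \<partial>lborel) \<longlonglongrightarrow> 0"
proof -
  have p_mono: "p k i \<le> p k j" if "i \<le> j" for k i j
    unfolding p_def using that t by (intro divide_right_mono mult_left_mono) auto
  show part: "partition_of t (Suc k) (p k)" for k
  proof -
    have "p k i \<le> t" if "i \<le> Suc k" for i
      using p_mono[OF that, where k=k] t by (simp add: p_def)
    moreover have "0 \<le> p k i" for i using t by (simp add: p_def)
    moreover have "p k i \<le> p k (Suc i)" for i by (rule p_mono) simp
    ultimately show ?thesis by (auto simp: partition_of_def)
  qed
  have val: "\<exists>q. q < s \<and> s - t / real (Suc k) \<le> q \<and> 0 \<le> q \<and> step_fun (Suc k) (p k) (a k) s = (t - q) powr (\<alpha> - 1)"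
    if s: "0 < s" "s < t" for s k
  proof -
    \<comment> \<open>The cells (p i, p (i+1)] are closed on the right, so the cell of s is found by
      a ceiling minus one instead of a floor.\<close>
    define i where "i = nat (\<lceil>s * real (Suc k) / t\<rceil> - 1)"
    have pos: "0 < s * real (Suc k) / t" using s t by simp
    then have "1 \<le> \<lceil>s * real (Suc k) / t\<rceil>" by linarith
    then have ri: "real i = of_int \<lceil>s * real (Suc k) / t\<rceil> - 1" unfolding i_def by simp
    have "real i < s * real (Suc k) / t" "s * real (Suc k) / t \<le> real i + 1"
      unfolding ri using ceiling_correct[of "s * real (Suc k) / t"] by linarith+
    then have i1: "p k i < s" "s \<le> p k (Suc i)"
      unfolding p_def using t by (simp_all add: field_simps)
    have ik: "i < Suc k"
    proof (rule ccontr)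
      assume "\<not> i < Suc k"
      then have "p k (Suc k) \<le> p k i" by (intro p_mono) auto
      then show False using i1 s t by (simp add: p_def)
    qed
    have "step_fun (Suc k) (p k) (a k) s = (\<Sum>j<Suc k. if j = i then a k i else 0)"
      unfolding step_fun_def
    proof (intro sum.cong refl)
      fix j
      consider "j = i" | "Suc j \<le> i" | "Suc i \<le> j" by linarith
      then show "a k j * indicator {p k j<..p k (Suc j)} s = (if j = i then a k i else 0)"
      proof cases
        case 2 then show ?thesis using p_mono[of "Suc j" i k] i1 by (auto simp: indicator_def)
      next
        case 3 then show ?thesis using p_mono[of "Suc i" j k] i1 by (auto simp: indicator_def)
      qed (use i1 in \<open>auto simp: indicator_def\<close>)
    qed
    also have "\<dots> = a k i" using ik by (simp only: sum.delta finite_lessThan lessThan_iff if_True)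
    finally have "step_fun (Suc k) (p k) (a k) s = (t - p k i) powr (\<alpha> - 1)" by (simp add: a_def)
    moreover have "p k (Suc i) = p k i + t / real (Suc k)" by (simp only: p_def of_nat_Suc[of i] distrib_left add_divide_distrib mult_1_right add.commute)
    ultimately show ?thesis using i1 t by (intro exI[of _ "p k i"]) (auto simp: p_def)
  qed
  have st[measurable]: "step_fun n q d \<in> borel_measurable borel" for n q d
    unfolding step_fun_def[abs_def] by measurable
  have lim: "(\<lambda>k. step_fun (Suc k) (p k) (a k) s) \<longlonglongrightarrow> (t - s) powr (\<alpha> - 1)" if s: "0 < s" "s < t" for s
  proof -
    obtain q where q: "\<And>k. q k < s" "\<And>k. s - t / real (Suc k) \<le> q k" "\<And>k. step_fun (Suc k) (p k) (a k) s = (t - q k) powr (\<alpha> - 1)"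
      using val[OF s] by metis
    have "(\<lambda>k. s - t * inverse (real (Suc k))) \<longlonglongrightarrow> s - t * 0"
      by (intro tendsto_intros LIMSEQ_inverse_real_of_nat)
    then have "q \<longlonglongrightarrow> s"
      by (intro real_tendsto_sandwich[of "\<lambda>k. s - t * inverse (real (Suc k))" q _ "\<lambda>_. s"])
         (use q(2) less_imp_le[OF q(1)] in \<open>auto simp: divide_inverse intro!: always_eventually\<close>)
    then have "(\<lambda>k. (t - q k) powr (\<alpha> - 1)) \<longlonglongrightarrow> (t - s) powr (\<alpha> - 1)"
      using s by (intro tendsto_intros) auto
    then show ?thesis by (simp add: q(3))
  qed
  have bd: "\<bar>(t - s) powr (\<alpha> - 1) - step_fun (Suc k) (p k) (a k) s\<bar> \<le> (t - s) powr (\<alpha> - 1)" if s: "0 < s" "s < t" for s k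
  proof -
    obtain q where q: "q < s" "step_fun (Suc k) (p k) (a k) s = (t - q) powr (\<alpha> - 1)" using val[OF s] by metis
    have "(t - q) powr (\<alpha> - 1) \<le> (t - s) powr (\<alpha> - 1)"
      using q s \<alpha> by (intro powr_mono2') auto
    moreover have "0 \<le> (t - q) powr (\<alpha> - 1)" by simp
    ultimately show ?thesis unfolding q(2) by linarith
  qed
  have ae: "AE s in lborel. s \<noteq> 0 \<and> s \<noteq> t"
    using AE_lborel_singleton[of 0] AE_lborel_singleton[of t] by eventually_elim simp
  have "(\<lambda>k. \<integral>\<^sup>+s\<in>{0..t}. ennreal (((t - s) powr (\<alpha> - 1) - step_fun (Suc k) (p k) (a k) s)\<^sup>2) \<partial>lborel) \<longlonglongrightarrow> (NL (s::real). 0)"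
  proof (rule nn_integral_dominated_convergence[where w = "\<lambda>s. ennreal ((Gamma \<alpha>)\<^sup>2) * ennreal ((f0 (t + (-1) * s) * indicator {0<..t} (t + (-1) * s))\<^sup>2)"])
    show "AE s in lborel. ennreal (((t - s) powr (\<alpha> - 1) - step_fun (Suc k) (p k) (a k) s)\<^sup>2) * indicator {0..t} s
      \<le> ennreal ((Gamma \<alpha>)\<^sup>2) * ennreal ((f0 (t + (-1) * s) * indicator {0<..t} (t + (-1) * s))\<^sup>2)" for k
      using ae
    proof eventually_elim
      case (elim s)
      show ?case
      proof (cases "s \<in> {0..t}")
        case True
        then have s: "0 < s" "s < t" using elim by auto
        have "((t - s) powr (\<alpha> - 1) - step_fun (Suc k) (p k) (a k) s)\<^sup>2 \<le> ((t - s) powr (\<alpha> - 1))\<^sup>2"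
          using bd[OF s, of k] by (simp add: abs_le_square_iff[symmetric])
        then show ?thesis using s Gamma_pos by (auto simp: f0_def ennreal_mult[symmetric] power_divide intro!: ennreal_leI)
      qed simp
    qed
    show "AE s in lborel. (\<lambda>k. ennreal (((t - s) powr (\<alpha> - 1) - step_fun (Suc k) (p k) (a k) s)\<^sup>2) * indicator {0..t} s) \<longlonglongrightarrow> 0"
      using ae
    proof eventually_elim
      case (elim s)
      show ?case
      proof (cases "s \<in> {0..t}")
        case True
        then have s: "0 < s" "s < t" using elim by auto
        have "(\<lambda>k. ennreal (((t - s) powr (\<alpha> - 1) - step_fun (Suc k) (p k) (a k) s)\<^sup>2)) \<longlonglongrightarrow> ennreal (((t - s) powr (\<alpha> - 1) - (t - s) powr (\<alpha> - 1))\<^sup>2)"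
          by (intro tendsto_ennrealI tendsto_intros lim s)
        then show ?thesis using True by simp
      qed simp
    qed
    have l: "L2 lborel (\<lambda>s. f0 s * indicator {0<..t} s)"
    proof (rule L2_bound[OF L2_cmult[OF Lw_L2[OF Lw_f0[of 1]], of "exp t"]])
      show "AE s in lborel. \<bar>f0 s * indicator {0<..t} s\<bar> \<le> \<bar>exp t * (exp (- 1 * s) * f0 s)\<bar>"
      proof (rule AE_I2)
        fix s
        have "\<bar>f0 s\<bar> \<le> exp t * exp (- s) * \<bar>f0 s\<bar>" if "s \<le> t"
          using that by (simp add: exp_add[symmetric] mult_le_cancel_right1)
        then show "\<bar>f0 s * indicator {0<..t} s\<bar> \<le> \<bar>exp t * (exp (- 1 * s) * f0 s)\<bar>"
          by (auto simp: indicator_def abs_mult mult.assoc)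
      qed
    qed auto
    have "(NL s. ennreal ((Gamma \<alpha>)\<^sup>2) * ennreal ((f0 (t + (-1) * s) * indicator {0<..t} (t + (-1) * s))\<^sup>2))
      = ennreal ((Gamma \<alpha>)\<^sup>2) * (NL s. ennreal ((f0 (t + (-1) * s) * indicator {0<..t} (t + (-1) * s))\<^sup>2))"
      by (rule nn_integral_cmult) measurable
    also have "(NL s. ennreal ((f0 (t + (-1) * s) * indicator {0<..t} (t + (-1) * s))\<^sup>2)) = (NL s. ennreal ((f0 s * indicator {0<..t} s)\<^sup>2))"
      by (subst nn_integral_real_affine[where c="-1" and t=t, of "\<lambda>s. ennreal ((f0 s * indicator {0<..t} s)\<^sup>2)"]) auto
    finally show "(NL s. ennreal ((Gamma \<alpha>)\<^sup>2) * ennreal ((f0 (t + (-1) * s) * indicator {0<..t} (t + (-1) * s))\<^sup>2)) < \<infinity>"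
      using l by (simp add: L2_iff_nn ennreal_mult_less_top)
  qed measurable
  then show "(\<lambda>k. \<integral>\<^sup>+s\<in>{0..t}. ennreal (((t - s) powr (\<alpha> - 1) - step_fun (Suc k) (p k) (a k) s)\<^sup>2) \<partial>lborel) \<longlonglongrightarrow> 0" by simp
qed

end

subsection \<open>The candidate control and its state\<close>

locale lq_bm = lq b c \<gamma> \<alpha> \<delta> lam \<rho>t + bmotion M W
  for b c \<gamma> \<alpha> \<delta> lam \<rho>t :: real and M :: "'a measure" and W :: "real \<Rightarrow> 'a \<Rightarrow> real" +
  fixes x0 \<sigma> :: real
begin

lemma wiener_powr_unique:
  assumes t: "0 \<le> t" and w: "wiener_integral M W t (\<lambda>s. (t - s) powr (\<alpha> - 1)) Y" "wiener_integral M W t (\<lambda>s. (t - s) powr (\<alpha> - 1)) Z"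
  shows "AE \<omega> in M. Y \<omega> = Z \<omega>"
proof (cases "t = 0")
  case False
  then have t0: "0 < t" using t by auto
  show ?thesis by (rule wiener_integral_unique[OF w grid_steps(1)[OF t0] grid_steps(2)[OF t0]])
next
  case True
  \<comment> \<open>On the degenerate interval the step function with no steps at all has zero
    error, so a constant sequence will do.\<close>
  have "(\<integral>\<^sup>+s\<in>{0..t}. ennreal (((t - s) powr (\<alpha> - 1) - step_fun 0 (\<lambda>_. 0) (\<lambda>_. 0) s)\<^sup>2) \<partial>lborel) = (NL (s::real). 0)"
    using True by (intro nn_integral_cong) (auto simp: step_fun_def indicator_def)
  then show ?thesis
    using True by (intro wiener_integral_unique[OF w, of "\<lambda>_. 0" "\<lambda>_ _. 0" "\<lambda>_ _. 0"]) (auto simp: partition_of_def)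
qed

text \<open>Mean and Gaussian kernel of $\phi = b X(\cdot - \delta) + c u$ and of the state $X$.\<close>

definition "h_ker = sol (nrm f0 (\<lambda>t. f0 (t - \<delta>)))"
definition "p_ker t = f0 t + kop (kA 0) h_ker t"
definition "phi_det = sol (nrm (\<lambda>t. x0 * one t) (\<lambda>t. x0 * one t))"
definition "X_det t = x0 * one t + kop (kA 0) phi_det t"
definition "phi t \<omega> = phi_det t + \<sigma> * Iq h_ker t \<omega>"
definition "opt_X t \<omega> = X_det t + \<sigma> * Iq p_ker t \<omega>"
definition "opt_u t \<omega> = (phi t \<omega> - b * delayed x0 \<delta> opt_X t \<omega>) / c"

context
  fixes \<mu> assumes mu: "\<rho>t < \<mu>" "\<mu> \<le> lam / 2"
begin

lemma mu_range: "0 < \<mu>" "\<mu> < lam" using mu \<rho>t0 by auto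

lemma Lw_h_ker: "Lw \<mu> h_ker"
  unfolding h_ker_def by (intro Lw_sol Lw_nrm Lw_f0 Lw_shift mu mu_range \<delta>)

lemma Lw_p_ker: "Lw \<mu> p_ker"
  unfolding p_ker_def[abs_def] by (intro Lw_add Lw_f0 Lw_kop[OF schur_kA] Lw_h_ker mu_range)

lemma Lw_phi_det: "Lw \<mu> phi_det"
  unfolding phi_det_def by (intro Lw_sol Lw_nrm Lw_cmult Lw_one mu mu_range)

lemma Lw_X_det: "Lw \<mu> X_det"
  unfolding X_det_def[abs_def] by (intro Lw_add Lw_cmult Lw_one Lw_kop[OF schur_kA] Lw_phi_det mu_range)

lemma L2F_phi: "L2F M W (- \<mu>) phi"
  unfolding phi_def[abs_def] by (intro L2F_lincomb L2F_det L2F_Iq Lw_phi_det Lw_h_ker mu_range)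

lemma L2F_opt_X: "L2F M W (- \<mu>) opt_X"
  unfolding opt_X_def[abs_def] by (intro L2F_lincomb L2F_det L2F_Iq Lw_X_det Lw_p_ker mu_range)

lemma L2F_opt_u: "L2F M W (- \<mu>) opt_u"
proof -
  have "opt_u = (\<lambda>t \<omega>. (1/c) * phi t \<omega> + (- b / c) * delayed x0 \<delta> opt_X t \<omega>)"
    using c by (auto simp: opt_u_def fun_eq_iff field_simps)
  then show ?thesis by (simp only:) (intro L2F_lincomb L2F_cmult L2F_phi L2F_delayed L2F_opt_X mu_range \<delta>)
qed

end

lemma half_lam: "\<rho>t < lam / 2" "lam / 2 \<le> lam / 2" using lam by auto

lemma locL2_all: "locL2 f0" "locL2 h_ker" "locL2 p_ker" "locL2 phi_det" "locL2 (kop (kA 0) h_ker)"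
  using Lw_locL2[OF Lw_f0[OF mu_range(1)[OF half_lam]]] Lw_locL2[OF Lw_h_ker[OF half_lam]] Lw_locL2[OF Lw_p_ker[OF half_lam]]
    Lw_locL2[OF Lw_phi_det[OF half_lam]] Lw_locL2[OF Lw_kop[OF schur_kA Lw_h_ker[OF half_lam], of 0]] mu_range(1)[OF half_lam] by auto

lemma f0_le: "s \<le> 0 \<Longrightarrow> f0 s = 0" by (simp add: f0_def)

lemma kA_conv:
  assumes "0 \<le> t" shows "kop (kA 0) h t = (LBINT s. indicator {0..t} s * (f0 (t - s) * h s))"
  unfolding kop_def using assms
  by (intro bochner_cong) (auto simp: kA_def trans_ker_def indicator_def f0_le)

lemma powr_conv:
  assumes "0 \<le> t"
  shows "1 / Gamma \<alpha> * (\<integral>s\<in>{0..t}. (t - s) powr (\<alpha> - 1) * F s \<partial>lborel) = (LBINT s. indicator {0..t} s * (f0 (t - s) * F s))"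
proof -
  have "1 / Gamma \<alpha> * (\<integral>s\<in>{0..t}. (t - s) powr (\<alpha> - 1) * F s \<partial>lborel) = (LBINT s. 1 / Gamma \<alpha> * (indicator {0..t} s *\<^sub>R ((t - s) powr (\<alpha> - 1) * F s)))"
    unfolding set_lebesgue_integral_def by (rule integral_mult_right_zero[symmetric])
  also have "\<dots> = (LBINT s. indicator {0..t} s * (f0 (t - s) * F s))"
    by (intro bochner_cong) (auto simp: f0_def indicator_def)
  finally show ?thesis .
qed

lemma wiener_Iq_f0:
  assumes "0 \<le> t"
  shows "wiener_integral M W t (\<lambda>s. (t - s) powr (\<alpha> - 1)) (\<lambda>\<omega>. Gamma \<alpha> * Iq f0 t \<omega>)"
proof (rule is_wi_wiener_integral[OF is_wi_cmult[OF Iq_wi[OF locL2_all(1) assms]] assms])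
  have "AE s in lborel. s \<noteq> (0::real)" by (rule AE_lborel_singleton)
  then show "AE s in lborel. Gamma \<alpha> * (indicator {0<..t} s * f0 (t - s)) = indicator {0..t} s * (t - s) powr (\<alpha> - 1)"
    by eventually_elim (use Gamma_pos in \<open>auto simp: indicator_def f0_def\<close>)
qed measurable

text \<open>By definition \<open>p_ker\<close> is f0 + K \<open>h_ker\<close>. The stochastic Fubini
  theorem turns the stochastic convolution of K \<open>h_ker\<close> into K applied to the paths of
  that of \<open>h_ker\<close>, so noise plus drift recombine to x0 + K phi + \<sigma>
  I(f0).\<close>

lemma opt_X_equation:
  assumes t: "0 \<le> t"
  shows "AE \<omega> in M. opt_X t \<omega> = x0 + (LBINT s. indicator {0..t} s * (f0 (t - s) * phi s \<omega>)) + \<sigma> * Iq f0 t \<omega>"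
proof -
  have fi: "integrable lborel (\<lambda>s. f0 s * indicator {0<..t} s)"
  proof -
    have "integrable lborel (\<lambda>s. (f0 s * indicator {0<..t} s) * indicator {0<..t} s)"
      using locL2_all(1) by (intro L2_mult L2_indicator_Ioc) (auto simp: locL2_def simp del: indicator_simps)
    moreover have "(\<lambda>s. (f0 s * indicator {0<..t} s) * indicator {0<..t} s) = (\<lambda>s. f0 s * indicator {0<..t} s)"
      by (auto simp: fun_eq_iff indicator_def)
    ultimately show ?thesis by (simp only:)
  qed
  have h_ker0: "h_ker s = 0" if "s < 0" for s using LwD(2)[OF Lw_h_ker[OF half_lam] that] .
  have K: "kop (kA 0) h_ker \<tau> = (LBINT s. f0 (\<tau> - s) * h_ker s)" if "0 \<le> \<tau>" for \<tau>
    unfolding kop_def using that h_ker0 by (intro bochner_cong) (auto simp: kA_def trans_ker_def)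
  have SF1: "AE \<omega> in M. integrable lborel (\<lambda>s. indicator {0..t} s * (f0 (t - s) * Iq h_ker s \<omega>))"
    by (rule stochastic_fubini(1)[OF locL2_all(2) h_ker0 f0_measurable f0_le fi locL2_all(5) K t])
  have SF2: "AE \<omega> in M. Iq (kop (kA 0) h_ker) t \<omega> = (LBINT s. indicator {0..t} s * (f0 (t - s) * Iq h_ker s \<omega>))"
    by (rule stochastic_fubini(2)[OF locL2_all(2) h_ker0 f0_measurable f0_le fi locL2_all(5) K t])
  have pd: "integrable lborel (\<lambda>s. indicator {0..t} s * (f0 (t - s) * phi_det s))"
  proof -
    have "L2 lborel (\<lambda>s. wt (lam/2) (\<lambda>t \<omega>. phi_det t) (s, undefined))"
    proof -
      have "(\<lambda>s. wt (lam/2) (\<lambda>t \<omega>. phi_det t) (s, undefined)) = (\<lambda>s. exp (- (lam/2) * s) * phi_det s)"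
        using LwD(2)[OF Lw_phi_det[OF half_lam]] by (auto simp: fun_eq_iff wt_pair indicator_def not_le)
      then show ?thesis using Lw_L2[OF Lw_phi_det[OF half_lam]] by simp
    qed
    from L2_lborel_indicator_prod[OF this locL2_all(1) f0_le _ t] show ?thesis using mu_range(1)[OF half_lam] by simp
  qed
  have "AE \<omega> in M. Iq p_ker t \<omega> = Iq f0 t \<omega> + 1 * Iq (kop (kA 0) h_ker) t \<omega>"
    using Iq_lincomb[OF locL2_all(1) locL2_all(5) t, of 1] by (simp add: p_ker_def[abs_def])
  with SF1 SF2 show ?thesis
  proof eventually_elim
    case (elim \<omega>)
    have "(LBINT s. indicator {0..t} s * (f0 (t - s) * phi s \<omega>)) =
      (LBINT s. indicator {0..t} s * (f0 (t - s) * phi_det s) + \<sigma> * (indicator {0..t} s * (f0 (t - s) * Iq h_ker s \<omega>)))"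
      by (intro bochner_cong) (auto simp: phi_def algebra_simps)
    also have "\<dots> = kop (kA 0) phi_det t + \<sigma> * Iq (kop (kA 0) h_ker) t \<omega>"
      using pd elim by (simp add: kA_conv[OF t])
    finally show ?case using elim t by (simp add: opt_X_def X_det_def one_def algebra_simps)
  qed
qed

lemma phi_opt_u: "b * delayed x0 \<delta> opt_X s \<omega> + c * opt_u s \<omega> = phi s \<omega>"
  using c by (simp add: opt_u_def)

lemma is_state_opt_u:
  assumes mu: "\<rho>t < \<mu>" "\<mu> \<le> lam / 2"
  shows "is_state M W x0 b c \<sigma> \<alpha> \<delta> \<mu> opt_u opt_X"
  unfolding is_state_def
proof (intro conjI allI impI L2F_opt_X mu)
  fix t :: real assume t: "0 \<le> t"
  show "\<exists>Y. wiener_integral M W t (\<lambda>s. (t - s) powr (\<alpha> - 1)) Y \<and>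
        (AE \<omega> in M. opt_X t \<omega> = x0
            + 1 / Gamma \<alpha> * (\<integral>s\<in>{0..t}. (t - s) powr (\<alpha> - 1)
                   * (b * delayed x0 \<delta> opt_X s \<omega> + c * opt_u s \<omega>) \<partial>lborel)
            + \<sigma> / Gamma \<alpha> * Y \<omega>)"
    unfolding phi_opt_u powr_conv[OF t]
    using wiener_Iq_f0[OF t] opt_X_equation[OF t] Gamma_pos by (intro exI conjI) auto
qed

end

subsection \<open>The first-order condition\<close>

lemma AE_reflect:
  assumes "AE x in lborel. P x"
  shows "AE x in lborel. P (s - x :: real)"
proof -
  obtain N where N: "N \<in> null_sets lborel" "{x \<in> space lborel. \<not> P x} \<subseteq> N"
    using assms unfolding eventually_ae_filter by auto
  have [measurable]: "N \<in> sets borel" using N(1) by auto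
  have "AE x in lborel. x \<notin> N" by (rule AE_not_in[OF N(1)])
  then have "AE x in lborel. s + (-1) * x \<notin> N"
    by (intro AE_borel_affine[where P = "\<lambda>x. x \<notin> N"]) auto
  then show ?thesis by eventually_elim (use N(2) in auto)
qed

lemma abs_mult_le_sq: "\<bar>a * b\<bar> \<le> a\<^sup>2 + b\<^sup>2" for a b :: real
proof -
  have "2 * (\<bar>a\<bar> * \<bar>b\<bar>) \<le> a\<^sup>2 + b\<^sup>2" using sum_squares_bound[of "\<bar>a\<bar>" "\<bar>b\<bar>"] by simp
  moreover have "0 \<le> \<bar>a\<bar> * \<bar>b\<bar>" by simp
  ultimately show ?thesis unfolding abs_mult by linarith
qed

context lq_bm
begin

abbreviation "w0 \<equiv> wt (lam / 2)"

lemma lam_pos: "0 < lam" "0 < lam / 2" "lam / 2 < lam" using lam \<rho>t0 by auto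

lemma kA_kB:
  assumes "0 \<le> s" "0 \<le> t"
  shows "exp (- lam * t) * kA d t s = exp (- lam * s) * kB d s t"
proof -
  have "exp (- lam * t) = exp (- lam * s) * exp (lam * (s - t))" by (simp add: exp_add[symmetric] algebra_simps)
  then show ?thesis using assms by (simp add: kA_def kB_def trans_ker_def)
qed

lemma kB_measurable:
  "f \<in> borel_measurable N \<Longrightarrow> g \<in> borel_measurable N \<Longrightarrow> (\<lambda>x. kB d (f x) (g x)) \<in> borel_measurable N"
  using schur_measurable[OF schur_kB[OF lam_pos(3)]] .

lemma kA_measurable:
  "f \<in> borel_measurable N \<Longrightarrow> g \<in> borel_measurable N \<Longrightarrow> (\<lambda>x. kA d (f x) (g x)) \<in> borel_measurable N"
  using schur_measurable[OF schur_kA[OF lam_pos(2)]] .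

text \<open>The expectation of $\psi(s)$ times the adjoint operator $K^* S_d^*$ applied to $Y$ at time $s$.\<close>

definition adj_pair :: "real \<Rightarrow> (real \<Rightarrow> 'a \<Rightarrow> real) \<Rightarrow> (real \<Rightarrow> 'a \<Rightarrow> real) \<Rightarrow> real \<Rightarrow> real" where
  "adj_pair d Y \<psi> s = (\<integral>z. kB d s (fst z) * (Y (fst z) (snd z) * \<psi> s (snd z)) \<partial>NN)"

sublocale NT: pair_sigma_finite NN "lborel :: real measure" ..

sublocale TN: pair_sigma_finite "lborel :: real measure" NN ..

text \<open>Adjointness of the delayed fractional integral in the discounted space, in expectation.
  The adjoint of a process looks into the future and is not adapted; it is therefore never formed as
  a process, and only its pairing with \<psi> at each time s occurs.\<close>

lemma pairing:
  assumes Y: "L2 NN (w0 Y)" and psi: "L2 NN (w0 \<psi>)"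
  shows "AE s in lborel. 0 \<le> s \<longrightarrow> integrable NN (\<lambda>z. kB d s (fst z) * (Y (fst z) (snd z) * \<psi> s (snd z)))"
    and "integrable lborel (\<lambda>s. indicator {0..} s * exp (- lam * s) * adj_pair d Y \<psi> s)"
    and "(\<integral>z. w0 Y z * w0 (\<lambda>t \<omega>. LBINT s. kA d t s * \<psi> s \<omega>) z \<partial>NN) = (LBINT s. indicator {0..} s * exp (- lam * s) * adj_pair d Y \<psi> s)"
    and "w0 (\<lambda>t \<omega>. LBINT s. kA d t s * \<psi> s \<omega>) \<in> borel_measurable NN"
proof -
  note [measurable] = L2_measurable[OF Y] L2_measurable[OF psi] kA_measurable
  define Wk where "Wk t s = exp (- (lam/2) * (t - s)) * kA d t s" for t s
  define C where "C = exp (- (lam/2) * d) * (lam/2) powr (- \<alpha>)"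
  have sA: "schur (lam/2) C (kA d)" unfolding C_def by (rule schur_kA[OF lam_pos(2)])
  have kA0: "0 \<le> kA d t s" for t s by (simp add: kA_def trans_ker_def f0_nonneg)
  have Wk0: "0 \<le> Wk t s" for t s unfolding Wk_def using kA0 by simp
  have W1: "(NL s. ennreal (Wk t s)) \<le> ennreal C" for t
    using schurD(5)[OF sA, of t] kA0 by (simp add: Wk_def)
  have W2: "(NL t. ennreal (Wk t s)) \<le> ennreal C" for s
    using schurD(6)[OF sA, of s] kA0 by (simp add: Wk_def)
  have Wm: "(\<lambda>x. Wk (f x) (g x)) \<in> borel_measurable N" if [measurable]: "f \<in> borel_measurable N" "g \<in> borel_measurable N" for f g N
    unfolding Wk_def by measurable
  note [measurable] = Wm
  \<comment> \<open>The discount e^(-lam t) is shared out as e^(-lam t / 2) on Y, e^(-lam (t - s) /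
    2) on the kernel and e^(-lam s / 2) on \<psi>. The kernel then satisfies the Schur bounds for
    the weight lam / 2, and the other two factors are in L2.\<close>
  define G where "G z s = w0 Y z * (Wk (fst z) s * w0 \<psi> (s, snd z))" for z s
  have psm: "(\<lambda>x. w0 \<psi> (f x, g x)) \<in> borel_measurable N" if "f \<in> borel_measurable N" "g \<in> measurable N M" for f g N
    using measurable_compose[OF measurable_Pair[OF _ that(2)] L2_measurable[OF psi]] that(1) by simp
  note [measurable] = psm
  have Gm: "case_prod G \<in> borel_measurable (NN \<Otimes>\<^sub>M lborel)"
    unfolding G_def case_prod_beta by measurable
  have fin: "(\<integral>\<^sup>+z. (NL s. ennreal \<bar>G z s\<bar>) \<partial>NN) < \<infinity>"
  proof -
    have "(\<integral>\<^sup>+z. (NL s. ennreal \<bar>G z s\<bar>) \<partial>NN)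
      \<le> (\<integral>\<^sup>+z. (NL s. ennreal (Wk (fst z) s) * ennreal ((w0 Y z)\<^sup>2) + ennreal (Wk (fst z) s) * ennreal ((w0 \<psi> (s, snd z))\<^sup>2)) \<partial>NN)"
    proof (intro nn_integral_mono)
      fix z :: "real \<times> 'a" and s :: real
      have "\<bar>G z s\<bar> = Wk (fst z) s * \<bar>w0 Y z * w0 \<psi> (s, snd z)\<bar>" unfolding G_def using Wk0[of "fst z" s] by (simp add: abs_mult)
      also have "\<dots> \<le> Wk (fst z) s * ((w0 Y z)\<^sup>2 + (w0 \<psi> (s, snd z))\<^sup>2)" by (intro mult_left_mono abs_mult_le_sq Wk0)
      finally have "ennreal \<bar>G z s\<bar> \<le> ennreal (Wk (fst z) s * (w0 Y z)\<^sup>2 + Wk (fst z) s * (w0 \<psi> (s, snd z))\<^sup>2)"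
        by (intro ennreal_leI) (simp add: distrib_left)
      then show "ennreal \<bar>G z s\<bar> \<le> ennreal (Wk (fst z) s) * ennreal ((w0 Y z)\<^sup>2) + ennreal (Wk (fst z) s) * ennreal ((w0 \<psi> (s, snd z))\<^sup>2)"
        using Wk0[of "fst z" s] by (simp add: ennreal_mult)
    qed
    also have "\<dots> = (\<integral>\<^sup>+z. (NL s. ennreal (Wk (fst z) s) * ennreal ((w0 Y z)\<^sup>2)) + (NL s. ennreal (Wk (fst z) s) * ennreal ((w0 \<psi> (s, snd z))\<^sup>2)) \<partial>NN)"
      by (intro nn_integral_cong nn_integral_add) measurable
    also have "\<dots> = (\<integral>\<^sup>+z. (NL s. ennreal (Wk (fst z) s) * ennreal ((w0 Y z)\<^sup>2)) \<partial>NN) + (\<integral>\<^sup>+z. (NL s. ennreal (Wk (fst z) s) * ennreal ((w0 \<psi> (s, snd z))\<^sup>2)) \<partial>NN)"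
      by (intro nn_integral_add) measurable
    also have "(\<integral>\<^sup>+z. (NL s. ennreal (Wk (fst z) s) * ennreal ((w0 Y z)\<^sup>2)) \<partial>NN) = (\<integral>\<^sup>+z. (NL s. ennreal (Wk (fst z) s)) * ennreal ((w0 Y z)\<^sup>2) \<partial>NN)"
      by (intro nn_integral_cong nn_integral_multc) measurable
    also have "\<dots> \<le> (\<integral>\<^sup>+z. ennreal C * ennreal ((w0 Y z)\<^sup>2) \<partial>NN)"
      by (intro nn_integral_mono mult_right_mono W1) auto
    also have "\<dots> = ennreal C * (\<integral>\<^sup>+z. ennreal ((w0 Y z)\<^sup>2) \<partial>NN)" by (rule nn_integral_cmult) measurable
    also have "(\<integral>\<^sup>+z. (NL s. ennreal (Wk (fst z) s) * ennreal ((w0 \<psi> (s, snd z))\<^sup>2)) \<partial>NN)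
      = (\<integral>\<^sup>+\<omega>. (NL t. (NL s. ennreal (Wk t s) * ennreal ((w0 \<psi> (s, \<omega>))\<^sup>2))) \<partial>M)"
      by (subst TM.nn_integral_snd[symmetric]) auto
    also have "\<dots> \<le> (\<integral>\<^sup>+\<omega>. ennreal C * (NL s. ennreal ((w0 \<psi> (s, \<omega>))\<^sup>2)) \<partial>M)"
    proof (rule nn_integral_mono)
      fix \<omega> assume [measurable]: "\<omega> \<in> space M"
      have "(NL t. (NL s. ennreal (Wk t s) * ennreal ((w0 \<psi> (s, \<omega>))\<^sup>2))) = (NL s. (NL t. ennreal (Wk t s) * ennreal ((w0 \<psi> (s, \<omega>))\<^sup>2)))"
        by (rule lborel_pair.Fubini') measurable
      also have "\<dots> = (NL s. (NL t. ennreal (Wk t s)) * ennreal ((w0 \<psi> (s, \<omega>))\<^sup>2))"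
        by (intro nn_integral_cong nn_integral_multc) measurable
      also have "\<dots> \<le> (NL s. ennreal C * ennreal ((w0 \<psi> (s, \<omega>))\<^sup>2))"
        by (intro nn_integral_mono mult_right_mono W2) auto
      also have "\<dots> = ennreal C * (NL s. ennreal ((w0 \<psi> (s, \<omega>))\<^sup>2))" by (rule nn_integral_cmult) measurable
      finally show "(NL t. (NL s. ennreal (Wk t s) * ennreal ((w0 \<psi> (s, \<omega>))\<^sup>2))) \<le> ennreal C * (NL s. ennreal ((w0 \<psi> (s, \<omega>))\<^sup>2))" .
    qed
    also have "\<dots> = ennreal C * (\<integral>\<^sup>+\<omega>. (NL s. ennreal ((w0 \<psi> (s, \<omega>))\<^sup>2)) \<partial>M)" by (rule nn_integral_cmult) measurable
    also have "(\<integral>\<^sup>+\<omega>. (NL s. ennreal ((w0 \<psi> (s, \<omega>))\<^sup>2)) \<partial>M) = (\<integral>\<^sup>+z. ennreal ((w0 \<psi> z)\<^sup>2) \<partial>NN)"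
      by (rule TM.nn_integral_snd) measurable
    also have "ennreal C * (\<integral>\<^sup>+z. ennreal ((w0 Y z)\<^sup>2) \<partial>NN) + ennreal C * (\<integral>\<^sup>+z. ennreal ((w0 \<psi> z)\<^sup>2) \<partial>NN) < \<infinity>"
      using Y psi by (simp add: L2_iff_nn ennreal_mult_less_top)
    finally show ?thesis by (simp add: add_mono)
  qed
  have Gi: "integrable (NN \<Otimes>\<^sub>M lborel) (case_prod G)" and Gswap: "(LBINT s. (\<integral>z. G z s \<partial>NN)) = (\<integral>z. (LBINT s. G z s) \<partial>NN)"
    using NT.fubini_abs[OF Gm fin] by auto
  have Gi2: "integrable (lborel \<Otimes>\<^sub>M NN) (\<lambda>(s, z). G z s)"
    using NT.integrable_product_swap[OF Gi] by simp
  have G1: "G z s = exp (- lam * s) * (kB d s (fst z) * (Y (fst z) (snd z) * \<psi> s (snd z)))" if s: "0 \<le> s" for z s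
  proof (cases "0 \<le> fst z")
    case True
    have "exp (- (lam/2) * fst z) * Wk (fst z) s * exp (- (lam/2) * s) = exp (- lam * fst z) * kA d (fst z) s"
    proof -
      have "exp (- lam * fst z) = exp (- (lam/2) * fst z) * exp (- (lam/2) * (fst z - s)) * exp (- (lam/2) * s)"
        by (simp add: exp_add[symmetric] field_simps)
      then show ?thesis by (simp add: Wk_def)
    qed
    then have "G z s = exp (- lam * fst z) * kA d (fst z) s * (Y (fst z) (snd z) * \<psi> s (snd z))"
      using True s by (simp add: G_def wt_def)
    then show ?thesis using kA_kB[OF s True, of d] by simp
  next
    case False
    then show ?thesis by (simp add: G_def wt_def kB_def trans_ker_def)
  qed
  have G2: "G z s = 0" if "\<not> 0 \<le> s" for z s using that by (simp add: G_def wt_def)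
  have GJ: "(\<integral>z. G z s \<partial>NN) = indicator {0..} s * exp (- lam * s) * adj_pair d Y \<psi> s" for s
    using G1[of s] G2[of s] unfolding adj_pair_def by (cases "0 \<le> s") simp_all
  have "AE s in lborel. integrable NN (\<lambda>z. G z s)"
    using TN.AE_integrable_fst'[OF Gi2] by simp
  then show "AE s in lborel. 0 \<le> s \<longrightarrow> integrable NN (\<lambda>z. kB d s (fst z) * (Y (fst z) (snd z) * \<psi> s (snd z)))"
  proof eventually_elim
    case (elim s)
    show ?case
    proof
      assume s: "0 \<le> s"
      have "integrable NN (\<lambda>z. exp (lam * s) * G z s)" using elim by simp
      then show "integrable NN (\<lambda>z. kB d s (fst z) * (Y (fst z) (snd z) * \<psi> s (snd z)))"
        by (simp add: G1[OF s] mult.assoc[symmetric] exp_add[symmetric])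
    qed
  qed
  show "integrable lborel (\<lambda>s. indicator {0..} s * exp (- lam * s) * adj_pair d Y \<psi> s)"
    using TN.integrable_fst'[OF Gi2] by (simp add: GJ)
  have G3: "(LBINT s. G z s) = w0 Y z * w0 (\<lambda>t \<omega>. LBINT s. kA d t s * \<psi> s \<omega>) z" for z
  proof -
    have "(LBINT s. G z s) = (LBINT s. w0 Y z * (exp (- (lam/2) * fst z) * (kA d (fst z) s * \<psi> s (snd z))))"
    proof (intro bochner_cong refl)
      fix s
      have "Wk (fst z) s * w0 \<psi> (s, snd z) = exp (- (lam/2) * fst z) * (kA d (fst z) s * \<psi> s (snd z))"
      proof (cases "0 \<le> s")
        case True
        have "exp (- (lam/2) * fst z) = exp (- (lam/2) * (fst z - s)) * exp (- (lam/2) * s)"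
          by (simp add: exp_add[symmetric] field_simps)
        then show ?thesis using True by (simp add: Wk_def wt_pair)
      qed (simp add: wt_pair kA_def trans_ker_def)
      then show "G z s = w0 Y z * (exp (- (lam/2) * fst z) * (kA d (fst z) s * \<psi> s (snd z)))" by (simp add: G_def)
    qed
    also have "\<dots> = w0 Y z * w0 (\<lambda>t \<omega>. LBINT s. kA d t s * \<psi> s \<omega>) z"
      by (cases "0 \<le> fst z") (simp_all add: wt_def)
    finally show ?thesis .
  qed
  show "(\<integral>z. w0 Y z * w0 (\<lambda>t \<omega>. LBINT s. kA d t s * \<psi> s \<omega>) z \<partial>NN) = (LBINT s. indicator {0..} s * exp (- lam * s) * adj_pair d Y \<psi> s)"
    using Gswap unfolding G3 GJ by simp
  have "(\<lambda>z. indicator {0..} (fst z) * exp (- (lam/2) * fst z) * (LBINT s. kA d (fst z) s * (exp ((lam/2) * s) * w0 \<psi> (s, snd z)))) \<in> borel_measurable NN"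
    by measurable
  also have "(\<lambda>z. indicator {0..} (fst z) * exp (- (lam/2) * fst z) * (LBINT s. kA d (fst z) s * (exp ((lam/2) * s) * w0 \<psi> (s, snd z)))) = w0 (\<lambda>t \<omega>. LBINT s. kA d t s * \<psi> s \<omega>)"
  proof
    fix z :: "real \<times> 'a"
    have "(LBINT s. kA d (fst z) s * (exp ((lam/2) * s) * w0 \<psi> (s, snd z))) = (LBINT s. kA d (fst z) s * \<psi> s (snd z))"
    proof (intro bochner_cong refl)
      fix s show "kA d (fst z) s * (exp ((lam/2) * s) * w0 \<psi> (s, snd z)) = kA d (fst z) s * \<psi> s (snd z)"
        by (cases "0 \<le> s") (auto simp: wt_pair kA_def trans_ker_def mult.assoc[symmetric] exp_add[symmetric])
    qed
    then show "indicator {0..} (fst z) * exp (- (lam/2) * fst z) * (LBINT s. kA d (fst z) s * (exp ((lam/2) * s) * w0 \<psi> (s, snd z))) = w0 (\<lambda>t \<omega>. LBINT s. kA d t s * \<psi> s \<omega>) z"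
      by (simp add: wt_def)
  qed
  finally show "w0 (\<lambda>t \<omega>. LBINT s. kA d t s * \<psi> s \<omega>) \<in> borel_measurable NN" .
qed

text \<open>\<open>kB\<close> only connects s with times after s \<ge> \<theta>, so nothing is lost
  when time is restarted at \<theta>. Hence the equation on [\<theta>, oo) is the half-line equation
  again.\<close>

lemma kB_translate:
  assumes d: "0 \<le> d" and th: "0 < \<theta>" "\<theta> \<le> s"
  shows "kB d s t = kB d (s - \<theta>) (t - \<theta>)"
proof (cases "\<theta> \<le> t")
  case True then show ?thesis using th by (simp add: kB_def trans_ker_def)
next
  case False
  then have "f0 (- (s - t) - d) = 0" using th d by (intro f0_le) auto
  then show ?thesis using False th by (simp add: kB_def trans_ker_def)
qed

text \<open>Exchanging the integrals and restarting time at the noise time \<theta> moves the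
  adjoint from the process onto its convolution kernel q, evaluated at the age s - \<theta> of the
  noise. Absolute integrability comes from the same computation for |q|.\<close>

lemma density_swap:
  assumes d: "0 \<le> d" and q: "Lw (lam/2) q" and m: "L2 lborel m" and s: "0 \<le> s"
  shows "integrable lborel (\<lambda>t. LBINT \<theta>. kB d s t * (indicator {0<..s} \<theta> * q (t - \<theta>) * m \<theta>))"
    and "(LBINT t. (LBINT \<theta>. kB d s t * (indicator {0<..s} \<theta> * q (t - \<theta>) * m \<theta>)))
       = (LBINT \<theta>. indicator {0<..s} \<theta> * kop (kB d) q (s - \<theta>) * m \<theta>)"
proof -
  have [measurable]: "q \<in> borel_measurable borel" "m \<in> borel_measurable borel" using LwD(1)[OF q] L2_measurable[OF m] by auto
  note [measurable] = kB_measurable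
  define H where "H t \<theta> = kB d s t * (indicator {0<..s} \<theta> * q (t - \<theta>) * m \<theta>)" for t \<theta>
  have Hm: "case_prod H \<in> borel_measurable (lborel \<Otimes>\<^sub>M lborel)" unfolding H_def case_prod_beta by measurable
  have qa: "Lw (lam/2) (\<lambda>t. \<bar>q t\<bar>)"
    using q by (auto simp: Lw_def power_mult_distrib)
  note sB = schur_kB[OF lam_pos(3), of d]
  have Ql: "locL2 (kop (kB d) (\<lambda>t. \<bar>q t\<bar>))" by (rule Lw_locL2[OF Lw_kop[OF sB qa]]) (use lam_pos in auto)
  have tr: "(NL t. ennreal \<bar>H t \<theta>\<bar>) = ennreal \<bar>indicator {0<..s} \<theta> * m \<theta>\<bar> * (NL r. ennreal \<bar>kB d (s - \<theta>) r * q r\<bar>)" for \<theta>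
  proof (cases "\<theta> \<in> {0<..s}")
    case True
    have "(NL t. ennreal \<bar>H t \<theta>\<bar>) = (NL t. ennreal \<bar>indicator {0<..s} \<theta> * m \<theta>\<bar> * ennreal \<bar>kB d (s - \<theta>) (- \<theta> + 1 * t) * q (- \<theta> + 1 * t)\<bar>)"
      using True kB_translate[OF d, of \<theta> s] by (intro nn_integral_cong) (simp add: H_def ennreal_mult[symmetric] abs_mult mult_ac)
    also have "\<dots> = ennreal \<bar>indicator {0<..s} \<theta> * m \<theta>\<bar> * (NL t. ennreal \<bar>kB d (s - \<theta>) (- \<theta> + 1 * t) * q (- \<theta> + 1 * t)\<bar>)"
      by (rule nn_integral_cmult) measurable
    also have "(NL t. ennreal \<bar>kB d (s - \<theta>) (- \<theta> + 1 * t) * q (- \<theta> + 1 * t)\<bar>) = (NL r. ennreal \<bar>kB d (s - \<theta>) r * q r\<bar>)"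
      by (subst nn_integral_real_affine[where c=1 and t="- \<theta>", of "\<lambda>r. ennreal \<bar>kB d (s - \<theta>) r * q r\<bar>"]) auto
    finally show ?thesis .
  qed (simp add: H_def)
  have ae: "AE \<theta> in lborel. (NL r. ennreal \<bar>kB d (s - \<theta>) r * q r\<bar>) = ennreal (kop (kB d) (\<lambda>t. \<bar>q t\<bar>) (s - \<theta>))"
    using AE_reflect[OF kop_AE_integrable[OF sB qa], of s]
  proof eventually_elim
    case (elim \<theta>)
    have kB0: "0 \<le> kB d (s - \<theta>) r" for r by (simp add: kB_def trans_ker_def f0_nonneg)
    have "(NL r. ennreal \<bar>kB d (s - \<theta>) r * q r\<bar>) = (NL r. ennreal (kB d (s - \<theta>) r * \<bar>q r\<bar>))"
      using kB0 by (simp add: abs_mult)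
    also have "\<dots> = ennreal (LBINT r. kB d (s - \<theta>) r * \<bar>q r\<bar>)"
      using kB0 by (intro nn_integral_eq_integral elim) auto
    finally show ?case by (simp add: kop_def)
  qed
  have Q0: "0 \<le> kop (kB d) (\<lambda>t. \<bar>q t\<bar>) x" for x unfolding kop_def by (intro Bochner_Integration.integral_nonneg) (simp add: kB_def trans_ker_def f0_nonneg)
  have fin: "(NL t. NL \<theta>. ennreal \<bar>H t \<theta>\<bar>) < \<infinity>"
  proof -
    have "(NL t. NL \<theta>. ennreal \<bar>H t \<theta>\<bar>) = (NL \<theta>. NL t. ennreal \<bar>H t \<theta>\<bar>)"
    proof (rule lborel_pair.Fubini'[symmetric])
      show "(\<lambda>(t, \<theta>). ennreal \<bar>H t \<theta>\<bar>) \<in> borel_measurable (lborel \<Otimes>\<^sub>M lborel)" using Hm by (simp add: case_prod_beta)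
    qed
    also have "\<dots> = (NL \<theta>. ennreal (norm ((indicator {0<..s} \<theta> * kop (kB d) (\<lambda>t. \<bar>q t\<bar>) (s - \<theta>)) * m \<theta>)))"
      unfolding tr using ae
      by (intro nn_integral_cong_AE, eventually_elim) (use Q0 in \<open>simp add: ennreal_mult[symmetric] abs_mult mult_ac\<close>)
    also have "\<dots> < \<infinity>"
      using L2_mult[OF locL2_conv(1)[OF Ql, of s] m] by (simp add: integrable_iff_bounded)
    finally show ?thesis .
  qed
  have Hi: "integrable (lborel \<Otimes>\<^sub>M lborel) (case_prod H)" by (rule lborel_pair.fubini_abs(1)[OF Hm fin])
  show "integrable lborel (\<lambda>t. LBINT \<theta>. kB d s t * (indicator {0<..s} \<theta> * q (t - \<theta>) * m \<theta>))"
    using lborel_pair.integrable_fst'[OF Hi] by (simp add: H_def)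
  have "(LBINT t. (LBINT \<theta>. H t \<theta>)) = (LBINT \<theta>. (LBINT t. H t \<theta>))"
    by (rule lborel_pair.fubini_abs(2)[OF Hm fin, symmetric])
  also have "\<dots> = (LBINT \<theta>. indicator {0<..s} \<theta> * kop (kB d) q (s - \<theta>) * m \<theta>)"
  proof (intro bochner_cong refl)
    fix \<theta>
    show "(LBINT t. H t \<theta>) = indicator {0<..s} \<theta> * kop (kB d) q (s - \<theta>) * m \<theta>"
    proof (cases "\<theta> \<in> {0<..s}")
      case True
      have "(LBINT t. H t \<theta>) = (LBINT t. (kB d (s - \<theta>) (- \<theta> + 1 * t) * q (- \<theta> + 1 * t)) * m \<theta>)"
        using True kB_translate[OF d, of \<theta> s] by (intro bochner_cong) (auto simp: H_def)
      also have "\<dots> = (LBINT t. kB d (s - \<theta>) (- \<theta> + 1 * t) * q (- \<theta> + 1 * t)) * m \<theta>" by (rule integral_mult_left_zero)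
      also have "(LBINT t. kB d (s - \<theta>) (- \<theta> + 1 * t) * q (- \<theta> + 1 * t)) = kop (kB d) q (s - \<theta>)"
        unfolding kop_def by (subst lborel_integral_real_affine[where c=1 and t="- \<theta>", of "\<lambda>r. kB d (s - \<theta>) r * q r"]) auto
      finally show ?thesis using True by simp
    qed (simp add: H_def)
  qed
  finally show "(LBINT t. (LBINT \<theta>. kB d s t * (indicator {0<..s} \<theta> * q (t - \<theta>) * m \<theta>)))
       = (LBINT \<theta>. indicator {0<..s} \<theta> * kop (kB d) q (s - \<theta>) * m \<theta>)" by (simp add: H_def)
qed

text \<open>Since \<open>kB d s t\<close> vanishes for t < s, only future values of the convolution
  occur, and against \<psi> at time s they see the noise up to s. What remains is the adjoint
  applied to the mean, and to the kernel q under the density m.\<close>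

lemma adj_pair_gaussian:
  assumes d: "0 \<le> d" and dd: "Lw (lam/2) dd" and q: "Lw (lam/2) q" and s: "0 \<le> s"
    and xi: "\<psi> s \<in> borel_measurable (Ft s)" "L2 M (\<psi> s)"
    and m: "L2 lborel m" "\<And>f Y. is_wi f Y \<Longrightarrow> (\<integral>\<omega>. \<psi> s \<omega> * Y \<omega> \<partial>M) = (LBINT s. f s * m s)"
    and int: "integrable NN (\<lambda>z. kB d s (fst z) * ((dd (fst z) + \<sigma> * Iq q (fst z) (snd z)) * \<psi> s (snd z)))"
    and int2: "integrable lborel (\<lambda>t. kB d s t * dd t)"
  shows "adj_pair d (\<lambda>t \<omega>. dd t + \<sigma> * Iq q t \<omega>) \<psi> s = (\<integral>\<omega>. \<psi> s \<omega> \<partial>M) * kop (kB d) dd s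
     + \<sigma> * (LBINT \<theta>. indicator {0<..s} \<theta> * kop (kB d) q (s - \<theta>) * m \<theta>)"
proof -
  have lq: "locL2 q" by (rule Lw_locL2[OF q]) (use lam_pos in auto)
  have "adj_pair d (\<lambda>t \<omega>. dd t + \<sigma> * Iq q t \<omega>) \<psi> s = (LBINT t. (\<integral>\<omega>. kB d s t * ((dd t + \<sigma> * Iq q t \<omega>) * \<psi> s \<omega>) \<partial>M))"
    unfolding adj_pair_def using TM.integral_fst'[OF int] by simp
  also have "\<dots> = (LBINT t. (kB d s t * dd t) * (\<integral>\<omega>. \<psi> s \<omega> \<partial>M) + \<sigma> * (LBINT \<theta>. kB d s t * (indicator {0<..s} \<theta> * q (t - \<theta>) * m \<theta>)))"
  proof (intro bochner_cong refl)
    fix t :: real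
    show "(\<integral>\<omega>. kB d s t * ((dd t + \<sigma> * Iq q t \<omega>) * \<psi> s \<omega>) \<partial>M)
      = (kB d s t * dd t) * (\<integral>\<omega>. \<psi> s \<omega> \<partial>M) + \<sigma> * (LBINT \<theta>. kB d s t * (indicator {0<..s} \<theta> * q (t - \<theta>) * m \<theta>))"
    proof (cases "s \<le> t")
      case True
      have "(\<integral>\<omega>. kB d s t * ((dd t + \<sigma> * Iq q t \<omega>) * \<psi> s \<omega>) \<partial>M) = (\<integral>\<omega>. (kB d s t * dd t) * \<psi> s \<omega> + kB d s t * (\<sigma> * (\<psi> s \<omega> * Iq q t \<omega>)) \<partial>M)"
        by (intro bochner_cong) (auto simp: algebra_simps)
      also have "\<dots> = (kB d s t * dd t) * (\<integral>\<omega>. \<psi> s \<omega> \<partial>M) + kB d s t * (\<sigma> * (\<integral>\<omega>. \<psi> s \<omega> * Iq q t \<omega> \<partial>M))"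
        using L2_integrable[OF xi(2)] L2_mult[OF xi(2) Iq_L2[OF lq, of t]] s True by simp
      also have "(\<integral>\<omega>. \<psi> s \<omega> * Iq q t \<omega> \<partial>M) = (LBINT \<theta>. indicator {0<..s} \<theta> * q (t - \<theta>) * m \<theta>)"
        by (rule Iq_riesz[OF lq s True xi m(2)])
      finally show ?thesis by (simp add: mult.left_commute)
    next
      case False
      then have "kB d s t = 0" using d by (simp add: kB_def trans_ker_def f0_le)
      then show ?thesis by simp
    qed
  qed
  also have "\<dots> = (LBINT t. kB d s t * dd t) * (\<integral>\<omega>. \<psi> s \<omega> \<partial>M) + \<sigma> * (LBINT t. (LBINT \<theta>. kB d s t * (indicator {0<..s} \<theta> * q (t - \<theta>) * m \<theta>)))"
    using int2 density_swap(1)[OF d q m(1) s] by simp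
  also have "\<dots> = (\<integral>\<omega>. \<psi> s \<omega> \<partial>M) * kop (kB d) dd s
     + \<sigma> * (LBINT \<theta>. indicator {0<..s} \<theta> * kop (kB d) q (s - \<theta>) * m \<theta>)"
    unfolding density_swap(2)[OF d q m(1) s] by (simp add: kop_def mult.commute)
  finally show ?thesis .
qed

lemma L2F_AE_L2_M:
  assumes "L2F M W (- \<mu>) f"
  shows "AE t in lborel. 0 \<le> t \<longrightarrow> L2 M (f t)"
proof -
  have L: "L2 NN (wt \<mu> f)" and ad: "\<And>t. 0 \<le> t \<Longrightarrow> f t \<in> borel_measurable (Ft t)" using assms by (auto simp: L2F_iff)
  have "(\<lambda>(s, \<omega>). (wt \<mu> f (s, \<omega>))\<^sup>2) = (\<lambda>z. (wt \<mu> f z)\<^sup>2)" by auto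
  then have "integrable NN (\<lambda>(s, \<omega>). (wt \<mu> f (s, \<omega>))\<^sup>2)" using L2_integrable_sq[OF L] by simp
  from TM.AE_integrable_fst'[OF this]
  have "AE t in lborel. integrable M (\<lambda>\<omega>. (wt \<mu> f (t, \<omega>))\<^sup>2)" by simp
  then show ?thesis
  proof eventually_elim
    case (elim t)
    show ?case
    proof
      assume t: "0 \<le> t"
      have "integrable M (\<lambda>\<omega>. (exp (- \<mu> * t))\<^sup>2 * (f t \<omega>)\<^sup>2)" using elim t by (simp add: wt_pair power_mult_distrib)
      then have "integrable M (\<lambda>\<omega>. (f t \<omega>)\<^sup>2)" by simp
      then show "L2 M (f t)" using ad[OF t] measurable_from_subalg[OF Ft_subalgebra] by (auto simp: L2_def)
    qed
  qed
qed

lemma gaussian_expectation: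
  assumes q: "locL2 q" and s: "0 \<le> s" and xi: "\<xi> \<in> borel_measurable (Ft s)" "L2 M \<xi>"
    and m: "\<And>f Y. is_wi f Y \<Longrightarrow> (\<integral>\<omega>. \<xi> \<omega> * Y \<omega> \<partial>M) = (LBINT s. f s * m s)"
  shows "(\<integral>\<omega>. (a + \<sigma> * Iq q s \<omega>) * \<xi> \<omega> \<partial>M) = (\<integral>\<omega>. \<xi> \<omega> \<partial>M) * a + \<sigma> * (LBINT \<theta>. indicator {0<..s} \<theta> * q (s - \<theta>) * m \<theta>)"
proof -
  have "(\<integral>\<omega>. (a + \<sigma> * Iq q s \<omega>) * \<xi> \<omega> \<partial>M) = (\<integral>\<omega>. a * \<xi> \<omega> + \<sigma> * (\<xi> \<omega> * Iq q s \<omega>) \<partial>M)"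
    by (intro bochner_cong) (auto simp: algebra_simps)
  also have "\<dots> = a * (\<integral>\<omega>. \<xi> \<omega> \<partial>M) + \<sigma> * (\<integral>\<omega>. \<xi> \<omega> * Iq q s \<omega> \<partial>M)"
    using L2_integrable[OF xi(2)] L2_mult[OF xi(2) Iq_L2[OF q s]] by simp
  finally show ?thesis using Iq_riesz[OF q s order.refl xi m] by (simp add: mult.commute)
qed

text \<open>One formula for both regimes: for s \<le> \<delta> the delayed state is the
  deterministic history x0, and on the right-hand side the K term and the integral with
  \<open>p_ker\<close> vanish.\<close>

lemma delayed_expectation:
  assumes s: "0 \<le> s" and xi: "\<xi> \<in> borel_measurable (Ft s)" "L2 M \<xi>"
    and m: "\<And>f Y. is_wi f Y \<Longrightarrow> (\<integral>\<omega>. \<xi> \<omega> * Y \<omega> \<partial>M) = (LBINT s. f s * m s)"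
  shows "(\<integral>\<omega>. delayed x0 \<delta> opt_X s \<omega> * \<xi> \<omega> \<partial>M) = (\<integral>\<omega>. \<xi> \<omega> \<partial>M) * (x0 * one s + kop (kA 0) phi_det (s - \<delta>))
     + \<sigma> * (LBINT \<theta>. indicator {0<..s} \<theta> * p_ker (s - \<theta> - \<delta>) * m \<theta>)"
proof (cases "s - \<delta> \<le> 0")
  case True
  have "kop (kA 0) phi_det (s - \<delta>) = (\<integral>r. 0 \<partial>(lborel :: real measure))"
    unfolding kop_def using True by (intro bochner_cong) (auto simp: kA_def trans_ker_def f0_le)
  moreover have "(LBINT \<theta>. indicator {0<..s} \<theta> * p_ker (s - \<theta> - \<delta>) * m \<theta>) = (\<integral>\<theta>. 0 \<partial>(lborel :: real measure))"
    using True LwD(2)[OF Lw_p_ker[OF half_lam]] by (intro bochner_cong) (auto simp: indicator_def)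
  ultimately show ?thesis using True s by (simp add: delayed_def one_def)
next
  case False
  have X: "delayed x0 \<delta> opt_X s \<omega> = (x0 * one s + kop (kA 0) phi_det (s - \<delta>)) + \<sigma> * Iq p_ker (s - \<delta>) \<omega>" for \<omega>
    using False \<delta> s by (simp add: delayed_def opt_X_def X_det_def one_def)
  have lp: "L2 M (Iq p_ker (s - \<delta>))" by (rule Iq_L2[OF locL2_all(3)]) (use False in auto)
  have "(\<integral>\<omega>. delayed x0 \<delta> opt_X s \<omega> * \<xi> \<omega> \<partial>M) = (\<integral>\<omega>. (x0 * one s + kop (kA 0) phi_det (s - \<delta>)) * \<xi> \<omega> + \<sigma> * (\<xi> \<omega> * Iq p_ker (s - \<delta>) \<omega>) \<partial>M)"
    unfolding X by (intro bochner_cong) (auto simp: algebra_simps)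
  also have "\<dots> = (x0 * one s + kop (kA 0) phi_det (s - \<delta>)) * (\<integral>\<omega>. \<xi> \<omega> \<partial>M) + \<sigma> * (\<integral>\<omega>. \<xi> \<omega> * Iq p_ker (s - \<delta>) \<omega> \<partial>M)"
    using L2_integrable[OF xi(2)] L2_mult[OF xi(2) lp] by simp
  also have "(\<integral>\<omega>. \<xi> \<omega> * Iq p_ker (s - \<delta>) \<omega> \<partial>M) = (LBINT \<theta>. indicator {0<..s - \<delta>} \<theta> * p_ker (s - \<delta> - \<theta>) * m \<theta>)"
    by (rule m[OF Iq_wi[OF locL2_all(3)]]) (use False in auto)
  also have "\<dots> = (LBINT \<theta>. indicator {0<..s} \<theta> * p_ker (s - \<theta> - \<delta>) * m \<theta>)"
  proof (intro bochner_cong refl)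
    fix \<theta>
    have e: "s - \<delta> - \<theta> = s - \<theta> - \<delta>" by simp
    show "indicator {0<..s - \<delta>} \<theta> * p_ker (s - \<delta> - \<theta>) * m \<theta> = indicator {0<..s} \<theta> * p_ker (s - \<theta> - \<delta>) * m \<theta>"
      unfolding e using LwD(2)[OF Lw_p_ker[OF half_lam], of "s - \<theta> - \<delta>"] \<delta> by (auto simp: indicator_def)
  qed
  finally show ?thesis by (simp add: mult.commute)
qed

text \<open>The conditional optimality condition in weak form, tested with \<psi> at time s. The
  density m of \<psi> at s separates it into the expectation of \<psi> times the identity for the
  means at s, and an integral over \<theta> of the identity for the Gaussian kernels at s - \<theta>
  against m. Both are instances of \<open>det_identity\<close>.\<close>

theorem first_order:
  assumes psi: "L2F M W (- (lam/2)) \<psi>"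
  shows "AE s in lborel. 0 \<le> s \<longrightarrow> \<kappa> * adj_pair 0 opt_X \<psi> s - b * adj_pair \<delta> phi \<psi> s + (\<integral>\<omega>. (phi s \<omega> - b * delayed x0 \<delta> opt_X s \<omega>) * \<psi> s \<omega> \<partial>M) = 0"
proof -
  note Lhh = Lw_h_ker[OF half_lam] and Lpp = Lw_p_ker[OF half_lam] and Lphd = Lw_phi_det[OF half_lam] and LXd = Lw_X_det[OF half_lam]
  have L: "L2 NN (w0 \<psi>)" "\<And>s. 0 \<le> s \<Longrightarrow> \<psi> s \<in> borel_measurable (Ft s)" using psi by (auto simp: L2F_iff)
  have LX: "L2 NN (w0 opt_X)" and Lph: "L2 NN (w0 phi)" using L2F_opt_X[OF half_lam] L2F_phi[OF half_lam] by (auto simp: L2F_iff)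
  note sB = schur_kB[OF lam_pos(3)]
  have D1: "AE \<tau> in lborel. \<kappa> * kop (kB 0) p_ker \<tau> - b * kop (kB \<delta>) h_ker \<tau> + h_ker \<tau> - b * p_ker (\<tau> - \<delta>) = 0"
    using det_identity[OF Lw_f0[OF lam_pos(2)] Lw_shift[OF Lw_f0[OF lam_pos(2)] \<delta>] half_lam]
    unfolding h_ker_def[symmetric] p_ker_def[abs_def, symmetric] by (simp add: p_ker_def)
  have D2: "AE s in lborel. \<kappa> * kop (kB 0) X_det s - b * kop (kB \<delta>) phi_det s + phi_det s - b * (x0 * one s + kop (kA 0) phi_det (s - \<delta>)) = 0"
    using det_identity[OF Lw_cmult[OF Lw_one[OF lam_pos(2)]] Lw_cmult[OF Lw_one[OF lam_pos(2)]] half_lam, of x0 x0]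
    unfolding phi_det_def[symmetric] X_det_def[abs_def, symmetric] .
  show ?thesis
    using pairing(1)[OF LX L(1), of 0] pairing(1)[OF Lph L(1), of \<delta>] L2F_AE_L2_M[OF psi] D2
      kop_AE_integrable[OF sB LXd, of 0] kop_AE_integrable[OF sB Lphd, of \<delta>]
      L2F_AE_L2_M[OF L2F_phi[OF half_lam]] L2F_AE_L2_M[OF L2F_delayed[OF L2F_opt_X[OF half_lam] lam_pos(2) \<delta>, of x0]]
  proof eventually_elim
    case (elim s)
    show ?case
    proof
      assume s: "0 \<le> s"
      define E where "E = (\<integral>\<omega>. \<psi> s \<omega> \<partial>M)"
      have xi: "\<psi> s \<in> borel_measurable (Ft s)" "L2 M (\<psi> s)" using L(2) elim s by auto
      obtain m where m: "L2 lborel m" "\<And>f Y. is_wi f Y \<Longrightarrow> (\<integral>\<omega>. \<psi> s \<omega> * Y \<omega> \<partial>M) = (LBINT s. f s * m s)"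
        using riesz_density[OF xi(2)] by metis
      \<comment> \<open>Expectation of \<psi> at s times the stochastic convolution of F at s,
        expressed through m. As T is linear, the Gaussian terms can be collected inside one
        integral.\<close>
      define T where "T F = (LBINT \<theta>. indicator {0<..s} \<theta> * F (s - \<theta>) * m \<theta>)" for F :: "real \<Rightarrow> real"
      have Ti: "integrable lborel (\<lambda>\<theta>. indicator {0<..s} \<theta> * F (s - \<theta>) * m \<theta>)" if "Lw (lam/2) F" for F
        by (rule L2_mult[OF locL2_conv(1)[OF Lw_locL2[OF that]] m(1)]) (use lam_pos in auto)
      have 1: "adj_pair 0 opt_X \<psi> s = E * kop (kB 0) X_det s + \<sigma> * T (kop (kB 0) p_ker)"
        unfolding E_def T_def opt_X_def[abs_def]
        by (rule adj_pair_gaussian[where \<psi> = \<psi> and s = s, OF order.refl LXd Lpp s xi m]) (use elim s in \<open>auto simp: opt_X_def\<close>)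
      have 2: "adj_pair \<delta> phi \<psi> s = E * kop (kB \<delta>) phi_det s + \<sigma> * T (kop (kB \<delta>) h_ker)"
        unfolding E_def T_def phi_def[abs_def]
        by (rule adj_pair_gaussian[where \<psi> = \<psi> and s = s, OF \<delta> Lphd Lhh s xi m]) (use elim s in \<open>auto simp: phi_def\<close>)
      have 3: "(\<integral>\<omega>. phi s \<omega> * \<psi> s \<omega> \<partial>M) = E * phi_det s + \<sigma> * T h_ker"
        unfolding E_def T_def phi_def by (rule gaussian_expectation[OF locL2_all(2) s xi m(2)])
      have 4: "(\<integral>\<omega>. delayed x0 \<delta> opt_X s \<omega> * \<psi> s \<omega> \<partial>M) = E * (x0 * one s + kop (kA 0) phi_det (s - \<delta>)) + \<sigma> * T (\<lambda>r. p_ker (r - \<delta>))"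
        unfolding E_def T_def by (rule delayed_expectation[OF s xi m(2)])
      have 5: "(\<integral>\<omega>. (phi s \<omega> - b * delayed x0 \<delta> opt_X s \<omega>) * \<psi> s \<omega> \<partial>M) = (\<integral>\<omega>. phi s \<omega> * \<psi> s \<omega> \<partial>M) - b * (\<integral>\<omega>. delayed x0 \<delta> opt_X s \<omega> * \<psi> s \<omega> \<partial>M)"
      proof -
        have "(\<integral>\<omega>. (phi s \<omega> - b * delayed x0 \<delta> opt_X s \<omega>) * \<psi> s \<omega> \<partial>M) = (\<integral>\<omega>. phi s \<omega> * \<psi> s \<omega> - b * (delayed x0 \<delta> opt_X s \<omega> * \<psi> s \<omega>) \<partial>M)"
          by (intro bochner_cong) (auto simp: algebra_simps)
        then show ?thesis using L2_mult[OF _ xi(2)] elim s by simp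
      qed
      have 6: "\<kappa> * T (kop (kB 0) p_ker) - b * T (kop (kB \<delta>) h_ker) + T h_ker - b * T (\<lambda>r. p_ker (r - \<delta>)) = 0"
      proof -
        note i = Ti[OF Lw_kop[OF sB Lpp, of 0]] Ti[OF Lw_kop[OF sB Lhh, of \<delta>]] Ti[OF Lhh] Ti[OF Lw_shift[OF Lpp \<delta>]]
        have "\<kappa> * T (kop (kB 0) p_ker) - b * T (kop (kB \<delta>) h_ker) + T h_ker - b * T (\<lambda>r. p_ker (r - \<delta>))
          = (LBINT \<theta>. \<kappa> * (indicator {0<..s} \<theta> * kop (kB 0) p_ker (s - \<theta>) * m \<theta>) - b * (indicator {0<..s} \<theta> * kop (kB \<delta>) h_ker (s - \<theta>) * m \<theta>)
             + indicator {0<..s} \<theta> * h_ker (s - \<theta>) * m \<theta> - b * (indicator {0<..s} \<theta> * p_ker (s - \<theta> - \<delta>) * m \<theta>))"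
          unfolding T_def using i by simp
        also have "\<dots> = (\<integral>\<theta>. 0 \<partial>(lborel :: real measure))"
        proof (intro integral_cong_AE)
          show "AE \<theta> in lborel. \<kappa> * (indicator {0<..s} \<theta> * kop (kB 0) p_ker (s - \<theta>) * m \<theta>) - b * (indicator {0<..s} \<theta> * kop (kB \<delta>) h_ker (s - \<theta>) * m \<theta>)
             + indicator {0<..s} \<theta> * h_ker (s - \<theta>) * m \<theta> - b * (indicator {0<..s} \<theta> * p_ker (s - \<theta> - \<delta>) * m \<theta>) = 0"
            using AE_reflect[OF D1, of s]
          proof eventually_elim
            case (elim \<theta>)
            have "\<kappa> * (indicator {0<..s} \<theta> * kop (kB 0) p_ker (s - \<theta>) * m \<theta>) - b * (indicator {0<..s} \<theta> * kop (kB \<delta>) h_ker (s - \<theta>) * m \<theta>)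
             + indicator {0<..s} \<theta> * h_ker (s - \<theta>) * m \<theta> - b * (indicator {0<..s} \<theta> * p_ker (s - \<theta> - \<delta>) * m \<theta>)
             = indicator {0<..s} \<theta> * m \<theta> * (\<kappa> * kop (kB 0) p_ker (s - \<theta>) - b * kop (kB \<delta>) h_ker (s - \<theta>) + h_ker (s - \<theta>) - b * p_ker (s - \<theta> - \<delta>))"
              by (simp add: algebra_simps)
            then show ?case unfolding elim by simp
          qed
        qed (use i in \<open>auto intro!: borel_measurable_diff borel_measurable_add borel_measurable_times[OF borel_measurable_const] dest: borel_measurable_integrable\<close>)
        finally show ?thesis by simp
      qed
      have "\<kappa> * adj_pair 0 opt_X \<psi> s - b * adj_pair \<delta> phi \<psi> s + (\<integral>\<omega>. (phi s \<omega> - b * delayed x0 \<delta> opt_X s \<omega>) * \<psi> s \<omega> \<partial>M)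
        = E * (\<kappa> * kop (kB 0) X_det s - b * kop (kB \<delta>) phi_det s + phi_det s - b * (x0 * one s + kop (kA 0) phi_det (s - \<delta>)))
          + \<sigma> * (\<kappa> * T (kop (kB 0) p_ker) - b * T (kop (kB \<delta>) h_ker) + T h_ker - b * T (\<lambda>r. p_ker (r - \<delta>)))"
        unfolding 5 1 2 3 4 by (simp add: algebra_simps)
      also have "\<dots> = 0" using elim 6 by simp
      finally show "\<kappa> * adj_pair 0 opt_X \<psi> s - b * adj_pair \<delta> phi \<psi> s + (\<integral>\<omega>. (phi s \<omega> - b * delayed x0 \<delta> opt_X s \<omega>) * \<psi> s \<omega> \<partial>M) = 0" .
    qed
  qed
qed

end

section \<open>Quadratic expansion of the cost\<close>

context lq_bm
begin

text \<open>The unknown noise of the competing state equals that of the candidate by uniqueness of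
  the Wiener integral, so it cancels. The difference of the states is K applied to the difference
  \<psi> of the drifts, an explicit linear map although each drift contains its own delayed
  state.\<close>

lemma state_difference:
  assumes v: "L2F M W (- (lam/2)) v" and V: "is_state M W x0 b c \<sigma> \<alpha> \<delta> (lam/2) v V"
  defines "\<psi> \<equiv> \<lambda>t \<omega>. (b * delayed x0 \<delta> V t \<omega> + c * v t \<omega>) - phi t \<omega>"
  shows "L2F M W (- (lam/2)) \<psi>"
    and "0 \<le> t \<Longrightarrow> AE \<omega> in M. V t \<omega> - opt_X t \<omega> = (LBINT s. kA 0 t s * \<psi> s \<omega>)"
proof -
  let ?F = "\<lambda>t \<omega>. b * delayed x0 \<delta> V t \<omega> + c * v t \<omega>"
  have LV: "L2F M W (- (lam/2)) V" using V by (simp add: is_state_def)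
  have LF: "L2F M W (- (lam/2)) ?F"
    by (intro L2F_lincomb L2F_cmult L2F_delayed LV v lam_pos \<delta>)
  show "L2F M W (- (lam/2)) \<psi>"
    using L2F_lincomb[OF LF L2F_phi[OF half_lam], of "-1"] by (simp add: \<psi>_def)
  assume t: "0 \<le> t"
  obtain Y where Y: "wiener_integral M W t (\<lambda>s. (t - s) powr (\<alpha> - 1)) Y"
     "AE \<omega> in M. V t \<omega> = x0 + 1 / Gamma \<alpha> * (\<integral>s\<in>{0..t}. (t - s) powr (\<alpha> - 1) * ?F s \<omega> \<partial>lborel) + \<sigma> / Gamma \<alpha> * Y \<omega>"
    using V t unfolding is_state_def by blast
  have "AE \<omega> in M. Y \<omega> = Gamma \<alpha> * Iq f0 t \<omega>"
    by (rule wiener_powr_unique[OF t Y(1) wiener_Iq_f0[OF t]])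
  then show "AE \<omega> in M. V t \<omega> - opt_X t \<omega> = (LBINT s. kA 0 t s * \<psi> s \<omega>)"
    using Y(2) opt_X_equation[OF t] L2F_AE_L2[OF LF] L2F_AE_L2[OF L2F_phi[OF half_lam]]
  proof eventually_elim
    case (elim \<omega>)
    have i: "integrable lborel (\<lambda>s. indicator {0..t} s * (f0 (t - s) * ?F s \<omega>))"
      "integrable lborel (\<lambda>s. indicator {0..t} s * (f0 (t - s) * phi s \<omega>))"
      using L2_lborel_indicator_prod[OF elim(4) locL2_all(1) f0_le _ t]
        L2_lborel_indicator_prod[OF elim(5) locL2_all(1) f0_le _ t] lam_pos by auto
    have "V t \<omega> - opt_X t \<omega> = (LBINT s. indicator {0..t} s * (f0 (t - s) * ?F s \<omega>)) - (LBINT s. indicator {0..t} s * (f0 (t - s) * phi s \<omega>))"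
      using elim(1-3) Gamma_pos unfolding powr_conv[OF t] by simp
    also have "\<dots> = (LBINT s. indicator {0..t} s * (f0 (t - s) * ?F s \<omega>) - indicator {0..t} s * (f0 (t - s) * phi s \<omega>))"
      by (rule Bochner_Integration.integral_diff[OF i, symmetric])
    also have "\<dots> = (LBINT s. indicator {0..t} s * (f0 (t - s) * \<psi> s \<omega>))"
      by (intro bochner_cong) (auto simp: \<psi>_def algebra_simps)
    finally show ?case using kA_conv[OF t, of "\<lambda>s. \<psi> s \<omega>"] by (simp add: kop_def)
  qed
qed

lemma wt_cong_AE:
  assumes "\<And>t. 0 \<le> t \<Longrightarrow> AE \<omega> in M. f t \<omega> = g t \<omega>"
    and f: "wt \<mu> f \<in> borel_measurable NN" and g: "wt \<mu> g \<in> borel_measurable NN"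
  shows "AE z in NN. wt \<mu> f z = wt \<mu> g z"
proof (rule TM.AE_pair_measure)
  show "{x \<in> space NN. wt \<mu> f x = wt \<mu> g x} \<in> sets NN" by (rule borel_measurable_eq[OF f g])
  show "AE t in lborel. AE \<omega> in M. wt \<mu> f (t, \<omega>) = wt \<mu> g (t, \<omega>)"
  proof (rule AE_I2)
    fix t :: real
    show "AE \<omega> in M. wt \<mu> f (t, \<omega>) = wt \<mu> g (t, \<omega>)"
    proof (cases "0 \<le> t")
      case True
      from assms(1)[OF this] show ?thesis by eventually_elim (simp add: wt_pair)
    qed (simp add: wt_pair)
  qed
qed

lemma integral_NN: "integrable NN F \<Longrightarrow> (\<integral>z. F z \<partial>NN) = (LBINT t. (\<integral>\<omega>. F (t, \<omega>) \<partial>M))"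
  for F :: "real \<times> 'a \<Rightarrow> real"
  using TM.integral_fst'[of F] by simp

text \<open>The first variation of the cost in the direction of an arbitrary competitor. Written in
  terms of \<psi> with Z = K \<psi> and its delayed version, every pairing becomes an integral over
  s of e^(-lam s) times one of the expectations in \<open>first_order\<close>.\<close>

lemma linear_term_zero:
  assumes v: "L2F M W (- (lam/2)) v" and V: "is_state M W x0 b c \<sigma> \<alpha> \<delta> (lam/2) v V"
  defines "Z \<equiv> \<lambda>t \<omega>. V t \<omega> + (-1) * opt_X t \<omega>" and "w \<equiv> \<lambda>t \<omega>. v t \<omega> + (-1) * opt_u t \<omega>"
  shows "(\<integral>z. w0 opt_X z * w0 Z z \<partial>NN) + (\<integral>z. w0 opt_u z * w0 w z \<partial>NN) / \<gamma> = 0"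
proof -
  define \<psi> where "\<psi> = (\<lambda>t \<omega>. (b * delayed x0 \<delta> V t \<omega> + c * v t \<omega>) - phi t \<omega>)"
  define dX where "dX = delayed x0 \<delta> opt_X"
  define dZ where "dZ = (\<lambda>t \<omega>. delayed x0 \<delta> V t \<omega> + (-1) * dX t \<omega>)"
  define R where "R d = (\<lambda>t \<omega>. LBINT s. kA d t s * \<psi> s \<omega>)" for d
  define B where "B = (\<lambda>t \<omega>. phi t \<omega> + (- b) * dX t \<omega>)"
  have LV: "L2F M W (- (lam/2)) V" using V by (simp add: is_state_def)
  have Lps: "L2F M W (- (lam/2)) \<psi>" unfolding \<psi>_def by (rule state_difference(1)[OF v V])
  have sd: "AE \<omega> in M. Z t \<omega> = R 0 t \<omega>" if "0 \<le> t" for t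
    using state_difference(2)[OF v V that] by (simp add: Z_def R_def \<psi>_def)
  have LdX: "L2F M W (- (lam/2)) dX" unfolding dX_def by (intro L2F_delayed L2F_opt_X half_lam lam_pos \<delta>)
  have LZ: "L2F M W (- (lam/2)) Z" unfolding Z_def by (intro L2F_lincomb LV L2F_opt_X half_lam)
  have LdZ: "L2F M W (- (lam/2)) dZ" unfolding dZ_def by (intro L2F_lincomb L2F_delayed LV LdX lam_pos \<delta>)
  have Lw: "L2F M W (- (lam/2)) w" unfolding w_def by (intro L2F_lincomb v L2F_opt_u half_lam)
  have LB: "L2F M W (- (lam/2)) B" unfolding B_def by (intro L2F_lincomb L2F_phi LdX half_lam)
  have L: "L2 NN (w0 opt_X)" "L2 NN (w0 Z)" "L2 NN (w0 dX)" "L2 NN (w0 dZ)" "L2 NN (w0 \<psi>)" "L2 NN (w0 phi)" "L2 NN (w0 B)" "L2 NN (w0 opt_u)" "L2 NN (w0 w)"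
    using L2F_opt_X[OF half_lam] LZ LdX LdZ Lps L2F_phi[OF half_lam] LB L2F_opt_u[OF half_lam] Lw by (simp_all add: L2F_iff)
  note P0 = pairing[OF L(1) L(5), of 0] and Pd = pairing[OF L(6) L(5), of \<delta>]
  have aeZ: "AE z in NN. w0 Z z = w0 (R 0) z"
    using P0(4) by (intro wt_cong_AE sd L2_measurable[OF L(2)]) (simp_all add: R_def)
  have sdd: "AE \<omega> in M. dZ t \<omega> = R \<delta> t \<omega>" if t: "0 \<le> t" for t
  proof (cases "t - \<delta> \<le> 0")
    case True
    have "R \<delta> t \<omega> = (\<integral>s. 0 \<partial>(lborel :: real measure))" for \<omega>
      unfolding R_def using True by (intro bochner_cong) (auto simp: kA_def trans_ker_def f0_le)
    then show ?thesis using True by (simp add: dZ_def dX_def delayed_def)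
  next
    case False
    have "R \<delta> t \<omega> = R 0 (t - \<delta>) \<omega>" for \<omega>
      unfolding R_def using False t by (intro bochner_cong) (auto simp: kA_def trans_ker_def algebra_simps)
    with sd[of "t - \<delta>"] False show ?thesis by (simp add: dZ_def dX_def delayed_def Z_def)
  qed
  have aedZ: "AE z in NN. w0 dZ z = w0 (R \<delta>) z"
    using Pd(4) by (intro wt_cong_AE sdd L2_measurable[OF L(4)]) (simp_all add: R_def)
  define i where "i s = indicator {0..} s * exp (- lam * s)" for s :: real
  define J1 where "J1 = (\<integral>z. w0 opt_X z * w0 Z z \<partial>NN)"
  have I1: "J1 = (LBINT s. i s * adj_pair 0 opt_X \<psi> s)"
  proof -
    have "J1 = (\<integral>z. w0 opt_X z * w0 (R 0) z \<partial>NN)"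
      unfolding J1_def using aeZ L2_measurable[OF L(1)] L2_measurable[OF L(2)] P0(4)
      by (intro integral_cong_AE borel_measurable_times) (auto simp: R_def elim: eventually_mono)
    then show ?thesis using P0(3) by (simp add: R_def i_def)
  qed
  have I2: "(\<integral>z. w0 phi z * w0 dZ z \<partial>NN) = (LBINT s. i s * adj_pair \<delta> phi \<psi> s)"
  proof -
    have "(\<integral>z. w0 phi z * w0 dZ z \<partial>NN) = (\<integral>z. w0 phi z * w0 (R \<delta>) z \<partial>NN)"
      using aedZ L2_measurable[OF L(6)] L2_measurable[OF L(4)] Pd(4)
      by (intro integral_cong_AE borel_measurable_times) (auto simp: R_def elim: eventually_mono)
    then show ?thesis using Pd(3) by (simp add: R_def i_def)
  qed
  \<comment> \<open>The delay multiplies the discounted pairing by e^(-lam \<delta>). Before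
    \<delta> the delayed state need not vanish, but the delayed difference does, since all states
    share the history x0. At t = \<delta> itself \<open>delayed\<close> returns x0, hence the
    identity almost everywhere.\<close>
  have I3: "(\<integral>z. w0 dX z * w0 dZ z \<partial>NN) = exp (- lam * \<delta>) * J1"
  proof -
    define a where "a t = (\<integral>\<omega>. w0 opt_X (t, \<omega>) * w0 Z (t, \<omega>) \<partial>M)" for t
    define a' where "a' t = (\<integral>\<omega>. w0 dX (t, \<omega>) * w0 dZ (t, \<omega>) \<partial>M)" for t
    have am: "a \<in> borel_measurable lborel" "a' \<in> borel_measurable lborel"
      using borel_measurable_integrable[OF TM.integrable_fst'[OF L2_mult[OF L(1) L(2)]]]
        borel_measurable_integrable[OF TM.integrable_fst'[OF L2_mult[OF L(3) L(4)]]] by (simp_all add: a_def[abs_def] a'_def[abs_def])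
    have [measurable]: "a \<in> borel_measurable borel" using am by simp
    have "AE t in lborel. t \<noteq> \<delta>" by (rule AE_lborel_singleton)
    then have "AE t in lborel. a' t = exp (- lam * \<delta>) * a (- \<delta> + 1 * t)"
    proof eventually_elim
      case (elim t)
      show ?case
      proof (cases "\<delta> < t")
        case True
        have "(exp (- (lam/2) * t))\<^sup>2 = exp (- lam * t)" "(exp (- (lam/2) * (t - \<delta>)))\<^sup>2 = exp (- lam * (t - \<delta>))"
          by (simp_all add: exp_double[symmetric])
        moreover have "exp (- lam * t) = exp (- lam * \<delta>) * exp (- lam * (t - \<delta>))" by (simp add: exp_add[symmetric] algebra_simps)
        ultimately have e: "(exp (- (lam/2) * t))\<^sup>2 = exp (- lam * \<delta>) * (exp (- (lam/2) * (t - \<delta>)))\<^sup>2" by simp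
        have "a' t = (\<integral>\<omega>. exp (- lam * \<delta>) * (w0 opt_X (t - \<delta>, \<omega>) * w0 Z (t - \<delta>, \<omega>)) \<partial>M)"
          unfolding a'_def
        proof (intro bochner_cong refl)
          fix \<omega>
          have "w0 dX (t, \<omega>) * w0 dZ (t, \<omega>) = (exp (- (lam/2) * t))\<^sup>2 * (opt_X (t - \<delta>) \<omega> * Z (t - \<delta>) \<omega>)"
            using True \<delta> by (simp add: wt_pair dX_def dZ_def delayed_def Z_def power2_eq_square mult_ac)
          also have "\<dots> = exp (- lam * \<delta>) * (w0 opt_X (t - \<delta>, \<omega>) * w0 Z (t - \<delta>, \<omega>))"
            unfolding e using True by (simp add: wt_pair power2_eq_square mult_ac)
          finally show "w0 dX (t, \<omega>) * w0 dZ (t, \<omega>) = exp (- lam * \<delta>) * (w0 opt_X (t - \<delta>, \<omega>) * w0 Z (t - \<delta>, \<omega>))" .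
        qed
        also have "\<dots> = exp (- lam * \<delta>) * a (t - \<delta>)" unfolding a_def by (rule integral_mult_right_zero)
        finally show ?thesis by simp
      next
        case False
        with elim have lt: "t < \<delta>" by simp
        then have "a (- \<delta> + 1 * t) = 0" by (simp add: a_def wt_pair)
        moreover have "a' t = 0" using lt by (simp add: a'_def wt_pair dZ_def dX_def delayed_def)
        ultimately show ?thesis by simp
      qed
    qed
    then have "(LBINT t. a' t) = (LBINT t. exp (- lam * \<delta>) * a (- \<delta> + 1 * t))"
      using am by (intro integral_cong_AE) auto
    also have "\<dots> = exp (- lam * \<delta>) * (LBINT t. a (- \<delta> + 1 * t))" by (rule integral_mult_right_zero)
    also have "(LBINT t. a (- \<delta> + 1 * t)) = (LBINT t. a t)"
      by (subst lborel_integral_real_affine[where c=1 and t="- \<delta>", of a]) auto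
    finally show ?thesis
      unfolding J1_def integral_NN[OF L2_mult[OF L(1) L(2)]] integral_NN[OF L2_mult[OF L(3) L(4)]]
      by (simp add: a_def a'_def)
  qed
  define e4 where "e4 s = (\<integral>\<omega>. (phi s \<omega> - b * delayed x0 \<delta> opt_X s \<omega>) * \<psi> s \<omega> \<partial>M)" for s
  have e4: "(\<integral>\<omega>. w0 B (s, \<omega>) * w0 \<psi> (s, \<omega>) \<partial>M) = i s * e4 s" for s
  proof -
    have "exp (- lam * s) = exp (- (lam/2) * s) * exp (- (lam/2) * s)" by (simp add: exp_add[symmetric])
    then have "w0 B (s, \<omega>) * w0 \<psi> (s, \<omega>) = i s * ((phi s \<omega> - b * delayed x0 \<delta> opt_X s \<omega>) * \<psi> s \<omega>)" for \<omega>
      by (simp add: wt_pair i_def B_def dX_def indicator_def)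
    then show ?thesis unfolding e4_def by simp
  qed
  have I4: "(\<integral>z. w0 B z * w0 \<psi> z \<partial>NN) = (LBINT s. i s * e4 s)"
    unfolding integral_NN[OF L2_mult[OF L(7) L(5)]] e4 ..
  have i4: "integrable lborel (\<lambda>s. i s * e4 s)"
    using TM.integrable_fst'[OF L2_mult[OF L(7) L(5)]] by (simp add: e4)
  have i1: "integrable lborel (\<lambda>s. i s * adj_pair 0 opt_X \<psi> s)" and i2: "integrable lborel (\<lambda>s. i s * adj_pair \<delta> phi \<psi> s)"
    using P0(2) Pd(2) by (simp_all add: i_def)
  \<comment> \<open>The first-order condition, integrated over time against the discount.\<close>
  have S: "\<kappa> * J1 - b * (\<integral>z. w0 phi z * w0 dZ z \<partial>NN) + (\<integral>z. w0 B z * w0 \<psi> z \<partial>NN) = 0"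
  proof -
    have "\<kappa> * J1 - b * (\<integral>z. w0 phi z * w0 dZ z \<partial>NN) + (\<integral>z. w0 B z * w0 \<psi> z \<partial>NN)
      = (LBINT s. \<kappa> * (i s * adj_pair 0 opt_X \<psi> s) - b * (i s * adj_pair \<delta> phi \<psi> s) + i s * e4 s)"
      unfolding I1 I2 I4 using i1 i2 i4 by simp
    also have "\<dots> = (\<integral>s. 0 \<partial>(lborel :: real measure))"
    proof (intro integral_cong_AE)
      show "AE s in lborel. \<kappa> * (i s * adj_pair 0 opt_X \<psi> s) - b * (i s * adj_pair \<delta> phi \<psi> s) + i s * e4 s = 0"
        using first_order[OF Lps]
      proof eventually_elim
        case (elim s)
        have "\<kappa> * (i s * adj_pair 0 opt_X \<psi> s) - b * (i s * adj_pair \<delta> phi \<psi> s) + i s * e4 s = i s * (\<kappa> * adj_pair 0 opt_X \<psi> s - b * adj_pair \<delta> phi \<psi> s + e4 s)"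
          by (simp add: algebra_simps)
        then show ?case using elim by (cases "0 \<le> s") (simp_all add: e4_def i_def)
      qed
    qed (use i1 i2 i4 in \<open>auto intro!: borel_measurable_diff borel_measurable_add borel_measurable_times[OF borel_measurable_const] dest: borel_measurable_integrable\<close>)
    finally show ?thesis by simp
  qed
  have cu: "c * w0 opt_u z = w0 B z" for z
    by (simp add: wt_def B_def dX_def phi_opt_u[symmetric, of "fst z" "snd z"] algebra_simps)
  have cw: "c * w0 w z = w0 \<psi> z - b * w0 dZ z" for z
    by (simp add: wt_def w_def \<psi>_def dZ_def dX_def phi_opt_u[symmetric, of "fst z" "snd z"] algebra_simps)
  have cB: "w0 B z = w0 phi z - b * w0 dX z" for z by (simp add: wt_def B_def algebra_simps)
  \<comment> \<open>Multiplied by c^2, the control pairing is expressed by c u = phi - b S X and c w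
    = \<psi> - b S Z. The b^2 term contributes b^2 e^(-lam \<delta>) J1, which is what separates
    \<kappa> from c^2 \<gamma>.\<close>
  have "c\<^sup>2 * (\<integral>z. w0 opt_u z * w0 w z \<partial>NN) = (\<integral>z. (c * w0 opt_u z) * (c * w0 w z) \<partial>NN)"
    by (simp add: power2_eq_square mult_ac)
  also have "\<dots> = (\<integral>z. w0 B z * w0 \<psi> z - b * (w0 phi z * w0 dZ z) + b\<^sup>2 * (w0 dX z * w0 dZ z) \<partial>NN)"
    unfolding cu cw by (intro bochner_cong) (auto simp: cB algebra_simps power2_eq_square)
  also have "\<dots> = (\<integral>z. w0 B z * w0 \<psi> z \<partial>NN) - b * (\<integral>z. w0 phi z * w0 dZ z \<partial>NN) + b\<^sup>2 * (exp (- lam * \<delta>) * J1)"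
    using L2_mult[OF L(7) L(5)] L2_mult[OF L(6) L(4)] L2_mult[OF L(3) L(4)] I3 by simp
  also have "\<dots> = - (c\<^sup>2 * \<gamma> * J1)"
    using S by (simp add: \<kappa>_def algebra_simps)
  finally have "c\<^sup>2 * (\<gamma> * J1 + (\<integral>z. w0 opt_u z * w0 w z \<partial>NN)) = 0" by (simp add: algebra_simps)
  then have "\<gamma> * J1 + (\<integral>z. w0 opt_u z * w0 w z \<partial>NN) = 0" using c by simp
  then show ?thesis using \<gamma> unfolding J1_def by (simp add: field_simps)
qed

text \<open>The mixed terms cancel by \<open>linear_term_zero\<close> and the square of the state
  difference is dropped. The square of the control difference is kept, so that the same inequality
  gives optimality and uniqueness.\<close>

lemma cost_expansion:
  assumes v: "L2F M W (- (lam/2)) v" and V: "is_state M W x0 b c \<sigma> \<alpha> \<delta> (lam/2) v V"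
  defines "w \<equiv> \<lambda>t \<omega>. v t \<omega> + (-1) * opt_u t \<omega>"
  shows "(\<integral>z. (w0 opt_X z)\<^sup>2 \<partial>NN) + (\<integral>z. (w0 opt_u z)\<^sup>2 \<partial>NN) / \<gamma> + (\<integral>z. (w0 w z)\<^sup>2 \<partial>NN) / \<gamma>
    \<le> (\<integral>z. (w0 V z)\<^sup>2 \<partial>NN) + (\<integral>z. (w0 v z)\<^sup>2 \<partial>NN) / \<gamma>"
proof -
  define Z where "Z = (\<lambda>t \<omega>. V t \<omega> + (-1) * opt_X t \<omega>)"
  have LV: "L2F M W (- (lam/2)) V" using V by (simp add: is_state_def)
  have LZ: "L2F M W (- (lam/2)) Z" unfolding Z_def by (intro L2F_lincomb LV L2F_opt_X half_lam)
  have Lw: "L2F M W (- (lam/2)) w" unfolding w_def by (intro L2F_lincomb v L2F_opt_u half_lam)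
  have L: "L2 NN (w0 opt_X)" "L2 NN (w0 Z)" "L2 NN (w0 opt_u)" "L2 NN (w0 w)"
    using L2F_opt_X[OF half_lam] LZ L2F_opt_u[OF half_lam] Lw by (simp_all add: L2F_iff)
  have sq: "(\<integral>z. (f z + g z)\<^sup>2 \<partial>NN) = (\<integral>z. (f z)\<^sup>2 \<partial>NN) + 2 * (\<integral>z. f z * g z \<partial>NN) + (\<integral>z. (g z)\<^sup>2 \<partial>NN)"
    if f: "L2 NN f" and g: "L2 NN g" for f g
  proof -
    have "(\<lambda>z. (f z + g z)\<^sup>2) = (\<lambda>z. (f z)\<^sup>2 + 2 * (f z * g z) + (g z)\<^sup>2)" by (auto simp: power2_sum)
    then show ?thesis using L2_integrable_sq[OF f] L2_integrable_sq[OF g] L2_mult[OF f g] by simp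
  qed
  have e1: "w0 V z = w0 opt_X z + w0 Z z" for z by (simp add: wt_def Z_def algebra_simps)
  have e2: "w0 v z = w0 opt_u z + w0 w z" for z by (simp add: wt_def w_def algebra_simps)
  have "(\<integral>z. w0 opt_X z * w0 Z z \<partial>NN) + (\<integral>z. w0 opt_u z * w0 w z \<partial>NN) / \<gamma> = 0"
    unfolding Z_def w_def by (rule linear_term_zero[OF v V])
  then have "2 * (\<integral>z. w0 opt_X z * w0 Z z \<partial>NN) + 2 * (\<integral>z. w0 opt_u z * w0 w z \<partial>NN) / \<gamma> = 0" by (simp add: field_simps)
  moreover have "0 \<le> (\<integral>z. (w0 Z z)\<^sup>2 \<partial>NN)" by simp
  moreover have "x + u / \<gamma> + w' / \<gamma> \<le> x + 2 * i + z + (u + 2 * j + w') / \<gamma>"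
    if "2 * i + 2 * j / \<gamma> = 0" "0 \<le> z" for x u w' i j z :: real
    using that by (simp add: add_divide_distrib)
  ultimately show ?thesis unfolding e1 e2 sq[OF L(1,2)] sq[OF L(3,4)] by blast
qed

lemma cost_real:
  assumes "L2F M W (- (lam/2)) v" "is_state M W x0 b c \<sigma> \<alpha> \<delta> (lam/2) v V"
  shows "cost M lam \<gamma> v V = ennreal (1/2 * ((\<integral>z. (w0 V z)\<^sup>2 \<partial>NN) + (\<integral>z. (w0 v z)\<^sup>2 \<partial>NN) / \<gamma>))"
proof -
  have "L2F M W (- (lam/2)) V" using assms by (simp add: is_state_def)
  then show ?thesis using assms(1) by (intro cost_eq \<gamma>) (simp_all add: L2F_iff)
qed

theorem optimal_opt_u: "optimal_control M W x0 b c \<sigma> \<alpha> \<delta> \<gamma> lam (lam/2) opt_u"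
  unfolding optimal_control_def
proof (intro conjI exI[of _ opt_X] allI impI)
  show "L2F M W (- (lam/2)) opt_u" by (rule L2F_opt_u[OF half_lam])
  show st: "is_state M W x0 b c \<sigma> \<alpha> \<delta> (lam/2) opt_u opt_X" by (rule is_state_opt_u[OF half_lam])
  fix v V assume "L2F M W (- (lam/2)) v \<and> is_state M W x0 b c \<sigma> \<alpha> \<delta> (lam/2) v V"
  then have v: "L2F M W (- (lam/2)) v" "is_state M W x0 b c \<sigma> \<alpha> \<delta> (lam/2) v V" by auto
  have "0 \<le> (\<integral>z. (w0 (\<lambda>t \<omega>. v t \<omega> + (-1) * opt_u t \<omega>) z)\<^sup>2 \<partial>NN) / \<gamma>" using \<gamma> by simp
  from order_trans[OF add_increasing2[OF this order.refl] cost_expansion[OF v]]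
  show "cost M lam \<gamma> opt_u opt_X \<le> cost M lam \<gamma> v V"
    unfolding cost_real[OF v] cost_real[OF L2F_opt_u[OF half_lam] st] by (intro ennreal_leI mult_left_mono) auto
qed

text \<open>An optimal v has a state whose cost does not exceed that of the candidate, so the gap in
  \<open>cost_expansion\<close>, the weighted square of v - \<open>opt_u\<close> over \<gamma>, is
  zero. All costs involved are finite, which allows the comparison in the reals.\<close>

theorem optimal_unique:
  assumes opt: "optimal_control M W x0 b c \<sigma> \<alpha> \<delta> \<gamma> lam (lam/2) v"
  shows "AE \<omega> in M. AE t in lborel. 0 \<le> t \<longrightarrow> v t \<omega> = opt_u t \<omega>"
proof -
  define w where "w = (\<lambda>t \<omega>. v t \<omega> + (-1) * opt_u t \<omega>)"
  have st: "is_state M W x0 b c \<sigma> \<alpha> \<delta> (lam/2) opt_u opt_X" by (rule is_state_opt_u[OF half_lam])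
  have v: "L2F M W (- (lam/2)) v" using opt by (simp add: optimal_control_def)
  obtain V where V: "is_state M W x0 b c \<sigma> \<alpha> \<delta> (lam/2) v V" "cost M lam \<gamma> v V \<le> cost M lam \<gamma> opt_u opt_X"
    using opt st L2F_opt_u[OF half_lam] unfolding optimal_control_def by blast
  have nn: "0 \<le> 1/2 * ((\<integral>z. (w0 f z)\<^sup>2 \<partial>NN) + (\<integral>z. (w0 g z)\<^sup>2 \<partial>NN) / \<gamma>)" for f g using \<gamma> by simp
  have "(\<integral>z. (w0 V z)\<^sup>2 \<partial>NN) + (\<integral>z. (w0 v z)\<^sup>2 \<partial>NN) / \<gamma> \<le> (\<integral>z. (w0 opt_X z)\<^sup>2 \<partial>NN) + (\<integral>z. (w0 opt_u z)\<^sup>2 \<partial>NN) / \<gamma>"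
    using V(2) unfolding cost_real[OF v V(1)] cost_real[OF L2F_opt_u[OF half_lam] st] ennreal_le_iff[OF nn] by (rule mult_left_le_imp_le) simp
  with cost_expansion[OF v V(1)] have "(\<integral>z. (w0 w z)\<^sup>2 \<partial>NN) / \<gamma> \<le> 0" unfolding w_def by linarith
  moreover have "0 \<le> (\<integral>z. (w0 w z)\<^sup>2 \<partial>NN)" by simp
  ultimately have z: "(\<integral>z. (w0 w z)\<^sup>2 \<partial>NN) = 0" using \<gamma> by (simp add: divide_le_0_iff)
  have "L2F M W (- (lam/2)) w" unfolding w_def by (intro L2F_lincomb v L2F_opt_u half_lam)
  then have L: "L2 NN (w0 w)" by (simp add: L2F_iff)
  have "AE z in NN. w0 w z = 0" by (rule L2_sq_zero_AE[OF L z])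
  then have "AE t in lborel. AE \<omega> in M. w0 w (t, \<omega>) = 0" by (rule TM.AE_pair)
  moreover have "{z \<in> space NN. w0 w (fst z, snd z) = 0} \<in> sets NN"
    using borel_measurable_eq[OF L2_measurable[OF L] borel_measurable_const[of 0]] by (simp only: prod.collapse)
  ultimately have "AE \<omega> in M. AE t in lborel. w0 w (t, \<omega>) = 0" by (simp only: TM.AE_commute)
  then show ?thesis
  proof eventually_elim
    case (elim \<omega>)
    then show ?case by eventually_elim (auto simp: wt_pair w_def)
  qed
qed

section \<open>Explicit formulas for the control\<close>

lemma gl_measurable[measurable]: "gl \<in> borel_measurable borel"
  unfolding g_lam_def[abs_def] set_lebesgue_integral_def pos_powr_def by measurable

lemma nrm_gl: "0 \<le> t \<Longrightarrow> nrm f0 (\<lambda>t. f0 (t - \<delta>)) t = gl t"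
  by (simp add: nrm_def kB_f0 gl_g_conv)

lemma rl_neg: "s < 0 \<Longrightarrow> rl t s = 0"
  using schurD(4)[OF schur_rl[OF half_lam]] by simp

lemma h_ker_formula:
  assumes "0 \<le> \<tau>"
  shows "h_ker \<tau> = (\<integral>s\<in>{0..}. rl \<tau> s * gl s \<partial>lborel) - gl \<tau>"
proof -
  have "kop rl (nrm f0 (\<lambda>t. f0 (t - \<delta>))) \<tau> = (\<integral>s\<in>{0..}. rl \<tau> s * gl s \<partial>lborel)"
    unfolding kop_def set_lebesgue_integral_def
    by (intro bochner_cong) (auto simp: indicator_def rl_neg nrm_gl)
  then show ?thesis using assms by (simp add: h_ker_def sol_def nrm_gl)
qed

text \<open>The data of the mean equation are constant on [0, oo), equal to (\<kappa>
  lam^(-\<alpha>) - b) x0, because the adjoint of K maps constants to constants. They can be pulled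
  out of the resolvent integral, and the -1 is the identity part of \<open>sol\<close>.\<close>

lemma phi_det_formula:
  assumes "0 \<le> t"
  shows "phi_det t = (\<kappa> * lam powr (- \<alpha>) - b) * ((\<integral>s\<in>{0..}. rl t s \<partial>lborel) - 1) * x0"
proof -
  have n: "nrm (\<lambda>t. x0 * one t) (\<lambda>t. x0 * one t) s = (\<kappa> * lam powr (- \<alpha>) - b) * x0" if "0 \<le> s" for s
  proof -
    have "kop (kB 0) (\<lambda>t. x0 * one t) s = x0 * kop (kB 0) one s" unfolding kop_def by (simp add: mult.left_commute)
    then show ?thesis using that by (simp add: nrm_def kB_one one_def algebra_simps)
  qed
  have "kop rl (nrm (\<lambda>t. x0 * one t) (\<lambda>t. x0 * one t)) t = (LBINT s. (\<kappa> * lam powr (- \<alpha>) - b) * x0 * (indicator {0..} s *\<^sub>R rl t s))"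
    unfolding kop_def by (intro bochner_cong) (auto simp: indicator_def rl_neg n)
  also have "\<dots> = (\<kappa> * lam powr (- \<alpha>) - b) * x0 * (\<integral>s\<in>{0..}. rl t s \<partial>lborel)"
    unfolding set_lebesgue_integral_def by (rule integral_mult_right_zero)
  finally show ?thesis using assms by (simp add: phi_det_def sol_def n algebra_simps)
qed

text \<open>The formula for \<open>h_ker\<close> holds at nonnegative arguments, that is for
  \<theta> \<le> t, which is all that the integral over [0, t] sees. The convolution uses (0, t]
  instead; the difference is one point.\<close>

lemma wiener_h_ker:
  assumes t: "0 \<le> t"
  shows "wiener_integral M W t (\<lambda>\<theta>. (\<integral>s\<in>{0..}. rl (t - \<theta>) s * gl s \<partial>lborel) - gl (t - \<theta>)) (Iq h_ker t)"
proof (rule is_wi_wiener_integral[OF Iq_wi[OF locL2_all(2) t] t])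
  note [measurable] = schur_measurable[OF schur_rl[OF half_lam]]
  show "(\<lambda>\<theta>. (\<integral>s\<in>{0..}. rl (t - \<theta>) s * gl s \<partial>lborel) - gl (t - \<theta>)) \<in> borel_measurable borel"
    unfolding set_lebesgue_integral_def by measurable
  have "AE \<theta> in lborel. \<theta> \<noteq> (0::real)" by (rule AE_lborel_singleton)
  then show "AE \<theta> in lborel. indicator {0<..t} \<theta> * h_ker (t - \<theta>) = indicator {0..t} \<theta> * ((\<integral>s\<in>{0..}. rl (t - \<theta>) s * gl s \<partial>lborel) - gl (t - \<theta>))"
  proof eventually_elim
    case (elim \<theta>)
    then show ?case using h_ker_formula[of "t - \<theta>"] by (cases "\<theta> \<in> {0<..t}") (auto simp: indicator_def)
  qed
qed

lemma opt_u_formula: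
  assumes "0 \<le> t"
  shows "opt_u t \<omega> = - (b / c) * delayed x0 \<delta> opt_X t \<omega>
     + (\<kappa> * lam powr (- \<alpha>) - b) / c * ((\<integral>s\<in>{0..}. rl t s \<partial>lborel) - 1) * x0 + \<sigma> / c * Iq h_ker t \<omega>"
  using c by (simp add: opt_u_def phi_def phi_det_formula[OF assms] field_simps)

end

theorem theorem5p10:
  fixes M :: "'a measure" and W :: "real \<Rightarrow> 'a \<Rightarrow> real"
    and x0 b \<sigma> c \<gamma> \<alpha> \<delta> lam \<rho> \<rho>t :: real
  assumes complete: "complete_measure M"
    and bm: "brownian_motion M W"
    and c: "c \<noteq> 0" and \<gamma>: "\<gamma> > 0"
    and \<alpha>: "1/2 < \<alpha>" "\<alpha> \<le> 1"
    and \<delta>: "\<delta> \<ge> 0" and lam: "lam > 0"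
    and \<rho>0: "b = 0 \<Longrightarrow> \<rho> = 0"
    and \<rho>1: "b \<noteq> 0 \<Longrightarrow> \<rho> > 0 \<and> \<bar>b\<bar> * (1 + exp (-\<rho> * \<delta>)) * \<rho> powr (-\<alpha>) = 1"
    and \<rho>t: "\<rho>t > \<rho>"
      "((c\<^sup>2 * \<gamma> + b\<^sup>2 * exp (-2 * \<rho>t * \<delta>)) * (2 * \<rho>t) powr (-\<alpha>)
          + \<bar>b\<bar> * (1 + exp (-\<rho>t * \<delta>))) * \<rho>t powr (-\<alpha>) = 1/2"
    and lam\<rho>: "lam > 2 * \<rho>t"
  shows "\<exists>u. optimal_control M W x0 b c \<sigma> \<alpha> \<delta> \<gamma> lam (lam/2) u \<and>
     (\<forall>v. optimal_control M W x0 b c \<sigma> \<alpha> \<delta> \<gamma> lam (lam/2) v \<longrightarrow>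
        (AE \<omega> in M. AE t in lborel. 0 \<le> t \<longrightarrow> v t \<omega> = u t \<omega>)) \<and>
     (\<forall>\<mu>. \<rho>t < \<mu> \<and> \<mu> \<le> lam/2 \<longrightarrow>
        L2F M W (-\<mu>) u \<and>
        fredholm_kernel (-\<mu>) (k_lam b c \<gamma> \<alpha> \<delta> lam) \<and>
        (\<exists>r. fredholm_resolvent (-\<mu>) (k_lam b c \<gamma> \<alpha> \<delta> lam) r \<and>
          (\<exists>X. is_state M W x0 b c \<sigma> \<alpha> \<delta> (lam/2) u X \<and> L2F M W (-\<mu>) X \<and>
             (\<forall>t\<ge>0. \<exists>Y. wiener_integral M W t
                  (\<lambda>\<theta>. (\<integral>s\<in>{0..}. r (t - \<theta>) s * g_lam b c \<gamma> \<alpha> \<delta> lam s \<partial>lborel)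
                        - g_lam b c \<gamma> \<alpha> \<delta> lam (t - \<theta>)) Y \<and>
                (AE \<omega> in M. u t \<omega> =
                   - (b / c) * delayed x0 \<delta> X t \<omega>
                   + ((c\<^sup>2 * \<gamma> + b\<^sup>2 * exp (-lam * \<delta>)) * lam powr (-\<alpha>) - b) / c
                       * ((\<integral>s\<in>{0..}. r t s \<partial>lborel) - 1) * x0
                   + \<sigma> / c * Y \<omega>)))))"
proof -
  have \<rho>t0: "\<rho>t > 0" using \<rho>0 \<rho>1 \<rho>t(1) by (cases "b = 0") auto
  interpret prob_space M using bm by (simp add: brownian_motion_def)
  interpret lq_bm b c \<gamma> \<alpha> \<delta> lam \<rho>t M W x0 \<sigma>
    using c \<gamma> \<alpha> \<delta> \<rho>t0 \<rho>t(2) lam\<rho> bm by unfold_locales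
  show ?thesis
  proof (intro exI[of _ opt_u] conjI allI impI)
    show "optimal_control M W x0 b c \<sigma> \<alpha> \<delta> \<gamma> lam (lam/2) opt_u" by (rule optimal_opt_u)
    show "AE \<omega> in M. AE t in lborel. 0 \<le> t \<longrightarrow> v t \<omega> = opt_u t \<omega>"
      if "optimal_control M W x0 b c \<sigma> \<alpha> \<delta> \<gamma> lam (lam/2) v" for v
      by (rule optimal_unique[OF that])
  next
    fix \<mu> assume "\<rho>t < \<mu> \<and> \<mu> \<le> lam / 2"
    then have mu: "\<rho>t < \<mu>" "\<mu> \<le> lam / 2" by auto
    show "L2F M W (-\<mu>) opt_u" by (rule L2F_opt_u[OF mu])
    show "fredholm_kernel (-\<mu>) kl" by (rule fredholm_kernel_schur[OF schur_kl[OF mu_range[OF mu]]])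
    show "\<exists>r. fredholm_resolvent (-\<mu>) kl r \<and>
          (\<exists>X. is_state M W x0 b c \<sigma> \<alpha> \<delta> (lam/2) opt_u X \<and> L2F M W (-\<mu>) X \<and>
             (\<forall>t\<ge>0. \<exists>Y. wiener_integral M W t (\<lambda>\<theta>. (\<integral>s\<in>{0..}. r (t - \<theta>) s * gl s \<partial>lborel) - gl (t - \<theta>)) Y \<and>
                (AE \<omega> in M. opt_u t \<omega> = - (b / c) * delayed x0 \<delta> X t \<omega>
                   + ((c\<^sup>2 * \<gamma> + b\<^sup>2 * exp (-lam * \<delta>)) * lam powr (-\<alpha>) - b) / c
                       * ((\<integral>s\<in>{0..}. r t s \<partial>lborel) - 1) * x0
                   + \<sigma> / c * Y \<omega>)))"
    \<comment> \<open>The same resolvent and the same state serve every \<mu>: neither is built from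
      the weight, only their integrability is checked for it.\<close>
    proof (intro exI[of _ rl] exI[of _ opt_X] conjI allI impI)
      show "fredholm_resolvent (-\<mu>) kl rl" by (rule fredholm_resolvent_rl[OF mu])
      show "is_state M W x0 b c \<sigma> \<alpha> \<delta> (lam/2) opt_u opt_X" by (rule is_state_opt_u[OF half_lam])
      show "L2F M W (-\<mu>) opt_X" by (rule L2F_opt_X[OF mu])
      fix t :: real assume t: "0 \<le> t"
      show "\<exists>Y. wiener_integral M W t (\<lambda>\<theta>. (\<integral>s\<in>{0..}. rl (t - \<theta>) s * gl s \<partial>lborel) - gl (t - \<theta>)) Y \<and>
                (AE \<omega> in M. opt_u t \<omega> = - (b / c) * delayed x0 \<delta> opt_X t \<omega>
                   + ((c\<^sup>2 * \<gamma> + b\<^sup>2 * exp (-lam * \<delta>)) * lam powr (-\<alpha>) - b) / c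
                       * ((\<integral>s\<in>{0..}. rl t s \<partial>lborel) - 1) * x0
                   + \<sigma> / c * Y \<omega>)"
        using wiener_h_ker[OF t] opt_u_formula[OF t] unfolding \<kappa>_def by (intro exI[of _ "Iq h_ker t"]) auto
    qed
  qed
qed

end
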